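(* Let $Y$ be a finite-dimensional bounded degree simplicial complex, fix $q\ge1$, and fix constants $a>0$ and $b$. Suppose that for every $d\in\mathbb{N}$ there is a constant $k=k(d,q)$ such that every finite simplicial complex $Z$ with dimension at most $q$ and degree at most $d$ admits a $k$-coarse construction into $Y$ with volume at most $k|Z|^a\ln(1+|Z|)^b$. Then ${}_s\mathrm{TO}^q_Y(r)\gtrsim r^{1/a}\ln(1+r)^{-b/a}$.
   Context: A simplicial complex is the topological realisation of an abstract simplicial complex $(S,\mathcal S)$; degree is $\max_s|\{t\ne s:\{s,t\}\in\mathcal S\}|$, dimension $\max_{U\in\mathcal S}|U|-1$; bounded degree means $S$ countable and finite degree. $|Z|$ is the number of $0$-simplices; $Z^{\le\ell}$ is the $\ell$-skeleton; closed simplices are sets of points whose support lies in a fixed element of $\mathcal S$; $Z\le X$ means an injection of $0$-simplices sending simplices to simplices. For finite $Z$ and continuous $f:Z\to\mathbb R^q$, ${}_s\mathrm{Ov}(f)=\max_z|\{\sigma\text{ closed simplex of }Z: z\in f(\sigma)\}|$, ${}_s\mathrm{TO}^q(Z)=\min_f{}_s\mathrm{Ov}(f)$, ${}_s\mathrm{TO}^q_Y(r)=\max\{{}_s\mathrm{TO}^q(Z):Z\le Y,|Z|\le r\}$. A continuous map $f:Z\to Y$ ($Z$ finite) is a $k$-coarse construction if $f(Z^{\le\ell})\subseteq Y^{\le\ell}$ for every $\ell$ and every closed simplex of $Y$ meets $f(\sigma')$ for at most $k$ closed simplices $\sigma'$ of $Z$; its volume is the minimal number of $0$-simplices of a subcomplex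 of $Y$ containing $f(Z)$. $f\gtrsim g$ means there is $C$ with $g(r)\le Cf(Cr)+C$ for all $r$. *)

theory Defs
  imports "HOL-Analysis.Analysis"
begin

text \<open>An abstract simplicial complex is represented by its family of simplices
  (finite nonempty vertex sets, closed under nonempty subsets); the vertex set
  is the union of the simplices (every vertex forms a 0-simplex).\<close>

definition simplicial_complex :: "'v set set \<Rightarrow> bool" where
  "simplicial_complex K \<longleftrightarrow>
     (\<forall>U\<in>K. finite U \<and> U \<noteq> {}) \<and>
     (\<forall>U\<in>K. \<forall>V. V \<subseteq> U \<and> V \<noteq> {} \<longrightarrow> V \<in> K)"

definition vertices :: "'v set set \<Rightarrow> 'v set" where
  "vertices K = \<Union>K"

definition supp :: "('v \<Rightarrow> real) \<Rightarrow> 'v set" where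
  "supp x = {v. x v \<noteq> 0}"

text \<open>Topological realisation: barycentric coordinate functions, with the
  topology inherited from the product topology on \<open>'v \<Rightarrow> real\<close>
  (which agrees with the usual topology for locally finite complexes).\<close>

definition realisation :: "'v set set \<Rightarrow> ('v \<Rightarrow> real) set" where
  "realisation K = {x. (\<forall>v. 0 \<le> x v) \<and> supp x \<in> K \<and> sum x (supp x) = 1}"

definition closed_simplex :: "'v set set \<Rightarrow> 'v set \<Rightarrow> ('v \<Rightarrow> real) set" where
  "closed_simplex K U = {x \<in> realisation K. supp x \<subseteq> U}"

definition skeleton :: "'v set set \<Rightarrow> nat \<Rightarrow> ('v \<Rightarrow> real) set" where
  "skeleton K l = {x \<in> realisation K. card (supp x) \<le> l + 1}"

definition degree_le :: "'v set set \<Rightarrow> nat \<Rightarrow> bool" where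
  "degree_le K d \<longleftrightarrow> (\<forall>s\<in>vertices K. finite {t. t \<noteq> s \<and> {s, t} \<in> K} \<and>
                                   card {t. t \<noteq> s \<and> {s, t} \<in> K} \<le> d)"

definition dimension_le :: "'v set set \<Rightarrow> nat \<Rightarrow> bool" where
  "dimension_le K n \<longleftrightarrow> (\<forall>U\<in>K. card U \<le> n + 1)"

definition bounded_degree :: "'v set set \<Rightarrow> bool" where
  "bounded_degree K \<longleftrightarrow> countable (vertices K) \<and> (\<exists>d. degree_le K d)"

definition finite_dimensional :: "'v set set \<Rightarrow> bool" where
  "finite_dimensional K \<longleftrightarrow> (\<exists>n. dimension_le K n)"

definition embeds_in :: "'u set set \<Rightarrow> 'v set set \<Rightarrow> bool" where
  "embeds_in Z Y \<longleftrightarrow> (\<exists>g. inj_on g (vertices Z) \<and> (\<forall>U\<in>Z. g ` U \<in> Y))"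

definition subcomplex :: "'v set set \<Rightarrow> 'v set set \<Rightarrow> bool" where
  "subcomplex Y' Y \<longleftrightarrow> simplicial_complex Y' \<and> Y' \<subseteq> Y"

definition s_Ov :: "'u set set \<Rightarrow> (('u \<Rightarrow> real) \<Rightarrow> real^'q::finite) \<Rightarrow> nat" where
  "s_Ov Z f = Max (range (\<lambda>z. card {U \<in> Z. z \<in> f ` closed_simplex Z U}))"

definition s_TO :: "'u set set \<Rightarrow> 'q::finite itself \<Rightarrow> nat" where
  "s_TO Z (_ :: 'q itself) =
     (LEAST n. \<exists>f :: ('u \<Rightarrow> real) \<Rightarrow> real^'q.
                  continuous_on (realisation Z) f \<and> s_Ov Z f = n)"

text \<open>\<open>\<^sub>sTO\<^sup>q\<^sub>Y(r)\<close>; test complexes Z have vertices in \<open>nat\<close>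
  (every finite complex is isomorphic to one of these).\<close>
definition s_TO_Y :: "'v set set \<Rightarrow> 'q::finite itself \<Rightarrow> real \<Rightarrow> nat" where
  "s_TO_Y Y q r = Max {s_TO Z q | Z :: nat set set.
        simplicial_complex Z \<and> finite (vertices Z) \<and> embeds_in Z Y \<and>
        real (card (vertices Z)) \<le> r}"

definition coarse_construction ::
  "'u set set \<Rightarrow> 'v set set \<Rightarrow> nat \<Rightarrow> (('u \<Rightarrow> real) \<Rightarrow> ('v \<Rightarrow> real)) \<Rightarrow> bool" where
  "coarse_construction Z Y k f \<longleftrightarrow>
     continuous_on (realisation Z) f \<and> f ` realisation Z \<subseteq> realisation Y \<and>
     (\<forall>l. f ` skeleton Z l \<subseteq> skeleton Y l) \<and>
     (\<forall>V\<in>Y. card {U \<in> Z. closed_simplex Y V \<inter> f ` closed_simplex Z U \<noteq> {}} \<le> k)"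

definition volume_le ::
  "'u set set \<Rightarrow> 'v set set \<Rightarrow> (('u \<Rightarrow> real) \<Rightarrow> ('v \<Rightarrow> real)) \<Rightarrow> real \<Rightarrow> bool" where
  "volume_le Z Y f B \<longleftrightarrow>
     (\<exists>Y'. subcomplex Y' Y \<and> finite (vertices Y') \<and> f ` realisation Z \<subseteq> realisation Y' \<and>
           real (card (vertices Y')) \<le> B)"

end

theory Submission
 imports Defs "HOL-Homology.Homology" "HOL-Library.Z2" "HOL-Library.Function_Algebras"
  "HOL-Real_Asymp.Real_Asymp" "Berlekamp_Zassenhaus.Finite_Field"
begin

text \<open>A coarse construction transports overlap: if every map from \<open>Z\<close> to \<open>q\<close>-space has a point in a fixed
 proportion of the images of the closed simplices, then so does, up to the factor \<open>k\<close>, every map from the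
 subcomplex of \<open>Y\<close> carrying the image. Taking \<open>|Z|\<close> of order \<open>r powr (1 / a) * ln (1 + r) powr (- b / a)\<close>, that
 subcomplex has at most \<open>C * r\<close> vertices. So what is needed is, for every \<open>q\<close>, a family of \<open>q\<close>-dimensional complexes
 of bounded degree with linear overlap, whose sizes have bounded ratios.

 Such complexes are the \<open>q\<close>-skeleta of the coset geometries of a unipotent group over a large finite field. Their
 vertex links consist of the subspaces opposite to a fixed flag. There cycles have small fillings, by coning from a
 generic line, and averaging the cones over the group gives coboundary expansion. The links of codimension two are
 nearly mixing by a Heisenberg group computation, and this passes to all links by trickling down. Both facts together
 imply (Evra and Kaufman) that every small cocycle is the coboundary of a small cochain. Finally, following Gromov,
 a map without highly covered points would pull back the dual cochains of a fine grid to small cocycles; filling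
 them successively writes the constant cocycle as zero.\<close>

unbundle no m_inv_syntax

section \<open>Small cocycles in chamber systems\<close>

text \<open>The order in which the constants are chosen carries the argument. The number of flags in
  a cone is bounded in terms of the rank \<open>N\<close> alone, so the expansion constant of stars
  does not depend on the field, while the mixing constant is of order \<open>1 / sqrt p\<close>.
  Hence the prime \<open>p\<close> is chosen last, so large that mixing beats every loss of the
  local-to-global step. Afterwards only the truncation length \<open>L\<close> grows: vertex
  stabilisers, hence degrees and links, are bounded independently of \<open>L\<close>, while the
  group is not. The unipotent group makes this explicit: the stabiliser of a vertex acts simply
  transitively on the complete flags opposite to a fixed one, which determines links and
  intersections of stabilisers and makes averaging exact. The rank is \<open>q + 2\<close>, so
  chambers have dimension \<open>q + 1\<close>: on the \<open>q\<close>-skeleton every cochain of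
  degree \<open>q\<close> is closed, and being a coboundary is what makes it a cocycle of the full
  complex, where the filling theorem applies.\<close>

lemma bit_add_self [simp]: "(x::bit) + x = 0"
 by (cases x) auto

declare add_bit_eq_xor [simp del] mult_bit_eq_and [simp del]

lemma bit_sum_nonzero_ex:
 fixes f :: "'a => bit"
 assumes "sum f A ~= 0"
 shows "\<exists>x\<in>A. f x ~= 0"
 using assms by (meson sum.neutral)

text \<open>Each unordered pair occurs twice. This is the reason for \<open>cob (cob x) = 0\<close>
  mod 2, and later for the cancellation of corrections in two added coordinates.\<close>

lemma sum_symmetric_bit:
 fixes B :: "'i => 'i => bit"
 assumes "finite A" "\<And>i j. B i j = B j i"
 shows "(\<Sum>i\<in>A. \<Sum>j\<in>A - {i}. B i j) = 0"
 using assms(1)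
proof (induction A rule: finite_induct)
 case (insert x A)
 have "(\<Sum>i\<in>A. \<Sum>j\<in>insert x A - {i}. B i j) = (\<Sum>i\<in>A. (\<Sum>j\<in>A - {i}. B i j) + B x i)"
 proof (rule sum.cong[OF refl])
  fix i assume i: "i \<in> A"
  then have "insert x A - {i} = insert x (A - {i})" using insert.hyps(2) by auto
  then show "(\<Sum>j\<in>insert x A - {i}. B i j) = (\<Sum>j\<in>A - {i}. B i j) + B x i"
   using insert.hyps assms(2)[of i x] by simp
 qed
 also have "... = (\<Sum>i\<in>A. B x i)" by (simp add: sum.distrib insert.IH)
 finally show ?case using insert.hyps by simp
qed simp

lemma sum_cart_fst:
 fixes f :: "'a => real"
 shows "(\<Sum>p\<in>A \<times> {..<N}. f (fst p)) = (\<Sum>x\<in>A. real N * f x)"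
 using sum.cartesian_product'[of "%p. f (fst p)" A "{..<N::nat}"] by simp

text \<open>A coloured simplicial complex is encoded by its set \<open>G\<close> of chambers: \<open>v i g\<close> is the vertex of colour
 \<open>i\<close> of the chamber \<open>g\<close>, the faces of type \<open>I\<close> are the classes \<open>cls I g\<close>, and a cochain assigns to a type and a
 chamber the value on the corresponding face. Faces are weighted by the number of chambers containing them.\<close>

locale chambers =
 fixes N :: nat and G :: "'g set" and v :: "nat => 'g => 'v"
 assumes finG: "finite G"
begin

definition cls :: "nat set => 'g => 'g set" where
 "cls I g = {h\<in>G. \<forall>i\<in>I. v i h = v i g}"

text \<open>The index \<open>m\<close> counts vertices, so it is the usual degree plus one. The
  value \<open>m = 0\<close> is the empty face, so the complex is augmented.\<close>

definition cochain :: "nat => (nat set => 'g => bit) => bool" where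
 "cochain m a \<longleftrightarrow>
  (\<forall>I g. a I g ~= 0 --> I \<subseteq> {..<N} & card I = m & g \<in> G) &
  (\<forall>I g h. g \<in> G & h \<in> G & (\<forall>i\<in>I. v i g = v i h) --> a I g = a I h)"

definition cob :: "(nat set => 'g => bit) => nat set => 'g => bit" where
 "cob a J g = (if J \<subseteq> {..<N} then (\<Sum>j\<in>J. a (J - {j}) g) else 0)"

definition wt :: "(nat set => 'g => bit) => nat" where
 "wt a = (\<Sum>I\<in>Pow {..<N}. card {g\<in>G. a I g ~= 0})"

definition in_star :: "nat => 'g => (nat set => 'g => bit) => bool" where
 "in_star i0 g0 a \<longleftrightarrow> (\<forall>I g. a I g ~= 0 --> i0 \<in> I & v i0 g = v i0 g0)"

definition cadd :: "(nat set => 'g => bit) => (nat set => 'g => bit) => nat set => 'g => bit" where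
 "cadd a b = (%I g. a I g + b I g)"

text \<open>Removing the vertex from the faces turns cochains in its star into cochains of its link
  one degree lower, so this is coboundary expansion of vertex links. The coboundary of
  \<open>L\<close> lies in the star as well, because a face avoiding the vertex has no facet
  containing it.\<close>

definition star_expansion :: "real => bool" where
 "star_expansion B \<longleftrightarrow> (\<forall>i0<N. \<forall>g0\<in>G. \<forall>m L. 2 <= m & m < N & cochain m L & in_star i0 g0 L -->
   (\<exists>b. cochain (m - 1) b & in_star i0 g0 b & real (wt (cadd L (cob b))) <= B * real (wt (cob L))))"

text \<open>The expander mixing inequality for the bipartite graph between the vertices of colours
  \<open>i\<close> and \<open>j\<close> in the link of a face of type \<open>C\<close>. Sets of
  vertices are represented by the chambers through them, and the geometric mean in the usual error
  term is replaced by a sum.\<close>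

definition mixing :: "real => bool" where
 "mixing lam \<longleftrightarrow> (\<forall>C i j g S T. C \<subseteq> {..<N} & i < N & j < N & i ~= j & i \<notin> C & j \<notin> C & g \<in> G &
   S \<subseteq> cls C g & T \<subseteq> cls C g & (\<forall>h\<in>S. cls (insert i C) h \<subseteq> S) & (\<forall>h\<in>T. cls (insert j C) h \<subseteq> T) -->
   real (card (S Int T)) <= real (card S) * real (card T) / real (card (cls C g)) + lam * (real (card S) + real (card T)))"

lemma fin_cls [simp]: "finite (cls I g)"
 using finG by (auto simp: cls_def)

lemma cls_sub: "cls I g \<subseteq> G" by (auto simp: cls_def)

lemma cls_self: "g \<in> G ==> g \<in> cls I g" by (auto simp: cls_def)

lemma cls_eq: "h \<in> cls I g ==> cls I h = cls I g" by (auto simp: cls_def)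

lemma cls_sym: "g \<in> G ==> h \<in> cls I g ==> g \<in> cls I h" by (auto simp: cls_def)

lemma cls_mono: "I \<subseteq> J ==> cls J g \<subseteq> cls I g" by (auto simp: cls_def)

lemma card_cls_pos: "g \<in> G ==> card (cls I g) > 0"
 using cls_self card_gt_0_iff fin_cls by blast

lemma finS: "S \<subseteq> G ==> finite S" using finG finite_subset by blast

text \<open>Each \<open>h\<close> in \<open>S\<close> is counted once by every member of its class,
  with weight one over the size of that class.\<close>

lemma average:
 assumes S: "S \<subseteq> G"
 shows "(\<Sum>g\<in>G. real (card (cls I g Int S)) / real (card (cls I g))) = real (card S)"
proof -
 have fS: "finite S" using finS[OF S] .
 have "(\<Sum>g\<in>G. real (card (cls I g Int S)) / real (card (cls I g)))
   = (\<Sum>g\<in>G. \<Sum>h\<in>S. if h \<in> cls I g then 1 / real (card (cls I h)) else 0)"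
 proof (rule sum.cong[OF refl])
  fix g assume g: "g \<in> G"
  have "(\<Sum>h\<in>S. if h \<in> cls I g then 1 / real (card (cls I h)) else 0)
   = (\<Sum>h\<in>S Int cls I g. 1 / real (card (cls I h)))"
   using fS by (simp add: sum.inter_restrict)
  also have "... = (\<Sum>h\<in>S Int cls I g. 1 / real (card (cls I g)))"
   by (rule sum.cong) (auto simp: cls_eq)
  also have "... = real (card (cls I g Int S)) / real (card (cls I g))"
   by (simp add: Int_commute)
  finally show "real (card (cls I g Int S)) / real (card (cls I g)) =
   (\<Sum>h\<in>S. if h \<in> cls I g then 1 / real (card (cls I h)) else 0)" by simp
 qed
 also have "... = (\<Sum>h\<in>S. \<Sum>g\<in>G. if h \<in> cls I g then 1 / real (card (cls I h)) else 0)"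
  by (rule sum.swap)
 also have "... = (\<Sum>h\<in>S. 1)"
 proof (rule sum.cong[OF refl])
  fix h assume h: "h \<in> S"
  then have hG: "h \<in> G" using S by auto
  have "(\<Sum>g\<in>G. if h \<in> cls I g then 1 / real (card (cls I h)) else 0)
    = (\<Sum>g\<in>G Int {g. h \<in> cls I g}. 1 / real (card (cls I h)))"
   unfolding sum.inter_restrict[OF finG] by simp
  also have "G Int {g. h \<in> cls I g} = cls I h" using hG by (auto simp: cls_def)
  also have "(\<Sum>g\<in>cls I h. 1 / real (card (cls I h))) = 1"
   using card_cls_pos[OF hG, of I] by force
  finally show "(\<Sum>g\<in>G. if h \<in> cls I g then 1 / real (card (cls I h)) else 0) = 1" .
 qed
 finally show ?thesis by simp
qed

text \<open>Markov's inequality for the local densities, whose sum over all chambers is the size of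
  \<open>S\<close>.\<close>

lemma dense_count:
 assumes S: "S \<subseteq> G"
 shows "e * real (card {g\<in>G. real (card (cls I g Int S)) >= e * real (card (cls I g))}) <= real (card S)"
proof -
 let ?T = "{g\<in>G. real (card (cls I g Int S)) >= e * real (card (cls I g))}"
 have "e * real (card ?T) = (\<Sum>g\<in>?T. e)" by simp
 also have "... <= (\<Sum>g\<in>?T. real (card (cls I g Int S)) / real (card (cls I g)))"
  by (rule sum_mono) (auto simp: field_simps card_cls_pos)
 also have "... <= (\<Sum>g\<in>G. real (card (cls I g Int S)) / real (card (cls I g)))"
  using finG by (intro sum_mono2) auto
 finally show ?thesis using average[OF S] by simp
qed

text \<open>Mixing is applied in every class of type \<open>C\<close>. Sparsity of \<open>T\<close>
  bounds the product term by \<open>e\<close> times the part of \<open>S\<close>, and averaging over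
  the classes makes the bound global.\<close>

lemma sparse_inter:
 assumes mix: "mixing lam" and C: "C \<subseteq> {..<N}" "i < N" "j < N" "i ~= j" "i \<notin> C" "j \<notin> C"
  and S: "S \<subseteq> G" "\<And>h. h \<in> S ==> cls (insert i C) h \<subseteq> S"
  and T: "T \<subseteq> G" "\<And>h. h \<in> T ==> cls (insert j C) h \<subseteq> T"
  and sp: "\<And>g. g \<in> G ==> real (card (cls C g Int T)) <= e * real (card (cls C g))"
 shows "real (card (S Int T)) <= (e + lam) * real (card S) + lam * real (card T)"
proof -
 let ?c = "%g. real (card (cls C g))"
 let ?s = "%g. real (card (cls C g Int S)) / ?c g"
 let ?t = "%g. real (card (cls C g Int T)) / ?c g"
 have "real (card (S Int T)) = (\<Sum>g\<in>G. real (card (cls C g Int (S Int T))) / ?c g)"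
  using average[of "S Int T" C] S(1) by (simp add: le_infI1)
 also have "... <= (\<Sum>g\<in>G. (e + lam) * ?s g + lam * ?t g)"
 proof (rule sum_mono)
  fix g assume g: "g \<in> G"
  have cl: "cls (insert i C) h \<subseteq> cls C g Int S" if "h \<in> cls C g Int S" for h
   using that S(2) cls_mono[of C "insert i C" h] cls_eq[of h C g] by auto
  have cl': "cls (insert j C) h \<subseteq> cls C g Int T" if "h \<in> cls C g Int T" for h
   using that T(2) cls_mono[of C "insert j C" h] cls_eq[of h C g] by auto
  have pos: "?c g > 0" using card_cls_pos[OF g] by simp
  have "real (card ((cls C g Int S) Int (cls C g Int T))) <=
   real (card (cls C g Int S)) * real (card (cls C g Int T)) / ?c g
    + lam * (real (card (cls C g Int S)) + real (card (cls C g Int T)))"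
   using mix[unfolded mixing_def, rule_format, of C i j g "cls C g Int S" "cls C g Int T"] C g cl cl' by blast
  also have "real (card (cls C g Int S)) * real (card (cls C g Int T)) / ?c g
    <= real (card (cls C g Int S)) * e"
   using sp[OF g] pos by (simp add: divide_le_eq mult_left_mono mult.assoc)
  finally have "real (card ((cls C g Int S) Int (cls C g Int T))) / ?c g <=
   (real (card (cls C g Int S)) * e + lam * (real (card (cls C g Int S)) + real (card (cls C g Int T)))) / ?c g"
   using pos by (simp add: divide_right_mono)
  also have "... = (e + lam) * ?s g + lam * ?t g" by (simp add: algebra_simps add_divide_distrib)
  also have "(cls C g Int S) Int (cls C g Int T) = cls C g Int (S Int T)" by auto
  finally show "real (card (cls C g Int (S Int T))) / ?c g <= (e + lam) * ?s g + lam * ?t g" .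
 qed
 also have "... = (e + lam) * (\<Sum>g\<in>G. ?s g) + lam * (\<Sum>g\<in>G. ?t g)"
  by (simp add: sum.distrib sum_distrib_left)
 finally show ?thesis using average[OF S(1), of C] average[OF T(1), of C] by simp
qed

text \<open>The enlarged type together with the added colour \<open>j\<close> determines the
  original type, and there are at most \<open>N\<close> colours.\<close>

lemma double_count_insert:
 fixes f :: "nat set => real"
 assumes "\<And>J. f J >= 0"
 shows "(\<Sum>I\<in>{I. I \<subseteq> {..<N} & card I = l}. \<Sum>j\<in>{..<N} - I. f (insert j I))
    <= real N * (\<Sum>J\<in>{I. I \<subseteq> {..<N} & card I = Suc l}. f J)"
proof -
 let ?A = "%l. {I. I \<subseteq> {..<N} & card I = l}"
 have fA: "finite (?A l)" for l by (rule finite_subset[of _ "Pow {..<N}"]) auto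
 have "(\<Sum>I\<in>?A l. \<Sum>j\<in>{..<N} - I. f (insert j I))
   = (\<Sum>p\<in>Sigma (?A l) (%I. {..<N} - I). f (insert (snd p) (fst p)))"
  using fA by (subst sum.Sigma) (auto simp: case_prod_beta)
 also have "... = (\<Sum>p\<in>(%(I,j). (insert j I, j)) ` Sigma (?A l) (%I. {..<N} - I). f (fst p))"
 proof (subst sum.reindex)
  show "inj_on (%(I,j). (insert j I, j)) (Sigma (?A l) (%I. {..<N} - I))"
   by (auto simp: inj_on_def) (metis insert_ident)+
 qed (simp add: case_prod_beta)
 also have "... <= (\<Sum>p\<in>?A (Suc l) \<times> {..<N}. f (fst p))"
 proof (rule sum_mono2)
  show "(%(I,j). (insert j I, j)) ` Sigma (?A l) (%I. {..<N} - I) \<subseteq> ?A (Suc l) \<times> {..<N}"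
   by (auto simp: finite_subset[OF _ finite_lessThan] card_insert_if)
 qed (use fA assms in auto)
 also have "... = real N * (\<Sum>J\<in>?A (Suc l). f J)"
  by (simp add: sum_cart_fst sum_distrib_left)
 finally show ?thesis .
qed

lemma double_count_remove:
 fixes f :: "nat set => real"
 assumes "\<And>J. f J >= 0"
 shows "(\<Sum>J\<in>{I. I \<subseteq> {..<N} & card I = Suc l}. \<Sum>j\<in>J. f (J - {j}))
    <= real N * (\<Sum>I\<in>{I. I \<subseteq> {..<N} & card I = l}. f I)"
proof -
 let ?A = "%l. {I. I \<subseteq> {..<N} & card I = l}"
 have fA: "finite (?A l)" for l by (rule finite_subset[of _ "Pow {..<N}"]) auto
 have fJ: "finite J" if "J \<subseteq> {..<N}" for J using that finite_subset by blast
 have "(\<Sum>J\<in>?A (Suc l). \<Sum>j\<in>J. f (J - {j}))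
   = (\<Sum>p\<in>Sigma (?A (Suc l)) (%J. J). f (fst p - {snd p}))"
 proof (subst sum.Sigma)
  show "\<forall>x\<in>?A (Suc l). finite x" using fJ by blast
 qed (use fA in \<open>simp_all add: case_prod_beta\<close>)
 also have "... = (\<Sum>p\<in>(%(I,j). (I - {j}, j)) ` Sigma (?A (Suc l)) (%J. J). f (fst p))"
 proof (subst sum.reindex)
  show "inj_on (%(I,j). (I - {j}, j)) (Sigma (?A (Suc l)) (%J. J))"
   unfolding inj_on_def by (clarsimp simp del: Diff_iff) (metis insert_Diff)
 qed (simp add: case_prod_beta)
 also have "... <= (\<Sum>p\<in>?A l \<times> {..<N}. f (fst p))"
 proof (rule sum_mono2)
  show "(%(I,j). (I - {j}, j)) ` Sigma (?A (Suc l)) (%J. J) \<subseteq> ?A l \<times> {..<N}"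
   using fJ by (force simp: card_Diff_singleton)
 qed (use fA assms in auto)
 also have "... = real N * (\<Sum>J\<in>?A l. f J)"
  by (simp add: sum_cart_fst sum_distrib_left)
 finally show ?thesis .
qed


text \<open>A face is fat if it is in the support of \<open>a\<close> or if a definite proportion of the chambers through it
 contain a fat face of one dimension more.\<close>

primrec fatd :: "(nat set => 'g => bit) => (nat => real) => nat => nat => nat set => 'g set" where
 "fatd a e m 0 I = {g\<in>G. a I g ~= 0}"
| "fatd a e m (Suc d) I = {g\<in>G. \<exists>j\<in>{..<N} - I.
  real (card (cls I g Int fatd a e m d (insert j I))) >= e (m - Suc d) * real (card (cls I g))}"

definition fat :: "(nat set => 'g => bit) => (nat => real) => nat => nat set => 'g set" where
 "fat a e m I = (if I \<subseteq> {..<N} & card I <= m then fatd a e m (m - card I) I else {})"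

definition nfat :: "(nat set => 'g => bit) => (nat => real) => nat => nat => real" where
 "nfat a e m l = (\<Sum>I\<in>{I. I \<subseteq> {..<N} & card I = l}. real (card (fat a e m I)))"

lemma fin_types: "finite {I. I \<subseteq> {..<N} & card I = l}"
 by (rule finite_subset[of _ "Pow {..<N}"]) auto

lemma fin_face: "I \<subseteq> {..<N} ==> finite I"
 using finite_subset by blast

lemma fatd_sub: "fatd a e m d I \<subseteq> G" by (cases d) auto

lemma fat_sub: "fat a e m I \<subseteq> G" using fatd_sub by (auto simp: fat_def)

lemma fat_top: "I \<subseteq> {..<N} ==> card I = m ==> fat a e m I = {g\<in>G. a I g ~= 0}"
 by (simp add: fat_def)

lemma fat_rec:
 assumes "I \<subseteq> {..<N}" "card I < m"
 shows "fat a e m I = {g\<in>G. \<exists>j\<in>{..<N} - I.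
  real (card (cls I g Int fat a e m (insert j I))) >= e (card I) * real (card (cls I g))}"
proof -
 have fI: "finite I" using assms fin_face by auto
 obtain d where d: "m = card I + Suc d" using assms(2) less_iff_Suc_add by auto
 have "fat a e m (insert j I) = fatd a e m d (insert j I)" if "j \<in> {..<N} - I" for j
  using that assms fI d by (simp add: fat_def)
 then show ?thesis using assms d by (auto simp: fat_def)
qed

lemma fat_cls:
 assumes "cochain m a" "g \<in> fat a e m I"
 shows "cls I g \<subseteq> fat a e m I"
proof (cases "card I = m")
 case True
 have I: "I \<subseteq> {..<N}" using assms(2) by (auto simp: fat_def split: if_splits)
 show ?thesis
 proof
  fix h assume h: "h \<in> cls I g"
  have "g \<in> G" using assms(2) fat_sub by blast
  moreover have "h \<in> G" "\<forall>i\<in>I. v i g = v i h" using h by (auto simp: cls_def)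
  ultimately have "a I h = a I g" using assms(1) unfolding cochain_def by metis
  then show "h \<in> fat a e m I" using assms(2) fat_top[OF I True] \<open>h \<in> G\<close> by auto
 qed
next
 case False
 then have I: "I \<subseteq> {..<N}" "card I < m" using assms(2) by (auto simp: fat_def split: if_splits)
 show ?thesis
 proof
  fix h assume h: "h \<in> cls I g"
  then show "h \<in> fat a e m I" using assms(2) cls_eq[OF h] cls_sub unfolding fat_rec[OF I] by auto
 qed
qed

text \<open>By Markov's inequality each descent by one vertex costs a factor \<open>1 / e l\<close>;
  the choices of the extra colour cost the factor \<open>N\<close>.\<close>

lemma nfat_step:
 assumes "l < m" and e: "e l > 0"
 shows "nfat a e m l <= real N / e l * nfat a e m (Suc l)"
proof -
 have "e l * real (card (fat a e m I)) <= (\<Sum>j\<in>{..<N} - I. real (card (fat a e m (insert j I))))"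
  if I: "I \<subseteq> {..<N}" "card I = l" for I
 proof -
  let ?D = "%j. {g\<in>G. real (card (cls I g Int fat a e m (insert j I))) >= e l * real (card (cls I g))}"
  have fe: "fat a e m I = (\<Union>j\<in>{..<N} - I. ?D j)" using fat_rec[OF I(1)] I(2) assms(1) by auto
  have "real (card (fat a e m I)) <= real (\<Sum>j\<in>{..<N} - I. card (?D j))"
   unfolding fe using card_UN_le[of "{..<N} - I" ?D] of_nat_le_iff by blast
  then have "e l * real (card (fat a e m I)) <= e l * real (\<Sum>j\<in>{..<N} - I. card (?D j))"
   using e by (simp add: mult_left_mono)
  also have "... = (\<Sum>j\<in>{..<N} - I. e l * real (card (?D j)))" by (simp add: sum_distrib_left)
  also have "... <= (\<Sum>j\<in>{..<N} - I. real (card (fat a e m (insert j I))))"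
   by (rule sum_mono) (rule dense_count[OF fat_sub])
  finally show ?thesis .
 qed
 then have "e l * nfat a e m l <= (\<Sum>I\<in>{I. I \<subseteq> {..<N} & card I = l}. \<Sum>j\<in>{..<N} - I. real (card (fat a e m (insert j I))))"
  unfolding nfat_def sum_distrib_left by (intro sum_mono) auto
 also have "... <= real N * nfat a e m (Suc l)"
  unfolding nfat_def by (rule double_count_insert) auto
 finally show ?thesis using e by (simp add: field_simps)
qed

lemma nfat_top: "cochain m a ==> nfat a e m m = real (wt a)"
proof -
 assume a: "cochain m a"
 have "wt a = (\<Sum>I\<in>{I. I \<subseteq> {..<N} & card I = m}. card {g\<in>G. a I g ~= 0})"
  unfolding wt_def
 proof (rule sum.mono_neutral_right)
  show "\<forall>i\<in>Pow {..<N} - {I. I \<subseteq> {..<N} & card I = m}. card {g \<in> G. a i g ~= 0} = 0"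
  proof
   fix i assume "i \<in> Pow {..<N} - {I. I \<subseteq> {..<N} & card I = m}"
   then have "{g \<in> G. a i g ~= 0} = {}" using a unfolding cochain_def by blast
   then show "card {g \<in> G. a i g ~= 0} = 0" by (metis card.empty)
  qed
 qed auto
 also have "real ... = nfat a e m m" unfolding nfat_def by (simp add: fat_top)
 finally show ?thesis by simp
qed

lemma nfat_bound:
 assumes a: "cochain m a" and e: "\<And>l. e l > 0" and "l <= m"
 shows "nfat a e m l <= (\<Prod>j\<in>{l..<m}. real N / e j) * real (wt a)"
 using assms(3)
proof (induction "m - l" arbitrary: l)
 case 0
 then show ?case using nfat_top[OF a] by simp
next
 case (Suc d)
 then have lm: "l < m" by simp
 have "nfat a e m l <= real N / e l * nfat a e m (Suc l)" using nfat_step[OF lm, of e a, OF e] .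
 also have "... <= real N / e l * ((\<Prod>j\<in>{Suc l..<m}. real N / e j) * real (wt a))"
  using Suc lm e[of l] by (intro mult_left_mono) auto
 also have "... = (\<Prod>j\<in>{l..<m}. real N / e j) * real (wt a)"
  using lm by (simp add: prod.atLeast_Suc_lessThan)
 finally show ?case .
qed

text \<open>Outside these chambers, two fat faces that share all but one vertex each have a fat
  intersection. This is what allows the chains of \<open>conn\<close> to be moved from one top face
  to another.\<close>

definition bad :: "(nat set => 'g => bit) => (nat => real) => nat => 'g set" where
 "bad a e m = (\<Union>I\<in>{I. I \<subseteq> {..<N} & card I < m}. \<Union>i\<in>{..<N} - I. \<Union>j\<in>{..<N} - I - {i}.
   fat a e m (insert i I) Int fat a e m (insert j I) - fat a e m I)"

lemma bad_sub: "bad a e m \<subseteq> G"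
 unfolding bad_def by (intro UN_least subset_trans[OF Diff_subset le_infI1[OF fat_sub]])

text \<open>Where the face of type \<open>I\<close> is not fat, the fat faces of type
  \<open>insert j I\<close> fill less than the proportion \<open>e (card I)\<close> of its chambers,
  by the definition of fatness. Mixing then limits how often they meet fat faces of type
  \<open>insert i I\<close>.\<close>

lemma bad_piece:
 assumes a: "cochain m a" and mix: "mixing lam"
  and I: "I \<subseteq> {..<N}" "card I < m" and i: "i \<in> {..<N} - I" "j \<in> {..<N} - I" "i ~= j"
  and pos: "e (card I) > 0" "lam >= 0"
 shows "real (card (fat a e m (insert i I) Int fat a e m (insert j I) - fat a e m I))
  <= (e (card I) + lam) * (real (card (fat a e m (insert i I))) + real (card (fat a e m (insert j I))))"
proof -
 let ?F = "%j. fat a e m (insert j I)"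
 let ?S = "?F i - fat a e m I" and ?T = "?F j - fat a e m I"
 have inv: "cls (insert j I) h \<subseteq> ?F j - fat a e m I" if "h \<in> ?F j - fat a e m I" for h j
 proof
  fix g assume g: "g \<in> cls (insert j I) h"
  have "g \<in> ?F j" using fat_cls[OF a, of h e "insert j I"] that g by auto
  moreover have "g \<notin> fat a e m I"
  proof
   assume "g \<in> fat a e m I"
   moreover have "h \<in> cls I g" using that g fat_sub[of a e m "insert j I"] by (auto simp: cls_def)
   ultimately show False using fat_cls[OF a] that by blast
  qed
  ultimately show "g \<in> ?F j - fat a e m I" by auto
 qed
 have "real (card (?S Int ?T)) <= (e (card I) + lam) * real (card ?S) + lam * real (card ?T)"
 proof (rule sparse_inter[OF mix I(1)])
  show "?S \<subseteq> G" "?T \<subseteq> G" by (rule subset_trans[OF Diff_subset fat_sub])+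
  fix g assume g: "g \<in> G"
  show "real (card (cls I g Int ?T)) <= e (card I) * real (card (cls I g))"
  proof (cases "g \<in> fat a e m I")
   case True
   then have "cls I g Int ?T = {}" using fat_cls[OF a] by blast
   then show ?thesis using pos by simp
  next
   case False
   then have "real (card (cls I g Int ?F j)) < e (card I) * real (card (cls I g))"
    using fat_rec[OF I, of a e] i g by force
   moreover have "card (cls I g Int ?T) <= card (cls I g Int ?F j)"
    by (rule card_mono) auto
   ultimately show ?thesis by linarith
  qed
 qed (use i inv in auto)
 also have "... <= (e (card I) + lam) * real (card (?F i)) + (e (card I) + lam) * real (card (?F j))"
 proof (rule add_mono)
  have f: "finite (?F i)" "finite (?F j)" using finS[OF fat_sub] by auto
  show "(e (card I) + lam) * real (card ?S) <= (e (card I) + lam) * real (card (?F i))"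
   using f pos by (intro mult_left_mono of_nat_mono card_mono) auto
  show "lam * real (card ?T) <= (e (card I) + lam) * real (card (?F j))"
   using f pos by (intro mult_mono of_nat_mono card_mono) auto
 qed
 also have "?S Int ?T = ?F i Int ?F j - fat a e m I" by auto
 finally show ?thesis by (simp add: algebra_simps)
qed

text \<open>One factor \<open>N\<close> comes from the colour that does not occur in the summand,
  the other from double counting the types \<open>insert j I\<close>.\<close>

lemma bad_bound:
 assumes a: "cochain m a" and mix: "mixing lam" and e: "\<And>l. e l > 0" and lam: "lam >= 0"
 shows "real (card (bad a e m)) <= (\<Sum>l<m. 2 * real N * real N * (e l + lam) * nfat a e m (Suc l))"
proof -
 let ?c = "%I i. real (card (fat a e m (insert i I)))"
 let ?P = "%I i j. fat a e m (insert i I) Int fat a e m (insert j I) - fat a e m I"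
 let ?B = "%l. \<Union>I\<in>{I. I \<subseteq> {..<N} & card I = l}. \<Union>i\<in>{..<N} - I. \<Union>j\<in>{..<N} - I - {i}. ?P I i j"
 have finP: "finite (?P I i j)" for I i j using finS[OF fat_sub] by simp
 have "bad a e m \<subseteq> (\<Union>l<m. ?B l)" unfolding bad_def by blast
 then have "card (bad a e m) <= card (\<Union>l<m. ?B l)"
 proof (rule card_mono[rotated])
  have "?P I i j \<subseteq> G" for I i j by (rule subset_trans[OF Diff_subset le_infI1[OF fat_sub]])
  then have "(\<Union>l<m. ?B l) \<subseteq> G" by (intro UN_least)
  then show "finite (\<Union>l<m. ?B l)" using finS by blast
 qed
 also have "... <= (\<Sum>l<m. card (?B l))" by (rule card_UN_le) auto
 finally have 1: "real (card (bad a e m)) <= (\<Sum>l<m. real (card (?B l)))"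
  unfolding of_nat_sum[symmetric] of_nat_le_iff .
 have "real (card (?B l)) <= 2 * real N * real N * (e l + lam) * nfat a e m (Suc l)" if l: "l < m" for l
 proof -
  have i1: "(\<Sum>j\<in>{..<N} - I - {i}. (e l + lam) * (?c I i + ?c I j))
    <= (e l + lam) * real N * ?c I i + (e l + lam) * (\<Sum>j\<in>{..<N} - I. ?c I j)" for I i
  proof -
   have "(\<Sum>j\<in>{..<N} - I - {i}. (e l + lam) * (?c I i + ?c I j))
    <= (\<Sum>j\<in>{..<N} - I. (e l + lam) * (?c I i + ?c I j))"
    using e[of l] lam by (intro sum_mono2) auto
   also have "... = (e l + lam) * (real (card ({..<N} - I)) * ?c I i) + (e l + lam) * (\<Sum>j\<in>{..<N} - I. ?c I j)"
    by (simp add: sum_distrib_left distrib_left sum.distrib)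
   also have "... <= (e l + lam) * (real N * ?c I i) + (e l + lam) * (\<Sum>j\<in>{..<N} - I. ?c I j)"
    using e[of l] lam card_mono[of "{..<N}" "{..<N} - I"]
    by (intro add_right_mono mult_left_mono mult_right_mono) auto
   finally show ?thesis by (simp add: mult.assoc)
  qed
  have i2: "real (card (\<Union>i\<in>{..<N} - I. \<Union>j\<in>{..<N} - I - {i}. ?P I i j))
    <= 2 * real N * (e l + lam) * (\<Sum>j\<in>{..<N} - I. ?c I j)" if I: "I \<subseteq> {..<N}" "card I = l" for I
  proof -
   have "card (\<Union>i\<in>{..<N} - I. \<Union>j\<in>{..<N} - I - {i}. ?P I i j)
    <= (\<Sum>i\<in>{..<N} - I. card (\<Union>j\<in>{..<N} - I - {i}. ?P I i j))" by (rule card_UN_le) auto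
   also have "... <= (\<Sum>i\<in>{..<N} - I. \<Sum>j\<in>{..<N} - I - {i}. card (?P I i j))"
    by (intro sum_mono card_UN_le) auto
   finally have "real (card (\<Union>i\<in>{..<N} - I. \<Union>j\<in>{..<N} - I - {i}. ?P I i j))
    <= real (\<Sum>i\<in>{..<N} - I. \<Sum>j\<in>{..<N} - I - {i}. card (?P I i j))" using of_nat_le_iff by blast
   also have "... = (\<Sum>i\<in>{..<N} - I. \<Sum>j\<in>{..<N} - I - {i}. real (card (?P I i j)))" by simp
   also have "... <= (\<Sum>i\<in>{..<N} - I. \<Sum>j\<in>{..<N} - I - {i}. (e l + lam) * (?c I i + ?c I j))"
   proof (intro sum_mono)
    fix i j assume ij: "i \<in> {..<N} - I" "j \<in> {..<N} - I - {i}"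
    show "real (card (?P I i j)) <= (e l + lam) * (?c I i + ?c I j)"
     using bad_piece[OF a mix I(1), of i j e] I l ij e lam by auto
   qed
   also have "... <= (\<Sum>i\<in>{..<N} - I. (e l + lam) * real N * ?c I i + (e l + lam) * (\<Sum>j\<in>{..<N} - I. ?c I j))"
    by (intro sum_mono i1)
   also have "... = (e l + lam) * (real N + real (card ({..<N} - I))) * (\<Sum>j\<in>{..<N} - I. ?c I j)"
    by (simp add: sum.distrib algebra_simps sum_distrib_left)
   also have "... <= (e l + lam) * (real N + real N) * (\<Sum>j\<in>{..<N} - I. ?c I j)"
    using e[of l] lam card_mono[of "{..<N}" "{..<N} - I"]
    by (intro mult_right_mono mult_left_mono add_left_mono) (auto intro: sum_nonneg)
   finally show ?thesis by (simp add: algebra_simps)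
  qed
  have "card (?B l) <= (\<Sum>I\<in>{I. I \<subseteq> {..<N} & card I = l}. card (\<Union>i\<in>{..<N} - I. \<Union>j\<in>{..<N} - I - {i}. ?P I i j))"
   by (rule card_UN_le[OF fin_types])
  then have "real (card (?B l)) <= (\<Sum>I\<in>{I. I \<subseteq> {..<N} & card I = l}. real (card (\<Union>i\<in>{..<N} - I. \<Union>j\<in>{..<N} - I - {i}. ?P I i j)))"
   unfolding of_nat_sum[symmetric] of_nat_le_iff .
  also have "... <= (\<Sum>I\<in>{I. I \<subseteq> {..<N} & card I = l}. 2 * real N * (e l + lam) * (\<Sum>j\<in>{..<N} - I. ?c I j))"
   by (intro sum_mono i2) auto
  also have "... = 2 * real N * (e l + lam) * (\<Sum>I\<in>{I. I \<subseteq> {..<N} & card I = l}. \<Sum>j\<in>{..<N} - I. ?c I j)"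
   by (simp add: sum_distrib_left)
  also have "... <= 2 * real N * (e l + lam) * (real N * nfat a e m (Suc l))"
   using e[of l] lam unfolding nfat_def by (intro mult_left_mono double_count_insert) auto
  finally show ?thesis by (simp add: algebra_simps)
 qed
 then have "(\<Sum>l<m. real (card (?B l))) <= (\<Sum>l<m. 2 * real N * real N * (e l + lam) * nfat a e m (Suc l))"
  by (intro sum_mono) auto
 with 1 show ?thesis by linarith
qed


text \<open>\<open>conn a e m g T I\<close>: at the chamber \<open>g\<close> the face of type \<open>I\<close> is joined to the face of type
 \<open>T\<close> of the support of \<open>a\<close> by a saturated chain of fat faces.\<close>

inductive conn :: "(nat set => 'g => bit) => (nat => real) => nat => 'g => nat set => nat set => bool"
 for a e m g T where
 top: "card T = m ==> g \<in> fat a e m T ==> conn a e m g T T"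
| step: "conn a e m g T J ==> j \<in> J ==> g \<in> fat a e m (J - {j}) ==> conn a e m g T (J - {j})"

lemma conn_fat: "conn a e m g T I ==> g \<in> fat a e m I & g \<in> fat a e m T & I \<subseteq> T & card T = m"
 by (induction rule: conn.induct) auto

lemma conn_types: "conn a e m g T I ==> T \<subseteq> {..<N} & I \<subseteq> T & card T = m & g \<in> G"
 using conn_fat[of a e m g T I] fat_sub[of a e m T] by (auto simp: fat_def split: if_splits)

lemma conn_support: "conn a e m g T I ==> a T g ~= 0"
 using conn_fat[of a e m g T I] conn_types[of a e m g T I] fat_top by blast

lemma conn_cls:
 assumes "conn a e m g T I" "cochain m a" "h \<in> cls T g"
 shows "conn a e m h T I"
 using assms
proof (induction rule: conn.induct)
 case top
 then show ?case using fat_cls[of m a g e T] by (auto intro: conn.top)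
next
 case (step J j)
 have "J \<subseteq> T" using conn_fat step by blast
 then have "h \<in> cls (J - {j}) g" using step cls_mono[of "J - {j}" T g] by auto
 then have "h \<in> fat a e m (J - {j})" using fat_cls[of m a g e "J - {j}"] step by auto
 then show ?case using step by (auto intro: conn.step)
qed

lemma not_badD:
 assumes "g \<notin> bad a e m" "I \<subseteq> {..<N}" "card I < m" "i \<in> {..<N} - I" "j \<in> {..<N} - I" "i ~= j"
  "g \<in> fat a e m (insert i I)" "g \<in> fat a e m (insert j I)"
 shows "g \<in> fat a e m I"
 using assms unfolding bad_def by blast

text \<open>The chain from \<open>T\<close> down to \<open>I\<close> is copied below
  \<open>J - {x}\<close> by deleting \<open>x\<close> from each of its faces. At every rung of this
  ladder two fat faces meet in a face that must be fat, because the chamber is not bad.\<close>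

lemma conn_exchange:
 assumes "conn a e m g T I" and nb: "g \<notin> bad a e m"
  and J: "J \<subseteq> {..<N}" "card J = Suc m" "x \<in> J" "T \<subseteq> J" "T ~= J - {x}" and T': "g \<in> fat a e m (J - {x})"
 shows "(x \<notin> I & conn a e m g (J - {x}) I) \<or>
    (x \<in> I & g \<in> fat a e m (I - {x}) & conn a e m g (J - {x}) (I - {x}))"
 using assms
proof (induction rule: conn.induct)
 case top
 have fJ: "finite J" by (rule fin_face[OF J(1)])
 have cT': "card (J - {x}) = m" using card_Diff_singleton[OF J(3)] J(2) by linarith
 have xT: "x \<in> T"
 proof (rule ccontr)
  assume "x \<notin> T"
  then have "T \<subseteq> J - {x}" using J by auto
  then have "T = J - {x}" using cT' top fJ by (metis card_subset_eq finite_Diff)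
  then show False using J by auto
 qed
 have "card (J - T) = 1" using J fJ top by (simp add: card_Diff_subset finite_subset)
 then obtain y where y: "J - T = {y}" using card_1_singletonE by auto
 have t1: "insert x (T - {x}) = T" using xT by auto
 have t2: "insert y (T - {x}) = J - {x}" using y J xT by auto
 have fT: "finite T" using J fJ finite_subset by blast
 have "m > 0" using xT fT top by (auto simp: card_gt_0_iff)
 have "g \<in> fat a e m (T - {x})"
 proof (rule not_badD[OF nb, of _ x y])
  show "g \<in> fat a e m (insert x (T - {x}))" "g \<in> fat a e m (insert y (T - {x}))"
   unfolding t1 t2 using top by auto
  show "card (T - {x}) < m" using xT fT top \<open>m > 0\<close> by simp
 qed (use y J xT in auto)
 moreover have "conn a e m g (J - {x}) (J - {x})" using cT' T' by (auto intro: conn.top)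
 moreover have "J - {x} - {y} = T - {x}" using t2 y by blast
 moreover have "y \<in> J - {x}" using y xT by auto
 ultimately show ?case using conn.step[of a e m g "J - {x}" "J - {x}" y] xT by auto
next
 case (step K j)
 have IH: "(x \<notin> K & conn a e m g (J - {x}) K) \<or>
    (x \<in> K & g \<in> fat a e m (K - {x}) & conn a e m g (J - {x}) (K - {x}))"
  using step by auto
 have KT: "K \<subseteq> T" "card T = m" using conn_fat step by blast+
 have fJ: "finite J" by (rule fin_face[OF J(1)])
 have fT: "finite T" using J(4) fJ by (rule finite_subset)
 have fK: "finite K" using KT(1) fT by (rule finite_subset)
 have cK: "card K <= m" using KT card_mono[OF fT KT(1)] by simp
 show ?case
 proof (cases "x \<in> K")
  case False
  then show ?thesis using IH step by (auto intro: conn.step)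
 next
  case True
  then have 1: "g \<in> fat a e m (K - {x})" "conn a e m g (J - {x}) (K - {x})" using IH by auto
  show ?thesis
  proof (cases "x = j")
   case True
   then show ?thesis using 1 by auto
  next
   case False
   \<comment> \<open>Both \<open>K - {j}\<close> and \<open>K - {x}\<close> are fat and exceed
     \<open>?I\<close> by one vertex.\<close>
   let ?I = "K - {j} - {x}"
   have e1: "insert x ?I = K - {j}" "insert j ?I = K - {x}" using True False step by auto
   have "g \<in> fat a e m ?I"
   proof (rule not_badD[OF nb, of _ x j])
    show "g \<in> fat a e m (insert x ?I)" "g \<in> fat a e m (insert j ?I)"
     unfolding e1 using step 1 by auto
    have "card ?I < card K" using True False step fK by (intro psubset_card_mono) auto
    then show "card ?I < m" using cK by simp
   qed (use True False step KT J in auto)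
   moreover have "?I = K - {x} - {j}" by auto
   ultimately have "conn a e m g (J - {x}) ?I"
    using conn.step[OF 1(2), of j] step False by auto
   then show ?thesis using \<open>g \<in> fat a e m ?I\<close> True False by auto
  qed
 qed
qed

section \<open>Locally minimal cocycles\<close>

definition ncon :: "(nat set => 'g => bit) => (nat => real) => nat => nat set => real" where
 "ncon a e m I = (\<Sum>T\<in>Pow {..<N}. real (card {g\<in>G. conn a e m g T I}))"

definition ntot :: "(nat set => 'g => bit) => (nat => real) => nat => nat => real" where
 "ntot a e m l = (\<Sum>I\<in>{I. I \<subseteq> {..<N} & card I = l}. ncon a e m I)"

text \<open>The support, at \<open>J\<close>, of the coboundary of that part of \<open>a\<close>
  which is joined to the face of type \<open>I\<close> of the same chamber.\<close>

definition oddf :: "(nat set => 'g => bit) => (nat => real) => nat => nat set => nat set => 'g set" where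
 "oddf a e m I J = {g\<in>G. J \<subseteq> {..<N} & (\<Sum>j\<in>J. if conn a e m g (J - {j}) I then 1 else 0::bit) ~= 0}"

definition locmin :: "nat => (nat set => 'g => bit) => bool" where
 "locmin m a \<longleftrightarrow> (\<forall>i0<N. \<forall>g0\<in>G. \<forall>b. cochain (m - 1) b & in_star i0 g0 b --> wt a <= wt (cadd a (cob b)))"

text \<open>The part of \<open>a\<close> outside \<open>L\<close> contributes a fixed amount to the
  weight of \<open>a\<close>, and adding a coboundary to \<open>a\<close> instead of
  \<open>L\<close> raises the weight by at most this amount. So a gain for \<open>L\<close> would be
  a gain for \<open>a\<close>.\<close>

lemma locmin_sub:
 assumes "locmin m a" "\<And>I g. L I g ~= 0 ==> a I g ~= 0"
 shows "locmin m L"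
 unfolding locmin_def
proof (intro allI impI ballI)
 fix i0 g0 b assume H: "i0 < N" "g0 \<in> G" "cochain (m - 1) b & in_star i0 g0 b"
 let ?d = "cob b"
 have split: "card {g\<in>G. a I g ~= 0} = card {g\<in>G. L I g ~= 0} + card {g\<in>G. a I g ~= 0 & L I g = 0}" for I
 proof -
  have "{g\<in>G. a I g ~= 0} = {g\<in>G. L I g ~= 0} Un {g\<in>G. a I g ~= 0 & L I g = 0}" using assms(2) by auto
  then show ?thesis using finG by (simp add: card_Un_disjoint disjoint_iff)
 qed
 have up: "card {g\<in>G. cadd a ?d I g ~= 0} <= card {g\<in>G. cadd L ?d I g ~= 0} + card {g\<in>G. a I g ~= 0 & L I g = 0}" for I
 proof -
  have "{g\<in>G. cadd a ?d I g ~= 0} \<subseteq> {g\<in>G. cadd L ?d I g ~= 0} Un {g\<in>G. a I g ~= 0 & L I g = 0}"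
  proof
   fix g assume "g \<in> {g\<in>G. cadd a ?d I g ~= 0}"
   then show "g \<in> {g\<in>G. cadd L ?d I g ~= 0} Un {g\<in>G. a I g ~= 0 & L I g = 0}"
    using assms(2)[of I g] by (cases "a I g"; cases "L I g") (auto simp: cadd_def)
  qed
  then have "card {g\<in>G. cadd a ?d I g ~= 0} <= card ({g\<in>G. cadd L ?d I g ~= 0} Un {g\<in>G. a I g ~= 0 & L I g = 0})"
   by (rule card_mono[rotated]) (use finG in auto)
  then show ?thesis using card_Un_le order_trans by blast
 qed
 have "wt a <= wt (cadd a ?d)" using assms(1) H unfolding locmin_def by blast
 moreover have "wt a = wt L + (\<Sum>I\<in>Pow {..<N}. card {g\<in>G. a I g ~= 0 & L I g = 0})"
  unfolding wt_def using split by (simp add: sum.distrib)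
 moreover have "wt (cadd a ?d) <= wt (cadd L ?d) + (\<Sum>I\<in>Pow {..<N}. card {g\<in>G. a I g ~= 0 & L I g = 0})"
  unfolding wt_def sum.distrib[symmetric] by (intro sum_mono up)
 ultimately show "wt L <= wt (cadd L ?d)" by linarith
qed

text \<open>For a fixed face of type \<open>I\<close>, the faces of \<open>a\<close> joined to it
  form a cochain in the star of any vertex of that face. As a part of \<open>a\<close> it is locally
  minimal, so star expansion bounds its weight by that of its coboundary. Averaging over all faces
  of type \<open>I\<close> gives the claim.\<close>

lemma ncon_le_odd:
 assumes a: "cochain m a" and lm: "locmin m a" and ex: "star_expansion B" and m: "2 <= m" "m < N"
  and I: "I \<subseteq> {..<N}" "I ~= {}" and B: "B >= 0"
 shows "ncon a e m I <= B * (\<Sum>J\<in>Pow {..<N}. real (card (oddf a e m I J)))"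
proof -
 obtain i0 where i0: "i0 \<in> I" using I by auto
 let ?L = "%g0 T g. if conn a e m g T I & g \<in> cls I g0 then 1 else 0 :: bit"
 have piece: "(\<Sum>T\<in>Pow {..<N}. real (card (cls I g0 Int {g\<in>G. conn a e m g T I})))
   <= B * (\<Sum>J\<in>Pow {..<N}. real (card (cls I g0 Int oddf a e m I J)))" if g0: "g0 \<in> G" for g0
 proof -
  have star: "in_star i0 g0 (?L g0)"
   unfolding in_star_def
  proof (intro allI impI)
   fix T g assume "?L g0 T g ~= 0"
   then have "conn a e m g T I" "g \<in> cls I g0" by (auto split: if_splits)
   then show "i0 \<in> T & v i0 g = v i0 g0" using i0 conn_types[of a e m g T I] by (auto simp: cls_def)
  qed
  have coch: "cochain m (?L g0)"
   unfolding cochain_def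
  proof (intro conjI allI impI)
   fix T g assume "?L g0 T g ~= 0"
   then have "conn a e m g T I" by (auto split: if_splits)
   from conn_types[OF this] show "T \<subseteq> {..<N}" "card T = m" "g \<in> G" by simp_all
  next
   fix T g h assume gh: "g \<in> G & h \<in> G & (\<forall>i\<in>T. v i g = v i h)"
   then have hg: "h \<in> cls T g" "g \<in> cls T h" by (auto simp: cls_def)
   have c: "conn a e m g T I \<longleftrightarrow> conn a e m h T I"
    using conn_cls[OF _ a hg(1)] conn_cls[OF _ a hg(2)] by auto
   have "g \<in> cls I g0 \<longleftrightarrow> h \<in> cls I g0" if "conn a e m g T I"
   proof -
    have "\<forall>i\<in>I. v i h = v i g" using conn_types[OF that] gh by (metis subsetD)
    then show ?thesis using gh by (simp add: cls_def)
   qed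
   then show "?L g0 T g = ?L g0 T h" using c by auto
  qed
  obtain b where b: "cochain (m - 1) b" "in_star i0 g0 b"
   "real (wt (cadd (?L g0) (cob b))) <= B * real (wt (cob (?L g0)))"
  proof -
   have "i0 < N" using i0 I by auto
   then show ?thesis
    using ex[unfolded star_expansion_def, rule_format, OF _ g0, of i0 m "?L g0"] star coch m that by blast
  qed
  have "locmin m (?L g0)"
  proof (rule locmin_sub[OF lm])
   fix T g assume "?L g0 T g ~= 0"
   then have "conn a e m g T I" by (auto split: if_splits)
   then show "a T g ~= 0" by (rule conn_support)
  qed
  then have "wt (?L g0) <= wt (cadd (?L g0) (cob b))"
   using b(1,2) i0 I(1) g0 unfolding locmin_def by (meson lessThan_iff subsetD)
  then have main: "real (wt (?L g0)) <= B * real (wt (cob (?L g0)))" using b(3) by linarith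
  have w1: "real (wt (?L g0)) = (\<Sum>T\<in>Pow {..<N}. real (card (cls I g0 Int {g\<in>G. conn a e m g T I})))"
  proof -
   have "{g\<in>G. ?L g0 T g ~= 0} = cls I g0 Int {g\<in>G. conn a e m g T I}" for T by auto
   then show ?thesis unfolding wt_def by simp
  qed
  have w2: "real (wt (cob (?L g0))) = (\<Sum>J\<in>Pow {..<N}. real (card (cls I g0 Int oddf a e m I J)))"
  proof -
   have "{g\<in>G. cob (?L g0) J g ~= 0} = cls I g0 Int oddf a e m I J" if "J \<in> Pow {..<N}" for J
   proof -
    have "cob (?L g0) J g = (if g \<in> cls I g0 then (\<Sum>j\<in>J. if conn a e m g (J - {j}) I then 1 else 0) else 0)" for g
     using that by (simp add: cob_def)
    then show ?thesis using that cls_sub unfolding oddf_def by auto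
   qed
   then show ?thesis unfolding wt_def by simp
  qed
  show ?thesis using main unfolding w1 w2 .
 qed
 have avg: "(\<Sum>g0\<in>G. (\<Sum>T\<in>Pow {..<N}. real (card (cls I g0 Int X T))) / real (card (cls I g0)))
   = (\<Sum>T\<in>Pow {..<N}. real (card (X T)))" if "\<And>T. X T \<subseteq> G" for X
 proof -
  have "(\<Sum>g0\<in>G. (\<Sum>T\<in>Pow {..<N}. real (card (cls I g0 Int X T))) / real (card (cls I g0)))
   = (\<Sum>T\<in>Pow {..<N}. \<Sum>g0\<in>G. real (card (cls I g0 Int X T)) / real (card (cls I g0)))"
   by (subst sum.swap) (simp add: sum_divide_distrib)
  then show ?thesis using average[OF that] by simp
 qed
 have "ncon a e m I = (\<Sum>g0\<in>G. (\<Sum>T\<in>Pow {..<N}. real (card (cls I g0 Int {g\<in>G. conn a e m g T I}))) / real (card (cls I g0)))"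
  unfolding ncon_def by (rule avg[symmetric]) auto
 also have "... <= (\<Sum>g0\<in>G. (B * (\<Sum>J\<in>Pow {..<N}. real (card (cls I g0 Int oddf a e m I J)))) / real (card (cls I g0)))"
  by (intro sum_mono divide_right_mono piece) auto
 also have "... = B * (\<Sum>g0\<in>G. (\<Sum>J\<in>Pow {..<N}. real (card (cls I g0 Int oddf a e m I J))) / real (card (cls I g0)))"
  by (simp add: sum_distrib_left)
 also have "... = B * (\<Sum>J\<in>Pow {..<N}. real (card (oddf a e m I J)))"
  by (subst avg) (auto simp: oddf_def)
 finally show ?thesis .
qed


text \<open>The facets of \<open>J\<close> in the support of \<open>a\<close> are even in number and
  those joined to \<open>I\<close> odd, so some facet \<open>J - {x}\<close> in the support is not
  joined to \<open>I\<close>. Exchanging a joined facet for it can fail only if \<open>x\<close>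
  lies in \<open>I\<close>, and then the chain continues to \<open>I - {x}\<close>.\<close>

lemma odd_descends:
 assumes a: "cochain m a" and coc: "cob a J g = 0" and g: "g \<in> oddf a e m I J" and nb: "g \<notin> bad a e m"
 shows "\<exists>i\<in>I. \<exists>T. conn a e m g T (I - {i})"
proof -
 have J: "J \<subseteq> {..<N}" and s: "(\<Sum>j\<in>J. if conn a e m g (J - {j}) I then 1 else 0::bit) ~= 0"
  using g by (auto simp: oddf_def)
 obtain y where y: "y \<in> J" "conn a e m g (J - {y}) I"
  using bit_sum_nonzero_ex[OF s] by (auto split: if_splits)
 have fJ: "finite J" by (rule fin_face[OF J])
 have cT: "card (J - {y}) = m" using conn_types[OF y(2)] by simp
 then have cJ: "card J = Suc m" using card_Suc_Diff1[OF fJ y(1)] by simp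
 have "\<exists>x\<in>J. a (J - {x}) g ~= 0 & \<not> conn a e m g (J - {x}) I"
 proof (rule ccontr)
  assume H: "\<not> ?thesis"
  have "(\<Sum>j\<in>J. if conn a e m g (J - {j}) I then 1 else 0::bit) = (\<Sum>j\<in>J. a (J - {j}) g)"
  proof (intro sum.cong refl)
   fix x assume "x \<in> J"
   then have "a (J - {x}) g ~= 0 \<longleftrightarrow> conn a e m g (J - {x}) I"
    using H conn_support[of a e m g "J - {x}" I] by auto
   then show "(if conn a e m g (J - {x}) I then 1 else 0::bit) = a (J - {x}) g"
    by (cases "a (J - {x}) g") auto
  qed
  then show False using s coc J by (simp add: cob_def)
 qed
 then obtain x where x: "x \<in> J" "a (J - {x}) g ~= 0" "\<not> conn a e m g (J - {x}) I" by auto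
 have gG: "g \<in> G" using g by (auto simp: oddf_def)
 have cx: "card (J - {x}) = m" using card_Diff_singleton[OF x(1)] cJ by simp
 have fx: "g \<in> fat a e m (J - {x})"
  using fat_top[of "J - {x}" m a e] cx J gG x(2) by auto
 have ne: "J - {y} ~= J - {x}" using y(2) x(3) by metis
 from conn_exchange[OF y(2) nb J cJ x(1) Diff_subset ne fx] x(3)
 have "x \<in> I" "g \<in> fat a e m (I - {x})" by auto
 then show ?thesis using conn.step[OF y(2)] by blast
qed

text \<open>Star expansion replaces joined faces by faces of odd coboundary, and at such a face the
  chamber is bad or the chain descends by one vertex. The factor \<open>4 ^ N\<close> accounts for
  the sums over the types \<open>I\<close> and \<open>J\<close>.\<close>

lemma ntot_step:
 assumes a: "cochain m a" and coc: "\<And>J g. cob a J g = 0" and lm: "locmin m a"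
  and ex: "star_expansion B" and m: "2 <= m" "m < N" and B: "B >= 0"
 shows "ntot a e m (Suc l) <= B * 4 ^ N * (real (card (bad a e m)) + ntot a e m l)"
proof -
 let ?I = "%l. {I. I \<subseteq> {..<N} & card I = l}"
 let ?b = "real (card (bad a e m))"
 have np: "ncon a e m I >= 0" for I unfolding ncon_def by (rule sum_nonneg) auto
 have p: "ncon a e m I <= B * (2 ^ N * (?b + (\<Sum>i\<in>I. ncon a e m (I - {i}))))" if I: "I \<in> ?I (Suc l)" for I
 proof -
  have I': "I \<subseteq> {..<N}" "I ~= {}" "finite I" using I fin_face by auto
  have odd: "real (card (oddf a e m I J)) <= ?b + (\<Sum>i\<in>I. ncon a e m (I - {i}))" for J
  proof -
   let ?U = "\<Union>i\<in>I. \<Union>T\<in>Pow {..<N}. {g\<in>G. conn a e m g T (I - {i})}"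
   have "oddf a e m I J \<subseteq> bad a e m Un ?U"
   proof
    fix g assume g: "g \<in> oddf a e m I J"
    show "g \<in> bad a e m Un ?U"
    proof (cases "g \<in> bad a e m")
     case False
     from odd_descends[OF a coc g False] obtain i T where "i \<in> I" "conn a e m g T (I - {i})" by blast
     then show ?thesis using conn_types[of a e m g T "I - {i}"] by blast
    qed simp
   qed
   then have "card (oddf a e m I J) <= card (bad a e m Un ?U)"
    by (rule card_mono[rotated]) (use finS[OF bad_sub] finG I' in auto)
   also have "... <= card (bad a e m) + card ?U" by (rule card_Un_le)
   also have "card ?U <= (\<Sum>i\<in>I. card (\<Union>T\<in>Pow {..<N}. {g\<in>G. conn a e m g T (I - {i})}))"
    by (rule card_UN_le[OF I'(3)])
   also have "... <= (\<Sum>i\<in>I. \<Sum>T\<in>Pow {..<N}. card {g\<in>G. conn a e m g T (I - {i})})"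
    by (intro sum_mono card_UN_le) auto
   finally have "real (card (oddf a e m I J)) <= real (card (bad a e m) + (\<Sum>i\<in>I. \<Sum>T\<in>Pow {..<N}. card {g\<in>G. conn a e m g T (I - {i})}))"
    unfolding of_nat_le_iff by simp
   then show ?thesis by (simp add: ncon_def)
  qed
  have "ncon a e m I <= B * (\<Sum>J\<in>Pow {..<N}. real (card (oddf a e m I J)))"
   by (rule ncon_le_odd[OF a lm ex m I'(1,2) B])
  also have "... <= B * (\<Sum>J\<in>Pow {..<N}. ?b + (\<Sum>i\<in>I. ncon a e m (I - {i})))"
   by (intro mult_left_mono sum_mono odd B)
  finally show ?thesis by (simp add: card_Pow)
 qed
 have cI: "real (card (?I (Suc l))) <= 2 ^ N"
 proof -
  have "card (?I (Suc l)) <= card (Pow {..<N})" by (rule card_mono) auto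
  also have "... = 2 ^ N" by (simp add: card_Pow)
  finally have "real (card (?I (Suc l))) <= real (2 ^ N)" unfolding of_nat_le_iff .
  then show ?thesis by simp
 qed
 have "ntot a e m (Suc l) <= (\<Sum>I\<in>?I (Suc l). B * (2 ^ N * (?b + (\<Sum>i\<in>I. ncon a e m (I - {i})))))"
  unfolding ntot_def by (rule sum_mono[OF p])
 also have "... = B * 2 ^ N * (real (card (?I (Suc l))) * ?b + (\<Sum>I\<in>?I (Suc l). \<Sum>i\<in>I. ncon a e m (I - {i})))"
  by (simp add: sum.distrib sum_distrib_left algebra_simps)
 also have "... <= B * 2 ^ N * (2 ^ N * ?b + real N * ntot a e m l)"
  unfolding ntot_def
  by (intro mult_left_mono add_mono mult_right_mono cI double_count_remove np) (use B in auto)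
 also have "... <= B * 2 ^ N * (2 ^ N * ?b + 2 ^ N * ntot a e m l)"
 proof -
  have "ntot a e m l >= 0" unfolding ntot_def by (intro sum_nonneg np)
  moreover have "real N <= 2 ^ N" using of_nat_less_two_power[of N] less_imp_le by auto
  ultimately show ?thesis using B by (intro mult_left_mono add_left_mono mult_right_mono) auto
 qed
 also have "... = B * 4 ^ N * (?b + ntot a e m l)"
 proof -
  have "(4::real) ^ N = 2 ^ N * 2 ^ N" by (simp flip: power_mult_distrib)
  then show ?thesis by (simp add: algebra_simps)
 qed
 finally show ?thesis .
qed

text \<open>Smallness keeps the empty face from being fat, so the recursion of
  \<open>ntot_step\<close> starts at zero and bounds the weight of \<open>a\<close> by a multiple of
  the number of bad chambers. That number is itself a small multiple of the weight, which can be
  absorbed.\<close>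

theorem locmin_cocycle_zero:
 assumes a: "cochain m a" and coc: "\<And>J g. cob a J g = 0" and lm: "locmin m a"
  and ex: "star_expansion B" and mix: "mixing lam" and m: "2 <= m" "m < N" and B: "B >= 1"
  and e: "\<And>l. e l > 0" and lam: "lam >= 0"
  and small: "(\<Prod>j\<in>{1..<m}. real N / e j) * real (wt a) < e 0 * real (card G)"
  and const: "real m * (B * 4 ^ N) ^ m * (\<Sum>l<m. 2 * real N * real N * (e l + lam) * (\<Prod>j\<in>{Suc l..<m}. real N / e j)) < 1"
 shows "wt a = 0"
proof (rule ccontr)
 assume "wt a ~= 0"
 then have wpos: "real (wt a) > 0" by simp
 let ?b = "real (card (bad a e m))"
 let ?A = "B * 4 ^ N"
 have A1: "?A >= 1" using B by (metis mult_mono' mult_1 one_le_numeral one_le_power zero_le_one)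
 have empty: "fat a e m {} = {}"
 proof (rule ccontr)
  assume "fat a e m {} ~= {}"
  then obtain g where g: "g \<in> fat a e m {}" by auto
  then obtain j where j: "j \<in> {..<N}" "real (card (cls {} g Int fat a e m {j})) >= e 0 * real (card (cls {} g))"
   using fat_rec[of "{}" m a e] m by auto
  have c0: "cls {} g = G" by (auto simp: cls_def)
  have "e 0 * real (card G) <= real (card (fat a e m {j}))"
   using j(2) fat_sub[of a e m "{j}"] unfolding c0 by (simp add: Int_absorb1)
  also have "... <= nfat a e m 1"
   unfolding nfat_def using fin_types[of 1] j(1)
   by (intro member_le_sum[of "{j}" _ "%I. real (card (fat a e m I))"]) auto
  also have "... <= (\<Prod>j\<in>{1..<m}. real N / e j) * real (wt a)"
   using nfat_bound[OF a e, of 1] m by simp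
  finally show False using small by simp
 qed
 have "ntot a e m 0 = 0"
 proof -
  have "\<not> conn a e m g T {}" for g T using conn_fat[of a e m g T "{}"] empty by auto
  moreover have "{I. I \<subseteq> {..<N} & card I = 0} = {{}}" using fin_face by auto
  ultimately show ?thesis by (simp add: ntot_def ncon_def)
 qed
 have bnd: "ntot a e m l <= real l * ?A ^ l * ?b" for l
 proof (induction l)
  case 0
  then show ?case using \<open>ntot a e m 0 = 0\<close> by simp
 next
  case (Suc l)
  have "ntot a e m (Suc l) <= ?A * (?b + ntot a e m l)"
   by (rule ntot_step[OF a coc lm ex m]) (use B in simp)
  also have "... <= ?A * (?A ^ l * ?b + real l * ?A ^ l * ?b)"
  proof (intro mult_left_mono add_mono Suc.IH)
   show "?b <= ?A ^ l * ?b" using one_le_power[OF A1, of l] by (simp add: mult_le_cancel_right1)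
  qed (use A1 in simp)
  finally show ?case by (simp add: algebra_simps)
 qed
 have "real (wt a) = nfat a e m m" using nfat_top[OF a] by simp
 also have "... <= ntot a e m m"
  unfolding nfat_def ntot_def
 proof (rule sum_mono)
  fix I assume I: "I \<in> {I. I \<subseteq> {..<N} & card I = m}"
  have "fat a e m I \<subseteq> {g\<in>G. conn a e m g I I}" using I fat_sub[of a e m I] conn.top by blast
  then have "real (card (fat a e m I)) <= real (card {g\<in>G. conn a e m g I I})"
   using finG by (simp add: card_mono)
  also have "... <= ncon a e m I" unfolding ncon_def
   using I by (intro member_le_sum[of I _ "%T. real (card {g\<in>G. conn a e m g T I})"]) auto
  finally show "real (card (fat a e m I)) <= ncon a e m I" .
 qed
 also have "... <= real m * ?A ^ m * ?b" by (rule bnd)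
 also have "... <= real m * ?A ^ m * (\<Sum>l<m. 2 * real N * real N * (e l + lam) * nfat a e m (Suc l))"
  using A1 by (intro mult_left_mono bad_bound[OF a mix e lam]) auto
 also have "... <= real m * ?A ^ m * (\<Sum>l<m. 2 * real N * real N * (e l + lam) * ((\<Prod>j\<in>{Suc l..<m}. real N / e j) * real (wt a)))"
 proof (intro mult_left_mono sum_mono nfat_bound[OF a e])
  fix l show "0 <= 2 * real N * real N * (e l + lam)" using e[of l] lam by simp
 qed (use A1 in auto)
 also have "... = (real m * ?A ^ m * (\<Sum>l<m. 2 * real N * real N * (e l + lam) * (\<Prod>j\<in>{Suc l..<m}. real N / e j))) * real (wt a)"
  by (simp add: sum_distrib_left sum_distrib_right mult.assoc)
 also have "... < real (wt a)" using const wpos by (simp add: mult_less_cancel_right1)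
 finally show False by simp
qed

text \<open>Minimising \<open>D \<cdot> |a + \<delta>h| + |h|\<close> yields a locally minimal representative together with control of \<open>h\<close>;
 here \<open>D\<close> exceeds the number of (face, chamber) pairs in any star.\<close>

theorem small_cocycle_filling:
 assumes a: "cochain m a" and coc: "\<And>J g. cob a J g = 0"
  and ex: "star_expansion B" and mix: "mixing lam" and m: "2 <= m" "m < N" and B: "B >= 1"
  and e: "\<And>l. e l > 0" and lam: "lam >= 0"
  and small: "(\<Prod>j\<in>{1..<m}. real N / e j) * real (wt a) < e 0 * real (card G)"
  and const: "real m * (B * 4 ^ N) ^ m * (\<Sum>l<m. 2 * real N * real N * (e l + lam) * (\<Prod>j\<in>{Suc l..<m}. real N / e j)) < 1"
  and D: "\<And>i g. i < N ==> g \<in> G ==> 2 ^ N * card (cls {i} g) < D"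
 shows "\<exists>h. cochain (m - 1) h & a = cob h & wt h <= D * wt a"
proof -
 have coch_add: "cochain k (cadd x y)" if "cochain k x" "cochain k y" for k x y
  using that unfolding cochain_def cadd_def by (metis add_0)
 have coch_cob: "cochain m (cob x)" if x: "cochain (m - 1) x" for x
  unfolding cochain_def
 proof (intro conjI allI impI)
  fix J g assume nz: "cob x J g ~= 0"
  then show J: "J \<subseteq> {..<N}" by (auto simp: cob_def split: if_splits)
  then obtain j where "j \<in> J" "x (J - {j}) g ~= 0" using nz bit_sum_nonzero_ex by (fastforce simp: cob_def)
  then have "card (J - {j}) = m - 1" "g \<in> G" using x unfolding cochain_def by blast+
  then show "card J = m" "g \<in> G" using card_Suc_Diff1[OF fin_face[OF J] \<open>j \<in> J\<close>] m by auto
 next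
  fix J g h assume H: "g \<in> G & h \<in> G & (\<forall>i\<in>J. v i g = v i h)"
  have "x (J - {j}) g = x (J - {j}) h" for j using x H unfolding cochain_def by (meson DiffD1)
  then show "cob x J g = cob x J h" by (simp add: cob_def)
 qed
 have cob_add: "cob (cadd x y) = cadd (cob x) (cob y)" for x y
  by (auto simp: cob_def cadd_def fun_eq_iff sum.distrib)
 have cob_cob: "cob (cob x) J g = 0" for x J g
 proof (cases "J \<subseteq> {..<N}")
  case True
  have fJ: "finite J" by (rule fin_face[OF True])
  have "cob (cob x) J g = (\<Sum>j\<in>J. \<Sum>i\<in>J - {j}. x (J - {j} - {i}) g)"
   using True by (auto simp: cob_def intro!: sum.cong)
  also have "... = 0" by (rule sum_symmetric_bit[OF fJ]) (simp only: Diff_insert2[symmetric] insert_commute)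
  finally show ?thesis .
 qed (simp add: cob_def)
 have wt0: "wt (%I g. 0) = 0" by (simp add: wt_def)
 have wt_tri: "wt (cadd x y) <= wt x + wt y" for x y
  unfolding wt_def sum.distrib[symmetric]
 proof (rule sum_mono)
  fix I
  have "{g\<in>G. cadd x y I g ~= 0} \<subseteq> {g\<in>G. x I g ~= 0} Un {g\<in>G. y I g ~= 0}" by (auto simp: cadd_def)
  then have "card {g\<in>G. cadd x y I g ~= 0} <= card ({g\<in>G. x I g ~= 0} Un {g\<in>G. y I g ~= 0})"
   by (rule card_mono[rotated]) (use finG in auto)
  then show "card {g\<in>G. cadd x y I g ~= 0} <= card {g\<in>G. x I g ~= 0} + card {g\<in>G. y I g ~= 0}"
   using card_Un_le order_trans by blast
 qed
 define Phi where "Phi h = D * wt (cadd a (cob h)) + wt h" for h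
 obtain h where h: "cochain (m - 1) h" "\<And>h'. cochain (m - 1) h' ==> Phi h <= Phi h'"
 proof -
  have "cochain (m - 1) (%I g. 0)" by (simp add: cochain_def)
  from ex_has_least_nat[of "cochain (m - 1)", OF this, of Phi] show ?thesis using that by blast
 qed
 let ?a = "cadd a (cob h)"
 have "Phi h <= Phi (%I g. 0)" using h(2) by (simp add: cochain_def)
 moreover have "cadd a (cob (%I g. 0)) = a" by (auto simp: cadd_def cob_def fun_eq_iff)
 ultimately have Ph: "D * wt ?a + wt h <= D * wt a" unfolding Phi_def by (simp add: wt0)
 have "N > 0" using m by simp
 have ca: "cochain m ?a" by (rule coch_add[OF a coch_cob[OF h(1)]])
 have lma: "locmin m ?a"
  unfolding locmin_def
 proof (intro allI impI ballI)
  fix i0 g0 b assume H: "i0 < N" "g0 \<in> G" "cochain (m - 1) b & in_star i0 g0 b"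
  have "Phi h <= Phi (cadd h b)" using h H coch_add by blast
  then have 1: "D * wt ?a + wt h <= D * wt (cadd ?a (cob b)) + wt (cadd h b)"
   unfolding Phi_def cob_add by (simp add: cadd_def add.assoc)
  have "wt b <= (\<Sum>I\<in>Pow {..<N}. card (cls {i0} g0))"
   unfolding wt_def using H by (intro sum_mono card_mono) (auto simp: in_star_def cls_def finG)
  then have "wt b < D" using D[OF H(1,2)] by (simp add: card_Pow)
  \<comment> \<open>A cochain in one star weighs less than \<open>D\<close>, so it cannot outweigh a
    drop by one in the first term of \<open>Phi\<close>.\<close>
  then have "D * wt ?a < D * Suc (wt (cadd ?a (cob b)))" using 1 wt_tri[of h b] by simp
  then have "wt ?a < Suc (wt (cadd ?a (cob b)))" using mult_less_cancel1 by blast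
  then show "wt ?a <= wt (cadd ?a (cob b))" by simp
 qed
 have "wt ?a <= wt a"
 proof (cases "G = {}")
  case True
  then show ?thesis unfolding wt_def by simp
 next
  case False
  then have "D > 0" using D[OF \<open>N > 0\<close>] by fastforce
  then show ?thesis using Ph by (metis add_leD1 mult_le_cancel1)
 qed
 have sm: "(\<Prod>j\<in>{1..<m}. real N / e j) * real (wt ?a) < e 0 * real (card G)"
 proof -
  have "(\<Prod>j\<in>{1..<m}. real N / e j) >= 0" by (rule prod_nonneg) (simp add: e less_imp_le)
  then have "(\<Prod>j\<in>{1..<m}. real N / e j) * real (wt ?a) <= (\<Prod>j\<in>{1..<m}. real N / e j) * real (wt a)"
   using \<open>wt ?a <= wt a\<close> by (intro mult_left_mono) auto
  then show ?thesis using small by linarith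
 qed
 have cz: "cob ?a J g = 0" for J g
  unfolding cob_add using coc cob_cob by (simp add: cadd_def)
 have "wt ?a = 0"
  by (rule locmin_cocycle_zero[OF ca cz lma ex mix m B e lam sm const])
 have "?a I g = 0" for I g
 proof (rule ccontr)
  assume nz: "?a I g ~= 0"
  then have "I \<in> Pow {..<N}" "g \<in> G" using ca unfolding cochain_def by blast+
  then have "card {g\<in>G. ?a I g ~= 0} = 0" using \<open>wt ?a = 0\<close> unfolding wt_def by (simp add: sum_eq_0_iff)
  then show False using nz \<open>g \<in> G\<close> finG by auto
 qed
 then have "a I g = cob h I g" for I g
  by (metis (no_types) cadd_def bit_add_self add.assoc add_0_right)
 then have "a = cob h" by blast
 then show ?thesis using h(1) Ph by auto
qed

end

section \<open>Mixing from links\<close>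

context chambers
begin

definition inv_on :: "nat set => 'g set => ('g => real) => bool" where
 "inv_on D X f \<longleftrightarrow> (\<forall>x\<in>X. \<forall>y\<in>cls D x. f y = f x)"

text \<open>A bound for the cosine of the angle between functions of the \<open>i\<close>-vertex and functions of the
 \<open>j\<close>-vertex, both orthogonal to constants, written without square roots.\<close>

definition angle :: "nat set => nat => nat => 'g => real => bool" where
 "angle C i j g0 lam \<longleftrightarrow> (\<forall>f h. inv_on (insert i C) (cls C g0) f & inv_on (insert j C) (cls C g0) h &
   sum f (cls C g0) = 0 & sum h (cls C g0) = 0 -->
   2 * (\<Sum>x\<in>cls C g0. f x * h x) <= lam * ((\<Sum>x\<in>cls C g0. (f x)\<^sup>2) + (\<Sum>x\<in>cls C g0. (h x)\<^sup>2)))"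

lemma angle_mono: "angle C i j g0 lam ==> lam <= lam' ==> angle C i j g0 lam'"
 unfolding angle_def
proof (intro allI impI)
 fix f h :: "'g => real"
 let ?X = "cls C g0"
 let ?Q = "(\<Sum>x\<in>?X. (f x)\<^sup>2) + (\<Sum>x\<in>?X. (h x)\<^sup>2)"
 assume A: "\<forall>f h. inv_on (insert i C) ?X f & inv_on (insert j C) ?X h & sum f ?X = 0 & sum h ?X = 0 -->
   2 * (\<Sum>x\<in>?X. f x * h x) <= lam * ((\<Sum>x\<in>?X. (f x)\<^sup>2) + (\<Sum>x\<in>?X. (h x)\<^sup>2))" "lam <= lam'"
  "inv_on (insert i C) ?X f & inv_on (insert j C) ?X h & sum f ?X = 0 & sum h ?X = 0"
 have "2 * (\<Sum>x\<in>?X. f x * h x) <= lam * ?Q" using A(1,3) by blast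
 also have "... <= lam' * ?Q"
  by (rule mult_right_mono[OF A(2)]) (intro add_nonneg_nonneg sum_nonneg zero_le_power2)
 finally show "2 * (\<Sum>x\<in>?X. f x * h x) <= lam' * ?Q" .
qed

definition avg :: "nat set => ('g => real) => 'g => real" where
 "avg D f x = sum f (cls D x) / real (card (cls D x))"

lemma sum_avg:
 assumes D: "C \<subseteq> D" and g0: "g0 \<in> G"
 shows "(\<Sum>x\<in>cls C g0. avg D f x) = sum f (cls C g0)"
proof -
 let ?X = "cls C g0"
 have sub: "cls D x \<subseteq> ?X" if "x \<in> ?X" for x using cls_mono[OF D, of x] cls_eq[OF that] by auto
 have XG: "?X \<subseteq> G" by (rule cls_sub)
 have "(\<Sum>x\<in>?X. avg D f x) = (\<Sum>x\<in>?X. \<Sum>y\<in>?X. if y \<in> cls D x then f y / real (card (cls D y)) else 0)"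
 proof (rule sum.cong[OF refl])
  fix x assume x: "x \<in> ?X"
  have "(\<Sum>y\<in>?X. if y \<in> cls D x then f y / real (card (cls D y)) else 0)
    = (\<Sum>y\<in>?X Int cls D x. f y / real (card (cls D y)))"
   by (simp add: sum.inter_restrict)
  also have "?X Int cls D x = cls D x" using sub[OF x] by auto
  also have "(\<Sum>y\<in>cls D x. f y / real (card (cls D y))) = (\<Sum>y\<in>cls D x. f y / real (card (cls D x)))"
   by (rule sum.cong) (auto simp: cls_eq)
  finally show "avg D f x = (\<Sum>y\<in>?X. if y \<in> cls D x then f y / real (card (cls D y)) else 0)"
   by (simp add: avg_def sum_divide_distrib)
 qed
 also have "... = (\<Sum>y\<in>?X. \<Sum>x\<in>?X. if y \<in> cls D x then f y / real (card (cls D y)) else 0)"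
  by (rule sum.swap)
 also have "... = (\<Sum>y\<in>?X. f y)"
 proof (rule sum.cong[OF refl])
  fix y assume y: "y \<in> ?X"
  then have yG: "y \<in> G" using XG by auto
  have "(\<Sum>x\<in>?X. if y \<in> cls D x then f y / real (card (cls D y)) else 0)
   = (\<Sum>x\<in>?X Int {x. y \<in> cls D x}. f y / real (card (cls D y)))"
   unfolding sum.inter_restrict[OF fin_cls] by simp
  also have "?X Int {x. y \<in> cls D x} = cls D y"
   using sub[OF y] yG XG y by (auto simp: cls_def)
  also have "(\<Sum>x\<in>cls D y. f y / real (card (cls D y))) = f y"
   using card_cls_pos[OF yG, of D] by force
  finally show "(\<Sum>x\<in>?X. if y \<in> cls D x then f y / real (card (cls D y)) else 0) = f y" .
 qed
 finally show ?thesis .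
qed

lemma avg_inv: "y \<in> cls D x ==> avg D f y = avg D f x"
 by (simp add: avg_def cls_eq)

text \<open>Averaging over classes is the orthogonal projection onto functions of the larger face,
  hence self-adjoint and idempotent.\<close>

lemma avg_mult:
 assumes "C \<subseteq> D" "g0 \<in> G"
 shows "(\<Sum>x\<in>cls C g0. f x * avg D h x) = (\<Sum>x\<in>cls C g0. avg D f x * avg D h x)"
proof -
 have "(\<Sum>x\<in>cls C g0. f x * avg D h x) = (\<Sum>x\<in>cls C g0. avg D (%x. f x * avg D h x) x)"
  by (rule sum_avg[OF assms, symmetric])
 also have "... = (\<Sum>x\<in>cls C g0. avg D f x * avg D h x)"
 proof (rule sum.cong[OF refl])
  fix x
  have "(\<Sum>y\<in>cls D x. f y * avg D h y) = (\<Sum>y\<in>cls D x. f y * avg D h x)"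
   by (rule sum.cong) (auto simp: avg_inv)
  then have "avg D (%x. f x * avg D h x) x = (\<Sum>y\<in>cls D x. f y) * avg D h x / real (card (cls D x))"
   unfolding avg_def[of D "%x. f x * avg D h x"] by (simp only: sum_distrib_right)
  then show "avg D (%x. f x * avg D h x) x = avg D f x * avg D h x" by (simp add: avg_def[of D f])
 qed
 finally show ?thesis .
qed

text \<open>The angle inequality is tested on \<open>f\<close> and its own projection scaled by
  \<open>1 / mu\<close>, which turns a bilinear bound into a bound for the norm of the
  projection.\<close>

lemma avg_norm:
 assumes ang: "angle C i l g0 mu" and mu: "mu > 0" and g0: "g0 \<in> G"
  and f: "inv_on (insert i C) (cls C g0) f" "sum f (cls C g0) = 0"
 shows "(\<Sum>x\<in>cls C g0. (avg (insert l C) f x)\<^sup>2) <= mu\<^sup>2 * (\<Sum>x\<in>cls C g0. (f x)\<^sup>2)"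
proof -
 let ?X = "cls C g0" and ?P = "avg (insert l C) f"
 let ?p = "\<Sum>x\<in>?X. (?P x)\<^sup>2" and ?F = "\<Sum>x\<in>?X. (f x)\<^sup>2"
 let ?h = "%x. (1 / mu) * ?P x"
 have "inv_on (insert l C) ?X ?h" by (simp add: inv_on_def avg_inv)
 moreover have "sum ?h ?X = 0"
  using sum_avg[of C "insert l C" g0 f] f(2) g0 unfolding sum_distrib_left[symmetric] by (simp add: subset_insertI)
 ultimately have "2 * (\<Sum>x\<in>?X. f x * ?h x) <= mu * (?F + (\<Sum>x\<in>?X. (?h x)\<^sup>2))"
  using ang f unfolding angle_def by blast
 moreover have "(\<Sum>x\<in>?X. f x * ?h x) = ?p / mu"
  using avg_mult[of C "insert l C" g0 f f] g0
  by (simp add: sum_divide_distrib[symmetric] power2_eq_square subset_insertI)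
 moreover have "(\<Sum>x\<in>?X. (?h x)\<^sup>2) = ?p / mu\<^sup>2"
  by (simp add: power_divide sum_divide_distrib[symmetric])
 ultimately have "2 * (?p / mu) <= mu * (?F + ?p / mu\<^sup>2)" by simp
 then have "2 * (?p / mu) * mu <= mu * (?F + ?p / mu\<^sup>2) * mu" using mu by (intro mult_right_mono) auto
 then show ?thesis using mu by (simp add: algebra_simps power2_eq_square)
qed

text \<open>Covariance is decomposed along the vertices of colour \<open>l\<close>. Inside the link
  of each of them the hypothesis bounds the centred parts by \<open>lam\<close>; the means over
  these links are the projections \<open>avg\<close>, which shrink by \<open>mu\<close> according to
  \<open>avg_norm\<close>.\<close>

lemma trickle:
 assumes loc: "\<And>x. x \<in> cls C g0 ==> angle (insert l C) i j x lam" and lam: "0 <= lam" "lam <= 1"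
  and ai: "angle C i l g0 mu" and aj: "angle C j l g0 mu" and mu: "mu > 0" and g0: "g0 \<in> G"
 shows "angle C i j g0 (lam + (1 - lam) * mu\<^sup>2)"
 unfolding angle_def
proof (intro allI impI, elim conjE)
 fix f h :: "'g => real"
 let ?X = "cls C g0" and ?D = "insert l C"
 assume f: "inv_on (insert i C) ?X f" and h: "inv_on (insert j C) ?X h" and f0: "sum f ?X = 0" and h0: "sum h ?X = 0"
 let ?F = "\<Sum>x\<in>?X. (f x)\<^sup>2" and ?H = "\<Sum>x\<in>?X. (h x)\<^sup>2"
 let ?p = "\<Sum>x\<in>?X. (avg ?D f x)\<^sup>2" and ?r = "\<Sum>x\<in>?X. (avg ?D h x)\<^sup>2"
 have CD: "C \<subseteq> ?D" by auto
 have p: "?p <= mu\<^sup>2 * ?F" by (rule avg_norm[OF ai mu g0 f f0])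
 have r: "?r <= mu\<^sup>2 * ?H" by (rule avg_norm[OF aj mu g0 h h0])
 have local: "2 * avg ?D (%x. f x * h x) x <= lam * (avg ?D (%x. (f x)\<^sup>2) x - (avg ?D f x)\<^sup>2
   + (avg ?D (%x. (h x)\<^sup>2) x - (avg ?D h x)\<^sup>2)) + 2 * (avg ?D f x * avg ?D h x)" if x: "x \<in> ?X" for x
 proof -
  let ?Y = "cls ?D x" and ?a = "avg ?D f x" and ?b = "avg ?D h x"
  have xG: "x \<in> G" using x cls_sub by auto
  have cY: "real (card ?Y) > 0" using card_cls_pos[OF xG] by simp
  have YX: "?Y \<subseteq> ?X" using cls_mono[OF CD, of x] cls_eq[OF x] by auto
  have sf: "sum f ?Y = real (card ?Y) * ?a" and sh: "sum h ?Y = real (card ?Y) * ?b"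
   using cY by (auto simp: avg_def)
  have "inv_on (insert i ?D) ?Y (%y. f y - ?a)" "inv_on (insert j ?D) ?Y (%y. h y - ?b)"
  proof -
   have sub: "cls (insert i ?D) y \<subseteq> cls (insert i C) y" for y i by (rule cls_mono) auto
   show "inv_on (insert i ?D) ?Y (%y. f y - ?a)"
    using f YX sub[of i] unfolding inv_on_def by (metis subsetD)
   show "inv_on (insert j ?D) ?Y (%y. h y - ?b)"
    using h YX sub[of j] unfolding inv_on_def by (metis subsetD)
  qed
  moreover have "(\<Sum>y\<in>?Y. f y - ?a) = 0" "(\<Sum>y\<in>?Y. h y - ?b) = 0"
   using sf sh by (auto simp: sum_subtractf)
  ultimately have "2 * (\<Sum>y\<in>?Y. (f y - ?a) * (h y - ?b)) <= lam * ((\<Sum>y\<in>?Y. (f y - ?a)\<^sup>2) + (\<Sum>y\<in>?Y. (h y - ?b)\<^sup>2))"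
   using loc[OF x] unfolding angle_def by blast
  moreover have "(\<Sum>y\<in>?Y. (f y - ?a) * (h y - ?b)) = (\<Sum>y\<in>?Y. f y * h y) - real (card ?Y) * (?a * ?b)"
  proof -
   have "(\<Sum>y\<in>?Y. (f y - ?a) * (h y - ?b)) = (\<Sum>y\<in>?Y. f y * h y) - ?a * sum h ?Y - ?b * sum f ?Y + real (card ?Y) * (?a * ?b)"
    by (simp add: algebra_simps sum.distrib sum_subtractf sum_distrib_left)
   then show ?thesis by (simp add: sf sh)
  qed
  moreover have "(\<Sum>y\<in>?Y. (k y - c)\<^sup>2) = (\<Sum>y\<in>?Y. (k y)\<^sup>2) - real (card ?Y) * c\<^sup>2"
   if k: "sum k ?Y = real (card ?Y) * c" for k and c :: real
  proof -
   have "(\<Sum>y\<in>?Y. (k y - c)\<^sup>2) = (\<Sum>y\<in>?Y. (k y)\<^sup>2) - 2 * c * sum k ?Y + real (card ?Y) * c\<^sup>2"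
    by (simp add: power2_diff sum.distrib sum_subtractf sum_distrib_left mult_ac)
   then show ?thesis by (simp add: k power2_eq_square)
  qed
  note this[OF sf] this[OF sh]
  ultimately have "2 * ((\<Sum>y\<in>?Y. f y * h y) - real (card ?Y) * (?a * ?b))
   <= lam * (((\<Sum>y\<in>?Y. (f y)\<^sup>2) - real (card ?Y) * ?a\<^sup>2) + ((\<Sum>y\<in>?Y. (h y)\<^sup>2) - real (card ?Y) * ?b\<^sup>2))" by simp
  then have "2 * ((\<Sum>y\<in>?Y. f y * h y) - real (card ?Y) * (?a * ?b)) / real (card ?Y)
   <= lam * (((\<Sum>y\<in>?Y. (f y)\<^sup>2) - real (card ?Y) * ?a\<^sup>2) + ((\<Sum>y\<in>?Y. (h y)\<^sup>2) - real (card ?Y) * ?b\<^sup>2)) / real (card ?Y)"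
   using cY by (intro divide_right_mono) auto
  moreover have "?Y ~= {}" using cls_self[OF xG] by blast
  ultimately show ?thesis using cY unfolding avg_def[of _ "%x. f x * h x"] avg_def[of _ "%x. (f x)\<^sup>2"] avg_def[of _ "%x. (h x)\<^sup>2"]
   by (simp add: diff_divide_distrib add_divide_distrib right_diff_distrib distrib_left)
 qed
 have "2 * (\<Sum>x\<in>?X. f x * h x) = (\<Sum>x\<in>?X. 2 * avg ?D (%x. f x * h x) x)"
  unfolding sum_distrib_left[symmetric] sum_avg[OF CD g0] ..
 also have "... <= (\<Sum>x\<in>?X. lam * (avg ?D (%x. (f x)\<^sup>2) x - (avg ?D f x)\<^sup>2
   + (avg ?D (%x. (h x)\<^sup>2) x - (avg ?D h x)\<^sup>2)) + 2 * (avg ?D f x * avg ?D h x))"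
  by (rule sum_mono[OF local])
 also have "... = lam * (?F - ?p + (?H - ?r)) + 2 * (\<Sum>x\<in>?X. avg ?D f x * avg ?D h x)"
  by (simp add: sum.distrib sum_subtractf sum_distrib_left[symmetric] sum_avg[OF CD g0])
 also have "... <= lam * (?F - ?p + (?H - ?r)) + (?p + ?r)"
 proof -
  have "2 * (\<Sum>x\<in>?X. avg ?D f x * avg ?D h x) <= ?p + ?r"
   unfolding sum_distrib_left sum.distrib[symmetric]
   by (intro sum_mono) (use sum_squares_bound in \<open>simp add: mult.assoc[symmetric]\<close>)
  then show ?thesis by simp
 qed
 also have "... = lam * (?F + ?H) + (1 - lam) * (?p + ?r)"
  by (simp add: algebra_simps)
 also have "... <= lam * (?F + ?H) + (1 - lam) * (mu\<^sup>2 * ?F + mu\<^sup>2 * ?H)"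
  using p r lam by (intro add_left_mono mult_left_mono) auto
 finally show "2 * (\<Sum>x\<in>?X. f x * h x) <= (lam + (1 - lam) * mu\<^sup>2) * (?F + ?H)"
  by (simp add: algebra_simps)
qed

definition stepr :: "nat set => nat => nat => ('g \<times> 'g) set" where
 "stepr C i j = {(x, y). x \<in> G & (y \<in> cls (insert i C) x \<or> y \<in> cls (insert j C) x)}"

text \<open>If \<open>f\<close> and \<open>h\<close> are close, then \<open>f\<close> changes little
  along a path of chambers in which neighbours share a vertex of colour \<open>i\<close> or
  \<open>j\<close>; having sum zero, \<open>f\<close> is small everywhere, and so is
  \<open>h\<close>. Hence the squared distance of \<open>f\<close> and \<open>h\<close> is a
  definite part of their squared norms. The gap depends on path lengths and is only used to exclude
  the value \<open>1\<close>.\<close>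

lemma angle_connected:
 assumes g0: "g0 \<in> G" and con: "\<And>x y. x \<in> G ==> y \<in> cls C x ==> (x, y) \<in> (stepr C i j)\<^sup>*"
 shows "\<exists>mu<1. angle C i j g0 mu"
proof -
 let ?X = "cls C g0"
 have XG: "?X \<subseteq> G" by (rule cls_sub)
 have "\<exists>k. (x, y) \<in> stepr C i j ^^ k" if "x \<in> ?X" "y \<in> ?X" for x y
  using con[of x y] that XG cls_eq[OF that(1)] rtrancl_imp_relpow by blast
 then have "\<forall>x y. \<exists>k. x \<in> ?X --> y \<in> ?X --> (x, y) \<in> stepr C i j ^^ k" by blast
 then obtain len where "\<forall>x y. x \<in> ?X --> y \<in> ?X --> (x, y) \<in> stepr C i j ^^ len x y"
  unfolding choice_iff by blast
 then have len: "\<And>x y. x \<in> ?X ==> y \<in> ?X ==> (x, y) \<in> stepr C i j ^^ len x y" by blast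
 define K where "K = real (Max ((%(x, y). len x y) ` (?X \<times> ?X)))"
 have K: "real (len x y) <= K" if "x \<in> ?X" "y \<in> ?X" for x y
  unfolding K_def of_nat_le_iff using that by (intro Max_ge) auto
 have K0: "K >= 0" by (simp add: K_def)
 define n where "n = real (card ?X)"
 have n: "n > 0" using card_cls_pos[OF g0] by (simp add: n_def)
 \<comment> \<open>The bounds for \<open>?F\<close> and \<open>?H\<close> obtained below,
   \<open>?F\<close> at most \<open>n * (2 * K)^2\<close> times \<open>?E\<close> and
   \<open>?H <= 2 * ?F + 2 * ?E\<close>, combine to \<open>?F + ?H <= M * ?E\<close>.\<close>
 define M where "M = 3 * (n * (2 * K)\<^sup>2) + 2"
 have M: "M > 0" using n by (simp add: M_def add_nonneg_pos)
 have "angle C i j g0 (1 - 1 / M)"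
  unfolding angle_def
 proof (intro allI impI, elim conjE)
  fix f h :: "'g => real"
  assume f: "inv_on (insert i C) ?X f" and h: "inv_on (insert j C) ?X h" and f0: "sum f ?X = 0" and h0: "sum h ?X = 0"
  let ?F = "\<Sum>x\<in>?X. (f x)\<^sup>2" and ?H = "\<Sum>x\<in>?X. (h x)\<^sup>2"
  let ?E = "\<Sum>x\<in>?X. (f x - h x)\<^sup>2"
  let ?e = "sqrt ?E"
  have e: "\<bar>f x - h x\<bar> <= ?e" if "x \<in> ?X" for x
   using member_le_sum[of x ?X "%x. (f x - h x)\<^sup>2"] that by (simp add: real_le_rsqrt)
  have path: "y \<in> ?X & \<bar>f x - f y\<bar> <= 2 * real k * ?e" if "(x, y) \<in> stepr C i j ^^ k" "x \<in> ?X" for k x y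
   using that
  proof (induction k arbitrary: y)
   case 0
   then show ?case by simp
  next
   case (Suc k)
   then obtain z where z: "(x, z) \<in> stepr C i j ^^ k" "(z, y) \<in> stepr C i j" by auto
   have zX: "z \<in> ?X" and zb: "\<bar>f x - f z\<bar> <= 2 * real k * ?e" using Suc.IH[OF z(1)] Suc.prems by auto
   have yX: "y \<in> ?X" using z(2) zX unfolding stepr_def cls_def by auto
   have "\<bar>f z - f y\<bar> <= 2 * ?e"
   proof (cases "y \<in> cls (insert i C) z")
    case True
    then show ?thesis using f zX unfolding inv_on_def by (auto simp: sum_nonneg)
   next
    case False
    then have "h y = h z" using h z(2) zX unfolding inv_on_def stepr_def by auto
    then show ?thesis using e[OF zX] e[OF yX] by linarith
   qed
   then show ?case using zb yX by (simp add: algebra_simps)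
  qed
  have fb: "\<bar>f x\<bar> <= 2 * K * ?e" if x: "x \<in> ?X" for x
  proof -
   have d: "\<bar>f x - f y\<bar> <= 2 * K * ?e" if y: "y \<in> ?X" for y
   proof -
    have "\<bar>f x - f y\<bar> <= 2 * real (len x y) * ?e" using path[OF len[OF x y] x] by auto
    also have "... <= 2 * K * ?e" using K[OF x y] by (intro mult_right_mono) (auto simp: sum_nonneg)
    finally show ?thesis .
   qed
   have "n * f x = (\<Sum>y\<in>?X. f x - f y)" using f0 by (simp add: sum_subtractf n_def)
   then have "n * \<bar>f x\<bar> = \<bar>\<Sum>y\<in>?X. f x - f y\<bar>" using n by (simp add: abs_mult flip: \<open>n * f x = _\<close>)
   also have "... <= (\<Sum>y\<in>?X. \<bar>f x - f y\<bar>)" by (rule sum_abs)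
   also have "... <= (\<Sum>y\<in>?X. 2 * K * ?e)" by (rule sum_mono[OF d])
   finally have "n * \<bar>f x\<bar> <= n * (2 * K * ?e)" by (simp add: n_def)
   then show ?thesis using n by simp
  qed
  have F: "?F <= n * (2 * K)\<^sup>2 * ?E"
  proof -
   have "?F <= (\<Sum>x\<in>?X. (2 * K)\<^sup>2 * ?E)"
   proof (rule sum_mono)
    fix x assume "x \<in> ?X"
    then have "\<bar>f x\<bar>\<^sup>2 <= (2 * K * ?e)\<^sup>2" by (intro power_mono fb) auto
    then show "(f x)\<^sup>2 <= (2 * K)\<^sup>2 * ?E" by (simp add: power_mult_distrib sum_nonneg)
   qed
   then show ?thesis by (simp add: n_def)
  qed
  have H: "?H <= 2 * ?F + 2 * ?E"
   unfolding sum_distrib_left sum.distrib[symmetric]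
  proof (rule sum_mono)
   fix x
   have "2 * (f x)\<^sup>2 + 2 * (f x - h x)\<^sup>2 - (h x)\<^sup>2 = (2 * f x - h x)\<^sup>2" by (simp add: power2_eq_square algebra_simps)
   then show "(h x)\<^sup>2 <= 2 * (f x)\<^sup>2 + 2 * (f x - h x)\<^sup>2"
    using zero_le_power2[of "2 * f x - h x"] by linarith
  qed
  have "?F + ?H <= M * ?E" using F H unfolding M_def by (simp add: algebra_simps)
  then have "(?F + ?H) / M <= ?E" using M by (simp add: field_simps)
  moreover have "?E = ?F + ?H - 2 * (\<Sum>x\<in>?X. f x * h x)"
   by (simp add: power2_diff sum.distrib sum_subtractf sum_distrib_left mult.assoc)
  ultimately show "2 * (\<Sum>x\<in>?X. f x * h x) <= (1 - 1 / M) * (?F + ?H)"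
   by (simp add: left_diff_distrib)
 qed
 then show ?thesis using M by (intro exI[of _ "1 - 1 / M"]) simp
qed

text \<open>The least common bound \<open>m\<close> for all pairs of colours is attained, and
  \<open>trickle\<close> yields another bound, so \<open>m <= lam + (1 - lam) * m^2\<close>. The
  difference factors as \<open>(1 - m) * (lam - (1 - lam) * m)\<close>. Connectedness gives
  \<open>m < 1\<close>, which leaves \<open>m <= lam / (1 - lam)\<close>.\<close>

lemma trickle_down:
 assumes g0: "g0 \<in> G" and C: "C \<subseteq> {..<N}" "card C + 3 <= N"
  and loc: "\<And>x i j l. [|x \<in> G; i < N; j < N; l < N; i ~= j; i ~= l; j ~= l; i \<notin> C; j \<notin> C; l \<notin> C|]
   ==> angle (insert l C) i j x lam"
  and lam: "0 <= lam" "lam < 1"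
  and con: "\<And>x y i j. [|x \<in> G; y \<in> cls C x; i < N; j < N; i ~= j; i \<notin> C; j \<notin> C|] ==> (x, y) \<in> (stepr C i j)\<^sup>*"
  and ij: "i < N" "j < N" "i ~= j" "i \<notin> C" "j \<notin> C"
 shows "angle C i j g0 (lam / (1 - lam))"
proof -
 let ?P = "{(i, j). i < N & j < N & i ~= j & i \<notin> C & j \<notin> C}"
 define V where "V = {mu. mu >= 0 & (\<forall>(i, j)\<in>?P. angle C i j g0 mu)}"
 have finP: "finite ?P" by (rule finite_subset[of _ "{..<N} \<times> {..<N}"]) auto
 have "\<forall>p\<in>?P. \<exists>mu. mu < 1 & angle C (fst p) (snd p) g0 mu"
 proof
  fix p assume "p \<in> ?P"
  then have "\<exists>mu<1. angle C (fst p) (snd p) g0 mu" by (intro angle_connected[OF g0 con]) auto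
  then show "\<exists>mu. mu < 1 & angle C (fst p) (snd p) g0 mu" by blast
 qed
 then obtain mu where "\<forall>p\<in>?P. mu p < 1 & angle C (fst p) (snd p) g0 (mu p)"
  unfolding bchoice_iff by blast
 then have mu: "mu p < 1 & angle C (fst p) (snd p) g0 (mu p)" if "p \<in> ?P" for p using that by blast
 define m0 where "m0 = Max (insert 0 (mu ` ?P))"
 have m01: "m0 < 1" unfolding m0_def using mu finP by (subst Max_less_iff) auto
 have m0V: "m0 \<in> V"
  unfolding V_def
 proof (intro CollectI conjI ballI)
  show "m0 >= 0" unfolding m0_def using finP by (intro Max_ge) auto
  fix p assume p: "p \<in> ?P"
  have "mu p <= m0" unfolding m0_def using finP p by (intro Max_ge) auto
  then show "case p of (i, j) => angle C i j g0 m0"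
   using angle_mono[of C "fst p" "snd p" g0 "mu p" m0] mu[OF p] by (simp add: case_prod_beta)
 qed
 define m where "m = Inf V"
 have bdd: "bdd_below V" by (rule bdd_belowI[of _ 0]) (auto simp: V_def)
 have mm0: "m <= m0" unfolding m_def by (rule cInf_lower[OF m0V bdd])
 have m0: "m >= 0" unfolding m_def by (rule cInf_greatest) (use m0V in \<open>auto simp: V_def\<close>)
 have up: "mu \<in> V" if gt: "mu > m" for mu
 proof -
  have "V ~= {}" using m0V by blast
  then obtain x where x: "x \<in> V" "x < mu" using cInf_lessD[of V mu] gt[unfolded m_def] by blast
  show ?thesis
   unfolding V_def
  proof (intro CollectI conjI ballI)
   show "mu >= 0" using x by (simp add: V_def)
   fix p assume p: "p \<in> ?P"
   obtain i j where pij: "p = (i, j)" by fastforce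
   have "angle C i j g0 x" using x(1) p unfolding V_def pij by blast
   then show "case p of (i, j) => angle C i j g0 mu" unfolding pij prod.case using angle_mono x(2) less_imp_le by blast
  qed
 qed
 have mV: "m \<in> V"
  unfolding V_def
 proof (intro CollectI conjI ballI m0)
  fix p assume p: "p \<in> ?P"
  obtain i j where pij: "p = (i, j)" by fastforce
  show "case p of (i, j) => angle C i j g0 m"
   unfolding pij prod.case angle_def
  proof (intro allI impI)
   fix f h :: "'g => real"
   let ?X = "cls C g0"
   assume A: "inv_on (insert i C) ?X f & inv_on (insert j C) ?X h & sum f ?X = 0 & sum h ?X = 0"
   let ?Q = "(\<Sum>x\<in>?X. (f x)\<^sup>2) + (\<Sum>x\<in>?X. (h x)\<^sup>2)"
   have Q: "?Q >= 0" by (simp add: sum_nonneg add_nonneg_nonneg)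
   show "2 * (\<Sum>x\<in>?X. f x * h x) <= m * ?Q"
   proof (rule field_le_epsilon)
    fix e :: real assume e: "e > 0"
    have "m + e / (?Q + 1) \<in> V" using e Q by (intro up) auto
    then have "angle C i j g0 (m + e / (?Q + 1))" using p pij unfolding V_def by auto
    then have "2 * (\<Sum>x\<in>?X. f x * h x) <= (m + e / (?Q + 1)) * ?Q" using A unfolding angle_def by blast
    also have "... <= m * ?Q + e" using Q e by (simp add: distrib_right field_simps)
    finally show "2 * (\<Sum>x\<in>?X. f x * h x) <= m * ?Q + e" .
   qed
  qed
 qed
 have "m <= lam / (1 - lam)"
 proof (rule ccontr)
  assume "\<not> ?thesis"
  then have big: "m > lam / (1 - lam)" by simp
  then have mpos: "m > 0" using lam divide_nonneg_pos[of lam "1 - lam"] by linarith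
  let ?m' = "lam + (1 - lam) * m\<^sup>2"
  have "?m' \<in> V"
   unfolding V_def
  proof (intro CollectI conjI ballI)
   show "?m' >= 0" using lam by simp
   fix p assume p: "p \<in> ?P"
   obtain i j where pij: "p = (i, j)" by fastforce
   have ij: "i < N" "j < N" "i ~= j" "i \<notin> C" "j \<notin> C" using p pij by auto
   \<comment> \<open>At least three colours are missing from \<open>C\<close>, so a colour
     \<open>l\<close> besides \<open>i\<close> and \<open>j\<close> is available.\<close>
   have "card (insert i (insert j C)) < N" using C ij finite_subset[OF C(1)] by (simp add: card_insert_if)
   then have "\<not> {..<N} \<subseteq> insert i (insert j C)"
    using card_mono[of "insert i (insert j C)" "{..<N}"] finite_subset[OF C(1)] by auto
   then obtain l where l: "l < N" "l ~= i" "l ~= j" "l \<notin> C" by auto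
   have "angle C i j g0 ?m'"
   proof (rule trickle[where l = l])
    show "angle (insert l C) i j x lam" if "x \<in> cls C g0" for x
     using loc[of x i j l] that cls_sub ij l by blast
    show "angle C i l g0 m" "angle C j l g0 m" using mV ij l unfolding V_def by auto
   qed (use lam mpos g0 in auto)
   then show "case p of (i, j) => angle C i j g0 ?m'" by (simp add: pij)
  qed
  then have "m <= ?m'" unfolding m_def by (rule cInf_lower[OF _ bdd])
  moreover have "?m' - m = (1 - m) * (lam - (1 - lam) * m)" by (simp add: power2_eq_square algebra_simps)
  moreover have "(1 - m) * (lam - (1 - lam) * m) < 0"
  proof (rule mult_pos_neg)
   show "1 - m > 0" using mm0 m01 by simp
   show "lam - (1 - lam) * m < 0" using big lam by (simp add: field_simps)
  qed
  ultimately show False by linarith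
 qed
 moreover have "angle C i j g0 m" using mV ij unfolding V_def by auto
 ultimately show ?thesis using angle_mono by blast
qed

text \<open>Every colour removed from \<open>C\<close> costs one application of
  \<open>trickle_down\<close>, and \<open>lam / (1 - d * lam)\<close> is the \<open>d\<close>-th
  iterate of \<open>x / (1 - x)\<close> at \<open>lam\<close>. The mixing inequality is the angle
  bound for the centred indicators of \<open>S\<close> and \<open>T\<close>.\<close>

theorem mixing_from_links:
 assumes N: "N >= 2"
  and base: "\<And>C x i j. [|C \<subseteq> {..<N}; card C + 2 = N; x \<in> G; i < N; j < N; i ~= j; i \<notin> C; j \<notin> C|] ==> angle C i j x lam"
  and con: "\<And>C x y i j. [|C \<subseteq> {..<N}; card C + 3 <= N; x \<in> G; y \<in> cls C x; i < N; j < N; i ~= j; i \<notin> C; j \<notin> C|]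
   ==> (x, y) \<in> (stepr C i j)\<^sup>*"
  and lam: "lam >= 0" "real N * lam < 1"
 shows "mixing (lam / (1 - real N * lam))"
proof -
 have all: "angle C i j x (lam / (1 - real d * lam))"
  if "card C + 2 + d = N" "C \<subseteq> {..<N}" "x \<in> G" "i < N" "j < N" "i ~= j" "i \<notin> C" "j \<notin> C" for d C x i j
  using that
 proof (induction d arbitrary: C x i j)
  case 0
  then show ?case using base by simp
 next
  case (Suc d)
  have "real (Suc d) * lam <= real N * lam" using Suc.prems(1) lam by (intro mult_right_mono) auto
  then have s: "real (Suc d) * lam < 1" using lam by linarith
  then have s': "1 - real d * lam > lam" "lam >= 0" using lam by (auto simp: algebra_simps)
  let ?l = "lam / (1 - real d * lam)"
  have l: "0 <= ?l" "?l < 1" using s' by (auto simp: field_simps)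
  have "angle C i j x (?l / (1 - ?l))"
  proof (rule trickle_down[OF Suc.prems(3,2) _ _ l])
   show "card C + 3 <= N" using Suc.prems by simp
   fix x i j k assume H: "x \<in> G" "i < N" "j < N" "k < N" "i ~= j" "i ~= k" "j ~= k" "i \<notin> C" "j \<notin> C" "k \<notin> C"
   have "card (insert k C) = Suc (card C)" using H finite_subset[OF Suc.prems(2)] by simp
   then show "angle (insert k C) i j x ?l" using Suc.prems H by (intro Suc.IH) auto
  next
   fix x y i j assume "x \<in> G" "y \<in> cls C x" "i < N" "j < N" "i ~= j" "i \<notin> C" "j \<notin> C"
   then show "(x, y) \<in> (stepr C i j)\<^sup>*" using con Suc.prems by simp
  qed (use Suc.prems in auto)
  moreover have "?l / (1 - ?l) = lam / (1 - real (Suc d) * lam)"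
  proof -
   define u where "u = 1 - real d * lam"
   have u: "u > lam" "u > 0" using s' unfolding u_def by auto
   then have "1 - lam / u = (u - lam) / u" by (simp add: diff_divide_distrib)
   then have "(lam / u) / (1 - lam / u) = lam / (u - lam)" using u by simp
   moreover have "u - lam = 1 - real (Suc d) * lam" by (simp add: u_def algebra_simps)
   ultimately show ?thesis unfolding u_def[symmetric] by simp
  qed
  ultimately show ?case by (rule back_subst)
 qed
 show ?thesis
  unfolding mixing_def
 proof (intro allI impI, elim conjE)
  fix C i j g S T
  let ?X = "cls C g" and ?r = "lam / (1 - real N * lam)"
  assume H: "C \<subseteq> {..<N}" "i < N" "j < N" "i ~= j" "i \<notin> C" "j \<notin> C" "g \<in> G" "S \<subseteq> ?X" "T \<subseteq> ?X"
   "\<forall>h\<in>S. cls (insert i C) h \<subseteq> S" "\<forall>h\<in>T. cls (insert j C) h \<subseteq> T"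
  have fC: "finite C" using H(1) finite_subset by blast
  have "card (insert i (insert j C)) <= N" using H card_mono[of "{..<N}" "insert i (insert j C)"] by auto
  then have "card C + 2 <= N" using H fC by simp
  then obtain d where d: "card C + 2 + d = N" using le_Suc_ex by blast
  have a: "angle C i j g (lam / (1 - real d * lam))" using all[OF d] H by blast
  have "real d * lam <= real N * lam" using d lam by (intro mult_right_mono) auto
  then have "lam / (1 - real d * lam) <= ?r" using lam by (intro divide_left_mono) auto
  then have a: "angle C i j g ?r" using a angle_mono by blast
  have r0: "?r >= 0" using lam by simp
  define n where "n = real (card ?X)"
  have n: "n > 0" using card_cls_pos[OF H(7)] by (simp add: n_def)
  define s where "s = real (card S)"
  define t where "t = real (card T)"
  let ?f = "%x. (if x \<in> S then 1 else 0) - s / n" and ?h = "%x. (if x \<in> T then 1 else 0) - t / n"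
  have sumS: "(\<Sum>x\<in>?X. if x \<in> S then 1 else 0) = s" "(\<Sum>x\<in>?X. if x \<in> T then 1 else 0) = t"
   using H by (auto simp: s_def t_def Int_absorb1 sum.If_cases)
  have inv1: "y \<in> S \<longleftrightarrow> x \<in> S" if "x \<in> ?X" "y \<in> cls (insert i C) x" for x y
   using that H(10) cls_sym[of x y "insert i C"] cls_sub by blast
  have inv2: "y \<in> T \<longleftrightarrow> x \<in> T" if "x \<in> ?X" "y \<in> cls (insert j C) x" for x y
   using that H(11) cls_sym[of x y "insert j C"] cls_sub by blast
  have "inv_on (insert i C) ?X ?f" "inv_on (insert j C) ?X ?h" using inv1 inv2 by (auto simp: inv_on_def)
  moreover have "sum ?f ?X = 0" "sum ?h ?X = 0"
   using sumS n by (auto simp: sum_subtractf n_def[symmetric])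
  ultimately have "2 * (\<Sum>x\<in>?X. ?f x * ?h x) <= ?r * ((\<Sum>x\<in>?X. (?f x)\<^sup>2) + (\<Sum>x\<in>?X. (?h x)\<^sup>2))"
   using a unfolding angle_def by blast
  moreover have "(\<Sum>x\<in>?X. ?f x * ?h x) = real (card (S Int T)) - s * t / n"
  proof -
   have "(\<Sum>x\<in>?X. ?f x * ?h x) = (\<Sum>x\<in>?X. (if x \<in> S Int T then 1 else 0) - (t / n) * (if x \<in> S then 1 else 0)
     - (s / n) * (if x \<in> T then 1 else 0) + s / n * (t / n))"
    by (intro sum.cong) (auto simp: algebra_simps)
   also have "... = real (card (S Int T)) - (t / n) * s - (s / n) * t + n * (s / n * (t / n))"
   proof -
    have sumST: "(\<Sum>x\<in>?X. if x \<in> S Int T then 1 else 0) = real (card (S Int T))"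
     using H by (simp add: sum.If_cases Int_absorb1 le_infI1 flip: Int_def)
    show ?thesis
     unfolding sum.distrib sum_subtractf sum_distrib_left[symmetric] sumS sumST sum_constant n_def by simp
   qed
   finally show ?thesis using n by (simp add: mult.commute)
  qed
  moreover have "(\<Sum>x\<in>?X. (?f x)\<^sup>2) <= s"
  proof -
   have "(\<Sum>x\<in>?X. (?f x)\<^sup>2) = (\<Sum>x\<in>?X. (if x \<in> S then 1 else 0) - (2 * s / n) * (if x \<in> S then 1 else 0) + (s / n)\<^sup>2)"
    by (intro sum.cong) (auto simp: algebra_simps power2_eq_square)
   also have "... = s - (2 * s / n) * s + n * (s / n)\<^sup>2"
    unfolding sum.distrib sum_subtractf sum_distrib_left[symmetric] sumS sum_constant n_def by simp
   also have "... = s - s\<^sup>2 / n" using n by (simp add: power2_eq_square)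
   finally show ?thesis using n by simp
  qed
  moreover have "(\<Sum>x\<in>?X. (?h x)\<^sup>2) <= t"
  proof -
   have "(\<Sum>x\<in>?X. (?h x)\<^sup>2) = (\<Sum>x\<in>?X. (if x \<in> T then 1 else 0) - (2 * t / n) * (if x \<in> T then 1 else 0) + (t / n)\<^sup>2)"
    by (intro sum.cong) (auto simp: algebra_simps power2_eq_square)
   also have "... = t - (2 * t / n) * t + n * (t / n)\<^sup>2"
    unfolding sum.distrib sum_subtractf sum_distrib_left[symmetric] sumS sum_constant n_def by simp
   also have "... = t - t\<^sup>2 / n" using n by (simp add: power2_eq_square)
   finally show ?thesis using n by simp
  qed
  ultimately have "2 * (real (card (S Int T)) - s * t / n) <= ?r * (s + t)"
  proof -
   assume A: "2 * (\<Sum>x\<in>?X. ?f x * ?h x) <= ?r * ((\<Sum>x\<in>?X. (?f x)\<^sup>2) + (\<Sum>x\<in>?X. (?h x)\<^sup>2))"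
    "(\<Sum>x\<in>?X. ?f x * ?h x) = real (card (S Int T)) - s * t / n"
    "(\<Sum>x\<in>?X. (?f x)\<^sup>2) <= s" "(\<Sum>x\<in>?X. (?h x)\<^sup>2) <= t"
   have "?r * ((\<Sum>x\<in>?X. (?f x)\<^sup>2) + (\<Sum>x\<in>?X. (?h x)\<^sup>2)) <= ?r * (s + t)"
    by (rule mult_left_mono[OF add_mono[OF A(3,4)] r0])
   with A(1,2) show ?thesis by simp
  qed
  moreover have "?r * (s + t) >= 0" using r0 by (rule mult_nonneg_nonneg) (simp add: s_def t_def)
  ultimately show "real (card (S Int T)) <= real (card S) * real (card T) / real (card ?X) + ?r * (real (card S) + real (card T))"
  proof -
   have gen: "2 * (A - B) <= R ==> R >= 0 ==> A <= B + R" for A B R :: real by argo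
   assume "2 * (real (card (S Int T)) - s * t / n) <= ?r * (s + t)" "?r * (s + t) >= 0"
   then show ?thesis unfolding s_def t_def n_def by (rule gen)
  qed
 qed
qed

end

section \<open>Filling cycles of flags opposite to a flag\<close>

lemma bit_pair_cancel:
 fixes f :: "'a => 'a => bit"
 assumes "finite A" "\<And>i j. f i j = f j i"
 shows "(\<Sum>i\<in>A. \<Sum>j\<in>A - {i}. f i j) = 0"
 using assms(1)
proof (induction A)
 case (insert a A)
 have "(\<Sum>j\<in>insert a A - {i}. f i j) = f i a + (\<Sum>j\<in>A - {i}. f i j)" if "i \<in> A" for i
 proof -
  have "insert a A - {i} = insert a (A - {i})" using that insert(2) by auto
  then show ?thesis using insert by simp
 qed
 then have "(\<Sum>i\<in>A. \<Sum>j\<in>insert a A - {i}. f i j) = (\<Sum>i\<in>A. f i a) + (\<Sum>i\<in>A. \<Sum>j\<in>A - {i}. f i j)"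
  by (simp add: sum.distrib)
 moreover have "(\<Sum>j\<in>insert a A - {a}. f a j) = (\<Sum>i\<in>A. f i a)"
  using insert assms(2) by (simp add: insert_Diff_if)
 ultimately show ?case using insert by simp
qed simp

text \<open>A chain mod 2 is a list of simplices, tested against cochains:
  \<open>ev (cobd c) z = 0\<close> for all \<open>c\<close> says that \<open>z\<close> is a cycle,
  and \<open>ev (cobd c) y = ev c z\<close> that \<open>y\<close> fills it. The length of the list
  records the size, which all later bounds concern.\<close>

definition ev :: "('a => bit) => 'a list => bit" where
 "ev c z = sum_list (map c z)"

definition cobd :: "('a set => bit) => 'a set => bit" where
 "cobd c s = (\<Sum>v\<in>s. c (s - {v}))"

lemma ev_simps [simp]: "ev c [] = 0" "ev c (x # z) = c x + ev c z" "ev c (y @ z) = ev c y + ev c z"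
 by (simp_all add: ev_def)

lemma ev_concat: "ev c (concat zs) = sum_list (map (ev c) zs)"
 by (induction zs) auto

lemma ev_map: "ev c (map f z) = ev (%x. c (f x)) z"
 by (simp add: ev_def comp_def)

lemma ev_add: "ev (%x. c x + d x) z = ev c z + ev d z"
 by (simp add: ev_def sum_list_addf)

lemma ev_cong: "(\<And>x. x \<in> set z ==> c x = d x) ==> ev c z = ev d z"
 by (simp add: ev_def cong: map_cong)

lemma ev_filter: "ev c (filter P z) = ev (%x. if P x then c x else 0) z"
 by (induction z) auto

lemma ev_sum: "finite A ==> ev (%x. \<Sum>v\<in>A. c v x) z = (\<Sum>v\<in>A. ev (c v) z)"
 by (induction z) (auto simp: sum.distrib)

lemma ev_distinct: "distinct xs ==> ev c xs = sum c (set xs)"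
 by (simp add: ev_def sum.distinct_set_conv_list)

lemma cobd_cobd: "finite s ==> cobd (cobd c) s = 0"
 unfolding cobd_def by (rule bit_pair_cancel) (simp_all add: Diff_insert2[symmetric] insert_commute)

lemma chain_enum:
 fixes C :: "'a set set"
 assumes "finite C" "\<And>x y. x \<in> C ==> y \<in> C ==> x \<subseteq> y \<or> y \<subseteq> x"
 shows "\<exists>f. bij_betw f {..<card C} C & (\<forall>i j. i < card C & j < card C --> (f i \<subseteq> f j \<longleftrightarrow> i <= j))"
 using assms
proof (induction "card C" arbitrary: C)
 case 0
 then show ?case by (auto simp: bij_betw_def)
next
 case (Suc n)
 have "C ~= {}" using Suc by auto
 then obtain m where m: "m \<in> C" "\<And>x. x \<in> C ==> m \<subseteq> x ==> x = m"
  using finite_has_maximal[OF Suc.prems(1)] by metis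
 then have top: "x \<subseteq> m" if "x \<in> C" for x using Suc.prems(2)[OF that m(1)] that by blast
 have cn: "card (C - {m}) = n" using Suc m by simp
 obtain f where f: "bij_betw f {..<n} (C - {m})" "\<And>i j. i < n ==> j < n ==> (f i \<subseteq> f j \<longleftrightarrow> i <= j)"
  using Suc.hyps(1)[of "C - {m}"] cn Suc.prems by auto
 let ?g = "f(n := m)"
 have "bij_betw ?g {..<n} (C - {m}) = bij_betw f {..<n} (C - {m})" by (rule bij_betw_cong) auto
 then have "bij_betw ?g {..<n} (C - {m})" using f(1) by simp
 then have "bij_betw ?g ({..<n} Un {n}) (C - {m} Un {?g n})" by (intro notIn_Un_bij_betw) simp_all
 then have "bij_betw ?g (insert n {..<n}) (insert m (C - {m}))" by simp
 then have "bij_betw ?g {..<Suc n} C" using m(1) by (simp add: lessThan_Suc insert_absorb)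
 moreover have "(?g i \<subseteq> ?g j \<longleftrightarrow> i <= j)" if "i < Suc n" "j < Suc n" for i j
 proof (cases "i = n"; cases "j = n")
  assume "i = n" "j ~= n"
  then have fj: "f j \<in> C - {m}" using bij_betwE[OF f(1)] that by auto
  then have "\<not> m \<subseteq> f j" using m(2)[of "f j"] by blast
  then show ?thesis using \<open>i = n\<close> \<open>j ~= n\<close> that by simp
 next
  assume "i ~= n" "j = n"
  then have "f i \<in> C - {m}" using bij_betwE[OF f(1)] that by auto
  then have "f i \<subseteq> m" using top[of "f i"] by blast
  then show ?thesis using \<open>i ~= n\<close> \<open>j = n\<close> that by simp
 qed (use f(2) that in auto)
 ultimately show ?case using Suc.hyps(2) by metis
qed

text \<open>The prism between a chain \<open>s\<close> and its image under \<open>u\<close>, extended by the cone with apex \<open>u b\<close>.\<close>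

definition prism :: "('a set => 'a set) => 'a set => 'a set set => 'a set => 'a set set" where
 "prism u b s V = {W\<in>s. W \<subseteq> V} Un u ` {W\<in>insert b s. V \<subseteq> W}"

text \<open>Deleting a member other than \<open>V\<close> from the cell at \<open>V\<close> gives a
  cell of the prism over a facet of \<open>s\<close>. The facets arising at \<open>V\<close> itself
  cancel between neighbouring cells; only \<open>s\<close> survives, because at the other end the
  image of \<open>s\<close> is absorbed by its cone with apex \<open>u b\<close>.\<close>

lemma prism_boundary:
 assumes fin: "finite s" and chain: "\<And>x y. x \<in> insert b s ==> y \<in> insert b s ==> x \<subseteq> y \<or> y \<subseteq> x"
  and b: "b \<notin> s" "\<And>x. x \<in> s ==> b \<subseteq> x"
  and inj: "inj_on u (insert b s)" and new: "\<And>x. x \<in> insert b s ==> u x \<notin> s"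
 shows "(\<Sum>V\<in>insert b s. cobd c (prism u b s V)) = c s + (\<Sum>W\<in>s. \<Sum>V\<in>insert b (s - {W}). c (prism u b (s - {W}) V))"
proof -
 let ?C = "insert b s"
 define Q where "Q V = {W\<in>s. W \<subset> V} Un u ` {W\<in>?C. V \<subseteq> W}" for V
 define R where "R V = {W\<in>s. W \<subseteq> V} Un u ` {W\<in>?C. V \<subset> W}" for V
 have one: "cobd c (prism u b s V) = (\<Sum>W\<in>s - {V}. c (prism u b (s - {W}) V)) + (if V \<in> s then c (Q V) else 0) + c (R V)"
  if V: "V \<in> ?C" for V
 proof -
  have fs: "finite {W\<in>s. W \<subseteq> V}" "finite {W\<in>?C. V \<subseteq> W}" using fin by auto
  have "cobd c (prism u b s V) = (\<Sum>W\<in>{W\<in>s. W \<subseteq> V}. c (prism u b s V - {W})) + (\<Sum>x\<in>u ` {W\<in>?C. V \<subseteq> W}. c (prism u b s V - {x}))"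
   unfolding cobd_def
   by (subst (1) prism_def, rule sum.union_disjoint) (use fs new in auto)
  also have "(\<Sum>x\<in>u ` {W\<in>?C. V \<subseteq> W}. c (prism u b s V - {x})) = (\<Sum>W\<in>{W\<in>?C. V \<subseteq> W}. c (prism u b s V - {u W}))"
   by (rule sum.reindex_cong[of u]) (use inj in \<open>auto intro: inj_on_subset\<close>)
  also have "{W\<in>?C. V \<subseteq> W} = insert V {W\<in>s. V \<subset> W}" using V b by auto
  also have "(\<Sum>W\<in>insert V {W\<in>s. V \<subset> W}. c (prism u b s V - {u W})) = c (prism u b s V - {u V}) + (\<Sum>W\<in>{W\<in>s. V \<subset> W}. c (prism u b s V - {u W}))"
   using fin by (subst sum.insert) auto
  also have "(\<Sum>W\<in>{W\<in>s. V \<subset> W}. c (prism u b s V - {u W})) = (\<Sum>W\<in>{W\<in>s. V \<subset> W}. c (prism u b (s - {W}) V))"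
  proof (rule sum.cong[OF refl])
   fix W assume W: "W \<in> {W\<in>s. V \<subset> W}"
   have "u x = u W \<longleftrightarrow> x = W" if "x \<in> ?C" for x using that W inj by (auto simp: inj_on_def)
   moreover have "u W \<notin> s" using W new by auto
   moreover have "W ~= b" using W b by auto
   moreover have "{x\<in>s. x \<subseteq> V} - {u W} = {x\<in>s - {W}. x \<subseteq> V}" using W \<open>u W \<notin> s\<close> by auto
   moreover have "u ` {x\<in>?C. V \<subseteq> x} - {u W} = u ` {x\<in>insert b (s - {W}). V \<subseteq> x}"
   proof -
    have e: "{x\<in>?C. V \<subseteq> x} - {W} = {x\<in>insert b (s - {W}). V \<subseteq> x}" using \<open>W ~= b\<close> by auto
    have "u ` ({x\<in>?C. V \<subseteq> x} - {W}) = u ` {x\<in>?C. V \<subseteq> x} - u ` {W}"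
     by (rule inj_on_image_set_diff[OF inj]) (use W in auto)
    then show ?thesis unfolding e image_insert image_empty by (rule sym)
   qed
   ultimately have "prism u b s V - {u W} = prism u b (s - {W}) V" unfolding prism_def Un_Diff by (simp only:)
   then show "c (prism u b s V - {u W}) = c (prism u b (s - {W}) V)" by simp
  qed
  also have "(\<Sum>W\<in>{W\<in>s. W \<subseteq> V}. c (prism u b s V - {W})) = (\<Sum>W\<in>{W\<in>s. W \<subset> V}. c (prism u b (s - {W}) V)) + (if V \<in> s then c (Q V) else 0)"
  proof -
   have low: "c (prism u b s V - {W}) = c (prism u b (s - {W}) V)" if W: "W \<in> s" "W \<subset> V" for W
   proof -
    have "W ~= b" using W b by auto
    moreover have "u x ~= W" if "x \<in> ?C" for x using new[OF that] W by auto
    ultimately have "prism u b s V - {W} = prism u b (s - {W}) V"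
     using W unfolding prism_def by auto
    then show ?thesis by simp
   qed
   show ?thesis
   proof (cases "V \<in> s")
    case True
    then have "{W\<in>s. W \<subseteq> V} = insert V {W\<in>s. W \<subset> V}" by auto
    moreover have "prism u b s V - {V} = Q V"
    proof -
     have "u x ~= V" if "x \<in> ?C" for x using new[OF that] True by auto
     then show ?thesis unfolding prism_def Q_def by auto
    qed
    ultimately show ?thesis using True fin low by (simp add: add.commute)
   next
    case False
    then have "{W\<in>s. W \<subseteq> V} = {W\<in>s. W \<subset> V}" by auto
    then show ?thesis using False low by simp
   qed
  qed
  also have "prism u b s V - {u V} = R V"
  proof -
   have "u x = u V \<longleftrightarrow> x = V" if "x \<in> ?C" for x using that V inj by (auto simp: inj_on_def)
   moreover have "u V \<notin> s" using V new by auto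
   ultimately show ?thesis unfolding prism_def R_def by auto
  qed
  finally have e: "cobd c (prism u b s V) = ((\<Sum>W\<in>{W\<in>s. W \<subset> V}. c (prism u b (s - {W}) V)) + (if V \<in> s then c (Q V) else 0))
    + (c (R V) + (\<Sum>W\<in>{W\<in>s. V \<subset> W}. c (prism u b (s - {W}) V)))" .
  have "s - {V} = {W\<in>s. W \<subset> V} Un {W\<in>s. V \<subset> W}" using chain V by blast
  moreover have "(\<Sum>W\<in>{W\<in>s. W \<subset> V} Un {W\<in>s. V \<subset> W}. c (prism u b (s - {W}) V)) =
   (\<Sum>W\<in>{W\<in>s. W \<subset> V}. c (prism u b (s - {W}) V)) + (\<Sum>W\<in>{W\<in>s. V \<subset> W}. c (prism u b (s - {W}) V))"
   by (rule sum.union_disjoint) (use fin in auto)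
  ultimately show ?thesis unfolding e by (simp add: ac_simps)
 qed
 \<comment> \<open>Along the enumeration of the chain, \<open>R\<close> at one member equals
   \<open>Q\<close> at the next, and \<open>R\<close> at the largest member is
   \<open>s\<close>.\<close>
 have tele: "(\<Sum>V\<in>s. c (Q V)) + (\<Sum>V\<in>?C. c (R V)) = c s"
 proof -
  obtain f where f: "bij_betw f {..<card ?C} ?C" "\<And>i j. i < card ?C ==> j < card ?C ==> (f i \<subseteq> f j \<longleftrightarrow> i <= j)"
   using chain_enum[of ?C] fin chain by auto
  define n where "n = card s"
  have cC: "card ?C = Suc n" using fin b by (simp add: n_def)
  have fC: "f i \<in> ?C" if "i < Suc n" for i using f(1) that cC by (auto simp: bij_betw_def)
  have all: "\<exists>i<Suc n. x = f i" if "x \<in> ?C" for x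
  proof -
   have "x \<in> f ` {..<Suc n}" using bij_betw_imp_surj_on[OF f(1)] cC that by simp
   then show ?thesis by blast
  qed
  have fe: "f i = f j \<longleftrightarrow> i = j" if "i < Suc n" "j < Suc n" for i j
   using f(1) that cC by (auto simp: bij_betw_def inj_on_def)
  have fl: "f i \<subset> f j \<longleftrightarrow> i < j" if "i < Suc n" "j < Suc n" for i j
  proof -
   have "f i \<subseteq> f j \<longleftrightarrow> i <= j" using f(2)[of i j] that cC by simp
   then show ?thesis by (simp only: psubset_eq fe[OF that] less_le)
  qed
  have f0: "f 0 = b"
  proof -
   obtain i where i: "i < Suc n" "b = f i" using all[of b] by auto
   have "b \<subseteq> f 0" using fC[of 0] b by auto
   then have "i <= 0" using f(2)[of i 0] i cC by auto
   then show ?thesis using i by auto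
  qed
  have RQ: "R (f i) = Q (f (Suc i))" if i: "i < n" for i
  proof -
   have "{W\<in>s. W \<subseteq> f i} = {W\<in>s. W \<subset> f (Suc i)}"
   proof (rule Collect_cong, rule conj_cong[OF refl])
    fix W assume "W \<in> s"
    then obtain j where j: "j < Suc n" "W = f j" using all by blast
    have "f j \<subseteq> f i \<longleftrightarrow> j <= i" "f j \<subset> f (Suc i) \<longleftrightarrow> j < Suc i" using f(2)[of j i] fl[of j "Suc i"] j(1) i cC by simp_all
    then show "W \<subseteq> f i \<longleftrightarrow> W \<subset> f (Suc i)" by (simp only: j(2) less_Suc_eq_le)
   qed
   moreover have "{W\<in>?C. f i \<subset> W} = {W\<in>?C. f (Suc i) \<subseteq> W}"
   proof (rule Collect_cong, rule conj_cong[OF refl])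
    fix W assume "W \<in> ?C"
    then obtain j where j: "j < Suc n" "W = f j" using all by blast
    have "f (Suc i) \<subseteq> f j \<longleftrightarrow> Suc i <= j" "f i \<subset> f j \<longleftrightarrow> i < j" using f(2)[of "Suc i" j] fl[of i j] j(1) i cC by simp_all
    then show "f i \<subset> W \<longleftrightarrow> f (Suc i) \<subseteq> W" by (simp only: j(2) Suc_le_eq)
   qed
   ultimately show ?thesis unfolding R_def Q_def by simp
  qed
  have Rn: "R (f n) = s"
  proof -
   have "{W\<in>?C. f n \<subset> W} = {}"
   proof -
    have False if W: "W \<in> ?C" "f n \<subset> W" for W
    proof -
     obtain j where "j < Suc n" "W = f j" using all[OF W(1)] by blast
     then show False using fl[of n j] W by auto
    qed
    then show ?thesis by blast
   qed
   moreover have "W \<subseteq> f n" if W: "W \<in> s" for W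
   proof -
    obtain j where "j < Suc n" "W = f j" using all[of W] W by blast
    then show ?thesis using f(2)[of j n] cC by auto
   qed
   ultimately show ?thesis unfolding R_def by auto
  qed
  have "(\<Sum>V\<in>?C. c (R V)) = (\<Sum>i<Suc n. c (R (f i)))"
   using sum.reindex_bij_betw[OF f(1), of "%V. c (R V)"] cC by simp
  also have "... = (\<Sum>i<n. c (Q (f (Suc i)))) + c s" using RQ Rn by simp
  also have "(\<Sum>i<n. c (Q (f (Suc i)))) = (\<Sum>V\<in>s. c (Q V))"
  proof -
   have "bij_betw f ({..<Suc n} - {0}) (?C - {f 0})"
    using f(1) unfolding cC by (intro bij_betw_DiffI) (auto simp: f0)
   moreover have "?C - {f 0} = s" using f0 b by auto
   ultimately have "bij_betw f ({..<Suc n} - {0}) s" by simp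
   then have "(\<Sum>V\<in>s. c (Q V)) = (\<Sum>i\<in>{..<Suc n} - {0}. c (Q (f i)))"
    using sum.reindex_bij_betw[of f _ s "%V. c (Q V)"] by metis
   also have "{..<Suc n} - {0} = Suc ` {..<n}" by (auto simp: image_iff less_Suc_eq_0_disj)
   also have "(\<Sum>i\<in>Suc ` {..<n}. c (Q (f i))) = (\<Sum>i<n. c (Q (f (Suc i))))"
    by (subst sum.reindex) auto
   finally show ?thesis by simp
  qed
  finally show ?thesis by (simp add: ac_simps)
 qed
 have "(\<Sum>V\<in>?C. cobd c (prism u b s V)) = (\<Sum>V\<in>?C. (\<Sum>W\<in>s - {V}. c (prism u b (s - {W}) V))) + ((\<Sum>V\<in>?C. if V \<in> s then c (Q V) else 0) + (\<Sum>V\<in>?C. c (R V)))"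
  by (simp only: one sum.distrib add.assoc cong: sum.cong)
 also have "(\<Sum>V\<in>?C. if V \<in> s then c (Q V) else 0) = (\<Sum>V\<in>s. c (Q V))"
  using fin b by (simp add: sum.If_cases Int_absorb1 subset_insertI)
 also have "(\<Sum>V\<in>?C. (\<Sum>W\<in>s - {V}. c (prism u b (s - {W}) V))) = (\<Sum>V\<in>?C. (\<Sum>W\<in>s. if W ~= V then c (prism u b (s - {W}) V) else 0))"
  using fin by (intro sum.cong[OF refl] sum.mono_neutral_cong_left) auto
 also have "... = (\<Sum>W\<in>s. (\<Sum>V\<in>?C. if W ~= V then c (prism u b (s - {W}) V) else 0))" by (rule sum.swap)
 also have "... = (\<Sum>W\<in>s. \<Sum>V\<in>insert b (s - {W}). c (prism u b (s - {W}) V))"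
 proof (rule sum.cong[OF refl])
  fix W assume W: "W \<in> s"
  show "(\<Sum>V\<in>?C. if W ~= V then c (prism u b (s - {W}) V) else 0) = (\<Sum>V\<in>insert b (s - {W}). c (prism u b (s - {W}) V))"
   using fin W b by (intro sum.mono_neutral_cong_right) auto
 qed
 finally show ?thesis using tele by (simp add: ac_simps)
qed

section \<open>Complements of the members of a complete flag\<close>

locale finite_field_space = vector_space scale
 for scale :: "'a::field => 'b::ab_group_add => 'b" (infixr \<open>*s\<close> 75) +
 assumes fin_field: "finite (UNIV :: 'a set)"
begin

definition addl :: "'b set => 'b => 'b set" where
 "addl W x = {w + c *s x | w c. w \<in> W}"

definition ssum :: "'b set => 'b set => 'b set" where
 "ssum A B = {a + b | a b. a \<in> A & b \<in> B}"

definition flagged :: "'b set => (nat => 'b set) => nat => bool" where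
 "flagged H F N \<longleftrightarrow> F 0 = {0} & F N = H & (\<forall>j<N. \<exists>y. y \<notin> F j & F (Suc j) = addl (F j) y)"

text \<open>As \<open>F j\<close> has dimension \<open>j\<close>, these are spaces of codimension
  \<open>j\<close>: larger indices belong to smaller spaces, and index \<open>1\<close> marks
  hyperplanes.\<close>

definition compl :: "'b set => (nat => 'b set) => nat => 'b set => bool" where
 "compl H F j W \<longleftrightarrow> subspace W & W \<subseteq> H & W Int F j = {0} & H \<subseteq> ssum W (F j)"

text \<open>The proper nonzero subspaces opposite to the flag. Their flags will turn out to be the
  simplices of the vertex links of the coset geometry.\<close>

definition opp :: "'b set => (nat => 'b set) => nat => 'b set set" where
 "opp H F N = {W. \<exists>j. 0 < j & j < N & compl H F j W}"

definition flags :: "'b set set => 'b set set set" where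
 "flags X = {s. finite s & s \<subseteq> X & (\<forall>U\<in>s. \<forall>V\<in>s. U \<subseteq> V \<or> V \<subseteq> U)}"

lemma flagged_step: "flagged H F N ==> j < N ==> \<exists>y. y \<notin> F j & F (Suc j) = addl (F j) y"
 by (simp add: flagged_def)

lemma flagged_ends: "flagged H F N ==> F 0 = {0}" "flagged H F N ==> F N = H"
 by (simp_all add: flagged_def)

lemma complD:
 assumes "compl H F j W"
 shows "subspace W" "W \<subseteq> H" "\<And>x. x \<in> W ==> x \<in> F j ==> x = 0" "\<And>h. h \<in> H ==> \<exists>w\<in>W. \<exists>f\<in>F j. h = w + f"
proof -
 show "subspace W" "W \<subseteq> H" using assms unfolding compl_def by simp_all
 show "x = 0" if "x \<in> W" "x \<in> F j" for x
 proof -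
  have "x \<in> W Int F j" using that by simp
  then show ?thesis using assms unfolding compl_def by simp
 qed
 show "\<exists>w\<in>W. \<exists>f\<in>F j. h = w + f" if "h \<in> H" for h
 proof -
  have "h \<in> ssum W (F j)" using assms that unfolding compl_def by blast
  then show ?thesis unfolding ssum_def by blast
 qed
qed

lemma complI:
 assumes "subspace W" "W \<subseteq> H" "0 \<in> F j" "\<And>x. x \<in> W ==> x \<in> F j ==> x = 0" "\<And>h. h \<in> H ==> \<exists>w\<in>W. \<exists>f\<in>F j. h = w + f"
 shows "compl H F j W"
proof -
 have "W Int F j = {0}" using assms(3,4) subspace_0[OF assms(1)] by auto
 moreover have "H \<subseteq> ssum W (F j)" using assms(5) unfolding ssum_def by blast
 ultimately show ?thesis unfolding compl_def using assms(1,2) by simp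
qed

lemma subspace_addl: "subspace W ==> subspace (addl W x)"
 unfolding subspace_def addl_def
proof (intro conjI ballI allI, goal_cases)
 case 1
 then show ?case by (auto intro!: exI[of _ 0])
next
 case (2 u v)
 then obtain w c w' c' where "u = w + c *s x" "v = w' + c' *s x" "w \<in> W" "w' \<in> W" by auto
 then have "u + v = (w + w') + (c + c') *s x" "w + w' \<in> W" using 2 by (auto simp: scale_left_distrib)
 then show ?case by blast
next
 case (3 k u)
 then obtain w c where "u = w + c *s x" "w \<in> W" by auto
 then have "k *s u = k *s w + (k * c) *s x" "k *s w \<in> W" using 3 by (auto simp: scale_right_distrib)
 then show ?case by blast
qed

lemma subspace_ssum: "subspace A ==> subspace B ==> subspace (ssum A B)"
 using subspace_sums[of A B] by (simp add: ssum_def)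

lemma addl_mono: "W \<subseteq> addl W x"
proof
 fix w assume "w \<in> W"
 then have "w + 0 *s x \<in> addl W x" unfolding addl_def by blast
 then show "w \<in> addl W x" by simp
qed

lemma addl_sub: "subspace H ==> W \<subseteq> H ==> x \<in> H ==> addl W x \<subseteq> H"
 unfolding addl_def by (auto intro: subspace_add subspace_scale)

lemma ssum_left: "0 \<in> B ==> A \<subseteq> ssum A B"
proof
 fix a assume "0 \<in> B" "a \<in> A"
 then have "a + 0 \<in> ssum A B" unfolding ssum_def by blast
 then show "a \<in> ssum A B" by simp
qed

lemma ssum_right: "0 \<in> A ==> B \<subseteq> ssum A B"
proof
 fix b assume "0 \<in> A" "b \<in> B"
 then have "0 + b \<in> ssum A B" unfolding ssum_def by blast
 then show "b \<in> ssum A B" by simp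
qed

lemma ssum_sub: "subspace H ==> A \<subseteq> H ==> B \<subseteq> H ==> ssum A B \<subseteq> H"
 unfolding ssum_def by (auto intro: subspace_add)

lemma flagged_subspace: "flagged H F N ==> j <= N ==> subspace (F j)"
proof (induction j)
 case 0
 then show ?case by (simp add: flagged_def)
next
 case (Suc j)
 then obtain y where "F (Suc j) = addl (F j) y" by (meson flagged_step Suc_le_lessD)
 then show ?case using Suc subspace_addl by simp
qed

lemma flagged_mono: "flagged H F N ==> i <= j ==> j <= N ==> F i \<subseteq> F j"
proof (induction j)
 case (Suc j)
 show ?case
 proof (cases "i = Suc j")
  case False
  then have "F i \<subseteq> F j" using Suc by auto
  moreover obtain y where "F (Suc j) = addl (F j) y" using Suc.prems by (meson flagged_step Suc_le_lessD)
  ultimately show ?thesis using addl_mono[of "F j" y] by auto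
 qed simp
qed simp

lemma flagged_strict:
 assumes F: "flagged H F N" and "i < j" "j <= N"
 shows "\<exists>y\<in>F j. y \<notin> F i"
proof -
 have "i < N" using assms(2,3) by simp
 then obtain y where y: "y \<notin> F i" "F (Suc i) = addl (F i) y" using flagged_step[OF F] by blast
 have "0 \<in> F i" using flagged_subspace[OF F, of i] assms subspace_0 by auto
 then have "0 + 1 *s y \<in> F (Suc i)" unfolding y(2) addl_def by blast
 then have "y \<in> F (Suc i)" by simp
 then show ?thesis using y(1) flagged_mono[OF F, of "Suc i" j] assms by auto
qed

lemma flagged_H: "flagged H F N ==> subspace H" "flagged H F N ==> j <= N ==> F j \<subseteq> H"
 using flagged_subspace[of H F N N] flagged_mono[of H F N j N] by (auto simp: flagged_def)

lemma finite_H: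
 assumes "flagged H F N"
 shows "finite H"
proof -
 have "finite (F j)" if "j <= N" for j
  using that
 proof (induction j)
  case 0
  then show ?case using assms by (simp add: flagged_def)
 next
  case (Suc j)
  then obtain y where "F (Suc j) = addl (F j) y" using assms by (meson flagged_step Suc_le_lessD)
  moreover have "addl (F j) y = (%(w, c). w + c *s y) ` (F j \<times> UNIV)" by (auto simp: addl_def)
  ultimately show ?case using Suc fin_field by simp
 qed
 then show ?thesis using assms unfolding flagged_def by blast
qed

lemma compl_antitone:
 assumes F: "flagged H F N" and W: "compl H F i W" and W': "compl H F j W'" and ij: "i <= j" "j <= N" and sub: "W \<subseteq> W'"
 shows "W = W'"
proof
 show "W' \<subseteq> W"
 proof
  fix w assume w: "w \<in> W'"
  then have "w \<in> H" using complD(2)[OF W'] by (rule subsetD[rotated])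
  from complD(4)[OF W this] obtain u f where u: "u \<in> W" "f \<in> F i" "w = u + f" by (elim bexE)
  have "w - u \<in> W'" using subspace_diff[OF complD(1)[OF W'] w] u(1) sub by (simp add: subsetD)
  then have "f \<in> W'" using u(3) by simp
  moreover have "f \<in> F j" using u(2) flagged_mono[OF F ij] by (rule subsetD[rotated])
  ultimately have "f = 0" by (rule complD(3)[OF W'])
  then show "w \<in> W" using u by simp
 qed
qed (rule sub)

lemma compl_unique:
 assumes F: "flagged H F N" and W: "compl H F i W" "compl H F j W" and N: "i <= N" "j <= N"
 shows "i = j"
proof -
 have False if W: "compl H F i W" "compl H F j W" and ij: "i < j" "j <= N" for i j
 proof -
  obtain y where y: "y \<in> F j" "y \<notin> F i" using flagged_strict[OF F ij] by (elim bexE)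
  have "y \<in> H" using y(1) flagged_H(2)[OF F ij(2)] by (rule subsetD[rotated])
  from complD(4)[OF W(1) this] obtain w f where w: "w \<in> W" "f \<in> F i" "y = w + f" by (elim bexE)
  have "f \<in> F j" using w(2) flagged_mono[OF F less_imp_le[OF ij(1)] ij(2)] by (rule subsetD[rotated])
  then have "y - f \<in> F j" by (rule subspace_diff[OF flagged_subspace[OF F ij(2)] y(1)])
  then have "w \<in> F j" using w(3) by simp
  then have "w = 0" by (rule complD(3)[OF W(2) w(1)])
  then show False using w y by simp
 qed
 then show ?thesis using assms nat_neq_iff by metis
qed

lemma compl_less:
 assumes F: "flagged H F N" and W: "compl H F i W" and W': "compl H F j W'" and N: "i <= N" "j <= N" and sub: "W \<subset> W'"
 shows "j < i"
proof (rule ccontr)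
 assume "\<not> j < i"
 then have "W = W'" using sub by (intro compl_antitone[OF F W W' _ N(2)]) auto
 then show False using sub by auto
qed

text \<open>The space \<open>W + F j\<close> has codimension one, because \<open>F (Suc j)\<close>
  is \<open>F j\<close> with one vector added; any vector outside it can take over the missing
  direction.\<close>

lemma compl_addl:
 assumes F: "flagged H F N" and W: "compl H F (Suc j) W" and j: "Suc j <= N" and x: "x \<in> H" "x \<notin> ssum W (F j)"
 shows "compl H F j (addl W x)"
proof -
 have sH: "subspace H" by (rule flagged_H(1)[OF F])
 have sF: "subspace (F j)" using flagged_subspace[OF F] j by simp
 have FF: "F j \<subseteq> F (Suc j)" using flagged_mono[OF F, of j "Suc j"] j by simp
 note sW = complD[OF W]
 obtain y where y: "F (Suc j) = addl (F j) y" using flagged_step[OF F, of j] j by auto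
 have dec: "\<exists>w f c. h = w + (f + c *s y) & w \<in> W & f \<in> F j" if hH: "h \<in> H" for h
 proof -
  obtain w g where wg: "w \<in> W" "g \<in> F (Suc j)" "h = w + g" using sW(4)[OF hH] by (elim bexE)
  then obtain f c where "g = f + c *s y" "f \<in> F j" unfolding y addl_def by auto
  then show ?thesis using wg by metis
 qed
 obtain w f c where xw: "x = w + (f + c *s y)" "w \<in> W" "f \<in> F j" using dec[OF x(1)] by (elim exE conjE)
 have c: "c ~= 0"
 proof
  assume "c = 0"
  then have "x = w + f" using xw by simp
  then show False using x(2) xw unfolding ssum_def by blast
 qed
 show ?thesis
 proof (rule complI[where F = F, OF subspace_addl[OF sW(1)] addl_sub[OF sH sW(2) x(1)] subspace_0[OF sF]])
  fix z assume "z \<in> addl W x" and zF: "z \<in> F j"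
  then obtain v d where z: "z = v + d *s x" "v \<in> W" unfolding addl_def by auto
  have "d = 0"
  proof (rule ccontr)
   assume d: "d ~= 0"
   have "d *s x = z - v" using z by simp
   then have "inverse d *s (d *s x) = inverse d *s (z - v)" by simp
   then have "x = (- inverse d) *s v + inverse d *s z" using d by (simp add: scale_right_diff_distrib)
   moreover have "(- inverse d) *s v \<in> W" "inverse d *s z \<in> F j"
    by (rule subspace_scale[OF sW(1) z(2)], rule subspace_scale[OF sF zF])
   ultimately show False using x(2) unfolding ssum_def by blast
  qed
  then have "z = v" using z by simp
  then show "z = 0" using z(2) zF FF by (intro sW(3)) auto
 next
  fix h assume "h \<in> H"
  from dec[OF this] obtain w' f' c' where h: "h = w' + (f' + c' *s y)" "w' \<in> W" "f' \<in> F j" by (elim exE conjE)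
  have "c *s y = x - w - f" using xw by simp
  then have "inverse c *s (c *s y) = inverse c *s (x - w - f)" by simp
  then have ye: "y = inverse c *s (x - w - f)" using c by simp
  let ?e = "c' * inverse c"
  have e: "h = ((w' - ?e *s w) + ?e *s x) + (f' - ?e *s f)"
   unfolding h(1) by (subst ye) (simp add: scale_right_diff_distrib algebra_simps)
  have "w' - ?e *s w \<in> W" by (rule subspace_diff[OF sW(1) h(2) subspace_scale[OF sW(1) xw(2)]])
  then have "(w' - ?e *s w) + ?e *s x \<in> addl W x" unfolding addl_def by blast
  moreover have "f' - ?e *s f \<in> F j" by (rule subspace_diff[OF sF h(3) subspace_scale[OF sF xw(3)]])
  ultimately show "\<exists>w\<in>addl W x. \<exists>f\<in>F j. h = w + f" using e by blast
 qed
qed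

text \<open>The hyperplane \<open>W\<close> is complementary to the line \<open>F 1\<close>, which
  all later members contain, so intersecting them with \<open>W\<close> lowers dimensions by one and
  keeps complements inside \<open>W\<close>. Thus the part below a hyperplane is an opposite
  geometry of smaller rank, on which the induction for fillings runs.\<close>

lemma hyper_compl:
 assumes F: "flagged H F (Suc N)" and W: "compl H F 1 W" and j: "j <= N"
 shows "compl W (%j. F (Suc j) Int W) j U \<longleftrightarrow> U \<subseteq> W & compl H F (Suc j) U"
proof
 note sW = complD[OF W]
 have sFj: "subspace (F (Suc j))" using flagged_subspace[OF F] j by simp
 have F1: "F 1 \<subseteq> F (Suc j)" using flagged_mono[OF F, of 1 "Suc j"] j by simp
 assume A: "compl W (%j. F (Suc j) Int W) j U"
 note sU = complD[OF A]
 have "compl H F (Suc j) U"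
 proof (rule complI[where F = F, OF sU(1) subset_trans[OF sU(2) sW(2)] subspace_0[OF sFj]])
  show "x = 0" if "x \<in> U" "x \<in> F (Suc j)" for x using that sU(2) by (intro sU(3)) auto
  fix h assume "h \<in> H"
  from sW(4)[OF this] obtain w f where h: "w \<in> W" "f \<in> F 1" "h = w + f" by (elim bexE)
  from sU(4)[OF h(1)] obtain u g where u: "u \<in> U" "g \<in> F (Suc j) Int W" "w = u + g" by (elim bexE)
  have "g + f \<in> F (Suc j)" using u(2) h(2) F1 by (intro subspace_add[OF sFj]) auto
  moreover have "h = u + (g + f)" using h u by (simp add: add.assoc)
  ultimately show "\<exists>w\<in>U. \<exists>f\<in>F (Suc j). h = w + f" using u(1) by blast
 qed
 then show "U \<subseteq> W & compl H F (Suc j) U" using sU(2) by simp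
next
 note sW = complD[OF W]
 assume A: "U \<subseteq> W & compl H F (Suc j) U"
 then have UW: "U \<subseteq> W" by simp
 note sU = complD[OF conjunct2[OF A]]
 have sFj: "subspace (F (Suc j))" using flagged_subspace[OF F] j by simp
 show "compl W (%j. F (Suc j) Int W) j U"
 proof (rule complI[where F = "%j. F (Suc j) Int W", OF sU(1) UW])
  show "0 \<in> F (Suc j) Int W" using subspace_0[OF sFj] subspace_0[OF sW(1)] by simp
  show "x = 0" if "x \<in> U" "x \<in> F (Suc j) Int W" for x using that by (intro sU(3)) auto
  fix w assume w: "w \<in> W"
  then have "w \<in> H" using sW(2) by (rule subsetD[rotated])
  from sU(4)[OF this] obtain u f where u: "u \<in> U" "f \<in> F (Suc j)" "w = u + f" by (elim bexE)
  have "w - u \<in> W" using subspace_diff[OF sW(1) w] u(1) UW by (simp add: subsetD)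
  then have "f \<in> F (Suc j) Int W" using u by simp
  then show "\<exists>u\<in>U. \<exists>f\<in>F (Suc j) Int W. w = u + f" using u by blast
 qed
qed

lemma hyper_flagged:
 assumes F: "flagged H F (Suc N)" and W: "compl H F 1 W"
 shows "flagged W (%j. F (Suc j) Int W) N"
 unfolding flagged_def
proof (intro conjI allI impI)
 note sW = complD[OF W]
 have "0 \<in> F 1 Int W" using subspace_0[OF sW(1)] subspace_0[OF flagged_subspace[OF F, of 1]] by simp
 then show "F (Suc 0) Int W = {0}" using sW(3) by auto
 show "F (Suc N) Int W = W" using flagged_ends(2)[OF F] sW(2) by auto
 fix j assume j: "j < N"
 obtain y where y: "y \<notin> F (Suc j)" "F (Suc (Suc j)) = addl (F (Suc j)) y" using flagged_step[OF F, of "Suc j"] j by auto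
 have sFj: "subspace (F (Suc j))" using flagged_subspace[OF F] j by simp
 have "0 + 1 *s y \<in> F (Suc (Suc j))" unfolding y(2) addl_def using subspace_0[OF sFj] by blast
 then have "y \<in> H" using flagged_H(2)[OF F, of "Suc (Suc j)"] j by auto
 \<comment> \<open>The new direction \<open>y\<close> is moved into \<open>W\<close> by subtracting
   an element of \<open>F 1\<close>, which lies in every member from there on.\<close>
 from sW(4)[OF this] obtain w f where w: "w \<in> W" "f \<in> F 1" "y = w + f" by (elim bexE)
 have f: "f \<in> F (Suc j)" using w(2) flagged_mono[OF F, of 1 "Suc j"] j by auto
 have wn: "w \<notin> F (Suc j)" using w(3) y(1) subspace_add[OF sFj _ f] by auto
 have 1: "F (Suc (Suc j)) = addl (F (Suc j)) w"
 proof (intro equalityI subsetI)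
  fix z assume "z \<in> F (Suc (Suc j))"
  then obtain g c where z: "z = g + c *s y" "g \<in> F (Suc j)" unfolding y(2) addl_def by auto
  have "z = (g + c *s f) + c *s w" using z w(3) by (simp add: scale_right_distrib algebra_simps)
  moreover have "g + c *s f \<in> F (Suc j)" by (rule subspace_add[OF sFj z(2) subspace_scale[OF sFj f]])
  ultimately show "z \<in> addl (F (Suc j)) w" unfolding addl_def by blast
 next
  fix z assume "z \<in> addl (F (Suc j)) w"
  then obtain g c where z: "z = g + c *s w" "g \<in> F (Suc j)" unfolding addl_def by auto
  have "z = (g - c *s f) + c *s y" using z w(3) by (simp add: scale_right_distrib algebra_simps)
  moreover have "g - c *s f \<in> F (Suc j)" by (rule subspace_diff[OF sFj z(2) subspace_scale[OF sFj f]])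
  ultimately show "z \<in> F (Suc (Suc j))" unfolding y(2) addl_def by blast
 qed
 have 2: "addl (F (Suc j)) w Int W = addl (F (Suc j) Int W) w"
 proof (intro equalityI subsetI)
  fix z assume "z \<in> addl (F (Suc j)) w Int W"
  then obtain g c where z: "z = g + c *s w" "g \<in> F (Suc j)" "z \<in> W" unfolding addl_def by auto
  have "z - c *s w \<in> W" by (rule subspace_diff[OF sW(1) z(3) subspace_scale[OF sW(1) w(1)]])
  then have "g \<in> W" using z(1) by simp
  then show "z \<in> addl (F (Suc j) Int W) w" using z unfolding addl_def by blast
 next
  fix z assume "z \<in> addl (F (Suc j) Int W) w"
  then obtain g c where z: "z = g + c *s w" "g \<in> F (Suc j)" "g \<in> W" unfolding addl_def by auto
  have "z \<in> W" unfolding z(1) by (rule subspace_add[OF sW(1) z(3) subspace_scale[OF sW(1) w(1)]])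
  then show "z \<in> addl (F (Suc j)) w Int W" using z unfolding addl_def by blast
 qed
 show "\<exists>y. y \<notin> F (Suc j) Int W & F (Suc (Suc j)) Int W = addl (F (Suc j) Int W) y"
  using wn 1 2 by (intro exI[of _ w]) simp
qed

lemma hyper_opp:
 assumes F: "flagged H F (Suc N)" and W: "compl H F 1 W"
 shows "opp W (%j. F (Suc j) Int W) N = {U \<in> opp H F (Suc N). U \<subset> W}"
proof (intro equalityI subsetI)
 fix U assume "U \<in> opp W (%j. F (Suc j) Int W) N"
 then obtain j where j: "0 < j" "j < N" "U \<subseteq> W" "compl H F (Suc j) U"
  using hyper_compl[OF F W] unfolding opp_def by auto
 have "U ~= W" using compl_unique[OF F j(4), of 1] j W by auto
 then show "U \<in> {U \<in> opp H F (Suc N). U \<subset> W}" using j unfolding opp_def by auto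
next
 fix U assume "U \<in> {U \<in> opp H F (Suc N). U \<subset> W}"
 then obtain j where j: "0 < j" "j < Suc N" "U \<subset> W" "compl H F j U" unfolding opp_def by auto
 then have "1 < j" using compl_less[OF F j(4) W] by auto
 then obtain i where i: "j = Suc i" "0 < i" by (metis Suc_lessE One_nat_def)
 then have "compl W (%j. F (Suc j) Int W) i U" using j hyper_compl[OF F W, of i U] by auto
 then show "U \<in> opp W (%j. F (Suc j) Int W) N" using i j unfolding opp_def by auto
qed

lemma card_proper_subspace:
 assumes "finite H" "subspace H" "subspace A" "A \<subseteq> H" "A ~= H"
 shows "card A * card (UNIV :: 'a set) <= card H"
proof -
 obtain x where x: "x \<in> H" "x \<notin> A" using assms by auto
 let ?f = "%(a, c). a + c *s x"
 have "inj_on ?f (A \<times> UNIV)"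
 proof (rule inj_onI, clarify)
  fix a c a' c' assume a: "a \<in> A" "a' \<in> A" and e: "a + c *s x = a' + c' *s x"
  have "(c - c') *s x = a' - a" using e by (simp add: scale_left_diff_distrib algebra_simps)
  then have d: "(c - c') *s x \<in> A" using a assms(3) subspace_diff by simp
  have "c = c'"
  proof (rule ccontr)
   assume "c ~= c'"
   then have "x = inverse (c - c') *s ((c - c') *s x)" by simp
   then show False using x d assms(3) subspace_scale by metis
  qed
  then show "a = a' & c = c'" using e by simp
 qed
 then have "card (A \<times> (UNIV :: 'a set)) = card (?f ` (A \<times> UNIV))" by (simp add: card_image)
 also have "... <= card H"
  using assms x by (intro card_mono) (auto intro: subspace_add subspace_scale)
 finally show ?thesis by (simp add: card_cartesian_product)
qed

text \<open>A proper subspace has at most the size of \<open>H\<close> divided by the size of the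
  field, so fewer subspaces than field elements cannot cover \<open>H\<close>.\<close>

lemma generic_vector:
 assumes H: "finite H" "subspace H" and As: "finite As" "card As < card (UNIV :: 'a set)"
  and A: "\<And>A. A \<in> As ==> subspace A & A \<subseteq> H & A ~= H"
 shows "\<exists>x\<in>H. \<forall>A\<in>As. x \<notin> A"
proof (rule ccontr)
 let ?q = "card (UNIV :: 'a set)"
 assume "\<not> ?thesis"
 then have "H \<subseteq> \<Union>As" by auto
 then have "card H <= card (\<Union>As)" using A As H by (intro card_mono) (auto intro: finite_subset)
 also have "... <= (\<Sum>A\<in>As. card A)" by (rule card_Union_le_sum_card)
 finally have "card H * ?q <= (\<Sum>A\<in>As. card A) * ?q" by simp
 also have "... = (\<Sum>A\<in>As. card A * ?q)" by (simp add: sum_distrib_right)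
 also have "... <= (\<Sum>A\<in>As. card H)" using A H by (intro sum_mono card_proper_subspace) auto
 finally have "card H * ?q <= card As * card H" by simp
 moreover have "card H > 0" using H subspace_0 by (auto simp: card_gt_0_iff)
 ultimately show False using As(2) by simp
qed

end

text \<open>In rank \<open>N + 1\<close> a cycle of length \<open>m\<close> involves at most
  \<open>m\<close> hyperplanes, and filling their links costs \<open>m * fill_size N m\<close>. The
  cycle that remains has length at most \<open>m + m * fill_size N m\<close>, and coning it
  multiplies the length by at most \<open>N + 1\<close>.\<close>

primrec fill_size :: "nat => nat => nat" where
 "fill_size 0 m = 0"
| "fill_size (Suc N) m = m * fill_size N m + Suc N * (m + m * fill_size N m)"

text \<open>The vector defining the cone has to avoid one subspace for each vertex of the remaining
  cycle and one for the zero space, at every rank of the induction.\<close>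

primrec fill_field :: "nat => nat => nat" where
 "fill_field 0 m = 0"
| "fill_field (Suc N) m = fill_field N m + Suc N * (m + m * fill_size N m) + 1"

lemma sum_list_le_length: "(\<And>x. x \<in> set xs ==> f x <= (k::nat)) ==> sum_list (map f xs) <= length xs * k"
 by (induction xs) (auto intro: add_mono)

context finite_field_space
begin

lemma flagsD:
 assumes "s \<in> flags X"
 shows "finite s" "s \<subseteq> X" "\<And>U V. U \<in> s ==> V \<in> s ==> U \<subseteq> V \<or> V \<subseteq> U"
 using assms unfolding flags_def by simp_all

lemma oppE:
 assumes "W \<in> opp H F N"
 obtains j where "0 < j" "j < N" "compl H F j W"
 using assms unfolding opp_def by auto

lemma zero_compl:
 assumes "flagged H F N"
 shows "compl H F N {0}"
proof (rule complI[where F = F])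
 show "subspace {0}" by (simp add: subspace_def)
 show "{0} \<subseteq> H" "0 \<in> F N" using subspace_0[OF flagged_H(1)[OF assms]] flagged_ends(2)[OF assms] by auto
 show "\<exists>w\<in>{0}. \<exists>f\<in>F N. h = w + f" if "h \<in> H" for h using that flagged_ends(2)[OF assms] by simp
qed simp

text \<open>If \<open>W\<close> is complementary to \<open>F (Suc j)\<close>, then
  \<open>W + F j\<close> is proper, since otherwise \<open>W\<close> would have two codimensions; a
  generic vector avoids these spaces simultaneously.\<close>

lemma generic_for_cone:
 assumes F: "flagged H F (Suc N)" and Ws: "finite Ws" "Ws \<subseteq> opp H F (Suc N)" and q: "card Ws + 1 < card (UNIV :: 'a set)"
 shows "\<exists>x\<in>H. \<forall>W\<in>insert {0} Ws. \<forall>j\<le>N. compl H F (Suc j) W --> x \<notin> ssum W (F j)"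
proof -
 define ty where "ty W = (SOME j. j <= N & compl H F (Suc j) W)" for W
 have ex: "\<exists>j\<le>N. compl H F (Suc j) W" if "W \<in> insert {0} Ws" for W
 proof (cases "W = {0}")
  case True
  then show ?thesis using zero_compl[OF F] by auto
 next
  case False
  then have "W \<in> opp H F (Suc N)" using that Ws by auto
  then obtain j where "0 < j" "j < Suc N" "compl H F j W" by (rule oppE)
  then show ?thesis by (intro exI[of _ "j - 1"]) auto
 qed
 have ty: "ty W <= N & compl H F (Suc (ty W)) W" if "W \<in> insert {0} Ws" for W
  unfolding ty_def by (rule someI_ex) (use ex[OF that] in blast)
 define As where "As = (%W. ssum W (F (ty W))) ` insert {0} Ws"
 have sH: "subspace H" by (rule flagged_H(1)[OF F])
 have "\<exists>x\<in>H. \<forall>A\<in>As. x \<notin> A"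
 proof (rule generic_vector[OF finite_H[OF F] sH])
  show "finite As" using Ws by (simp add: As_def)
  have "card As <= card (insert {0} Ws)" unfolding As_def using Ws by (intro card_image_le) auto
  also have "... <= card Ws + 1" by (simp add: card_insert_if Ws)
  finally show "card As < card (UNIV :: 'a set)" using q by simp
  fix A assume "A \<in> As"
  then obtain W where W: "W \<in> insert {0} Ws" "A = ssum W (F (ty W))" unfolding As_def by auto
  note t = ty[OF W(1)]
  note c = complD[OF conjunct2[OF t]]
  have sF: "subspace (F (ty W))" using flagged_subspace[OF F] t by simp
  have FF: "F (ty W) \<subseteq> F (Suc (ty W))" using flagged_mono[OF F, of "ty W" "Suc (ty W)"] t by simp
  have "subspace A" unfolding W(2) by (rule subspace_ssum[OF c(1) sF])
  moreover have "A \<subseteq> H" unfolding W(2) using ssum_sub[OF sH c(2)] flagged_H(2)[OF F, of "ty W"] t by simp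
  moreover have "A ~= H"
  proof
   assume "A = H"
   then have HA: "H = ssum W (F (ty W))" using W(2) by simp
   have "compl H F (ty W) W"
   proof (rule complI[where F = F, OF c(1) c(2) subspace_0[OF sF]])
    show "y = 0" if "y \<in> W" "y \<in> F (ty W)" for y using that FF by (intro c(3)) auto
    show "\<exists>w\<in>W. \<exists>f\<in>F (ty W). h = w + f" if "h \<in> H" for h
     using that unfolding HA ssum_def by blast
   qed
   then show False using compl_unique[OF F _ conjunct2[OF t], of "ty W"] t by simp
  qed
  ultimately show "subspace A & A \<subseteq> H & A ~= H" by simp
 qed
 then obtain x where x: "x \<in> H" "\<forall>A\<in>As. x \<notin> A" by auto
 have "x \<notin> ssum W (F j)" if W: "W \<in> insert {0} Ws" and j: "j <= N" "compl H F (Suc j) W" for W j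
 proof -
  have "Suc j = Suc (ty W)" using compl_unique[OF F j(2) conjunct2[OF ty[OF W]]] ty[OF W] j by simp
  then show ?thesis using x(2) W unfolding As_def by auto
 qed
 then show ?thesis using x(1) by blast
qed

text \<open>Adding a generic vector \<open>x\<close> to a space opposite to \<open>F (Suc j)\<close>
  gives one opposite to \<open>F j\<close>, which belongs to the complex as long as
  \<open>j > 0\<close>; this is why hyperplanes are excluded. The prism over a flag ends in a cone
  whose apex is the line through \<open>x\<close>, the image of the zero space.\<close>

lemma cone_fill:
 assumes F: "flagged H F (Suc N)" and N: "1 <= N"
  and z: "\<And>s. s \<in> set z ==> s \<in> flags (opp H F (Suc N)) & card s = k & (\<forall>W\<in>s. \<not> compl H F 1 W)"
  and cyc: "\<And>c. ev (cobd c) z = 0" and kN: "k <= N" and q: "Suc N * length z + 1 < card (UNIV :: 'a set)"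
 shows "\<exists>y. (\<forall>s\<in>set y. s \<in> flags (opp H F (Suc N)) & card s = Suc k) & length y <= Suc N * length z &
  (\<forall>c. ev (cobd c) y = ev c z)"
proof -
 let ?T = "opp H F (Suc N)"
 define Ws where "Ws = \<Union>(set z)"
 have fs: "finite s" "s \<subseteq> ?T" if "s \<in> set z" for s using flagsD[of s ?T] z[OF that] by auto
 have fW: "finite Ws" unfolding Ws_def using fs by auto
 have WT: "Ws \<subseteq> ?T" unfolding Ws_def using fs by auto
 have cW: "card Ws <= Suc N * length z"
 proof -
  have "card Ws <= (\<Sum>s\<in>set z. card s)" unfolding Ws_def by (rule card_Union_le_sum_card)
  also have "... <= (\<Sum>s\<in>set z. Suc N)" using z kN by (intro sum_mono) auto
  also have "... = Suc N * card (set z)" by simp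
  also have "... <= Suc N * length z" by (rule mult_le_mono2[OF card_length])
  finally show ?thesis .
 qed
 then obtain x where x: "x \<in> H" and gen: "\<And>W j. W \<in> insert {0} Ws ==> j <= N ==> compl H F (Suc j) W ==> x \<notin> ssum W (F j)"
  using generic_for_cone[OF F fW WT] q by force
 define u where "u W = addl W x" for W
 have tyj: "\<exists>j. 1 <= j & j <= N & compl H F (Suc j) W & compl H F j (u W)" if s: "s \<in> set z" and W: "W \<in> insert {0} s" for s W
 proof -
  have Wb: "W \<in> insert {0} Ws" using s W unfolding Ws_def by auto
  have "\<exists>j. 1 <= j & j <= N & compl H F (Suc j) W"
  proof (cases "W = {0}")
   case True
   then show ?thesis using zero_compl[OF F] N by auto
  next
   case False
   then have Ws: "W \<in> s" using W by simp
   then have "W \<in> ?T" using fs(2)[OF s] by auto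
   then obtain j where j: "0 < j" "j < Suc N" "compl H F j W" by (rule oppE)
   have "j ~= 1" using z[OF s] Ws j(3) by auto
   then obtain i where "j = Suc i" "1 <= i" using j(1) by (cases j) auto
   then show ?thesis using j by auto
  qed
  then obtain j where j: "1 <= j" "j <= N" "compl H F (Suc j) W" by auto
  have "compl H F j (u W)" unfolding u_def using j gen[OF Wb j(2,3)] by (intro compl_addl[OF F j(3) _ x]) auto
  then show ?thesis using j by blast
 qed
 have xn: "x \<notin> W" if s: "s \<in> set z" and W: "W \<in> insert {0} s" for s W
 proof -
  obtain j where j: "1 <= j" "j <= N" "compl H F (Suc j) W" using tyj[OF s W] by auto
  have "W \<subseteq> ssum W (F j)" using subspace_0[OF flagged_subspace[OF F, of j]] j by (intro ssum_left) simp
  moreover have "x \<notin> ssum W (F j)" using gen[OF _ j(2,3)] s W unfolding Ws_def by blast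
  ultimately show ?thesis by auto
 qed
 have sub: "subspace W" if s: "s \<in> set z" and W: "W \<in> insert {0} s" for s W
  using tyj[OF s W] complD(1) by blast
 have um: "u A \<subseteq> u B" if "A \<subseteq> B" for A B using that unfolding u_def addl_def by blast
 have ux: "W \<subseteq> u W" for W unfolding u_def by (rule addl_mono)
 have chain: "U \<subseteq> V \<or> V \<subseteq> U" if s: "s \<in> set z" and "U \<in> insert {0} s" "V \<in> insert {0} s" for s U V
 proof -
  have "{0} \<subseteq> W" if "W \<in> insert {0} s" for W using subspace_0[OF sub[OF s that]] by simp
  moreover have "U \<subseteq> V \<or> V \<subseteq> U" if "U \<in> s" "V \<in> s" using flagsD(3)[of s ?T U V] z[OF s] that by simp
  ultimately show ?thesis using that by blast
 qed
 have zn: "{0} \<notin> s" if s: "s \<in> set z" for s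
 proof
  assume "{0} \<in> s"
  then have "{0} \<in> ?T" using fs(2)[OF s] by auto
  then obtain j where "0 < j" "j < Suc N" "compl H F j {0}" by (rule oppE)
  then show False using compl_unique[OF F _ zero_compl[OF F], of j] by simp
 qed
 \<comment> \<open>Strictly nested members have different codimensions, and \<open>u\<close> lowers
   each codimension by one.\<close>
 have inj: "inj_on u (insert {0} s)" if s: "s \<in> set z" for s
 proof (rule inj_onI)
  have ne: "u U ~= u V" if UV: "U \<in> insert {0} s" "V \<in> insert {0} s" "U \<subset> V" for U V
  proof
   assume e: "u U = u V"
   obtain i where i: "1 <= i" "i <= N" "compl H F (Suc i) U" "compl H F i (u U)" using tyj[OF s UV(1)] by auto
   obtain j where j: "1 <= j" "j <= N" "compl H F (Suc j) V" "compl H F j (u V)" using tyj[OF s UV(2)] by auto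
   have "Suc j < Suc i" using compl_less[OF F i(3) j(3) _ _ UV(3)] i j by simp
   moreover have "i = j" using compl_unique[OF F i(4)] j(4) e i j by simp
   ultimately show False by simp
  qed
  fix U V assume UV: "U \<in> insert {0} s" "V \<in> insert {0} s" "u U = u V"
  show "U = V"
  proof (rule ccontr)
   assume "U ~= V"
   then have "U \<subset> V \<or> V \<subset> U" using chain[OF s UV(1,2)] by auto
   then show False using ne[of U V] ne[of V U] UV by auto
  qed
 qed
 have new: "u W \<notin> s" if s: "s \<in> set z" and W: "W \<in> insert {0} s" for s W
 proof
  assume uW: "u W \<in> s"
  have "0 + 1 *s x \<in> u W" unfolding u_def addl_def using subspace_0[OF sub[OF s W]] by blast
  then show False using xn[OF s, of "u W"] uW by simp
 qed
 have b0: "{0} \<subseteq> W" if s: "s \<in> set z" and "W \<in> s" for s W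
  using subspace_0[OF sub[OF s, of W]] that by simp
 have pf: "prism u {0} s V \<in> flags ?T & card (prism u {0} s V) = Suc k" if s: "s \<in> set z" and V: "V \<in> insert {0} s" for s V
 proof
  let ?A = "{W\<in>s. W \<subseteq> V}" and ?B = "{W\<in>insert {0} s. V \<subseteq> W}"
  have fin: "finite ?A" "finite ?B" using fs(1)[OF s] by auto
  have P: "prism u {0} s V = ?A Un u ` ?B" by (simp add: prism_def)
  have uT: "u W \<in> ?T" if W: "W \<in> insert {0} s" for W
  proof -
   obtain i where "1 <= i" "i <= N" "compl H F i (u W)" using tyj[OF s W] by auto
   then show ?thesis unfolding opp_def by (intro CollectI exI[of _ i]) auto
  qed
  have Ps: "prism u {0} s V \<subseteq> ?T" unfolding P
  proof (intro Un_least image_subsetI)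
   show "?A \<subseteq> ?T" using fs(2)[OF s] by (auto dest: subsetD)
   show "u W \<in> ?T" if "W \<in> ?B" for W using uT[of W] that by simp
  qed
  have Pc: "X \<subseteq> Y \<or> Y \<subseteq> X" if XY: "X \<in> prism u {0} s V" "Y \<in> prism u {0} s V" for X Y
  proof -
   have AB: "W \<subseteq> u W'" if "W \<in> ?A" "W' \<in> ?B" for W W' using that ux[of W'] by blast
   have AA: "W \<subseteq> W' \<or> W' \<subseteq> W" if "W \<in> ?A" "W' \<in> ?A" for W W' using chain[OF s, of W W'] that by simp
   have BB: "u W \<subseteq> u W' \<or> u W' \<subseteq> u W" if "W \<in> ?B" "W' \<in> ?B" for W W'
    using chain[OF s, of W W'] that um[of W W'] um[of W' W] by auto
   show ?thesis using XY unfolding P using AA AB BB by (elim UnE imageE) auto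
  qed
  show "prism u {0} s V \<in> flags ?T" unfolding flags_def
  proof (intro CollectI conjI ballI)
   show "finite (prism u {0} s V)" unfolding P using fin by simp
  qed (use Ps Pc in auto)
  have "?A Int u ` ?B = {}" using new[OF s] by auto
  then have "card (prism u {0} s V) = card ?A + card (u ` ?B)" unfolding P using fin by (intro card_Un_disjoint) auto
  also have "card (u ` ?B) = card ?B" using inj[OF s] by (intro card_image) (auto intro: inj_on_subset)
  also have "?B = insert V {W\<in>s. V \<subset> W}" using V b0[OF s] by auto
  also have "card (insert V {W\<in>s. V \<subset> W}) = Suc (card {W\<in>s. V \<subset> W})" using fs(1)[OF s] by (subst card_insert_disjoint) auto
  also have "card ?A + Suc (card {W\<in>s. V \<subset> W}) = Suc (card (?A Un {W\<in>s. V \<subset> W}))"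
   using fs(1)[OF s] by (subst card_Un_disjoint) auto
  also have "?A Un {W\<in>s. V \<subset> W} = s" using chain[OF s _ V] by blast
  finally show "card (prism u {0} s V) = Suc k" using z[OF s] by simp
 qed
 define lst where "lst s = (SOME xs. distinct xs & set xs = insert {0::'b} s)" for s
 have lst: "distinct (lst s)" "set (lst s) = insert {0} s" if "s \<in> set z" for s
 proof -
  have "\<exists>xs. distinct xs & set xs = insert {0} s" using finite_distinct_list[of "insert {0} s"] fs(1)[OF that] by auto
  then have "distinct (lst s) & set (lst s) = insert {0} s" unfolding lst_def by (rule someI_ex)
  then show "distinct (lst s)" "set (lst s) = insert {0} s" by auto
 qed
 define P where "P s = map (prism u {0} s) (lst s)" for s
 have evP: "ev c (P s) = (\<Sum>V\<in>insert {0} s. c (prism u {0} s V))" if "s \<in> set z" for c s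
  unfolding P_def ev_map using ev_distinct[OF lst(1)[OF that]] lst(2)[OF that] by simp
 show ?thesis
 proof (intro exI[of _ "concat (map P z)"] conjI ballI allI)
  fix t assume "t \<in> set (concat (map P z))"
  then obtain s where s: "s \<in> set z" "t \<in> set (P s)" by auto
  then have "t \<in> prism u {0} s ` insert {0} s" unfolding P_def set_map lst(2)[OF s(1)] by simp
  then obtain V where V: "t = prism u {0} s V" "V \<in> insert {0} s" by (rule imageE)
  show "t \<in> flags ?T" "card t = Suc k" using pf[OF s(1) V(2)] unfolding V(1) by simp_all
 next
  have "length (P s) <= Suc N" if "s \<in> set z" for s
  proof -
   have "length (P s) = card (insert {0} s)" unfolding P_def using distinct_card[OF lst(1)[OF that]] lst(2)[OF that] by simp
   also have "... <= Suc (card s)" by (simp add: card_insert_if fs(1)[OF that])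
   finally show ?thesis using z[OF that] kN by simp
  qed
  then have "sum_list (map (%s. length (P s)) z) <= length z * Suc N" by (rule sum_list_le_length)
  then show "length (concat (map P z)) <= Suc N * length z" by (simp add: length_concat comp_def mult.commute)
 next
  fix c :: "'b set set => bit"
  \<comment> \<open>\<open>cobd D s\<close> collects the prisms over the facets of \<open>s\<close>,
    so it evaluates to zero on the cycle \<open>z\<close>.\<close>
  define D where "D t = (\<Sum>V\<in>insert {0} t. c (prism u {0} t V))" for t
  have "ev (cobd c) (concat (map P z)) = ev (%s. ev (cobd c) (P s)) z"
   unfolding ev_concat by (simp only: ev_def map_map comp_def)
  also have "... = ev (%s. c s + cobd D s) z"
  proof (rule ev_cong)
   fix s assume s: "s \<in> set z"
   have "(\<Sum>V\<in>insert {0} s. cobd c (prism u {0} s V)) = c s + (\<Sum>W\<in>s. \<Sum>V\<in>insert {0} (s - {W}). c (prism u {0} (s - {W}) V))"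
    by (rule prism_boundary[OF fs(1)[OF s] chain[OF s] zn[OF s] b0[OF s] inj[OF s] new[OF s]])
   then show "ev (cobd c) (P s) = c s + cobd D s" unfolding evP[OF s] by (simp add: cobd_def D_def)
  qed
  also have "... = ev c z" by (simp add: ev_add cyc)
  finally show "ev (cobd c) (concat (map P z)) = ev c z" .
 qed
qed

lemma hyper_in_flag_unique:
 assumes F: "flagged H F (Suc N)" and s: "s \<in> flags X" and W: "W \<in> s" "compl H F 1 W" and V: "V \<in> s" "compl H F 1 V"
 shows "W = V"
proof -
 have "W \<subseteq> V \<or> V \<subseteq> W" by (rule flagsD(3)[OF s W(1) V(1)])
 then show ?thesis using compl_antitone[OF F W(2) V(2)] compl_antitone[OF F V(2) W(2)] by auto
qed

text \<open>Induction on the rank. A flag contains at most one hyperplane \<open>W\<close>, and the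
  flags of \<open>z\<close> through \<open>W\<close>, with \<open>W\<close> removed, form a cycle in
  the opposite geometry of \<open>W\<close>. Filling it there and adding \<open>W\<close> back gives
  \<open>y1\<close>, whose boundary differs from \<open>z\<close> by a cycle \<open>z2\<close>
  without hyperplanes, and \<open>z2\<close> is filled by a cone.\<close>

theorem flag_cycle_filling:
 assumes "flagged H F N" "k + 2 <= N"
  "\<And>s. s \<in> set z ==> s \<in> flags (opp H F N) & card s = k"
  "\<And>c. ev (cobd c) z = 0" "length z <= m" "fill_field N m < card (UNIV :: 'a set)"
 shows "\<exists>y. (\<forall>s\<in>set y. s \<in> flags (opp H F N) & card s = Suc k) & length y <= fill_size N m &
  (\<forall>c. ev (cobd c) y = ev c z)"
 using assms
proof (induction N arbitrary: H F k z)
 case 0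
 then show ?case by simp
next
 case (Suc N)
 note F = Suc.prems(1) and kN = Suc.prems(2) and z = Suc.prems(3) and cyc = Suc.prems(4) and len = Suc.prems(5) and q = Suc.prems(6)
 let ?T = "opp H F (Suc N)"
 let ?hyp = "%W. compl H F 1 W"
 define A where "A = {W. ?hyp W & (\<exists>s\<in>set z. W \<in> s)}"
 have fs: "finite s" "s \<subseteq> ?T" if "s \<in> set z" for s using flagsD[of s ?T] z[OF that] by auto
 have uni: "W = V" if "s \<in> set z" "W \<in> s" "?hyp W" "V \<in> s" "?hyp V" for s W V
  using hyper_in_flag_unique[OF F conjunct1[OF z[OF that(1)]] that(2-5)] .
 have Aeq: "A = (\<Union>s\<in>set z. {W\<in>s. ?hyp W})" unfolding A_def by auto
 have fA: "finite A" unfolding Aeq using fs(1) by auto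
 have cA: "card A <= m"
 proof -
  have one: "card {W\<in>s. ?hyp W} <= 1" if "s \<in> set z" for s
  proof (cases "{W\<in>s. ?hyp W} = {}")
   case False
   then obtain W where "W \<in> s" "?hyp W" by auto
   then have "{W\<in>s. ?hyp W} \<subseteq> {W}" using uni[OF that] by auto
   then have "card {W\<in>s. ?hyp W} <= card {W}" by (rule card_mono[rotated]) simp
   then show ?thesis by simp
  next
   case True
   then show ?thesis by (metis card.empty zero_le)
  qed
  have "card A <= (\<Sum>s\<in>set z. card {W\<in>s. ?hyp W})" unfolding Aeq by (rule card_UN_le) simp
  also have "... <= (\<Sum>s\<in>set z. 1)" by (rule sum_mono[OF one])
  also have "... <= length z" by (simp add: card_length)
  finally show ?thesis using len by simp
 qed
 obtain Hs where Hs: "set Hs = A" "distinct Hs" using finite_distinct_list[OF fA] by auto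
 have lHs: "length Hs <= m" using cA distinct_card[OF Hs(2)] Hs(1) by simp
 let ?F = "%W j. F (Suc j) Int W"
 let ?z = "%W. map (%s. s - {W}) (filter (%s. W \<in> s) z)"
 have oppW: "opp W (?F W) N = {U \<in> ?T. U \<subset> W}" if "?hyp W" for W by (rule hyper_opp[OF F that])
 have "\<exists>y. (\<forall>s\<in>set y. s \<in> flags (opp W (?F W) N) & card s = k) & length y <= fill_size N m &
  (\<forall>c. ev (cobd c) y = ev c (?z W))" if W: "W \<in> A" for W
 proof -
  have hW: "?hyp W" using W unfolding A_def by simp
  obtain s0 where "s0 \<in> set z" "W \<in> s0" using W unfolding A_def by auto
  then have "k > 0" using z[of s0] fs(1)[of s0] by (auto simp: card_gt_0_iff)
  then obtain k' where k': "k = Suc k'" using gr0_implies_Suc by blast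
  have "\<exists>y. (\<forall>s\<in>set y. s \<in> flags (opp W (?F W) N) & card s = Suc k') & length y <= fill_size N m &
   (\<forall>c. ev (cobd c) y = ev c (?z W))"
  proof (rule Suc.IH[OF hyper_flagged[OF F hW]])
   show "k' + 2 <= N" using kN k' by simp
   fix t assume "t \<in> set (?z W)"
   then obtain s where s: "s \<in> set z" "W \<in> s" "t = s - {W}" by auto
   have "U \<subset> W" if "U \<in> t" for U
   proof -
    have U: "U \<in> s" "U ~= W" using that s by auto
    then have UW: "U \<subseteq> W \<or> W \<subseteq> U" using flagsD(3)[of s ?T U W] z[OF s(1)] s(2) by simp
    have "\<not> W \<subset> U"
    proof
     assume WU: "W \<subset> U"
     have "U \<in> ?T" using U fs(2)[OF s(1)] by auto
     then obtain j where "0 < j" "j < Suc N" "compl H F j U" by (rule oppE)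
     then show False using compl_less[OF F hW _ _ _ WU, of j] by simp
    qed
    then show ?thesis using UW U by auto
   qed
   then have "t \<subseteq> opp W (?F W) N" unfolding oppW[OF hW] using s fs(2)[OF s(1)] by auto
   moreover have "\<forall>U\<in>t. \<forall>V\<in>t. U \<subseteq> V \<or> V \<subseteq> U" using flagsD(3)[of s ?T] z[OF s(1)] s(3) by simp
   ultimately show "t \<in> flags (opp W (?F W) N) & card t = k'"
    using s fs(1)[OF s(1)] z[OF s(1)] k' unfolding flags_def by simp
  next
   fix c :: "'b set set => bit"
   \<comment> \<open>A link of a cycle is a cycle: cochains of the link of \<open>W\<close> are
     tested on \<open>z\<close> after extension by zero to flags avoiding \<open>W\<close>.\<close>
   define c' where "c' t = (if W \<in> t then c (t - {W}) else 0)" for t :: "'b set set"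
   have "ev (cobd c) (?z W) = ev (%s. if W \<in> s then cobd c (s - {W}) else 0) z"
    by (simp add: ev_map ev_filter)
   also have "... = ev (cobd c') z"
   proof (rule ev_cong)
    fix s assume s: "s \<in> set z"
    show "(if W \<in> s then cobd c (s - {W}) else 0) = cobd c' s"
    proof (cases "W \<in> s")
     case True
     have "cobd c' s = c' (s - {W}) + (\<Sum>v\<in>s - {W}. c' (s - {v}))"
      unfolding cobd_def using sum.remove[OF fs(1)[OF s] True] by simp
     also have "(\<Sum>v\<in>s - {W}. c' (s - {v})) = (\<Sum>v\<in>s - {W}. c (s - {W} - {v}))"
     proof (rule sum.cong[OF refl])
      fix v assume "v \<in> s - {W}"
      moreover have "s - {v} - {W} = s - {W} - {v}" by auto
      ultimately show "c' (s - {v}) = c (s - {W} - {v})" unfolding c'_def using True by auto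
     qed
     finally show ?thesis using True by (simp add: c'_def cobd_def)
    next
     case False
     then show ?thesis by (simp add: cobd_def c'_def)
    qed
   qed
   finally show "ev (cobd c) (?z W) = 0" by (simp add: cyc)
  next
   show "length (?z W) <= m" using le_trans[OF length_filter_le len, of "%s. W \<in> s"] by simp
   show "fill_field N m < card (UNIV :: 'a set)" using q by simp
  qed
  then show ?thesis using k' by simp
 qed
 then have "\<forall>W\<in>A. \<exists>y. (\<forall>s\<in>set y. s \<in> flags (opp W (?F W) N) & card s = k) & length y <= fill_size N m &
  (\<forall>c. ev (cobd c) y = ev c (?z W))" by blast
 then obtain Y where "\<forall>W\<in>A. (\<forall>s\<in>set (Y W). s \<in> flags (opp W (?F W) N) & card s = k) & length (Y W) <= fill_size N m &
  (\<forall>c. ev (cobd c) (Y W) = ev c (?z W))" unfolding bchoice_iff by blast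
 then have Y1: "\<And>W s. W \<in> A ==> s \<in> set (Y W) ==> s \<in> flags (opp W (?F W) N) & card s = k"
  and Y2: "\<And>W. W \<in> A ==> length (Y W) <= fill_size N m" and Y3: "\<And>W c. W \<in> A ==> ev (cobd c) (Y W) = ev c (?z W)" by blast+
 have Yf: "finite t" "t \<subseteq> ?T" "W \<notin> t" "\<And>U. U \<in> t ==> U \<subset> W" "\<And>U V. U \<in> t ==> V \<in> t ==> U \<subseteq> V \<or> V \<subseteq> U"
  if W: "W \<in> A" and t: "t \<in> set (Y W)" for W t
 proof -
  have hW: "?hyp W" using W unfolding A_def by simp
  have fl: "t \<in> flags {U \<in> ?T. U \<subset> W}" using Y1[OF W t] unfolding oppW[OF hW] by simp
  note fd = flagsD[OF fl]
  show "finite t" "t \<subseteq> ?T" "W \<notin> t" using fd(1,2) by auto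
  show "U \<subset> W" if "U \<in> t" for U using fd(2) that by auto
  show "U \<subseteq> V \<or> V \<subseteq> U" if "U \<in> t" "V \<in> t" for U V by (rule fd(3)[OF that])
 qed
 define y1 where "y1 = concat (map (%W. map (insert W) (Y W)) Hs)"
 define z2 where "z2 = filter (%s. \<forall>W\<in>s. \<not> ?hyp W) z @ concat (map Y Hs)"
 have y1f: "s \<in> flags ?T & card s = Suc k" if s1: "s \<in> set y1" for s
 proof -
  obtain W t where Wt: "W \<in> A" "t \<in> set (Y W)" "s = insert W t" using s1 Hs(1) unfolding y1_def by auto
  have hW: "?hyp W" using Wt unfolding A_def by simp
  note Yt = Yf[OF Wt(1,2)]
  have "W \<in> ?T" unfolding opp_def using hW kN by auto
  then have "s \<subseteq> ?T" using Yt(2) Wt(3) by auto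
  moreover have "U \<subseteq> V \<or> V \<subseteq> U" if "U \<in> s" "V \<in> s" for U V
   using that Yt(4)[of U] Yt(4)[of V] Yt(5)[of U V] unfolding Wt(3) by auto
  ultimately show ?thesis using Yt(1,3) Wt(3) Y1[OF Wt(1,2)] unfolding flags_def by simp
 qed
 have z2f: "s \<in> flags ?T & card s = k & (\<forall>W\<in>s. \<not> ?hyp W)" if s: "s \<in> set z2" for s
 proof (cases "s \<in> set (concat (map Y Hs))")
  case True
  then obtain W where W: "W \<in> A" "s \<in> set (Y W)" using Hs(1) by auto
  have hW: "?hyp W" using W unfolding A_def by simp
  note Yt = Yf[OF W]
  have "\<not> ?hyp U" if "U \<in> s" for U
  proof
   assume "?hyp U"
   then show False using compl_less[OF F _ hW _ _ Yt(4)[OF that], of 1] by simp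
  qed
  then show ?thesis using Yt(1,2,5) Y1[OF W] unfolding flags_def by simp
 next
  case False
  then have "s \<in> set z" "\<forall>W\<in>s. \<not> ?hyp W" using s unfolding z2_def by auto
  then show ?thesis using z by simp
 qed
 have key: "ev (cobd c) y1 = ev c z2 + ev c z" for c :: "'b set set => bit"
 proof -
  have w: "ev (cobd c) (map (insert W) (Y W)) = ev c (Y W) + ev c (filter (%s. W \<in> s) z)" if W: "W \<in> A" for W and c :: "'b set set => bit"
  proof -
   define d where "d t = c (insert W t)" for t
   have "ev (cobd c) (map (insert W) (Y W)) = ev (%t. c t + cobd d t) (Y W)"
    unfolding ev_map
   proof (rule ev_cong)
    fix t assume t: "t \<in> set (Y W)"
    note Yt = Yf[OF W t]
    have "cobd c (insert W t) = c (insert W t - {W}) + (\<Sum>v\<in>t. c (insert W t - {v}))"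
     unfolding cobd_def using Yt by simp
    also have "(\<Sum>v\<in>t. c (insert W t - {v})) = (\<Sum>v\<in>t. d (t - {v}))"
    proof (rule sum.cong[OF refl])
     fix v assume "v \<in> t"
     then have "insert W t - {v} = insert W (t - {v})" using Yt(3) by auto
     then show "c (insert W t - {v}) = d (t - {v})" by (simp add: d_def)
    qed
    finally show "cobd c (insert W t) = c t + cobd d t" using Yt(3) by (simp add: cobd_def)
   qed
   also have "... = ev c (Y W) + ev d (?z W)" using Y3[OF W] by (simp add: ev_add)
   also have "ev d (?z W) = ev c (filter (%s. W \<in> s) z)"
    unfolding ev_map by (rule ev_cong) (auto simp: d_def insert_absorb)
   finally show ?thesis .
  qed
  have "ev (cobd c) y1 = sum_list (map (%W. ev (cobd c) (map (insert W) (Y W))) Hs)"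
   unfolding y1_def by (simp add: ev_concat comp_def)
  also have "... = sum_list (map (%W. ev c (Y W) + ev c (filter (%s. W \<in> s) z)) Hs)"
   using w Hs(1) by (intro arg_cong[of _ _ sum_list] map_cong) auto
  also have "... = ev c (concat (map Y Hs)) + (\<Sum>W\<in>A. ev c (filter (%s. W \<in> s) z))"
   unfolding sum_list_addf using Hs by (simp add: ev_concat comp_def sum.distinct_set_conv_list[symmetric])
  also have "(\<Sum>W\<in>A. ev c (filter (%s. W \<in> s) z)) = ev (%s. \<Sum>W\<in>A. if W \<in> s then c s else 0) z"
   unfolding ev_filter by (rule ev_sum[OF fA, symmetric])
  also have "... = ev (%s. (if \<forall>W\<in>s. \<not> ?hyp W then c s else 0) + c s) z"
  proof (rule ev_cong)
   fix s assume s: "s \<in> set z"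
   show "(\<Sum>W\<in>A. if W \<in> s then c s else 0) = (if \<forall>W\<in>s. \<not> ?hyp W then c s else 0) + c s"
   proof (cases "\<forall>W\<in>s. \<not> ?hyp W")
    case True
    then have "(\<Sum>W\<in>A. if W \<in> s then c s else 0) = 0" unfolding A_def by (intro sum.neutral) auto
    then show ?thesis using True by simp
   next
    case False
    then obtain W0 where W0: "W0 \<in> s" "?hyp W0" by auto
    have "(\<Sum>W\<in>A. if W \<in> s then c s else 0) = (\<Sum>W\<in>{W0}. c s)"
    proof (rule sum.mono_neutral_cong_right[OF fA])
     show "{W0} \<subseteq> A" using W0 s unfolding A_def by auto
     show "\<forall>W\<in>A - {W0}. (if W \<in> s then c s else 0) = 0" using uni[OF s _ _ W0] unfolding A_def by auto
    qed (use W0 in auto)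
    also have "... = (if \<forall>W\<in>s. \<not> ?hyp W then c s else 0) + c s" unfolding if_not_P[OF False] by simp
    finally show ?thesis .
   qed
  qed
  also have "... = ev c (filter (%s. \<forall>W\<in>s. \<not> ?hyp W) z) + ev c z" by (simp add: ev_add ev_filter)
  finally show ?thesis unfolding z2_def by (simp add: ac_simps)
 qed
 have cyc2: "ev (cobd c) z2 = 0" for c
 proof -
  have "ev (cobd (cobd c)) y1 = ev (%_. 0) y1"
   by (rule ev_cong) (use y1f flagsD(1) cobd_cobd in blast)
  also have "... = 0" by (simp add: ev_def)
  finally show ?thesis using key[of "cobd c"] cyc[of c] by simp
 qed
 have lz2: "length z2 <= m + m * fill_size N m" and ly1: "length y1 <= m * fill_size N m"
 proof -
  have s: "sum_list (map (%W. length (Y W)) Hs) <= length Hs * fill_size N m"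
   using Y2 Hs(1) by (intro sum_list_le_length) auto
  also have "... <= m * fill_size N m" using lHs by simp
  finally have s: "sum_list (map (%W. length (Y W)) Hs) <= m * fill_size N m" .
  then show "length y1 <= m * fill_size N m" unfolding y1_def by (simp add: length_concat comp_def)
  show "length z2 <= m + m * fill_size N m"
   unfolding z2_def length_append using add_mono[OF le_trans[OF length_filter_le len] s] by (simp add: length_concat comp_def)
 qed
 have "Suc N * length z2 <= Suc N * (m + m * fill_size N m)" using lz2 by (rule mult_le_mono2)
 then have "Suc N * length z2 + 1 < card (UNIV :: 'a set)" using q by simp
 from cone_fill[OF F _ z2f cyc2 _ this] kN
 obtain y2 where y2: "\<forall>s\<in>set y2. s \<in> flags ?T & card s = Suc k" "length y2 <= Suc N * length z2" "\<forall>c. ev (cobd c) y2 = ev c z2"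
  by auto
 show ?case
 proof (intro exI[of _ "y1 @ y2"] conjI ballI allI)
  fix s assume "s \<in> set (y1 @ y2)"
  then show "s \<in> flags ?T" "card s = Suc k" using y1f y2(1) by auto
 next
  show "length (y1 @ y2) <= fill_size (Suc N) m"
   using ly1 y2(2) \<open>Suc N * length z2 <= Suc N * (m + m * fill_size N m)\<close> by simp
  show "ev (cobd c) (y1 @ y2) = ev c z" for c using key[of c] y2(3) by (simp add: add.assoc[symmetric] add.commute)
 qed
qed

end

section \<open>Expansion of stars\<close>

text \<open>Bounds the length of the cycle formed by a flag of size \<open>k\<close> and the cones
  over its facets, which is the cycle that the cone over the flag has to fill.\<close>

primrec cone_arg :: "nat => nat => nat" where
 "cone_arg N 0 = 1"
| "cone_arg N (Suc k) = 1 + Suc k * fill_size N (cone_arg N k)"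

lemma card_filter_sum: "finite A ==> card {x\<in>A. P x} = (\<Sum>x\<in>A. if P x then 1 else 0)"
 by (simp add: sum.If_cases Int_def)

text \<open>A chain contraction, built by induction on the size of the flag: the flag and the cones
  over its facets together form a cycle, and its filling is the cone. The cone over the empty flag
  is an odd number of vertices, which serve as apex.\<close>

lemma (in finite_field_space) flag_cones:
 assumes F: "flagged H F N" and q: "\<And>k. k + 2 <= N ==> fill_field N (cone_arg N k) < card (UNIV :: 'a set)"
 shows "\<exists>c. \<forall>s. s \<in> flags (opp H F N) & card s + 2 <= N -->
  (\<forall>t\<in>set (c s). t \<in> flags (opp H F N) & card t = Suc (card s)) &
  length (c s) <= fill_size N (cone_arg N (card s)) &
  (\<forall>d. ev (cobd d) (c s) = d s + (\<Sum>v\<in>s. ev d (c (s - {v}))))"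
proof -
 let ?T = "opp H F N"
 let ?good = "%c s. (\<forall>t\<in>set (c s). t \<in> flags ?T & card t = Suc (card s)) &
  length (c s) <= fill_size N (cone_arg N (card s)) &
  (\<forall>d. ev (cobd d) (c s) = d s + (\<Sum>v\<in>s. ev d (c (s - {v}))))"
 have sub: "s - {v} \<in> flags ?T" if "s \<in> flags ?T" for s v using that unfolding flags_def by auto
 have "\<exists>c. \<forall>s. s \<in> flags ?T & card s + 2 <= N & card s < K --> ?good c s" for K
 proof (induction K)
  case 0
  then show ?case by simp
 next
  case (Suc K)
  then obtain c where c: "\<And>s. s \<in> flags ?T ==> card s + 2 <= N ==> card s < K ==> ?good c s" by blast
  have "\<exists>y. (\<forall>t\<in>set y. t \<in> flags ?T & card t = Suc K) & length y <= fill_size N (cone_arg N K) &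
    (\<forall>d. ev (cobd d) y = d s + (\<Sum>v\<in>s. ev d (c (s - {v}))))"
   if s: "s \<in> flags ?T" "card s + 2 <= N" "card s = K" for s
  proof -
   have fs: "finite s" using flagsD(1)[OF s(1)] .
   obtain vs where vs: "set vs = s" "distinct vs" using finite_distinct_list[OF fs] by auto
   define z where "z = s # concat (map (%v. c (s - {v})) vs)"
   have cv: "?good c (s - {v})" "Suc (card (s - {v})) = K" if "v \<in> s" for v
   proof -
    show "Suc (card (s - {v})) = K" using card_Suc_Diff1[OF fs that] s(3) by simp
    then show "?good c (s - {v})" using s sub[OF s(1)] by (intro c) auto
   qed
   have evz: "ev d z = d s + (\<Sum>v\<in>s. ev d (c (s - {v})))" for d
    unfolding z_def using vs by (simp add: ev_concat comp_def sum.distinct_set_conv_list[symmetric])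
   have "\<exists>y. (\<forall>t\<in>set y. t \<in> flags ?T & card t = Suc K) & length y <= fill_size N (cone_arg N K) &
    (\<forall>d. ev (cobd d) y = ev d z)"
   proof (rule flag_cycle_filling[OF F])
    show "K + 2 <= N" using s by simp
    show "t \<in> flags ?T & card t = K" if t: "t \<in> set z" for t
    proof (cases "t = s")
     case False
     then obtain v where v: "v \<in> s" "t \<in> set (c (s - {v}))" using t vs(1) unfolding z_def by auto
     show ?thesis using cv[OF v(1)] v(2) by auto
    qed (use s in auto)
    show "ev (cobd d) z = 0" for d
    proof -
     have "(\<Sum>v\<in>s. ev (cobd d) (c (s - {v}))) = (\<Sum>v\<in>s. d (s - {v}) + (\<Sum>w\<in>s - {v}. ev d (c (s - {v} - {w}))))"
      using cv(1) by (intro sum.cong) auto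
     also have "... = cobd d s + (\<Sum>v\<in>s. \<Sum>w\<in>s - {v}. ev d (c (s - {v} - {w})))"
      by (simp add: sum.distrib cobd_def)
     also have "(\<Sum>v\<in>s. \<Sum>w\<in>s - {v}. ev d (c (s - {v} - {w}))) = 0"
      by (rule bit_pair_cancel[OF fs]) (simp add: Diff_insert2[symmetric] insert_commute)
     finally show ?thesis unfolding evz by simp
    qed
    show "length z <= cone_arg N K"
    proof (cases K)
     case 0
     then have "s = {}" using s(3) fs by simp
     then show ?thesis using vs 0 unfolding z_def by simp
    next
     case (Suc k)
     have "sum_list (map (%v. length (c (s - {v}))) vs) <= length vs * fill_size N (cone_arg N k)"
      using cv Suc vs(1) by (intro sum_list_le_length) (metis nat.inject)
     moreover have "length vs = Suc k" using distinct_card[OF vs(2)] vs(1) s(3) Suc by simp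
     ultimately show ?thesis unfolding z_def Suc by (simp add: length_concat comp_def)
    qed
    show "fill_field N (cone_arg N K) < card (UNIV :: 'a set)" using q s by simp
   qed
   then show ?thesis unfolding evz .
  qed
  then obtain y where y: "\<And>s. s \<in> flags ?T ==> card s + 2 <= N ==> card s = K ==>
    (\<forall>t\<in>set (y s). t \<in> flags ?T & card t = Suc K) & length (y s) <= fill_size N (cone_arg N K) &
    (\<forall>d. ev (cobd d) (y s) = d s + (\<Sum>v\<in>s. ev d (c (s - {v}))))" by metis
  define c' where "c' s = (if card s = K then y s else c s)" for s
  have "?good c' s" if s: "s \<in> flags ?T" "card s + 2 <= N" "card s < Suc K" for s
  proof -
   have fs: "finite s" using flagsD(1)[OF s(1)] .
   have e: "(\<Sum>v\<in>s. ev d (c' (s - {v}))) = (\<Sum>v\<in>s. ev d (c (s - {v})))" for d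
   proof (rule sum.cong[OF refl])
    fix v assume "v \<in> s"
    then have "card (s - {v}) ~= K" using card_Suc_Diff1[OF fs, of v] s(3) by linarith
    then show "ev d (c' (s - {v})) = ev d (c (s - {v}))" unfolding c'_def by (simp only: if_False)
   qed
   show ?thesis
   proof (cases "card s = K")
    case True
    then have "c' s = y s" by (simp add: c'_def)
    show ?thesis unfolding e \<open>c' s = y s\<close> True by (rule y[OF s(1,2) True])
   next
    case False
    then have "c' s = c s" by (simp add: c'_def)
    have "card s < K" using False s(3) by simp
    show ?thesis unfolding e \<open>c' s = c s\<close> by (rule c[OF s(1,2) \<open>card s < K\<close>])
   qed
  qed
  then show ?case by blast
 qed
 from this[of N] obtain c where c: "\<And>s. s \<in> flags ?T & card s + 2 <= N & card s < N ==> ?good c s" by blast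
 show ?thesis
 proof (intro exI[of _ c] allI impI)
  fix s assume s: "s \<in> flags ?T & card s + 2 <= N"
  then have "card s < N" by linarith
  with s show "?good c s" by (intro c) simp
 qed
qed

context chambers
begin

lemma exists_below_average:
 fixes f :: "'h => nat"
 assumes "finite K" "K ~= {}" "(\<Sum>h\<in>K. f h) <= card K * m"
 shows "\<exists>h\<in>K. f h <= m"
proof (rule ccontr)
 assume "\<not> ?thesis"
 then have "(\<Sum>h\<in>K. m) < (\<Sum>h\<in>K. f h)" by (intro sum_strict_mono[OF assms(1,2)]) (simp add: not_le)
 then show False using assms(3) by simp
qed

text \<open>\<open>W x i\<close> is the subspace standing for the vertex \<open>i\<close> of the
  chamber \<open>x\<close>; \<open>T h\<close> and \<open>A h\<close> are the actions on chambers
  and subspaces. The cochain \<open>b h\<close> evaluates \<open>L\<close> on the cones moved by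
  \<open>h\<close>, so \<open>L + cob (b h)\<close> at a face is \<open>cob L\<close> summed over
  the moved cone of that face and vanishes unless the cone meets the support of
  \<open>cob L\<close>. As \<open>h\<close> varies, a simplex of the cone sweeps the star uniformly,
  so on average over \<open>h\<close> the weight is at most \<open>2 ^ N * M\<close> times that of
  \<open>cob L\<close>, and some \<open>h\<close> does as well as the average.\<close>

lemma star_filling:
 fixes W :: "'g => nat => 'w" and A :: "'h => 'w => 'w" and T :: "'h => 'g => 'g" and i0 :: nat
 defines "Phi \<equiv> %I x. W x ` (I - {i0})"
 assumes i0: "i0 < N" and g0: "g0 \<in> G" and X: "X = cls {i0} g0"
  and W: "\<And>x y i. x \<in> X ==> y \<in> X ==> i < N ==> i ~= i0 ==> v i x = v i y \<longleftrightarrow> W x i = W y i"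
  and Wne: "\<And>x y i j. x \<in> X ==> y \<in> X ==> i < N ==> j < N ==> i ~= i0 ==> j ~= i0 ==> W x i = W y j ==> i = j"
  and c1: "\<And>I x t. I \<subseteq> {..<N} ==> i0 \<in> I ==> card I < N ==> x \<in> X ==> t \<in> set (c (Phi I x)) ==>
    \<exists>J z. J \<subseteq> {..<N} & i0 \<in> J & z \<in> X & t = Phi J z"
  and c2: "\<And>I x. I \<subseteq> {..<N} ==> i0 \<in> I ==> card I < N ==> x \<in> X ==> length (c (Phi I x)) <= M"
  and c3: "\<And>I x d. I \<subseteq> {..<N} ==> i0 \<in> I ==> card I < N ==> x \<in> X ==>
    ev (cobd d) (c (Phi I x)) = d (Phi I x) + (\<Sum>w\<in>Phi I x. ev d (c (Phi I x - {w})))"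
  and K: "finite K" "K ~= {}"
  and T1: "\<And>h. h \<in> K ==> bij_betw (T h) X X" and T2: "\<And>x. x \<in> X ==> bij_betw (%h. T h x) K X"
  and T3: "\<And>h x i. h \<in> K ==> x \<in> X ==> i < N ==> i ~= i0 ==> W (T h x) i = A h (W x i)"
  and Ainj: "\<And>h. h \<in> K ==> inj (A h)"
  and L: "cochain m L" "in_star i0 g0 L" and m: "1 <= m" "m < N"
 shows "\<exists>b. cochain (m - 1) b & in_star i0 g0 b & real (wt (cadd L (cob b))) <= real (2 ^ N * M) * real (wt (cob L))"
proof -
 have finX: "finite X" and XG: "X \<subseteq> G" unfolding X using cls_sub by auto
 have Xv: "x \<in> X \<longleftrightarrow> x \<in> G & v i0 x = v i0 g0" for x unfolding X cls_def by simp
 have Wi: "inj_on (W x) (I - {i0})" if "I \<subseteq> {..<N}" "x \<in> X" for I x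
 proof (rule inj_onI)
  fix i j assume ij: "i \<in> I - {i0}" "j \<in> I - {i0}" "W x i = W x j"
  then have "i < N" "j < N" "i ~= i0" "j ~= i0" using that(1) by auto
  then show "i = j" using Wne[OF that(2) that(2)] ij(3) by blast
 qed
 have fin: "finite I" if "I \<subseteq> {..<N}" for I by (rule finite_subset[OF that]) simp
 have PhiD: "I = J & (\<forall>i\<in>I. v i x = v i y)"
  if IJ: "I \<subseteq> {..<N}" "J \<subseteq> {..<N}" "i0 \<in> I" "i0 \<in> J" and xy: "x \<in> X" "y \<in> X" and e: "Phi I x = Phi J y" for I J x y
 proof -
  have a: "\<exists>j\<in>J - {i0}. W x i = W y j" if "i \<in> I - {i0}" for i using e that unfolding Phi_def by blast
  have b: "\<exists>i\<in>I - {i0}. W y j = W x i" if "j \<in> J - {i0}" for j using e that unfolding Phi_def by blast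
  have a': "i \<in> J & W x i = W y i" if i: "i \<in> I - {i0}" for i
  proof -
   obtain j where j: "j \<in> J - {i0}" "W x i = W y j" using a[OF i] by blast
   then have "i = j" using Wne[OF xy, of i j] i IJ by auto
   then show ?thesis using j by auto
  qed
  have b': "j \<in> I" if j: "j \<in> J - {i0}" for j
  proof -
   obtain i where i: "i \<in> I - {i0}" "W y j = W x i" using b[OF j] by blast
   then have "i = j" using Wne[OF xy, of i j] j IJ by auto
   then show ?thesis using i by auto
  qed
  have "v i x = v i y" if "i \<in> I" for i
  proof (cases "i = i0")
   case True
   then show ?thesis using xy unfolding Xv by simp
  next
   case False
   then show ?thesis using W[OF xy, of i] a'[of i] that IJ by auto
  qed
  moreover have "I = J" using a' b' IJ(3,4) by blast
  ultimately show ?thesis by blast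
 qed
 have Phi_rem: "Phi (I - {i}) x = Phi I x - {W x i}" if "I \<subseteq> {..<N}" "x \<in> X" "i \<in> I - {i0}" for I x i
 proof -
  have "I - {i} - {i0} = (I - {i0}) - {i}" by auto
  then show ?thesis unfolding Phi_def using inj_on_image_set_diff[OF Wi[OF that(1,2)], of "I - {i0}" "{i}"] that(3) by auto
 qed
 have sumPhi: "(\<Sum>w\<in>Phi I x. f w) = (\<Sum>i\<in>I - {i0}. f (W x i))" if "I \<subseteq> {..<N}" "x \<in> X" for I x and f :: "'w => bit"
  unfolding Phi_def using sum.reindex[OF Wi[OF that]] by (simp add: comp_def)
 \<comment> \<open>The cochain \<open>L\<close> as a function of the flag alone, and zero on sets
   that are not flags of this star. By \<open>PhiD\<close> the choice of a representing type and
   chamber does not matter.\<close>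
 define gam where "gam s = (if \<exists>I x. I \<subseteq> {..<N} & i0 \<in> I & x \<in> X & s = Phi I x
   then (let p = (SOME p. fst p \<subseteq> {..<N} & i0 \<in> fst p & snd p \<in> X & s = Phi (fst p) (snd p)) in L (fst p) (snd p)) else 0)" for s
 have gam: "gam (Phi I x) = L I x" if I: "I \<subseteq> {..<N}" "i0 \<in> I" "x \<in> X" for I x
 proof -
  let ?Q = "%p. fst p \<subseteq> {..<N} & i0 \<in> fst p & snd p \<in> X & Phi I x = Phi (fst p) (snd p)"
  have "?Q (I, x)" using I by simp
  then have Q: "?Q (SOME p. ?Q p)" by (rule someI)
  obtain J y where p: "(SOME p. ?Q p) = (J, y)" by fastforce
  have Jy: "J \<subseteq> {..<N}" "i0 \<in> J" "y \<in> X" "Phi I x = Phi J y" using Q unfolding p by simp_all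
  have "I = J & (\<forall>i\<in>I. v i x = v i y)" by (rule PhiD[OF I(1) Jy(1) I(2) Jy(2) I(3) Jy(3,4)])
  moreover have "L I x = L I y" if "\<forall>i\<in>I. v i x = v i y"
   using L(1) that subsetD[OF XG I(3)] subsetD[OF XG Jy(3)] unfolding cochain_def by blast
  ultimately have "L J y = L I x" by simp
  moreover have "\<exists>I' x'. I' \<subseteq> {..<N} & i0 \<in> I' & x' \<in> X & Phi I x = Phi I' x'" using I by blast
  ultimately show ?thesis unfolding gam_def Let_def p by simp
 qed
 have L0: "L I x = 0" if "i0 \<notin> I" for I x using L(2) that unfolding in_star_def by blast
 have cobL: "cob L I x = cobd gam (Phi I x)" if I: "I \<subseteq> {..<N}" "i0 \<in> I" "x \<in> X" for I x
 proof -
  have "cob L I x = (\<Sum>i\<in>I. L (I - {i}) x)" using I by (simp add: cob_def)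
  also have "... = L (I - {i0}) x + (\<Sum>i\<in>I - {i0}. L (I - {i}) x)" by (rule sum.remove[OF fin[OF I(1)] I(2)])
  also have "... = (\<Sum>i\<in>I - {i0}. L (I - {i}) x)" by (simp add: L0)
  also have "... = (\<Sum>i\<in>I - {i0}. gam (Phi I x - {W x i}))"
  proof (rule sum.cong[OF refl])
   fix i assume i: "i \<in> I - {i0}"
   then show "L (I - {i}) x = gam (Phi I x - {W x i})"
   proof -
    have "I - {i} \<subseteq> {..<N}" "i0 \<in> I - {i}" using I i by auto
    then show ?thesis using gam[of "I - {i}" x] Phi_rem[OF I(1,3) i] I(3) by simp
   qed
  qed
  also have "... = cobd gam (Phi I x)" unfolding cobd_def sumPhi[OF I(1,3)] ..
  finally show ?thesis .
 qed
 have PhiT: "Phi I (T h x) = A h ` Phi I x" if "I \<subseteq> {..<N}" "x \<in> X" "h \<in> K" for I x h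
  unfolding Phi_def image_image using T3[OF that(3,2)] that(1) by (intro image_cong) auto
 define bb where "bb h I y = ev (%t. gam (A h ` t)) (c (Phi I y))" for h I y
 define inv where "inv h x = inv_into X (T h) x" for h x
 have inv: "inv h x \<in> X" "T h (inv h x) = x" if "h \<in> K" "x \<in> X" for h x
  using T1[OF that(1)] that(2) unfolding inv_def bij_betw_def by (metis inv_into_into, metis f_inv_into_f)
 have TX: "T h x \<in> X" if "h \<in> K" "x \<in> X" for h x using T1[OF that(1)] that(2) by (metis bij_betwE)
 have invT: "inv h (T h y) = y" if "h \<in> K" "y \<in> X" for h y
  using T1[OF that(1)] that(2) unfolding inv_def bij_betw_def by (metis inv_into_f_f)
 define b where "b h I x = (if I \<subseteq> {..<N} & i0 \<in> I & card I = m - 1 & x \<in> X then bb h I (inv h x) else 0)" for h I x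
 have bco: "cochain (m - 1) (b h)" if h: "h \<in> K" for h
  unfolding cochain_def
 proof (intro conjI allI impI)
  fix I x assume "b h I x ~= 0"
  then show "I \<subseteq> {..<N}" "card I = m - 1" "x \<in> G" using XG unfolding b_def by (auto split: if_splits)
 next
  fix I x y assume xy: "x \<in> G & y \<in> G & (\<forall>i\<in>I. v i x = v i y)"
  show "b h I x = b h I y"
  proof (cases "I \<subseteq> {..<N} & i0 \<in> I & card I = m - 1 & x \<in> X")
   case True
   then have yX: "y \<in> X" using xy unfolding Xv by auto
   have "W (inv h x) i = W (inv h y) i" if i: "i \<in> I - {i0}" for i
   proof -
    have iN: "i < N" "i ~= i0" using i True by auto
    have "A h (W (inv h x) i) = W x i" using T3[OF h inv(1)[OF h] iN, of x] inv(2)[OF h] True by auto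
    also have "... = W y i" using W[of x y i] True yX iN xy i by auto
    also have "... = A h (W (inv h y) i)" using T3[OF h inv(1)[OF h] iN, of y] inv(2)[OF h] yX by auto
    finally show ?thesis using Ainj[OF h] by (simp add: inj_eq)
   qed
   then have "Phi I (inv h x) = Phi I (inv h y)" unfolding Phi_def by (intro image_cong) auto
   then show ?thesis using True yX unfolding b_def bb_def by simp
  next
   case False
   then have ny: "\<not> (I \<subseteq> {..<N} & i0 \<in> I & card I = m - 1 & y \<in> X)" using xy unfolding Xv by auto
   show ?thesis by (simp only: b_def if_not_P[OF False] if_not_P[OF ny])
  qed
 qed
 have bst: "in_star i0 g0 (b h)" for h
  unfolding in_star_def
 proof (intro allI impI)
  fix I x assume "b h I x ~= 0"
  then show "i0 \<in> I & v i0 x = v i0 g0" unfolding b_def Xv by (auto split: if_splits)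
 qed
 let ?bad = "%h I y. cadd L (cob (b h)) I (T h y) ~= 0"
 have main: "cadd L (cob (b h)) I (T h y) = ev (%t. cobd gam (A h ` t)) (c (Phi I y))"
  if h: "h \<in> K" and I: "I \<subseteq> {..<N}" "i0 \<in> I" "card I = m" and y: "y \<in> X" for h I y
 proof -
  let ?d = "%t. gam (A h ` t)"
  have cd: "cobd ?d t = cobd gam (A h ` t)" for t
  proof -
   have "cobd gam (A h ` t) = (\<Sum>w\<in>t. gam (A h ` t - {A h w}))"
    unfolding cobd_def using sum.reindex[OF inj_on_subset[OF Ainj[OF h] subset_UNIV], of "%v. gam (A h ` t - {v})" t]
    by (simp add: comp_def)
   also have "... = cobd ?d t" unfolding cobd_def
    using Ainj[OF h] by (intro sum.cong arg_cong[of _ _ gam]) (auto simp: inj_eq image_set_diff)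
   finally show ?thesis by simp
  qed
  have "ev (cobd ?d) (c (Phi I y)) = ?d (Phi I y) + (\<Sum>w\<in>Phi I y. ev ?d (c (Phi I y - {w})))"
   using I m y by (intro c3) auto
  also have "?d (Phi I y) = L I (T h y)" using gam[OF I(1,2) TX[OF h y]] PhiT[OF I(1) y h] by simp
  also have "(\<Sum>w\<in>Phi I y. ev ?d (c (Phi I y - {w}))) = (\<Sum>i\<in>I - {i0}. bb h (I - {i}) y)"
   unfolding sumPhi[OF I(1) y] bb_def using Phi_rem[OF I(1) y] by (intro sum.cong) auto
  also have "... = (\<Sum>i\<in>I - {i0}. b h (I - {i}) (T h y))"
  proof (rule sum.cong[OF refl])
   fix i assume i: "i \<in> I - {i0}"
   have "card (I - {i}) = m - 1" using i I by simp
   then show "bb h (I - {i}) y = b h (I - {i}) (T h y)"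
    unfolding b_def using i I TX[OF h y] invT[OF h y] by auto
  qed
  also have "... = cob (b h) I (T h y)"
  proof -
   have "cob (b h) I (T h y) = (\<Sum>i\<in>I. b h (I - {i}) (T h y))" using I by (simp add: cob_def)
   also have "... = b h (I - {i0}) (T h y) + (\<Sum>i\<in>I - {i0}. b h (I - {i}) (T h y))" by (rule sum.remove[OF fin[OF I(1)] I(2)])
   finally show ?thesis by (simp add: b_def)
  qed
  finally show ?thesis unfolding cadd_def cd by simp
 qed
 have zero: "cadd L (cob (b h)) I x = 0" if "\<not> (I \<subseteq> {..<N} & i0 \<in> I & card I = m & x \<in> X)" for h I x
 proof (rule ccontr)
  assume nz: "cadd L (cob (b h)) I x ~= 0"
  show False
  proof (cases "L I x = 0")
   case False
   then have "I \<subseteq> {..<N} & card I = m & x \<in> G"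
    using conjunct1[OF L(1)[unfolded cochain_def]] by blast
   moreover have "i0 \<in> I & v i0 x = v i0 g0" using L(2) False unfolding in_star_def by blast
   ultimately have "I \<subseteq> {..<N} & card I = m & x \<in> G" "i0 \<in> I & v i0 x = v i0 g0" by simp_all
   then show False using that Xv by blast
  next
   case True
   then have "cob (b h) I x ~= 0" using nz by (simp add: cadd_def)
   then have I: "I \<subseteq> {..<N}" "(\<Sum>i\<in>I. b h (I - {i}) x) ~= 0" by (auto simp: cob_def split: if_splits)
   then obtain i where i: "i \<in> I" "b h (I - {i}) x ~= 0" using bit_sum_nonzero_ex by blast
   then have "i0 \<in> I - {i}" "card (I - {i}) = m - 1" "x \<in> X" unfolding b_def by (auto split: if_splits)
   moreover have "card I = m" using card_Suc_Diff1[OF fin[OF I(1)] i(1)] calculation(2) m by simp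
   ultimately show False using that I(1) by blast
  qed
 qed
 let ?Is = "{I. I \<subseteq> {..<N} & i0 \<in> I & card I = m}"
 have finI: "finite ?Is" by (rule finite_subset[of _ "Pow {..<N}"]) auto
 have cI: "card ?Is <= 2 ^ N"
 proof -
  have "card ?Is <= card (Pow {..<N})" by (rule card_mono) auto
  then show ?thesis by (simp add: card_Pow)
 qed
 have wtb: "wt (cadd L (cob (b h))) = (\<Sum>I\<in>?Is. card {y\<in>X. ?bad h I y})" if h: "h \<in> K" for h
 proof -
  have "wt (cadd L (cob (b h))) = (\<Sum>I\<in>?Is. card {x\<in>G. cadd L (cob (b h)) I x ~= 0})"
   unfolding wt_def
  proof (rule sum.mono_neutral_right)
   show "\<forall>I\<in>Pow {..<N} - ?Is. card {x\<in>G. cadd L (cob (b h)) I x ~= 0} = 0"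
   proof
    fix I assume "I \<in> Pow {..<N} - ?Is"
    then have "{x\<in>G. cadd L (cob (b h)) I x ~= 0} = {}" using zero by blast
    then show "card {x\<in>G. cadd L (cob (b h)) I x ~= 0} = 0" by (metis card.empty)
   qed
  qed auto
  also have "... = (\<Sum>I\<in>?Is. card {y\<in>X. ?bad h I y})"
  proof (rule sum.cong[OF refl])
   fix I assume "I \<in> ?Is"
   have "{x\<in>G. cadd L (cob (b h)) I x ~= 0} = {x\<in>X. cadd L (cob (b h)) I x ~= 0}" using zero XG by blast
   also have "... = T h ` {y\<in>X. ?bad h I y}"
    using T1[OF h] TX[OF h] unfolding bij_betw_def by (auto simp: image_iff)
   finally have "{x\<in>G. cadd L (cob (b h)) I x ~= 0} = T h ` {y\<in>X. ?bad h I y}" .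
   moreover have "inj_on (T h) {y\<in>X. ?bad h I y}" using T1[OF h] unfolding bij_betw_def by (auto intro: inj_on_subset)
   ultimately show "card {x\<in>G. cadd L (cob (b h)) I x ~= 0} = card {y\<in>X. ?bad h I y}" by (simp add: card_image)
  qed
  finally show ?thesis .
 qed
 \<comment> \<open>For one simplex of the cone, different \<open>h\<close> lead to different
   chambers, so \<open>cob L\<close> is hit at most \<open>wt (cob L)\<close> times; the cone has at
   most \<open>M\<close> simplices.\<close>
 have cnt: "card {h\<in>K. ?bad h I y} <= M * wt (cob L)" if I: "I \<in> ?Is" and y: "y \<in> X" for I y
 proof -
  let ?t = "%t. {h\<in>K. cobd gam (A h ` t) ~= 0}"
  have one: "card (?t t) <= wt (cob L)" if t: "t \<in> set (c (Phi I y))" for t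
  proof -
   have "card I < N" using I m by simp
   then obtain J z where J: "J \<subseteq> {..<N}" "i0 \<in> J" "z \<in> X" "t = Phi J z" using c1[of I y t] I y t by auto
   have "h \<in> ?t t \<longleftrightarrow> h \<in> K & cob L J (T h z) ~= 0" for h
    using cobL[OF J(1,2) TX[OF _ J(3)], of h] PhiT[OF J(1,3), of h] J(4) by auto
   then have "?t t = {h\<in>K. cob L J (T h z) ~= 0}" by blast
   then have "card (?t t) = card {h\<in>K. cob L J (T h z) ~= 0}" by (rule arg_cong)
   also have "card {h\<in>K. cob L J (T h z) ~= 0} = card ((%h. T h z) ` {h\<in>K. cob L J (T h z) ~= 0})"
    using T2[OF J(3)] unfolding bij_betw_def by (intro card_image[symmetric]) (auto intro: inj_on_subset)
   also have "... <= card {x\<in>G. cob L J x ~= 0}" using finG TX J(3) XG by (intro card_mono) auto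
   also have "... <= wt (cob L)" unfolding wt_def
    using J(1) by (intro member_le_sum[of J _ "%J. card {x\<in>G. cob L J x ~= 0}"]) auto
   finally show ?thesis .
  qed
  have "{h\<in>K. ?bad h I y} \<subseteq> (\<Union>t\<in>set (c (Phi I y)). ?t t)"
  proof
   fix h assume h: "h \<in> {h\<in>K. ?bad h I y}"
   then have "ev (%t. cobd gam (A h ` t)) (c (Phi I y)) ~= 0" using main[of h I y] I y by auto
   then have "\<exists>t\<in>set (c (Phi I y)). cobd gam (A h ` t) ~= 0"
    unfolding ev_def by (metis (no_types, lifting) sum_list_0 map_eq_conv)
   then show "h \<in> (\<Union>t\<in>set (c (Phi I y)). ?t t)" using h by auto
  qed
  then have "card {h\<in>K. ?bad h I y} <= card (\<Union>t\<in>set (c (Phi I y)). ?t t)"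
   using K by (intro card_mono) auto
  also have "... <= (\<Sum>t\<in>set (c (Phi I y)). card (?t t))" by (rule card_UN_le) simp
  also have "... <= (\<Sum>t\<in>set (c (Phi I y)). wt (cob L))" by (rule sum_mono[OF one])
  also have "... <= length (c (Phi I y)) * wt (cob L)" using card_length[of "c (Phi I y)"] by simp
  also have "... <= M * wt (cob L)" using c2[of I y] I m y by (intro mult_right_mono) auto
  finally show ?thesis .
 qed
 have cKX: "card K = card X"
 proof -
  have "g0 \<in> X" using g0 unfolding Xv by simp
  then show ?thesis using bij_betw_same_card[OF T2] by blast
 qed
 have "(\<Sum>h\<in>K. wt (cadd L (cob (b h)))) = (\<Sum>h\<in>K. \<Sum>I\<in>?Is. \<Sum>y\<in>X. if ?bad h I y then 1 else 0)"
  using wtb by (intro sum.cong refl) (simp only: card_filter_sum[OF finX])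
 also have "... = (\<Sum>I\<in>?Is. \<Sum>h\<in>K. \<Sum>y\<in>X. if ?bad h I y then 1 else 0)" by (rule sum.swap)
 also have "... = (\<Sum>I\<in>?Is. \<Sum>y\<in>X. \<Sum>h\<in>K. if ?bad h I y then 1 else 0)"
  by (intro sum.cong refl) (rule sum.swap)
 also have "... = (\<Sum>I\<in>?Is. \<Sum>y\<in>X. card {h\<in>K. ?bad h I y})"
  by (simp only: card_filter_sum[OF K(1)])
 also have "... <= (\<Sum>I\<in>?Is. \<Sum>y\<in>X. M * wt (cob L))" by (intro sum_mono cnt)
 also have "... = card ?Is * (card X * (M * wt (cob L)))" by simp
 also have "... <= 2 ^ N * (card X * (M * wt (cob L)))" using cI by (rule mult_le_mono1)
 also have "... = card K * (2 ^ N * M * wt (cob L))" by (simp add: cKX ac_simps)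
 finally have "\<exists>h\<in>K. wt (cadd L (cob (b h))) <= 2 ^ N * M * wt (cob L)" by (rule exists_below_average[OF K])
 then obtain h where h: "h \<in> K" "wt (cadd L (cob (b h))) <= 2 ^ N * M * wt (cob L)" by auto
 then have "real (wt (cadd L (cob (b h)))) <= real (2 ^ N * M * wt (cob L))" unfolding of_nat_le_iff by simp
 then show ?thesis using bco[OF h(1)] bst[of h] by (intro exI[of _ "b h"]) simp
qed

end

section \<open>The coset geometry of a unipotent group\<close>

definition fscale :: "'k::field => (nat => 'k) => nat => 'k" where
 "fscale c v = (%m. c * v m)"

interpretation vs: finite_field_space "fscale :: 'k::{field,finite} => _"
proof
 fix a b :: 'k and x y :: "nat => 'k"
 show "fscale a (x + y) = fscale a x + fscale a y" "fscale (a + b) x = fscale a x + fscale b x"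
  "fscale a (fscale b x) = fscale (a * b) x" "fscale 1 x = x"
  by (auto simp: fscale_def fun_eq_iff algebra_simps)
 show "finite (UNIV :: 'k set)" by simp
qed

definition unit_vec :: "nat => nat => 'k::field" where
 "unit_vec p = (%m. if m = p then 1 else 0)"

text \<open>The coordinate \<open>c\<close> itself is excluded both here and in
  \<open>Head c\<close>.\<close>

definition Tail :: "nat => (nat => 'k::field) set" where
 "Tail c = {v. \<forall>m\<le>c. v m = 0}"

definition Head :: "nat => (nat => 'k::field) set" where
 "Head c = {v. \<forall>m\<ge>c. v m = 0}"

text \<open>A finite quotient of the upper triangular unipotent group of the affine Kac-Moody group of type
 \<open>A\<close> with \<open>N\<close> nodes: \<open>Tr i c\<close> adds \<open>c\<close> times the next coordinate to
 every coordinate whose index is congruent to \<open>i\<close>.\<close>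

locale affine_group =
 fixes N L :: nat and ty :: "'k::{field,finite} itself"
 assumes N3: "3 <= N" and L: "2 * N < L"
begin

definition Tr :: "nat => 'k => (nat => 'k) => nat => 'k" where
 "Tr i c v = (%m. v m + (if m mod N = i & m + 1 < L then c * v (m + 1) else 0))"

text \<open>Products of generators already form a group, because \<open>Tr i (- c)\<close> inverts
  \<open>Tr i c\<close>. These subgroups play the role of standard parabolics.\<close>

inductive_set gen :: "nat set => ((nat => 'k) => nat => 'k) set" for J where
 id: "id \<in> gen J"
| step: "g \<in> gen J ==> i \<in> J ==> g o Tr i c \<in> gen J"

lemma suc_mod: "m mod N = i ==> (m + 1) mod N ~= i"
proof
 assume "m mod N = i" "(m + 1) mod N = i"
 then have "(m + 1) mod N = m mod N" by simp
 then have "N dvd (m + 1) - m" by (subst (asm) mod_eq_dvd_iff_nat) auto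
 then show False using N3 by simp
qed

lemma Tr_add: "Tr i a (Tr i b v) = Tr i (a + b) v"
 using suc_mod[of _ i] by (auto simp: Tr_def fun_eq_iff algebra_simps)

lemma Tr_zero: "Tr i 0 = id"
 by (auto simp: Tr_def fun_eq_iff)

lemma gen_Tr: "i \<in> J ==> Tr i c \<in> gen J"
 using gen.step[OF gen.id, of i J c] by simp

lemma gen_mono: "J \<subseteq> J' ==> gen J \<subseteq> gen J'"
proof
 fix g assume J: "J \<subseteq> J'" and "g \<in> gen J"
 from this(2) show "g \<in> gen J'" 
 proof induction
  case id
  show ?case by (rule gen.id)
 next
  case (step g i c)
  then show ?case using J by (intro gen.step) auto
 qed
qed

lemma gen_comp: "h \<in> gen J ==> g \<in> gen J ==> g o h \<in> gen J"
proof (induction rule: gen.induct)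
 case id
 then show ?case by simp
next
 case (step h i c)
 have "(g o h) o Tr i c \<in> gen J" by (rule gen.step[OF step.IH[OF step.prems] step.hyps(2)])
 then show ?case by (simp only: comp_assoc)
qed

lemma gen_inverse: "g \<in> gen J ==> \<exists>h\<in>gen J. g o h = id & h o g = id"
proof (induction rule: gen.induct)
 case id
 show ?case by (rule bexI[of _ id]) (auto intro: gen.id)
next
 case (step g i c)
 from step.IH obtain h where h: "h \<in> gen J" "g o h = id" "h o g = id" by blast
 have t: "Tr i c o Tr i (-c) = id" "Tr i (-c) o Tr i c = id"
  by (auto simp: fun_eq_iff Tr_add Tr_zero)
 show ?case
 proof (intro bexI conjI)
  show "Tr i (-c) o h \<in> gen J" by (rule gen_comp[OF h(1) gen_Tr[OF step.hyps(2)]])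
  have "g o Tr i c o (Tr i (- c) o h) = g o (Tr i c o Tr i (-c)) o h" by (simp only: comp_assoc)
  then show "g o Tr i c o (Tr i (- c) o h) = id" by (simp only: t h comp_id)
  have "Tr i (- c) o h o (g o Tr i c) = Tr i (-c) o (h o g) o Tr i c" by (simp only: comp_assoc)
  then show "Tr i (- c) o h o (g o Tr i c) = id" by (simp only: t h comp_id)
 qed
qed

lemma gen_bij: "g \<in> gen J ==> bij g"
 using gen_inverse o_bij by metis

lemma gen_inv: "g \<in> gen J ==> inv g \<in> gen J"
 using gen_inverse[of g J] by (metis inv_unique_comp)

lemma gen_inv_simps: "g \<in> gen J ==> inv g (g x) = x" "g \<in> gen J ==> g (inv g x) = x"
 "g \<in> gen J ==> inv g o g = id" "g \<in> gen J ==> g o inv g = id"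
 using gen_bij[of g J] by (auto simp: bij_is_inj bij_is_surj surj_f_inv_f fun_eq_iff)

lemma gen_add: "g \<in> gen J ==> g (u + v) = g u + g v"
proof (induction arbitrary: u v rule: gen.induct)
 case (step g i c)
 have "Tr i c (u + v) = Tr i c u + Tr i c v" by (auto simp: Tr_def fun_eq_iff algebra_simps)
 then show ?case by (simp only: comp_apply step.IH)
qed simp

lemma gen_scale: "g \<in> gen J ==> g (fscale a v) = fscale a (g v)"
proof (induction arbitrary: v rule: gen.induct)
 case (step g i c)
 have "Tr i c (fscale a v) = fscale a (Tr i c v)" by (auto simp: Tr_def fscale_def fun_eq_iff algebra_simps)
 then show ?case using step by simp
qed simp

lemma gen_zero: "g \<in> gen J ==> g 0 = 0"
 using gen_add[of g J 0 0] by simp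

lemma gen_fix: "g \<in> gen J ==> (\<And>m. m < L ==> v m = 0) ==> g v = v"
proof (induction rule: gen.induct)
 case (step g i c)
 have "Tr i c v = v" using step.prems by (auto simp: Tr_def fun_eq_iff)
 then show ?case using step by simp
qed simp

lemma gen_unipotent: "g \<in> gen J ==> v \<in> Head (Suc c) ==> g v - v \<in> Head c"
proof (induction arbitrary: v rule: gen.induct)
 case id
 show ?case by (simp add: Head_def)
next
 case (step g i a)
 have t: "Tr i a v - v \<in> Head c" using step.prems by (auto simp: Tr_def Head_def)
 then have "Tr i a v \<in> Head (Suc c)" using step.prems by (auto simp: Head_def)
 then have "g (Tr i a v) - Tr i a v \<in> Head c" by (rule step.IH)
 then show ?case using t by (auto simp: Head_def)
qed

lemma gen_Head: "g \<in> gen J ==> v \<in> Head c ==> g v \<in> Head c"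
proof (cases c)
 case 0
 assume g: "g \<in> gen J" and "v \<in> Head c"
 then have "v = 0" using 0 by (auto simp: Head_def fun_eq_iff)
 then show ?thesis using gen_zero[OF g] by (simp add: Head_def)
next
 case (Suc d)
 assume g: "g \<in> gen J" and v: "v \<in> Head c"
 then have "g v - v \<in> Head d" using gen_unipotent Suc by blast
 then show ?thesis using v Suc by (auto simp: Head_def)
qed

text \<open>\<open>Tr i\<close> reads coordinate \<open>m + 1\<close> to change coordinate
  \<open>m\<close>, so only a generator of type \<open>c mod N\<close> can carry something across
  position \<open>c\<close>.\<close>

lemma gen_Tail: "g \<in> gen J ==> c mod N \<notin> J ==> v \<in> Tail c ==> g v \<in> Tail c"
proof (induction arbitrary: v rule: gen.induct)
 case id
 then show ?case by simp
next
 case (step g i a)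
 have "Tr i a v \<in> Tail c"
  unfolding Tail_def
 proof (intro CollectI allI impI)
  fix m assume m: "m <= c"
  have "m mod N = i ==> m + 1 <= c" using m step by (cases "m = c") auto
  then show "Tr i a v m = 0" using step.prems m unfolding Tail_def Tr_def by auto
 qed
 then show ?case using step.IH step.prems by simp
qed

text \<open>The generators act with period \<open>N\<close> in the index. The truncation does not
  disturb this, since coordinates from \<open>L\<close> on vanish.\<close>

lemma gen_shift:
 assumes "g \<in> gen J" "v \<in> Head L"
 shows "g (%m. v (m + N)) = (%m. g v (m + N))"
 using assms
proof (induction arbitrary: v rule: gen.induct)
 case (step g i c)
 have "Tr i c (%m. v (m + N)) = (%m. Tr i c v (m + N))"
 proof
  fix m
  have "v (m + N + 1) = 0" if "\<not> m + N + 1 < L" using step.prems that by (auto simp: Head_def)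
  then show "Tr i c (%m. v (m + N)) m = Tr i c v (m + N)" by (auto simp: Tr_def add_ac)
 qed
 moreover have "Tr i c v \<in> Head L" using gen_Head[OF gen_Tr[of i "{i}"]] step.prems by auto
 ultimately show ?case using step by simp
qed simp

lemma gen_img_Head: "g \<in> gen J ==> g ` Head c = Head c"
 using gen_Head[of g J] gen_Head[OF gen_inv, of g J] gen_inv_simps(2)[of g J]
 by (auto simp: image_iff) metis

lemma gen_img_Tail: "g \<in> gen J ==> c mod N \<notin> J ==> g ` Tail c = Tail c"
 using gen_Tail[of g J c] gen_Tail[OF gen_inv, of g J c] gen_inv_simps(2)[of g J]
 by (auto simp: image_iff) metis

lemma gen_img_Int: "g \<in> gen J ==> g ` (A Int B) = g ` A Int g ` B"
 using gen_bij[of g J] by (simp add: bij_is_inj image_Int)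

lemma finite_gen: "finite (gen J)"
proof -
 have fH: "finite (Head L :: (nat => 'k) set)"
 proof -
  have "Head L \<subseteq> (%f m. if m < L then f m else 0) ` (PiE {..<L} (%_. UNIV :: 'k set))"
  proof
   fix v :: "nat => 'k" assume v: "v \<in> Head L"
   show "v \<in> (%f m. if m < L then f m else 0) ` (PiE {..<L} (%_. UNIV :: 'k set))"
   proof (rule image_eqI)
    show "v = (%m. if m < L then restrict v {..<L} m else 0)" using v by (auto simp: Head_def fun_eq_iff)
   qed (simp add: PiE_def extensional_def)
  qed
  then show ?thesis by (rule finite_subset) (intro finite_imageI finite_PiE, auto)
 qed
 have "inj_on (%g. restrict g (Head L)) (gen J)"
 proof (rule inj_onI)
  fix g h assume gh: "g \<in> gen J" "h \<in> gen J" "restrict g (Head L) = restrict h (Head L)"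
  show "g = h"
  proof
   fix v :: "nat => 'k"
   let ?a = "%m. if m < L then v m else 0" and ?b = "%m. if m < L then 0 else v m"
   have v: "v = ?a + ?b" by (auto simp: fun_eq_iff)
   have "?a \<in> Head L" by (auto simp: Head_def)
   then have "g ?a = h ?a" using gh(3) by (metis restrict_apply')
   moreover have "g ?b = ?b" "h ?b = ?b" using gen_fix gh by auto
   ultimately show "g v = h v" by (subst (1 2) v) (simp only: gen_add[OF gh(1)] gen_add[OF gh(2)])
  qed
 qed
 moreover have "(%g. restrict g (Head L)) ` gen J \<subseteq> PiE (Head L) (%_. Head L)"
  using gen_Head by auto
 then have "finite ((%g. restrict g (Head L)) ` gen J)"
  by (rule finite_subset) (intro finite_PiE fH)
 ultimately show ?thesis using finite_imageD by blast
qed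


text \<open>The block of \<open>k\<^sup>N\<close> on which the stabiliser of a vertex of type \<open>i0\<close> acts faithfully, with
 the fixed flag \<open>Fl\<close> and the standard opposite flag \<open>El\<close>.\<close>

definition Bl :: "nat => (nat => 'k) set" where
 "Bl i0 = Tail i0 Int Head (i0 + N + 1)"

definition Fl :: "nat => nat => (nat => 'k) set" where
 "Fl i0 j = Tail i0 Int Head (i0 + 1 + j)"

definition El :: "nat => nat => (nat => 'k) set" where
 "El i0 j = Tail (i0 + j) Int Head (i0 + N + 1)"

lemma subspace_Tail_Head: "vs.subspace (Tail c Int Head d :: (nat => 'k) set)"
 unfolding vs.subspace_def Tail_def Head_def fscale_def by auto

lemma flagged_block: "vs.flagged (Bl i0) (Fl i0) N"
 unfolding vs.flagged_def
proof (intro conjI allI impI)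
 have "v = 0" if "v \<in> Fl i0 0" for v
 proof
  fix m show "v m = 0 m" using that by (cases "m <= i0") (auto simp: Fl_def Tail_def Head_def)
 qed
 then show "Fl i0 0 = {0}" by (auto simp: Fl_def Tail_def Head_def)
 show "Fl i0 N = Bl i0" by (simp add: Fl_def Bl_def add_ac)
 fix j assume "j < N"
 let ?p = "i0 + 1 + j"
 have "unit_vec ?p \<notin> Fl i0 j" by (auto simp: Fl_def Head_def unit_vec_def)
 moreover have "Fl i0 (Suc j) = vs.addl (Fl i0 j) (unit_vec ?p)"
 proof (intro equalityI subsetI)
  fix v :: "nat => 'k" assume v: "v \<in> Fl i0 (Suc j)"
  let ?w = "%m. if m = ?p then 0 else v m"
  have "?w \<in> Fl i0 j" using v by (auto simp: Fl_def Tail_def Head_def)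
  moreover have "v = ?w + fscale (v ?p) (unit_vec ?p)" by (auto simp: fun_eq_iff fscale_def unit_vec_def)
  ultimately show "v \<in> vs.addl (Fl i0 j) (unit_vec ?p)" unfolding vs.addl_def by blast
 next
  fix v :: "nat => 'k" assume "v \<in> vs.addl (Fl i0 j) (unit_vec ?p)"
  then show "v \<in> Fl i0 (Suc j)"
   by (auto simp: vs.addl_def Fl_def Tail_def Head_def fscale_def unit_vec_def)
 qed
 ultimately show "\<exists>y. y \<notin> Fl i0 j & Fl i0 (Suc j) = vs.addl (Fl i0 j) y" by blast
qed

lemma compl_El: "j <= N ==> vs.compl (Bl i0) (Fl i0) j (El i0 j)"
proof (rule vs.complI[where F = "Fl i0"])
 assume j: "j <= N"
 show "vs.subspace (El i0 j)" unfolding El_def by (rule subspace_Tail_Head)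
 show "El i0 j \<subseteq> Bl i0" by (auto simp: El_def Bl_def Tail_def)
 show "0 \<in> Fl i0 j" by (auto simp: Fl_def Tail_def Head_def)
 show "x = 0" if "x \<in> El i0 j" "x \<in> Fl i0 j" for x
 proof
  fix m show "x m = 0 m" using that by (cases "m <= i0 + j") (auto simp: El_def Fl_def Tail_def Head_def)
 qed
 fix h assume h: "h \<in> Bl i0"
 let ?w = "%m. if m <= i0 + j then 0 else h m" and ?f = "%m. if m <= i0 + j then h m else 0"
 have "?w \<in> El i0 j" using h by (auto simp: El_def Bl_def Tail_def Head_def)
 moreover have "?f \<in> Fl i0 j" using h j by (auto simp: Fl_def Bl_def Tail_def Head_def)
 moreover have "h = ?w + ?f" by (auto simp: fun_eq_iff)
 ultimately show "\<exists>w\<in>El i0 j. \<exists>f\<in>Fl i0 j. h = w + f" by blast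
qed

lemma El_0: "El i0 0 = Bl i0" by (simp add: El_def Bl_def)

lemma gen_img_Bl: "i0 < N ==> i0 \<notin> J ==> g \<in> gen J ==> g ` Bl i0 = Bl i0"
 unfolding Bl_def by (simp add: gen_img_Int gen_img_Head gen_img_Tail)

lemma gen_img_Fl: "i0 < N ==> i0 \<notin> J ==> g \<in> gen J ==> g ` Fl i0 j = Fl i0 j"
 unfolding Fl_def by (simp add: gen_img_Int gen_img_Head gen_img_Tail)

lemma gen_img_El: "(i0 + j) mod N \<notin> J ==> g \<in> gen J ==> g ` El i0 j = El i0 j"
 unfolding El_def by (simp add: gen_img_Int gen_img_Head gen_img_Tail)

lemma gen_img_subspace: "g \<in> gen J ==> vs.subspace W ==> vs.subspace (g ` W)"
 unfolding vs.subspace_def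
proof (intro conjI ballI allI, goal_cases)
 case 1
 then show ?case using gen_zero[of g J] by (metis image_eqI)
next
 case (2 x y)
 then show ?case using gen_add[of g J] by (metis (no_types, lifting) image_iff)
next
 case (3 c x)
 then show ?case using gen_scale[of g J] by (metis (no_types, lifting) image_iff)
qed

lemma gen_img_compl:
 assumes i0: "i0 < N" "i0 \<notin> J" and g: "g \<in> gen J" and W: "vs.compl (Bl i0) (Fl i0) j W"
 shows "vs.compl (Bl i0) (Fl i0) j (g ` W)"
proof (rule vs.complI[where F = "Fl i0"])
 note sW = vs.complD[OF W]
 have inj: "inj g" using gen_bij[OF g] by (rule bij_is_inj)
 show "vs.subspace (g ` W)" by (rule gen_img_subspace[OF g sW(1)])
 show "g ` W \<subseteq> Bl i0" using image_mono[OF sW(2), of g] gen_img_Bl[OF i0 g] by simp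
 show "0 \<in> Fl i0 j" by (auto simp: Fl_def Tail_def Head_def)
 show "x = 0" if x: "x \<in> g ` W" "x \<in> Fl i0 j" for x
 proof -
  have "x \<in> g ` Fl i0 j" using x(2) gen_img_Fl[OF i0 g] by simp
  then obtain y z where "x = g y" "y \<in> W" "x = g z" "z \<in> Fl i0 j" using x(1) by auto
  then have "y = z" using inj by (auto simp: inj_eq)
  then have "y = 0" using sW(3)[of y] \<open>y \<in> W\<close> \<open>z \<in> Fl i0 j\<close> by simp
  then show ?thesis using gen_zero[OF g] \<open>x = g y\<close> by simp
 qed
 fix h assume "h \<in> Bl i0"
 then have "h \<in> g ` Bl i0" using gen_img_Bl[OF i0 g] by simp
 then obtain h' where h': "h' \<in> Bl i0" "h = g h'" by auto
 from sW(4)[OF h'(1)] obtain w f where "w \<in> W" "f \<in> Fl i0 j" "h' = w + f" by auto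
 then have "h = g w + g f" "g w \<in> g ` W" "g f \<in> Fl i0 j"
  using h' gen_add[OF g, of w f] gen_img_Fl[OF i0 g, of j] by auto
 then show "\<exists>w\<in>g ` W. \<exists>f\<in>Fl i0 j. h = w + f" by blast
qed

text \<open>The window from \<open>i0\<close> to \<open>i0 + N\<close> has \<open>N + 1\<close>
  positions, so only its two ends share a residue.\<close>

lemma mod_pos: "i0 < N ==> i0 + 1 <= r ==> r <= i0 + N ==> m <= i0 + N ==> i0 <= m ==> m mod N = r mod N ==> m = r \<or> (m = i0 & r = i0 + N)"
proof -
 assume a: "i0 < N" "i0 + 1 <= r" "r <= i0 + N" "m <= i0 + N" "i0 <= m" "m mod N = r mod N"
 show ?thesis
 proof (cases "m <= r")
  case True
  then have "N dvd r - m" using a(6) by (metis mod_eq_dvd_iff_nat)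
  then show ?thesis using a True by (cases "r = m") (auto dest!: dvd_imp_le)
 next
  case False
  then have "N dvd m - r" using a(6) by (metis mod_eq_dvd_iff_nat nat_le_linear)
  then show ?thesis using a False by (auto dest!: dvd_imp_le)
 qed
qed

text \<open>On the block a generator is an elementary matrix next to the diagonal. Commutators of
  these produce the elementary matrices farther away, provided that all types from \<open>r\<close>
  up to \<open>p - 1\<close> are available.\<close>

lemma transvection:
 assumes i0: "i0 < N" "i0 \<notin> J" and r: "i0 + 1 <= r" "r < p" "p <= i0 + N" and J: "\<And>s. r <= s ==> s < p ==> s mod N \<in> J"
 shows "\<exists>t\<in>gen J. \<forall>v\<in>Bl i0. t v = v + fscale (a * v p) (unit_vec r)"
 using r J
proof (induction "p - r" arbitrary: a p)
 case 0
 then show ?case by simp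
next
 case (Suc n)
 show ?case
 proof (cases "p = Suc r")
  case True
  have "Tr (r mod N) a v = v + fscale (a * v p) (unit_vec r)" if v: "v \<in> Bl i0" for v
  proof
   fix m
   have "v (Suc m) = 0" if "m mod N = r mod N" "m ~= r"
   proof (cases "i0 <= m & m <= i0 + N")
    case True
    then have "m = i0 & r = i0 + N" using mod_pos[of i0 r m] that i0 Suc.prems by auto
    then show ?thesis using Suc.prems by simp
   next
    case False
    then show ?thesis using v by (auto simp: Bl_def Tail_def Head_def)
   qed
   moreover have "Suc r < L" using Suc.prems i0 L True by simp
   ultimately show "Tr (r mod N) a v m = (v + fscale (a * v p) (unit_vec r)) m"
    using True by (auto simp: Tr_def fscale_def unit_vec_def)
  qed
  moreover have "r mod N \<in> J" using Suc.prems by simp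
  ultimately show ?thesis using gen_Tr by blast
 next
  case False
  define s where "s = p - 1"
  have s: "r < s" "Suc s = p" "s <= i0 + N" "i0 + 1 <= s" using False Suc.prems by (auto simp: s_def)
  have IH: "\<exists>t\<in>gen J. \<forall>v\<in>Bl i0. t v = v + fscale (c * v s) (unit_vec r)" for c
   by (rule Suc.hyps(1)) (use Suc.prems Suc.hyps(2) s in auto)
  obtain t1 where t1: "t1 \<in> gen J" "\<And>v. v \<in> Bl i0 ==> t1 v = v + fscale (a * v s) (unit_vec r)"
   using IH[of a] by blast
  obtain t1' where t1': "t1' \<in> gen J" "\<And>v. v \<in> Bl i0 ==> t1' v = v + fscale (- a * v s) (unit_vec r)"
   using IH[of "- a"] by blast
  have step: "\<exists>t\<in>gen J. \<forall>v\<in>Bl i0. t v = v + fscale (c * v p) (unit_vec s)" for c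
  proof -
   have "Tr (s mod N) c v = v + fscale (c * v p) (unit_vec s)" if v: "v \<in> Bl i0" for v
   proof
    fix m
    have "v (Suc m) = 0" if "m mod N = s mod N" "m ~= s"
    proof (cases "i0 <= m & m <= i0 + N")
     case True
     then have "m = i0 & s = i0 + N" using mod_pos[of i0 s m] that i0 s by auto
     then show ?thesis using s Suc.prems by simp
    next
     case False
     then show ?thesis using v by (auto simp: Bl_def Tail_def Head_def)
    qed
    moreover have "Suc s < L" using Suc.prems i0 L s by simp
    ultimately show "Tr (s mod N) c v m = (v + fscale (c * v p) (unit_vec s)) m"
     using s by (auto simp: Tr_def fscale_def unit_vec_def)
   qed
   moreover have "s mod N \<in> J" using Suc.prems s by simp
   ultimately show ?thesis using gen_Tr by blast
  qed
  obtain t2 where t2: "t2 \<in> gen J" "\<And>v. v \<in> Bl i0 ==> t2 v = v + fscale (1 * v p) (unit_vec s)" using step[of 1] by blast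
  obtain t2' where t2': "t2' \<in> gen J" "\<And>v. v \<in> Bl i0 ==> t2' v = v + fscale ((- 1) * v p) (unit_vec s)" using step[of "- 1"] by blast
  have inB: "g v \<in> Bl i0" if "g \<in> gen J" "v \<in> Bl i0" for g v using gen_img_Bl[OF i0 that(1)] that(2) by auto
  \<comment> \<open>The commutator of the transvections from \<open>s\<close> to \<open>r\<close>
    and from \<open>p\<close> to \<open>s\<close>, which is the one from \<open>p\<close> to
    \<open>r\<close>.\<close>
  let ?t = "t1 o (t2 o (t1' o t2'))"
  have "?t \<in> gen J" using t1 t2 t1' t2' by (intro gen_comp) auto
  moreover have "?t v = v + fscale (a * v p) (unit_vec r)" if v: "v \<in> Bl i0" for v
  proof -
   have b1: "t2' v \<in> Bl i0" by (rule inB[OF t2'(1) v])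
   have b2: "t1' (t2' v) \<in> Bl i0" by (rule inB[OF t1'(1) b1])
   have b3: "t2 (t1' (t2' v)) \<in> Bl i0" by (rule inB[OF t2(1) b2])
   have ne: "s ~= r" "p ~= r" "p ~= s" using s Suc.prems by auto
   define x1 where "x1 = t2' v"
   define x2 where "x2 = t1' x1"
   define x3 where "x3 = t2 x2"
   have x1: "x1 m = v m - (if m = s then v p else 0)" for m
    using t2'(2)[OF v] by (simp add: x1_def fscale_def unit_vec_def)
   have x2: "x2 m = x1 m - (if m = r then a * x1 s else 0)" for m
    using t1'(2)[OF b1] by (simp add: x2_def x1_def[symmetric] fscale_def unit_vec_def)
   have x3: "x3 m = x2 m + (if m = s then x2 p else 0)" for m
    using t2(2)[OF b2] by (simp add: x3_def x2_def[symmetric] x1_def[symmetric] fscale_def unit_vec_def)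
   have x4: "t1 x3 m = x3 m + (if m = r then a * x3 s else 0)" for m
    using t1(2)[OF b3] by (simp add: x3_def[symmetric] x2_def[symmetric] x1_def[symmetric] fscale_def unit_vec_def)
   have "t1 x3 m = (v + fscale (a * v p) (unit_vec r)) m" for m
    unfolding x4 x3 x2 x1 using ne by (simp add: fscale_def unit_vec_def algebra_simps)
   then show ?thesis by (auto simp: x1_def x2_def x3_def)
  qed
  ultimately show ?thesis by blast
 qed
qed

lemma transvections:
 assumes i0: "i0 < N" "i0 \<notin> J" and r: "i0 + 1 <= r" "r + n <= p" "p <= i0 + N" and J: "\<And>s. r <= s ==> s < p ==> s mod N \<in> J"
  and f: "\<And>m. m < r \<or> r + n <= m ==> f m = 0"
 shows "\<exists>t\<in>gen J. \<forall>v\<in>Bl i0. t v = v + fscale (v p) f"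
 using r(2) f
proof (induction n arbitrary: f)
 case 0
 then have "f = 0" by (intro ext) (metis add_0_right not_le zero_fun_apply)
 then show ?case by (intro bexI[of _ id] gen.id) (auto simp: fscale_def fun_eq_iff)
next
 case (Suc n)
 let ?q = "r + n"
 let ?f = "%m. if m = ?q then 0 else f m"
 obtain t1 where t1: "t1 \<in> gen J" "\<And>v. v \<in> Bl i0 ==> t1 v = v + fscale (v p) ?f"
  using Suc.IH[of ?f] Suc.prems by force
 obtain t2 where t2: "t2 \<in> gen J" "\<And>v. v \<in> Bl i0 ==> t2 v = v + fscale (f ?q * v p) (unit_vec ?q)"
  using transvection[OF i0, of ?q p "f ?q"] r(1,3) Suc.prems J by force
 have "(t1 o t2) v = v + fscale (v p) f" if v: "v \<in> Bl i0" for v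
 proof -
  have "t2 v \<in> Bl i0" using gen_img_Bl[OF i0 t2(1)] v by auto
  moreover have "?q ~= p" using Suc.prems by simp
  ultimately show ?thesis
   by (auto simp: t1(2) t2(2)[OF v] fun_eq_iff fscale_def unit_vec_def algebra_simps)
 qed
 then show ?case using gen_comp[OF t2(1) t1(1)] by blast
qed

lemma mod_inj: "i0 < N ==> j < N ==> j' < N ==> (i0 + j) mod N = (i0 + j') mod N ==> j = j'"
proof (induction j j' rule: linorder_wlog)
 case (le j j')
 have "N dvd (i0 + j') - (i0 + j)" using le by (metis mod_eq_dvd_iff_nat nat_add_left_cancel_le)
 then show ?case using le by (auto dest!: dvd_imp_le)
qed auto

text \<open>The types of generators that preserve both the block and the standard spaces
  \<open>El i0 d\<close> with \<open>d\<close> in \<open>D\<close>.\<close>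

definition types_off :: "nat => nat set => nat set" where
 "types_off i0 D = {(i0 + j) mod N | j. 0 < j & j < N & j \<notin> D}"

lemma types_off: "i0 < N ==> i0 \<notin> types_off i0 D" "i0 < N ==> j < N ==> j \<in> D ==> (i0 + j) mod N \<notin> types_off i0 D"
 unfolding types_off_def using mod_inj[of i0 0] mod_inj[of i0 j] by auto

text \<open>The flag is straightened from its smallest member upwards. Once the members of index
  above \<open>k\<close> are standard, the next one contains \<open>unit_vec p + f\<close> with
  \<open>f\<close> supported on smaller coordinates, and a product of transvections carries
  \<open>unit_vec p\<close> there. The members prescribed by \<open>D\<close> confine
  \<open>f\<close> to coordinates that only permitted generators are needed to reach.\<close>

theorem flag_transitive:
 assumes i0: "i0 < N" and W: "\<And>j. j <= N ==> vs.compl (Bl i0) (Fl i0) j (W j)" and Wm: "\<And>i j. i <= j ==> j <= N ==> W j \<subseteq> W i"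
  and D: "D \<subseteq> {1..<N}" "\<And>d. d \<in> D ==> W d = El i0 d"
 shows "\<exists>g\<in>gen (types_off i0 D). \<forall>j\<le>N. g ` El i0 j = W j"
proof -
 let ?J = "types_off i0 D"
 note F = flagged_block[of i0]
 have iJ: "i0 \<notin> ?J" using types_off(1)[OF i0] .
 have "\<exists>g\<in>gen ?J. \<forall>j. N - n <= j & j <= N --> g ` El i0 j = W j" if "n <= N" for n
  using that
 proof (induction n)
  case 0
  have "v = 0" if "v \<in> El i0 N" for v
  proof
   fix m show "v m = 0 m" using that by (cases "m <= i0 + N") (auto simp: El_def Tail_def Head_def)
  qed
  then have "El i0 N \<subseteq> W N" using vs.subspace_0[OF vs.complD(1)[OF W[of N]]] by auto
  then have "El i0 N = W N" by (rule vs.compl_antitone[OF F compl_El W, rotated 4]) auto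
  then show ?case by (intro bexI[of _ id] gen.id) auto
 next
  case (Suc n)
  then obtain g where g: "g \<in> gen ?J" "\<And>j. N - n <= j ==> j <= N ==> g ` El i0 j = W j" by auto
  define k where "k = N - Suc n"
  have k: "k < N" "Suc k = N - n" using Suc.prems by (auto simp: k_def)
  let ?h = "inv g"
  have h: "?h \<in> gen ?J" by (rule gen_inv[OF g(1)])
  have hc: "vs.compl (Bl i0) (Fl i0) j (?h ` W j)" if "j <= N" for j by (rule gen_img_compl[OF i0 iJ h W[OF that]])
  \<comment> \<open>The last prescribed index up to \<open>k\<close>; the default \<open>0\<close>
    stands for the whole block, which is \<open>El i0 0\<close>.\<close>
  define d where "d = Max (insert 0 {d\<in>D. d <= k})"
  have fin: "finite (insert 0 {d\<in>D. d <= k})" by simp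
  have dk: "d <= k" unfolding d_def by (subst Max_le_iff[OF fin]) auto
  have dmax: "d' <= d" if "d' \<in> D" "d' <= k" for d' unfolding d_def using that fin by (intro Max_ge) auto
  have din: "d = 0 \<or> d \<in> D" using Max_in[OF fin] unfolding d_def[symmetric] by auto
  have Wd: "?h ` W k \<subseteq> El i0 d"
  proof (cases "d \<in> D")
   case True
   have "?h ` W k \<subseteq> ?h ` W d" using Wm[OF dk] k by (intro image_mono) simp
   also have "... = El i0 d" using D(2)[OF True] gen_img_El[of i0 d ?J ?h] types_off(2)[OF i0 _ True] h dk k by simp
   finally show ?thesis .
  next
   case False
   then have "d = 0" using din by simp
   then show ?thesis using vs.complD(2)[OF hc[of k]] k by (simp add: El_0)
  qed
  let ?p = "i0 + 1 + k"
  have "unit_vec ?p \<in> Bl i0" using k by (auto simp: Bl_def Tail_def Head_def unit_vec_def)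
  from vs.complD(4)[OF hc[of k] this] obtain w f' where wf: "w \<in> ?h ` W k" "f' \<in> Fl i0 k" "unit_vec ?p = w + f'" using k by auto
  define f where "f = - f'"
  have wf2: "w = unit_vec ?p + f" using wf(3) by (simp add: f_def)
  have wE: "w \<in> El i0 d" using Wd wf(1) by auto
  have fz: "f m = 0" if "m < i0 + 1 + d \<or> i0 + 1 + d + (k - d) <= m" for m
  proof (cases "m < i0 + 1 + d")
   case True
   then have "w m = 0" using wE by (auto simp: El_def Tail_def)
   moreover have "m ~= ?p" using True dk by simp
   ultimately show ?thesis using wf2 by (simp add: unit_vec_def)
  next
   case False
   then have "i0 + 1 + k <= m" using that dk by simp
   then have "f' m = 0" using wf(2) by (auto simp: Fl_def Head_def)
   then show ?thesis by (simp add: f_def)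
  qed
  have Js: "s mod N \<in> ?J" if "i0 + 1 + d <= s" "s < ?p" for s
  proof -
   have "s - i0 <= k" "\<not> s - i0 <= d" using that by linarith+
   then have "s - i0 \<notin> D" using dmax[of "s - i0"] by blast
   then show ?thesis unfolding types_off_def using that k by (intro CollectI exI[of _ "s - i0"]) auto
  qed
  obtain t where t: "t \<in> gen ?J" "\<And>v. v \<in> Bl i0 ==> t v = v + fscale (v ?p) f"
   using transvections[OF i0 iJ, of "i0 + 1 + d" "k - d" ?p f] dk k Js fz by auto
  have tE: "t ` El i0 j = El i0 j" if "Suc k <= j" "j <= N" for j
  proof -
   have "t v = v" if v: "v \<in> El i0 j" for v
   proof -
    have "v \<in> Bl i0" "v ?p = 0" using v \<open>Suc k <= j\<close> by (auto simp: El_def Bl_def Tail_def)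
    then show ?thesis using t(2)[of v] by (auto simp: fscale_def fun_eq_iff)
   qed
   then show ?thesis by (metis (no_types, lifting) image_cong image_ident)
  qed
  have "t ` El i0 k \<subseteq> ?h ` W k"
  proof
   fix u assume "u \<in> t ` El i0 k"
   then obtain v where v: "v \<in> El i0 k" "u = t v" by auto
   have vB: "v \<in> Bl i0" using v by (auto simp: El_def Bl_def Tail_def)
   let ?v = "%m. if m = ?p then 0 else v m"
   have v': "?v \<in> El i0 (Suc k)" using v by (auto simp: El_def Tail_def Head_def le_Suc_eq)
   have "El i0 (Suc k) = ?h ` (g ` El i0 (Suc k))" using gen_inv_simps(1)[OF g(1)] by (simp add: image_image)
   also have "... = ?h ` W (Suc k)" using g(2)[of "Suc k"] k by simp
   also have "... \<subseteq> ?h ` W k" using Wm[of k "Suc k"] k by (intro image_mono) simp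
   finally have "?v \<in> ?h ` W k" using v' by auto
   moreover have "u = ?v + fscale (v ?p) w"
    unfolding v(2) t(2)[OF vB] wf2 by (auto simp: fun_eq_iff fscale_def unit_vec_def algebra_simps)
   moreover have "vs.subspace (?h ` W k)" using vs.complD(1)[OF hc[of k]] k by simp
   ultimately show "u \<in> ?h ` W k" using wf(1) vs.subspace_add vs.subspace_scale by metis
  qed
  then have "t ` El i0 k = ?h ` W k"
   using k by (intro vs.compl_antitone[OF F gen_img_compl[OF i0 iJ t(1) compl_El] hc]) auto
  then have "(g o t) ` El i0 k = g ` ?h ` W k" by (simp only: image_comp[symmetric])
  also have "... = W k" using gen_inv_simps(2)[OF g(1)] by (simp add: image_image)
  finally have k1: "(g o t) ` El i0 k = W k" .
  show ?case
  proof (intro bexI[of _ "g o t"] allI impI gen_comp[OF t(1) g(1)])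
   fix j assume j: "N - Suc n <= j & j <= N"
   show "(g o t) ` El i0 j = W j"
   proof (cases "j = k")
    case False
    then have "Suc k <= j" using j by (simp add: k_def)
    then show ?thesis using tE[of j] g(2)[of j] j k by (simp only: image_comp[symmetric])
   qed (use k1 in simp)
  qed
 qed
 from this[of N] show ?thesis by auto
qed

text \<open>A unipotent element that fixes the standard flag fixes every unit vector of the block,
  and periodicity spreads this. Below the block one shifts down from it. Above it the shift
  determines all coordinates of the image but the first \<open>N\<close>, and these vanish because
  \<open>Tail c\<close> is preserved for \<open>c\<close> congruent to \<open>i0\<close>.\<close>

theorem flag_free:
 assumes i0: "i0 < N" "i0 \<notin> J" and g: "g \<in> gen J" and E: "\<And>j. j <= N ==> g ` El i0 j = El i0 j"
 shows "g = id"
proof -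
 have blk: "g (unit_vec m) = unit_vec m" if m: "i0 < m" "m <= i0 + N" for m
 proof -
  let ?e = "unit_vec m :: nat => 'k"
  have "?e \<in> El i0 (m - i0 - 1)" using m by (auto simp: El_def Tail_def Head_def unit_vec_def)
  then have "g ?e \<in> g ` El i0 (m - i0 - 1)" by (rule imageI)
  also have "... = El i0 (m - i0 - 1)" by (rule E) (use m in simp)
  finally have "g ?e \<in> El i0 (m - i0 - 1)" .
  then have "g ?e \<in> Tail (m - 1)" using m by (auto simp: El_def Tail_def)
  moreover have "g ?e - ?e \<in> Head m" by (rule gen_unipotent[OF g]) (auto simp: Head_def unit_vec_def)
  ultimately show ?thesis
  proof (intro ext)
   fix r assume a: "g ?e \<in> Tail (m - 1)" "g ?e - ?e \<in> Head m"
   show "g ?e r = ?e r"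
   proof (cases "r < m")
    case True
    then show ?thesis using a(1) by (auto simp: Tail_def unit_vec_def)
   next
    case False
    then have "(g ?e - ?e) r = 0" using a(2) by (auto simp: Head_def)
    then show ?thesis by simp
   qed
  qed
 qed
 have unit: "g (unit_vec m) = unit_vec m" if mL: "m < L" for m
  using that
 proof (induction m rule: less_induct)
  case (less m)
  let ?e = "unit_vec m :: nat => 'k"
  show ?case
  proof (cases "i0 < m")
   case False
   have "g (%r. unit_vec (m + N) (r + N)) = (%r. g (unit_vec (m + N)) (r + N))"
    by (rule gen_shift[OF g]) (use False i0 L in \<open>auto simp: Head_def unit_vec_def\<close>)
   moreover have "(%r. unit_vec (m + N) (r + N)) = ?e" by (auto simp: unit_vec_def fun_eq_iff)
   moreover have "g (unit_vec (m + N)) = unit_vec (m + N)" using False i0 N3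
    by (cases "i0 < m + N") (auto intro: blk)
   ultimately show ?thesis by (simp add: unit_vec_def)
  next
   case im: True
   show ?thesis
   proof (cases "m <= i0 + N")
    case True
    then show ?thesis using blk im by simp
   next
    case False
    \<comment> \<open>The last position before \<open>m\<close> that is congruent to
      \<open>i0\<close>.\<close>
    define c where "c = i0 + N * ((m - i0 - 1) div N)"
    have c: "c < m" "m <= c + N" "N <= m" "c mod N = i0"
    proof -
     have "N * ((m - i0 - 1) div N) + (m - i0 - 1) mod N = m - i0 - 1" by simp
     moreover have "(m - i0 - 1) mod N < N" using N3 by simp
     ultimately show "c < m" "m <= c + N" "N <= m" using im False unfolding c_def by linarith+
     show "c mod N = i0" using i0 by (simp add: c_def)
    qed
    have "?e \<in> Tail c" using c by (auto simp: Tail_def unit_vec_def)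
    then have gt: "g ?e \<in> Tail c" using gen_Tail[OF g, of c] c i0 by simp
    have gs: "g (%r. ?e (r + N)) = (%r. g ?e (r + N))"
     by (rule gen_shift[OF g]) (use less.prems in \<open>auto simp: Head_def unit_vec_def\<close>)
    have es: "(%r. ?e (r + N)) = unit_vec (m - N)" using c by (auto simp: unit_vec_def fun_eq_iff)
    have "g (unit_vec (m - N)) = unit_vec (m - N)" using less.IH[of "m - N"] less.prems c N3 by auto
    then have hi: "g ?e (r + N) = unit_vec (m - N) r" for r using gs es by metis
    have cN: "N <= c + 1"
    proof -
     have "N <= m - i0 - 1" using False by simp
     then have "1 <= (m - i0 - 1) div N" using N3 by (metis One_nat_def Suc_leI div_greater_zero_iff gr0I not_numeral_le_zero)
     then have "N * 1 <= N * ((m - i0 - 1) div N)" by (rule mult_le_mono2)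
     then show ?thesis unfolding c_def by linarith
    qed
    show ?thesis
    proof
     fix r show "g ?e r = ?e r"
     proof (cases "r < N")
      case True
      then have "r <= c" using cN by simp
      then show ?thesis using gt c by (auto simp: Tail_def unit_vec_def)
     next
      case False
      then obtain r' where "r = r' + N" by (metis le_Suc_ex add.commute not_less)
      then show ?thesis using hi[of r'] c by (auto simp: unit_vec_def)
     qed
    qed
   qed
  qed
 qed
 have "g v = v" for v
 proof -
  have hd: "g v = v" if "v \<in> Head c" "c <= L" for v c
   using that
  proof (induction c arbitrary: v)
   case 0
   then have "v = 0" by (auto simp: Head_def fun_eq_iff)
   then show ?case using gen_zero[OF g] by (simp only:)
  next
   case (Suc c)
   let ?w = "%m. if m = c then 0 else v m"
   have "?w \<in> Head c" using Suc.prems by (auto simp: Head_def)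
   then have w: "g ?w = ?w" using Suc by simp
   have v: "v = ?w + fscale (v c) (unit_vec c)" by (auto simp: fun_eq_iff fscale_def unit_vec_def)
   have "g v = g ?w + fscale (v c) (g (unit_vec c))"
    by (subst v) (simp only: gen_add[OF g] gen_scale[OF g])
   also have "... = ?w + fscale (v c) (unit_vec c)" using w unit[of c] Suc.prems by simp
   finally show ?case using v by simp
  qed
  let ?a = "%m. if m < L then v m else 0" and ?b = "%m. if m < L then 0 else v m"
  have v: "v = ?a + ?b" by (auto simp: fun_eq_iff)
  have "g ?a = ?a" by (rule hd[of _ L]) (auto simp: Head_def)
  moreover have "g ?b = ?b" by (rule gen_fix[OF g]) auto
  ultimately show ?thesis by (subst (1 2) v) (simp only: gen_add[OF g])
 qed
 then show ?thesis by auto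
qed

end

text \<open>Missing members are inserted from the smallest upwards. The next one arises by adding a
  vector outside \<open>W (Suc k) + F k\<close>, taken from the smallest prescribed space
  \<open>M\<close> that has to contain it. Such a vector exists because \<open>M\<close> and
  \<open>F k\<close> together span \<open>H\<close>, while \<open>W (Suc k) + F k\<close> is
  proper.\<close>

lemma (in finite_field_space) flag_extend:
 assumes F: "flagged H F N" and t: "t \<in> flags (opp H F N)"
 shows "\<exists>W. (\<forall>j\<le>N. compl H F j (W j)) & (\<forall>i j. i <= j & j <= N --> W j \<subseteq> W i) &
  (\<forall>U\<in>t. \<forall>j\<le>N. compl H F j U --> W j = U)"
proof -
 note tf = flagsD[OF t]
 have sH: "subspace H" by (rule flagged_H(1)[OF F])
 have "\<exists>W. (\<forall>j. N - n <= j & j <= N --> compl H F j (W j)) & (\<forall>i j. N - n <= i & i <= j & j <= N --> W j \<subseteq> W i) &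
  (\<forall>U\<in>t. \<forall>j. N - n <= j & j <= N & compl H F j U --> W j = U) &
  (\<forall>U\<in>t. \<forall>j. j <= N - n & compl H F j U --> W (N - n) \<subseteq> U)" if "n <= N" for n
  using that
 proof (induction n)
  case 0
  have a: "{0} \<subseteq> U" if "compl H F j U" for U j using subspace_0[OF complD(1)[OF that]] by simp
  have b: "{0} = U" if "compl H F N U" for U
  proof -
   have "{0} \<subseteq> U" using subspace_0[OF complD(1)[OF that]] by simp
   then show ?thesis using compl_antitone[OF F zero_compl[OF F] that] by simp
  qed
  show ?case
  proof (intro exI[of _ "%_. {0}"] conjI allI impI ballI)
   fix j assume "N - 0 <= j & j <= N"
   then have "j = N" by simp
   then show "compl H F j {0}" using zero_compl[OF F] by simp
  next
   fix U j assume "N - 0 <= j & j <= N & compl H F j U"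
   then have "compl H F N U" by (metis diff_zero le_antisym)
   then show "{0} = U" by (rule b)
  next
   fix U j assume "j <= N - 0 & compl H F j U"
   then show "{0} \<subseteq> U" using a by blast
  qed simp
 next
  case (Suc n)
  define k where "k = N - Suc n"
  have k: "Suc k = N - n" "k < N" using Suc.prems by (auto simp: k_def)
  have "n <= N" using Suc.prems by simp
  from Suc.IH[OF this, folded k(1)] obtain W where
   W: "\<forall>j. Suc k <= j & j <= N --> compl H F j (W j)"
   "\<forall>i j. Suc k <= i & i <= j & j <= N --> W j \<subseteq> W i"
   "\<forall>U\<in>t. \<forall>j. Suc k <= j & j <= N & compl H F j U --> W j = U"
   "\<forall>U\<in>t. \<forall>j. j <= Suc k & compl H F j U --> W (Suc k) \<subseteq> U" by (elim exE conjE)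
  have W1: "\<And>j. Suc k <= j ==> j <= N ==> compl H F j (W j)"
   and W2: "\<And>i j. Suc k <= i ==> i <= j ==> j <= N ==> W j \<subseteq> W i"
   and W3: "\<And>U j. U \<in> t ==> Suc k <= j ==> j <= N ==> compl H F j U ==> W j = U"
   and W4: "\<And>U j. U \<in> t ==> j <= Suc k ==> compl H F j U ==> W (Suc k) \<subseteq> U"
   using W(1) apply simp using W(2) apply simp using W(3) apply simp using W(4) by blast
  have Wk: "compl H F (Suc k) (W (Suc k))" using W1[of "Suc k"] k by simp
  have nH: "\<not> H \<subseteq> ssum (W (Suc k)) (F k)"
  proof
   assume Hs: "H \<subseteq> ssum (W (Suc k)) (F k)"
   note c = complD[OF Wk]
   have FF: "F k \<subseteq> F (Suc k)" using flagged_mono[OF F, of k "Suc k"] k by simp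
   have "compl H F k (W (Suc k))"
   proof (rule complI[where F = F, OF c(1,2)])
    show "0 \<in> F k" using subspace_0[OF flagged_subspace[OF F]] k by simp
    show "x = 0" if "x \<in> W (Suc k)" "x \<in> F k" for x using that FF by (intro c(3)) auto
    show "\<exists>w\<in>W (Suc k). \<exists>f\<in>F k. h = w + f" if "h \<in> H" for h using that Hs unfolding ssum_def by blast
   qed
   then show False using compl_unique[OF F _ Wk, of k] k by simp
  qed
  have "\<exists>V. compl H F k V & W (Suc k) \<subseteq> V & (\<forall>U\<in>t. compl H F k U --> V = U) & (\<forall>U\<in>t. \<forall>j\<le>k. compl H F j U --> V \<subseteq> U)"
  proof (cases "\<exists>U\<in>t. compl H F k U")
   case True
   then obtain V where V: "V \<in> t" "compl H F k V" by blast
   have VU: "V \<subseteq> U" if U: "U \<in> t" "j <= k" "compl H F j U" for U j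
   proof (rule ccontr)
    assume "\<not> V \<subseteq> U"
    then have "U \<subset> V" using tf(3)[OF V(1) U(1)] by auto
    then have "k < j" using compl_less[OF F U(3) V(2)] U k by simp
    then show False using U by simp
   qed
   have VU2: "V = U" if U: "U \<in> t" "compl H F k U" for U
    using tf(3)[OF V(1) U(1)] compl_antitone[OF F V(2) U(2)] compl_antitone[OF F U(2) V(2)] k by auto
   show ?thesis
   proof (intro exI[of _ V] conjI ballI allI impI)
    show "compl H F k V" by (rule V(2))
    show "W (Suc k) \<subseteq> V" by (rule W4[OF V(1) _ V(2)]) simp
   qed (use VU VU2 in blast)+
  next
   case False
   let ?S = "{U\<in>t. \<exists>j\<le>k. compl H F j U}"
   obtain M where M: "subspace M" "M \<subseteq> H" "W (Suc k) \<subseteq> M" "\<And>U. U \<in> ?S ==> M \<subseteq> U" "\<exists>j\<le>k. H \<subseteq> ssum M (F j)"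
   proof (cases "?S = {}")
    case True
    have "H \<subseteq> ssum H (F 0)" using ssum_left[of "F 0" H] flagged_ends(1)[OF F] by simp
    moreover have "H \<subseteq> U" if "U \<in> ?S" for U using that unfolding True by simp
    ultimately show ?thesis by (intro that[of H] sH complD(2)[OF Wk] subset_refl exI[of _ 0] conjI) simp_all
   next
    case ne: False
    have fS: "finite ?S" using tf(1) by simp
    note mn = finite_has_minimal[OF fS ne]
    define M where "M = (SOME M. M \<in> ?S & (\<forall>U\<in>?S. U \<subseteq> M --> M = U))"
    have M0: "M \<in> ?S & (\<forall>U\<in>?S. U \<subseteq> M --> M = U)"
     unfolding M_def by (rule someI_ex) (rule mn[unfolded Bex_def])
    have M: "M \<in> ?S" "\<And>U. U \<in> ?S ==> U \<subseteq> M ==> M = U"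
     by (rule conjunct1[OF M0], rule bspec[OF conjunct2[OF M0], THEN mp])
    obtain j where j: "j <= k" "compl H F j M" using M(1) by auto
    have "M \<subseteq> U" if U: "U \<in> ?S" for U
    proof -
     have "M \<subseteq> U \<or> U \<subseteq> M" using M(1) U by (intro tf(3)) simp_all
     then show ?thesis using M(2)[OF U] by auto
    qed
    moreover have "H \<subseteq> ssum M (F j)" using j(2) unfolding compl_def by simp
    moreover have "W (Suc k) \<subseteq> M" using W4[of M j] M(1) j by simp
    ultimately show ?thesis by (intro that[of M] complD(1)[OF j(2)] complD(2)[OF j(2)] exI[of _ j] conjI j(1)) simp_all
   qed
   have "\<not> M \<subseteq> ssum (W (Suc k)) (F k)"
   proof
    assume Ms: "M \<subseteq> ssum (W (Suc k)) (F k)"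
    obtain j where j: "j <= k" "H \<subseteq> ssum M (F j)" using M(5) by blast
    have sub: "subspace (ssum (W (Suc k)) (F k))"
     using complD(1)[OF Wk] flagged_subspace[OF F, of k] k by (intro subspace_ssum) auto
    have "F j \<subseteq> F k" using flagged_mono[OF F j(1)] k by simp
    also have "F k \<subseteq> ssum (W (Suc k)) (F k)" using subspace_0[OF complD(1)[OF Wk]] by (rule ssum_right)
    finally have "ssum M (F j) \<subseteq> ssum (W (Suc k)) (F k)" by (rule ssum_sub[OF sub Ms])
    then show False using nH j(2) by blast
   qed
   then obtain x where x: "x \<in> M" "x \<notin> ssum (W (Suc k)) (F k)" by blast
   have "compl H F k (addl (W (Suc k)) x)" using x M(2) k by (intro compl_addl[OF F Wk]) auto
   moreover have "addl (W (Suc k)) x \<subseteq> M" by (rule addl_sub[OF M(1,3) x(1)])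
   moreover have "addl (W (Suc k)) x \<subseteq> U" if U: "U \<in> t" "j <= k" "compl H F j U" for U j
   proof -
    have "U \<in> ?S" using U by blast
    then have "M \<subseteq> U" by (rule M(4))
    then show ?thesis using \<open>addl (W (Suc k)) x \<subseteq> M\<close> by simp
   qed
   ultimately show ?thesis using False addl_mono[of "W (Suc k)" x]
    by (intro exI[of _ "addl (W (Suc k)) x"] conjI ballI allI impI) simp_all
  qed
  then obtain V where V0: "compl H F k V" "W (Suc k) \<subseteq> V" "\<forall>U\<in>t. compl H F k U --> V = U"
   "\<forall>U\<in>t. \<forall>j\<le>k. compl H F j U --> V \<subseteq> U" by (elim exE conjE)
  note V = V0(1,2) V0(3)[rule_format] V0(4)[rule_format]
  show ?case
   unfolding k_def[symmetric]
  proof (intro exI[of _ "W(k := V)"] conjI allI impI ballI)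
   fix j assume "k <= j & j <= N"
   then show "compl H F j ((W(k := V)) j)" using V(1) W1[of j] by (cases "j = k") auto
  next
   fix i j assume ij: "k <= i & i <= j & j <= N"
   show "(W(k := V)) j \<subseteq> (W(k := V)) i"
   proof (cases "i = k")
    case True
    show ?thesis
    proof (cases "j = k")
     case False
     then have "W j \<subseteq> W (Suc k)" using W2[of "Suc k" j] ij True by simp
     then show ?thesis using V(2) True False by auto
    qed (use True in simp)
   next
    case False
    then show ?thesis using W2[of i j] ij by simp
   qed
  next
   fix U j assume "U \<in> t" "k <= j & j <= N & compl H F j U"
   then show "(W(k := V)) j = U" using V(3)[of U] W3[of U j] by (cases "j = k") auto
  next
   fix U j assume "U \<in> t" "j <= k & compl H F j U"
   then show "(W(k := V)) k \<subseteq> U" using V(4)[of U j] by simp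
  qed
 qed
 from this[of N] obtain W where "\<forall>j. 0 <= j & j <= N --> compl H F j (W j)" "\<forall>i j. 0 <= i & i <= j & j <= N --> W j \<subseteq> W i"
  "\<forall>U\<in>t. \<forall>j. 0 <= j & j <= N & compl H F j U --> W j = U" by auto
 then show ?thesis by (intro exI[of _ W]) auto
qed

context affine_group
begin

section \<open>Chambers as group elements, faces as cosets\<close>

definition G :: "((nat => 'k) => nat => 'k) set" where
 "G = gen {..<N}"

definition vt :: "nat => ((nat => 'k) => nat => 'k) => ((nat => 'k) => nat => 'k) set" where
 "vt i g = (%k. g o k) ` gen ({..<N} - {i})"

sublocale ch: chambers N G vt
 by unfold_locales (simp add: G_def finite_gen)

lemma gen_G: "J \<subseteq> {..<N} ==> g \<in> gen J ==> g \<in> G"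
 using gen_mono unfolding G_def by blast

lemma G_comp: "g \<in> G ==> h \<in> G ==> g o h \<in> G"
 unfolding G_def by (rule gen_comp)

lemma inv_comp: "g \<in> gen J ==> inv g o (g o h) = h" "g \<in> gen J ==> g o (inv g o h) = h"
 using gen_inv_simps(3,4)[of g J] by (simp_all only: comp_assoc[symmetric] id_comp)

lemma vt_eq:
 assumes g: "g \<in> G" and h: "h \<in> G"
 shows "vt i g = vt i h \<longleftrightarrow> inv g o h \<in> gen ({..<N} - {i})"
proof
 assume "vt i g = vt i h"
 moreover have "h o id \<in> vt i h" unfolding vt_def by (rule imageI) (rule gen.id)
 ultimately have "h \<in> vt i g" by simp
 then obtain k where k: "h = g o k" "k \<in> gen ({..<N} - {i})" unfolding vt_def by (rule imageE)
 then show "inv g o h \<in> gen ({..<N} - {i})" using inv_comp(1)[of g "{..<N}" k] g unfolding G_def by (simp only:)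
next
 let ?K = "gen ({..<N} - {i})"
 let ?m = "inv g o h"
 assume m: "?m \<in> ?K"
 have hg: "h = g o ?m" using inv_comp(2)[of g "{..<N}" h] g unfolding G_def by (simp only:)
 show "vt i g = vt i h"
 proof
  show "vt i h \<subseteq> vt i g"
  proof
   fix x assume "x \<in> vt i h"
   then obtain k where k: "x = h o k" "k \<in> ?K" unfolding vt_def by (rule imageE)
   have "x = g o (?m o k)" unfolding k(1) by (subst (1) hg) (simp only: comp_assoc)
   moreover have "?m o k \<in> ?K" by (rule gen_comp[OF k(2) m])
   ultimately show "x \<in> vt i g" unfolding vt_def by (rule image_eqI)
  qed
  show "vt i g \<subseteq> vt i h"
  proof
   fix x assume "x \<in> vt i g"
   then obtain k where k: "x = g o k" "k \<in> ?K" unfolding vt_def by (rule imageE)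
   have "h o (inv ?m o k) = g o (?m o (inv ?m o k))" by (subst (1) hg) (simp only: comp_assoc)
   also have "... = x" using inv_comp(2)[OF m, of k] k(1) by (simp only:)
   finally have "x = h o (inv ?m o k)" by (rule sym)
   moreover have "inv ?m o k \<in> ?K" by (rule gen_comp[OF k(2) gen_inv[OF m]])
   ultimately show "x \<in> vt i h" unfolding vt_def by (rule image_eqI)
  qed
 qed
qed

text \<open>By transitivity some element of the smaller subgroup moves the standard flag exactly as
  \<open>m\<close> does; by freeness it equals \<open>m\<close>.\<close>

lemma stabilises_in_gen:
 assumes i0: "i0 < N" and m: "m \<in> gen ({..<N} - {i0})" and D: "D \<subseteq> {1..<N}" "\<And>d. d \<in> D ==> m ` El i0 d = El i0 d"
 shows "m \<in> gen (types_off i0 D)"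
proof -
 have i0': "i0 \<notin> {..<N} - {i0}" by simp
 have El_mono: "i <= j ==> El i0 j \<subseteq> El i0 i" for i j by (auto simp: El_def Tail_def)
 obtain g where g: "g \<in> gen (types_off i0 D)" "\<And>j. j <= N ==> g ` El i0 j = m ` El i0 j"
  using flag_transitive[OF i0, of "%j. m ` El i0 j" D] gen_img_compl[OF i0 i0' m compl_El] D El_mono by (auto simp: image_mono)
 have sub: "types_off i0 D \<subseteq> {..<N} - {i0}" using types_off(1)[OF i0, of D] i0 unfolding types_off_def by auto
 have g': "g \<in> gen ({..<N} - {i0})" using g(1) gen_mono[OF sub] by blast
 have "inv g o m = id"
 proof (rule flag_free[OF i0 i0' gen_comp[OF m gen_inv[OF g']]])
  fix j assume "j <= N"
  then have "(inv g o m) ` El i0 j = inv g ` (g ` El i0 j)" using g(2) by (simp only: image_comp[symmetric])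
  also have "... = El i0 j" using gen_inv_simps(1)[OF g'] by (simp add: image_image)
  finally show "(inv g o m) ` El i0 j = El i0 j" .
 qed
 then have "g = m" using inv_comp(2)[OF g', of m] by (simp only: comp_id)
 then show ?thesis using g(1) by simp
qed

text \<open>Seen from one colour \<open>i0\<close> in \<open>C\<close>, membership in the subgroup
  that omits the type \<open>(i0 + d) mod N\<close> implies preserving \<open>El i0 d\<close>, which
  reduces the claim to \<open>stabilises_in_gen\<close>. As a consequence the classes of any type
  are cosets of subgroups \<open>gen\<close>.\<close>

lemma gen_Inter:
 assumes C: "C \<subseteq> {..<N}" "C ~= {}" and m: "\<And>i. i \<in> C ==> m \<in> gen ({..<N} - {i})"
 shows "m \<in> gen ({..<N} - C)"
proof -
 obtain i0 where i0C: "i0 \<in> C" using C by auto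
 then have i0: "i0 < N" using C by auto
 define D where "D = {j\<in>{1..<N}. (i0 + j) mod N \<in> C}"
 have "m \<in> gen (types_off i0 D)"
 proof (rule stabilises_in_gen[OF i0 m[OF i0C]])
  fix d assume "d \<in> D"
  then have "(i0 + d) mod N \<in> C" by (simp add: D_def)
  from m[OF this] show "m ` El i0 d = El i0 d" by (rule gen_img_El[rotated]) simp
 qed (auto simp: D_def)
 moreover have "types_off i0 D \<subseteq> {..<N} - C" using i0 by (auto simp: types_off_def D_def)
 ultimately show ?thesis using gen_mono by blast
qed

lemma cls_eq_coset:
 assumes C: "C \<subseteq> {..<N}" and g: "g \<in> G"
 shows "ch.cls C g = (%k. g o k) ` gen ({..<N} - C)"
proof
 show "(%k. g o k) ` gen ({..<N} - C) \<subseteq> ch.cls C g"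
 proof
  fix h assume "h \<in> (%k. g o k) ` gen ({..<N} - C)"
  then obtain k where k: "h = g o k" "k \<in> gen ({..<N} - C)" by (rule imageE)
  have kG: "k \<in> G" using gen_G[OF _ k(2)] by blast
  then have hG: "h \<in> G" using G_comp[OF g] k(1) by simp
  have "vt i h = vt i g" if "i \<in> C" for i
  proof -
   have "inv g o h = k" using inv_comp(1)[of g "{..<N}" k] g k(1) unfolding G_def by (simp only:)
   moreover have "k \<in> gen ({..<N} - {i})" using k(2) gen_mono[of "{..<N} - C" "{..<N} - {i}"] that by blast
   ultimately show ?thesis using vt_eq[OF g hG, of i] by simp
  qed
  then show "h \<in> ch.cls C g" using hG by (simp add: ch.cls_def)
 qed
 show "ch.cls C g \<subseteq> (%k. g o k) ` gen ({..<N} - C)"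
 proof
  fix h assume "h \<in> ch.cls C g"
  then have h: "h \<in> G" "\<And>i. i \<in> C ==> vt i g = vt i h" by (auto simp: ch.cls_def)
  have hg: "h = g o (inv g o h)" using inv_comp(2)[of g "{..<N}" h] g unfolding G_def by (simp only:)
  have "inv g o h \<in> gen ({..<N} - C)"
  proof (cases "C = {}")
   case True
   then show ?thesis using gen_comp[of h "{..<N}" "inv g"] gen_inv[of g "{..<N}"] g h(1) unfolding G_def by simp
  next
   case False
   show ?thesis by (rule gen_Inter[OF C False]) (use vt_eq[OF g h(1)] h(2) in blast)
  qed
  then show "h \<in> (%k. g o k) ` gen ({..<N} - C)" by (rule image_eqI[where f = "%k. g o k", OF hg])
 qed
qed

text \<open>The type of a generator differs from \<open>i\<close> or from \<open>j\<close>, so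
  multiplying by it keeps the vertex of that colour.\<close>

lemma connected_steps:
 assumes C: "C \<subseteq> {..<N}" and x: "x \<in> G" and y: "y \<in> ch.cls C x" and ij: "i < N" "j < N" "i ~= j"
 shows "(x, y) \<in> (ch.stepr C i j)\<^sup>*"
proof -
 obtain k where k: "y = x o k" "k \<in> gen ({..<N} - C)" using y unfolding cls_eq_coset[OF C x] by (rule imageE)
 have "x o k \<in> G & (x, x o k) \<in> (ch.stepr C i j)\<^sup>*" using k(2)
 proof induction
  case id
  then show ?case using x by simp
 next
  case (step k l c)
  let ?z = "x o k"
  have z: "?z \<in> G" "(x, ?z) \<in> (ch.stepr C i j)\<^sup>*"
   by (rule conjunct1[OF step.IH], rule conjunct2[OF step.IH])
  have "\<exists>e\<in>{i, j}. ?z o Tr l c \<in> ch.cls (insert e C) ?z"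
  proof -
   obtain e where e: "e \<in> {i, j}" "l ~= e" using ij(3) by blast
   have "insert e C \<subseteq> {..<N}" using C e ij by auto
   moreover have "Tr l c \<in> gen ({..<N} - insert e C)" using step.hyps e by (intro gen_Tr) auto
   ultimately show ?thesis using cls_eq_coset[OF _ z(1), of "insert e C"] e(1) by blast
  qed
  then have st: "(?z, ?z o Tr l c) \<in> ch.stepr C i j" "?z o Tr l c \<in> G"
   using z(1) ch.cls_sub unfolding ch.stepr_def by blast+
  have "(x, ?z o Tr l c) \<in> (ch.stepr C i j)\<^sup>*" using z(2) st(1) by (rule rtrancl_into_rtrancl)
  with st(2) show ?case unfolding comp_assoc by (rule conjI)
 qed
 then show ?thesis using k(1) by simp
qed

end

section \<open>Angles in residues of rank two\<close>

lemma sum_shift_action: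
 assumes "finite X" "\<And>u. u \<in> X ==> t u \<in> X" "\<And>u. u \<in> X ==> t' u \<in> X" "\<And>u. u \<in> X ==> t (t' u) = u" "\<And>u. u \<in> X ==> t' (t u) = u"
 shows "(\<Sum>u\<in>X. F (t u)) = (\<Sum>u\<in>X. F u)"
 by (rule sum.reindex_bij_witness[of _ t' t]) (use assms in auto)

lemma sum_UNIV_shift: "(\<Sum>c\<in>(UNIV :: 'k::{ab_group_add,finite} set). F (s + c)) = (\<Sum>c\<in>UNIV. F c)"
 by (rule sum.reindex_bij_witness[of _ "%c. c - s" "%c. s + c"]) auto

text \<open>The sum of \<open>f\<close> over the action \<open>a\<close> is invariant under both
  actions and has mean zero, so it vanishes; since \<open>h\<close> is invariant under
  \<open>a\<close>, pairing \<open>h\<close> with \<open>f\<close> amounts to pairing it with this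
  sum.\<close>

lemma commuting_orthogonal:
 fixes a b :: "'k::{field,finite} => 'x => 'x" and f h :: "'x => real"
 assumes X: "finite X" and aX: "\<And>c u. u \<in> X ==> a c u \<in> X"
  and aa: "\<And>s t u. u \<in> X ==> a s (a t u) = a (s + t) u" "\<And>u. u \<in> X ==> a 0 u = u"
  and ab: "\<And>c d u. u \<in> X ==> a c (b d u) = b d (a c u)"
  and tr: "\<And>F :: 'x => real. (\<And>c u. u \<in> X ==> F (a c u) = F u) ==> (\<And>d u. u \<in> X ==> F (b d u) = F u) ==>
   sum F X = 0 ==> \<forall>u\<in>X. F u = 0"
  and f: "\<And>d u. u \<in> X ==> f (b d u) = f u" "sum f X = 0" and h: "\<And>c u. u \<in> X ==> h (a c u) = h u"
 shows "(\<Sum>u\<in>X. f u * h u) = 0"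
proof -
 have sh: "(\<Sum>u\<in>X. F (a c u)) = (\<Sum>u\<in>X. F u)" for c and F :: "'x => real"
  by (rule sum_shift_action[where t' = "a (-c)"]) (use X aX aa in auto)
 let ?G = "%u. \<Sum>c\<in>UNIV. f (a c u)"
 have "\<forall>u\<in>X. ?G u = 0"
 proof (rule tr)
  fix c u assume u: "u \<in> X"
  show "?G (a c u) = ?G u"
   using aa(1)[OF u] sum_UNIV_shift[of "%s. f (a s u)" c] by (simp add: add.commute)
 next
  fix d u assume u: "u \<in> X"
  show "?G (b d u) = ?G u" using ab[OF u] f(1) aX[OF u] by simp
 next
  show "sum ?G X = 0" by (subst sum.swap) (simp add: sh f(2))
 qed
 then have "0 = (\<Sum>u\<in>X. h u * ?G u)" by simp
 also have "... = (\<Sum>u\<in>X. \<Sum>c\<in>UNIV. f (a c u) * h (a c u))" using h by (simp add: sum_distrib_left mult.commute)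
 also have "... = (\<Sum>c\<in>(UNIV::'k set). \<Sum>u\<in>X. f u * h u)" by (subst sum.swap) (simp add: sh[of "%u. f u * h u"])
 also have "... = real (card (UNIV::'k set)) * (\<Sum>u\<in>X. f u * h u)" by simp
 finally show ?thesis by simp
qed

text \<open>For \<open>c ~= 0\<close> the invariance of \<open>f\<close> under \<open>b\<close> allows averaging \<open>f (a c u)\<close> over the centre.\<close>

lemma heisenberg_angle:
 fixes a b z :: "'k::{field,finite} => 'x => 'x" and f h :: "'x => real"
 assumes X: "finite X" and aX: "\<And>c u. u \<in> X ==> a c u \<in> X" and bX: "\<And>c u. u \<in> X ==> b c u \<in> X" and zX: "\<And>c u. u \<in> X ==> z c u \<in> X"
  and aa: "\<And>s t u. u \<in> X ==> a s (a t u) = a (s + t) u" "\<And>u. u \<in> X ==> a 0 u = u"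
  and bb: "\<And>s t u. u \<in> X ==> b s (b t u) = b (s + t) u" "\<And>u. u \<in> X ==> b 0 u = u"
  and zz: "\<And>s t u. u \<in> X ==> z s (z t u) = z (s + t) u" "\<And>u. u \<in> X ==> z 0 u = u"
  and za: "\<And>c d u. u \<in> X ==> z c (a d u) = a d (z c u)" and zb: "\<And>c d u. u \<in> X ==> z c (b d u) = b d (z c u)"
  and ab: "\<And>c d u. u \<in> X ==> a c (b d u) = b d (a c (z (r * c * d) u))" and r: "r ~= 0"
  and tr: "\<And>F :: 'x => real. (\<And>c u. u \<in> X ==> F (a c u) = F u) ==> (\<And>d u. u \<in> X ==> F (b d u) = F u) ==>
   sum F X = 0 ==> \<forall>u\<in>X. F u = 0"
  and f: "\<And>d u. u \<in> X ==> f (b d u) = f u" "sum f X = 0" and h: "\<And>c u. u \<in> X ==> h (a c u) = h u"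
 shows "2 * (\<Sum>u\<in>X. f u * h u) <= 1 / sqrt (real (card (UNIV :: 'k set))) * ((\<Sum>u\<in>X. (f u)\<^sup>2) + (\<Sum>u\<in>X. (h u)\<^sup>2))"
proof -
 let ?p = "real (card (UNIV::'k set))"
 have p: "?p > 0" by simp
 have sh: "(\<Sum>u\<in>X. F (a c u)) = (\<Sum>u\<in>X. F u)" "(\<Sum>u\<in>X. F (b c u)) = (\<Sum>u\<in>X. F u)"
  "(\<Sum>u\<in>X. F (z c u)) = (\<Sum>u\<in>X. F u)" for c and F :: "'x => real"
  by (rule sum_shift_action[where t' = "a (-c)"] sum_shift_action[where t' = "b (-c)"] sum_shift_action[where t' = "z (-c)"];
    use X aX aa bX bb zX zz in auto)+
 define H where "H u = (\<Sum>c\<in>UNIV. f (z c u))" for u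
 define G where "G u = (\<Sum>c\<in>UNIV. f (a c u))" for u
 have Ga: "G (a c u) = G u" if u: "u \<in> X" for c u
  using aa(1)[OF u] sum_UNIV_shift[of "%s. f (a s u)" c] by (simp add: add.commute G_def)
 have Hz: "H (z c u) = H u" if u: "u \<in> X" for c u
  using zz(1)[OF u] sum_UNIV_shift[of "%s. f (z s u)" c] by (simp add: add.commute H_def)
 have Hb: "H (b d u) = H u" if u: "u \<in> X" for d u
  using zb[OF u] f(1) zX[OF u] by (simp add: H_def)
 have HG: "(\<Sum>c\<in>UNIV. H (a c u)) = 0" if u: "u \<in> X" for u
 proof -
  have "\<forall>u\<in>X. (\<Sum>c\<in>UNIV. H (a c u)) = 0"
  proof (rule tr)
   fix c u assume u: "u \<in> X"
   show "(\<Sum>s\<in>UNIV. H (a s (a c u))) = (\<Sum>s\<in>UNIV. H (a s u))"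
    using aa(1)[OF u] sum_UNIV_shift[of "%s. H (a s u)" c] by (simp add: add.commute)
  next
   fix d u assume u: "u \<in> X"
   have "H (a s (b d u)) = H (a s u)" for s
    using ab[OF u, of s d] Hb[OF aX[OF zX[OF u]], of d] za[OF u, of _ s] Hz[OF aX[OF u]] by (metis)
   then show "(\<Sum>s\<in>UNIV. H (a s (b d u))) = (\<Sum>s\<in>UNIV. H (a s u))" by simp
  next
   have "sum H X = 0" unfolding H_def by (subst sum.swap) (simp add: sh f(2))
   then show "(\<Sum>u\<in>X. \<Sum>c\<in>UNIV. H (a c u)) = 0" by (subst sum.swap) (simp add: sh)
  qed
  then show ?thesis using u by blast
 qed
 have GG: "(\<Sum>u\<in>X. (G u)\<^sup>2) = ?p * (\<Sum>u\<in>X. f u * G u)"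
 proof -
  have "(\<Sum>u\<in>X. (G u)\<^sup>2) = (\<Sum>u\<in>X. \<Sum>c\<in>UNIV. f (a c u) * G (a c u))"
   by (rule sum.cong) (simp_all add: Ga power2_eq_square sum_distrib_right[symmetric], simp add: G_def)
  also have "... = (\<Sum>c\<in>(UNIV::'k set). \<Sum>u\<in>X. f u * G u)" by (subst sum.swap) (simp add: sh(1)[of "%u. f u * G u"])
  finally show ?thesis by simp
 qed
 have off: "?p * (\<Sum>u\<in>X. f u * f (a c u)) = (\<Sum>u\<in>X. f u * H (a c u))" if c: "c ~= 0" for c
 proof -
  have "?p * (\<Sum>u\<in>X. f u * f (a c u)) = (\<Sum>d\<in>(UNIV::'k set). \<Sum>u\<in>X. f u * f (a c u))" by simp
  also have "... = (\<Sum>d\<in>(UNIV::'k set). \<Sum>u\<in>X. f u * f (z (r * c * d) (a c u)))"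
  proof (rule sum.cong[OF refl])
   fix d :: 'k
   have "(\<Sum>u\<in>X. f u * f (a c u)) = (\<Sum>u\<in>X. f (b d u) * f (a c (b d u)))" by (rule sh(2)[symmetric])
   also have "... = (\<Sum>u\<in>X. f u * f (z (r * c * d) (a c u)))"
    by (rule sum.cong) (auto simp: f(1) ab za aX zX)
   finally show "(\<Sum>u\<in>X. f u * f (a c u)) = (\<Sum>u\<in>X. f u * f (z (r * c * d) (a c u)))" .
  qed
  also have "... = (\<Sum>u\<in>X. f u * (\<Sum>d\<in>(UNIV::'k set). f (z (r * c * d) (a c u))))"
   by (subst sum.swap) (simp add: sum_distrib_left)
  also have "... = (\<Sum>u\<in>X. f u * H (a c u))"
  proof -
   have "(\<Sum>d\<in>(UNIV::'k set). F (r * c * d)) = (\<Sum>d\<in>UNIV. F d)" for F :: "'k => real"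
    by (rule sum.reindex_bij_witness[of _ "%d. d / (r * c)" "%d. r * c * d"]) (use c r in auto)
   from this[of "%s. f (z s (a c _))"] show ?thesis unfolding H_def by simp
  qed
  finally show ?thesis .
 qed
 have fH: "(\<Sum>u\<in>X. f u * H u) >= 0"
 proof -
  have "?p * (\<Sum>u\<in>X. f u * H u) = (\<Sum>c\<in>(UNIV::'k set). \<Sum>u\<in>X. f (z c u) * H (z c u))" by (simp add: sh(3)[of "%u. f u * H u"])
  also have "... = (\<Sum>u\<in>X. H u * H u)"
   by (subst sum.swap) (simp add: Hz sum_distrib_right[symmetric] H_def[symmetric])
  also have "... >= 0" by (rule sum_nonneg) simp
  finally show ?thesis using p by (simp add: zero_le_mult_iff)
 qed
 \<comment> \<open>The term \<open>c = 0\<close> gives the norm of \<open>f\<close>. By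
   \<open>off\<close> the others combine to the pairing of \<open>f\<close> with the sum of
   \<open>H (a c u)\<close> over nonzero \<open>c\<close>, which is \<open>- H u\<close> by
   \<open>HG\<close>; this contribution is not positive.\<close>
 have "?p * (\<Sum>u\<in>X. f u * G u) <= ?p * (\<Sum>u\<in>X. (f u)\<^sup>2)"
 proof -
  have "(\<Sum>u\<in>X. f u * G u) = (\<Sum>c\<in>UNIV. \<Sum>u\<in>X. f u * f (a c u))" unfolding G_def by (subst sum.swap) (simp add: sum_distrib_left)
  also have "... = (\<Sum>u\<in>X. f u * f (a 0 u)) + (\<Sum>c\<in>UNIV - {0}. \<Sum>u\<in>X. f u * f (a c u))" by (simp add: sum.remove[of _ 0])
  also have "(\<Sum>u\<in>X. f u * f (a 0 u)) = (\<Sum>u\<in>X. (f u)\<^sup>2)" by (rule sum.cong) (auto simp: aa power2_eq_square)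
  finally have "?p * (\<Sum>u\<in>X. f u * G u) = ?p * (\<Sum>u\<in>X. (f u)\<^sup>2) + (\<Sum>c\<in>UNIV - {0}. ?p * (\<Sum>u\<in>X. f u * f (a c u)))"
   by (simp add: distrib_left sum_distrib_left)
  also have "(\<Sum>c\<in>UNIV - {0}. ?p * (\<Sum>u\<in>X. f u * f (a c u))) = (\<Sum>c\<in>UNIV - {0}. (\<Sum>u\<in>X. f u * H (a c u)))"
   by (rule sum.cong) (use off in auto)
  also have "... = (\<Sum>u\<in>X. f u * (\<Sum>c\<in>UNIV - {0}. H (a c u)))" by (subst sum.swap) (simp add: sum_distrib_left)
  also have "... = (\<Sum>u\<in>X. - (f u * H u))"
   by (rule sum.cong) (use HG in \<open>auto simp: sum_diff1 aa\<close>)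
  finally show ?thesis using fH by (simp add: sum_negf)
 qed
 then have G2: "(\<Sum>u\<in>X. (G u)\<^sup>2) <= ?p * (\<Sum>u\<in>X. (f u)\<^sup>2)" using GG by simp
 let ?s = "sqrt ?p"
 have s: "?s > 0" "?s * ?s = ?p" using p by auto
 have "?p * (2 * (\<Sum>u\<in>X. f u * h u)) = 2 * (\<Sum>c\<in>(UNIV::'k set). \<Sum>u\<in>X. f (a c u) * h (a c u))" by (simp add: sh(1)[of "%u. f u * h u"])
 also have "... = (\<Sum>u\<in>X. 2 * (h u * G u))"
  by (subst sum.swap) (simp add: h G_def sum_distrib_left mult.commute)
 also have "... <= (\<Sum>u\<in>X. ?s * (h u)\<^sup>2 + (G u)\<^sup>2 / ?s)"
 proof (rule sum_mono)
  fix u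
  have "0 <= (?s * h u - G u)\<^sup>2 / ?s" using s by simp
  also have "... = ?s * (h u)\<^sup>2 + (G u)\<^sup>2 / ?s - 2 * (h u * G u)"
   using s(1) by (simp add: field_simps power2_eq_square)
  finally show "2 * (h u * G u) <= ?s * (h u)\<^sup>2 + (G u)\<^sup>2 / ?s" by simp
 qed
 also have "... = ?s * (\<Sum>u\<in>X. (h u)\<^sup>2) + (\<Sum>u\<in>X. (G u)\<^sup>2) / ?s" by (simp add: sum.distrib sum_distrib_left sum_divide_distrib)
 also have "... <= ?s * (\<Sum>u\<in>X. (h u)\<^sup>2) + ?p * (\<Sum>u\<in>X. (f u)\<^sup>2) / ?s"
  using divide_right_mono[OF G2, of ?s] s by simp
 also have "... = ?p * (1 / ?s * ((\<Sum>u\<in>X. (f u)\<^sup>2) + (\<Sum>u\<in>X. (h u)\<^sup>2)))"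
  using s(1) by (simp add: field_simps real_div_sqrt)
 finally show ?thesis using p by (simp only: mult_le_cancel_left_pos)
qed

context affine_group
begin

text \<open>The commutators of type \<open>i\<close> with the following type. They commute with both
  and supply the centre in the Heisenberg relations.\<close>

definition Zr :: "nat => 'k => (nat => 'k) => nat => 'k" where
 "Zr i c v = (%m. v m + (if m mod N = i & m + 2 < L then c * v (m + 2) else 0))"

lemma suc_suc_mod: "m mod N = i ==> Suc (Suc m) mod N ~= i" "m mod N = i ==> Suc m mod N ~= i"
 "Suc (Suc m) mod N ~= Suc m mod N"
proof -
 have *: "(m + n) mod N ~= m mod N" if "0 < n" "n < 3" for m n
 proof
  assume "(m + n) mod N = m mod N"
  then have "N dvd (m + n) - m" by (subst (asm) mod_eq_dvd_iff_nat) auto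
  then show False using N3 that dvd_imp_le[of N n] by simp
 qed
 show "m mod N = i ==> Suc (Suc m) mod N ~= i" using *[of 2 m] by auto
 show "m mod N = i ==> Suc m mod N ~= i" using *[of 1 m] by auto
 show "Suc (Suc m) mod N ~= Suc m mod N" using *[of 1 "Suc m"] by auto
qed

lemma Zr_zero: "Zr i 0 = id" by (auto simp: Zr_def fun_eq_iff)

lemma Zr_add: "Zr i a (Zr i b v) = Zr i (a + b) v"
 using suc_suc_mod(1)[of _ i] by (auto simp: Zr_def fun_eq_iff algebra_simps)

lemma Zr_Tr: "Zr i a (Tr i b v) = Tr i b (Zr i a v)"
 using suc_suc_mod(1,2)[of _ i] by (auto simp: Zr_def Tr_def fun_eq_iff algebra_simps)

lemma Zr_Tr_Suc:
 assumes ij: "i < N" "j = Suc i mod N"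
 shows "Zr i a (Tr j b v) = Tr j b (Zr i a v)"
proof
 fix m
 have jm: "Suc m mod N ~= i" "m mod N ~= i" if "m mod N = j"
 proof -
  have e: "Suc m mod N = Suc (Suc i) mod N" using mod_Suc_eq[of m N] mod_Suc_eq[of "Suc i" N] that ij by simp
  show "Suc m mod N ~= i" using e suc_suc_mod(1)[of i "i mod N"] ij by simp
  show "m mod N ~= i" using that ij suc_suc_mod(2)[of i "i mod N"] by simp
 qed
 have im: "Suc (Suc m) mod N ~= j" "m mod N ~= j" if "m mod N = i"
 proof -
  have "j = Suc m mod N" using mod_Suc_eq[of m N] that ij by simp
  then show "Suc (Suc m) mod N ~= j" "m mod N ~= j" using suc_suc_mod(3)[of m] suc_suc_mod(2)[of m] by auto
 qed
 show "Zr i a (Tr j b v) m = Tr j b (Zr i a v) m"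
  using jm im by (cases "m mod N = j"; cases "m mod N = i") (auto simp: Zr_def Tr_def)
qed

lemma Tr_Tr_Suc:
 assumes ij: "i < N" "j = Suc i mod N"
 shows "Tr i c (Tr j d v) = Tr j d (Tr i c (Zr i (c * d) v))"
proof
 fix m
 have jm: "Suc m mod N ~= i" "m mod N ~= i" if "m mod N = j"
 proof -
  have e: "Suc m mod N = Suc (Suc i) mod N" using mod_Suc_eq[of m N] mod_Suc_eq[of "Suc i" N] that ij by simp
  show "Suc m mod N ~= i" using e suc_suc_mod(1)[of i "i mod N"] ij by simp
  show "m mod N ~= i" using that ij suc_suc_mod(2)[of i "i mod N"] by simp
 qed
 have im: "Suc m mod N = j" "Suc m mod N ~= i" if "m mod N = i"
  using mod_Suc_eq[of m N] suc_suc_mod(2)[OF that] that ij by simp_all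
 show "Tr i c (Tr j d v) m = Tr j d (Tr i c (Zr i (c * d) v)) m"
  using jm im by (cases "m mod N = j"; cases "m mod N = i") (auto simp: Zr_def Tr_def algebra_simps)
qed

lemma Tr_Tr_comm:
 assumes ij: "i < N" "j < N" "i ~= j" "j ~= Suc i mod N" "i ~= Suc j mod N"
 shows "Tr i c (Tr j d v) = Tr j d (Tr i c v)"
proof
 fix m
 have "Suc m mod N ~= i" if "m mod N = j" using mod_Suc_eq[of m N] that ij by simp
 moreover have "Suc m mod N ~= j" if "m mod N = i" using mod_Suc_eq[of m N] that ij by simp
 ultimately show "Tr i c (Tr j d v) m = Tr j d (Tr i c v) m"
  using ij by (cases "m mod N = j"; cases "m mod N = i") (auto simp: Tr_def)
qed

lemma Zr_gen:
 assumes ij: "i < N" "j = Suc i mod N"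
 shows "Zr i c \<in> gen {i, j}"
proof -
 have "Tr i (-1) o (Tr j (-c) o (Tr i 1 o Tr j c)) \<in> gen {i, j}" by (intro gen_comp gen_Tr) auto
 moreover have "Tr i (-1) (Tr j (-c) (Tr i 1 (Tr j c v))) = Zr i c v" for v
  using Tr_Tr_Suc[OF ij, of 1 c v] by (simp add: Tr_add Tr_zero)
 then have "Tr i (-1) o (Tr j (-c) o (Tr i 1 o Tr j c)) = Zr i c" by (simp only: fun_eq_iff comp_apply) blast
 ultimately show ?thesis by (simp only:)
qed

text \<open>With two colours missing, the class is a coset of the subgroup generated by two types.
  Consecutive types satisfy the Heisenberg relations, which give the bound
  \<open>1 / sqrt p\<close>; all other pairs commute, and the two function spaces are then
  orthogonal.\<close>

lemma base_angle:
 assumes C: "C \<subseteq> {..<N}" "card C + 2 = N" and x: "x \<in> G" and ij: "i < N" "j < N" "i ~= j" "i \<notin> C" "j \<notin> C"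
 shows "ch.angle C i j x (1 / sqrt (real (card (UNIV :: 'k set))))"
 unfolding ch.angle_def
proof (intro allI impI)
 fix f h :: "((nat => 'k) => nat => 'k) => real"
 let ?X = "ch.cls C x"
 assume A: "ch.inv_on (insert i C) ?X f & ch.inv_on (insert j C) ?X h & sum f ?X = 0 & sum h ?X = 0"
 have co: "{..<N} - C = {i, j}"
 proof -
  have "card ({..<N} - C) = 2" using C by (simp add: card_Diff_subset finite_subset[OF C(1)])
  moreover have "{i, j} \<subseteq> {..<N} - C" using ij by auto
  ultimately show ?thesis using card_subset_eq[of "{..<N} - C" "{i, j}"] ij(3) by simp
 qed
 have XX: "?X = (%k. x o k) ` gen {i, j}" using cls_eq_coset[OF C(1) x] co by simp
 have XG: "u \<in> G" if "u \<in> ?X" for u using that unfolding ch.cls_def by simp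
 have act: "u o k \<in> ?X" if u: "u \<in> ?X" and k: "k \<in> gen {i, j}" for u k
 proof -
  obtain l where l: "u = x o l" "l \<in> gen {i, j}" using u unfolding XX by (rule imageE)
  have "u o k = x o (l o k)" unfolding l(1) by (simp only: comp_assoc)
  moreover have "l o k \<in> gen {i, j}" by (rule gen_comp[OF k l(2)])
  ultimately show ?thesis unfolding XX by (rule image_eqI)
 qed
 have tri: "u o Tr i c \<in> ?X" and trj: "u o Tr j c \<in> ?X" if "u \<in> ?X" for u c
  using that by (auto intro!: act gen_Tr)
 have inv: "F (u o Tr l c) = F u"
  if F: "ch.inv_on (insert e C) ?X F" and u: "u \<in> ?X" and el: "e \<in> {i, j}" "l \<in> {i, j}" "l ~= e" for F :: "_ => real" and u e l c
 proof -
  have e: "insert e C \<subseteq> {..<N}" using C(1) ij el(1) by auto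
  have "Tr l c \<in> gen ({..<N} - insert e C)" using el ij by (intro gen_Tr) auto
  then have "u o Tr l c \<in> ch.cls (insert e C) u" unfolding cls_eq_coset[OF e XG[OF u]] by (rule imageI)
  then show ?thesis using F u unfolding ch.inv_on_def by blast
 qed
 have f: "f (u o Tr j c) = f u" and h: "h (u o Tr i c) = h u" if "u \<in> ?X" for u c
  using inv[of i f u j c] inv[of j h u i c] that A ij by auto
 have tr: "\<forall>u\<in>?X. F u = 0"
  if i: "\<And>c u. u \<in> ?X ==> F (u o Tr i c) = F u" and j: "\<And>d u. u \<in> ?X ==> F (u o Tr j d) = F u" and s: "sum F ?X = 0"
  for F :: "_ => real"
 proof -
  have "F (x o k) = F x" if "k \<in> gen {i, j}" for k
   using that
  proof induction
   case (step k l c)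
   have "x o k \<in> ?X" unfolding XX by (rule imageI) (rule step.hyps(1))
   then have "F ((x o k) o Tr l c) = F (x o k)" using step.hyps(2) i j by auto
   then show ?case using step.IH by (simp only: comp_assoc)
  qed simp
  then have c: "F u = F x" if "u \<in> ?X" for u using that unfolding XX by (elim imageE) simp
  have "?X ~= {}" unfolding ch.cls_def using x by auto
  moreover have "sum F ?X = real (card ?X) * F x" using c by simp
  ultimately have "F x = 0" using s by simp
  then show ?thesis using c by simp
 qed
 let ?Q = "(\<Sum>u\<in>?X. (f u)\<^sup>2) + (\<Sum>u\<in>?X. (h u)\<^sup>2)"
 let ?lam = "1 / sqrt (real (card (UNIV :: 'k set)))"
 note acts = ch.fin_cls tri trj
 \<comment> \<open>The centre is \<open>Zr p\<close>, where \<open>p\<close> is the first of the two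
   consecutive types; the sign \<open>r\<close> records which of \<open>i\<close> and
   \<open>j\<close> comes first.\<close>
 have adj: "2 * (\<Sum>u\<in>?X. f u * h u) <= ?lam * ?Q" if a: "j = Suc i mod N & p = i & r = -1 \<or> i = Suc j mod N & p = j & r = 1" for p and r :: 'k
 proof (rule heisenberg_angle[where a = "%c u. u o Tr i c" and b = "%c u. u o Tr j c" and z = "%c u. u o Zr p c" and r = r])
  show "u o Zr p c \<in> ?X" if "u \<in> ?X" for u c
   using a Zr_gen[of i j c] Zr_gen[of j i c] ij act[OF that, of "Zr p c"] by (auto simp: insert_commute)
  show "u o Tr j d o Tr i c = u o Zr p (r * c * d) o Tr i c o Tr j d" for u :: "(nat => 'k) => nat => 'k" and c d
  proof -
   have "Tr j d (Tr i c v) = Zr p (r * c * d) (Tr i c (Tr j d v))" for v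
    using a
   proof (elim disjE conjE)
    assume *: "j = Suc i mod N" "p = i" "r = -1"
    show ?thesis using Tr_Tr_Suc[OF ij(1) *(1), of c d v] *
     by (simp add: Zr_Tr Zr_Tr_Suc[OF ij(1) refl] Zr_add Zr_zero)
   next
    assume *: "i = Suc j mod N" "p = j" "r = 1"
    show ?thesis using Tr_Tr_Suc[OF ij(2) *(1), of d c v] *
     by (simp add: Zr_Tr Zr_Tr_Suc[OF ij(2) refl] mult.commute)
   qed
   then show ?thesis by (intro ext) (simp only: comp_apply)
  qed
  have "Zr p c (Tr i d v) = Tr i d (Zr p c v)" "Zr p c (Tr j d v) = Tr j d (Zr p c v)" for c d v
   using a Zr_Tr Zr_Tr_Suc[of i j] Zr_Tr_Suc[of j i] ij by metis+
  then show "u o Tr i d o Zr p c = u o Zr p c o Tr i d" "u o Tr j d o Zr p c = u o Zr p c o Tr j d"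
   for u :: "(nat => 'k) => nat => 'k" and c d
   by (intro ext, simp only: comp_apply)+
  show "r ~= 0" using a by auto
  show "u o Tr i t o Tr i s = u o Tr i (s + t)" "u o Tr j t o Tr j s = u o Tr j (s + t)" "u o Zr p t o Zr p s = u o Zr p (s + t)"
   for u :: "(nat => 'k) => nat => 'k" and s t
   by (intro ext, simp only: comp_apply Tr_add Zr_add add.commute)+
  show "u o Tr i 0 = u" "u o Tr j 0 = u" "u o Zr p 0 = u" for u :: "(nat => 'k) => nat => 'k"
   by (simp_all add: Tr_zero Zr_zero)
  show "sum f ?X = 0" using A by simp
 qed (use acts f h tr in auto)
 consider "j = Suc i mod N" | "i = Suc j mod N" | "j ~= Suc i mod N" "i ~= Suc j mod N" by blast
 then show "2 * (\<Sum>u\<in>?X. f u * h u) <= ?lam * ?Q"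
 proof cases
  case 1
  then show ?thesis using adj[of i "-1"] by simp
 next
  case 2
  then show ?thesis using adj[of j 1] by simp
 next
  case 3
  have "(\<Sum>u\<in>?X. f u * h u) = 0"
  proof (rule commuting_orthogonal[where a = "%c u. u o Tr i c" and b = "%c u. u o Tr j c"])
   show "u o Tr j d o Tr i c = u o Tr i c o Tr j d" for u :: "(nat => 'k) => nat => 'k" and c d
    by (intro ext) (simp only: comp_apply Tr_Tr_comm[OF ij(1,2,3) 3])
   show "u o Tr i t o Tr i s = u o Tr i (s + t)" for u :: "(nat => 'k) => nat => 'k" and s t
    by (intro ext) (simp only: comp_apply Tr_add add.commute)
   show "u o Tr i 0 = u" for u :: "(nat => 'k) => nat => 'k" by (simp add: Tr_zero)
   show "sum f ?X = 0" using A by simp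
  qed (use acts f h tr in auto)
  moreover have "?Q >= 0" by (intro add_nonneg_nonneg sum_nonneg) auto
  ultimately show ?thesis by simp
 qed
qed

end

text \<open>A bound for the length of every cone in a link that does not depend on the
  field.\<close>

definition fill_bound :: "nat => nat" where
 "fill_bound N = (\<Sum>k<N. fill_size N (cone_arg N k))"

section \<open>Vertex stars as complexes of opposite flags\<close>

context affine_group
begin

text \<open>In the star of a vertex of colour \<open>i0\<close>, a vertex of colour \<open>i\<close>
  corresponds to an opposite subspace of codimension \<open>off i0 i\<close>.\<close>

definition off :: "nat => nat => nat" where
 "off i0 i = (i + N - i0) mod N"

lemma off:
 assumes "i0 < N" "i < N" "i ~= i0"
 shows "0 < off i0 i" "off i0 i < N" "(i0 + off i0 i) mod N = i"
proof -
 have N: "0 < N" using N3 by simp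
 show "off i0 i < N" using N by (simp add: off_def)
 have "(i0 + off i0 i) mod N = (i0 + (i + N - i0)) mod N" unfolding off_def by (simp add: mod_add_right_eq)
 also have "... = i" using assms by simp
 finally show e: "(i0 + off i0 i) mod N = i" .
 show "0 < off i0 i" using e assms by (cases "off i0 i") auto
qed

lemma off_mod: "i0 < N ==> j < N ==> 0 < j ==> off i0 ((i0 + j) mod N) = j & (i0 + j) mod N ~= i0"
proof -
 assume A: "i0 < N" "j < N" "0 < j"
 have ne: "(i0 + j) mod N ~= i0" using mod_inj[of i0 j 0] A by auto
 have "(i0 + j) mod N < N" using A by simp
 note o = off[OF A(1) this ne]
 show ?thesis using mod_inj[OF A(1) A(2) o(2) o(3)[symmetric]] ne by simp
qed

text \<open>The star is a coset of \<open>?K\<close>. Sending a chamber to the corresponding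
  translate of the standard flag turns vertices into opposite subspaces and faces into flags, with
  \<open>?K\<close> acting simply transitively from the left, so that \<open>star_filling\<close>
  applies to the cones of \<open>flag_cones\<close>.\<close>

lemma star_expansion:
 assumes fld: "\<And>k. k + 2 <= N ==> fill_field N (cone_arg N k) < card (UNIV :: 'k set)"
 shows "ch.star_expansion (real (2 ^ N * fill_bound N))"
 unfolding ch.star_expansion_def
proof (intro allI impI ballI)
 fix i0 g0 m and L :: "nat set => ((nat => 'k) => nat => 'k) => bit"
 assume i0: "i0 < N" and g0: "g0 \<in> G" and A: "2 <= m & m < N & ch.cochain m L & ch.in_star i0 g0 L"
 let ?K = "gen ({..<N} - {i0})"
 let ?X = "ch.cls {i0} g0"
 let ?H = "Bl i0 :: (nat => 'k) set" and ?F = "Fl i0 :: nat => (nat => 'k) set"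
 note F = flagged_block[of i0]
 have i0K: "i0 \<notin> {..<N} - {i0}" by simp
 have KG: "?K \<subseteq> gen {..<N}" by (rule gen_mono) auto
 have g0': "g0 \<in> gen {..<N}" using g0 by (simp only: G_def)
 have XX: "?X = (%k. g0 o k) ` ?K" by (rule cls_eq_coset[OF _ g0]) (use i0 in auto)
 define r where "r x = inv g0 o x" for x :: "(nat => 'k) => nat => 'k"
 have rg: "r (g0 o h) = h" for h unfolding r_def by (rule inv_comp(1)[OF g0'])
 have gr: "g0 o r x = x" for x unfolding r_def by (rule inv_comp(2)[OF g0'])
 have rK: "r x \<in> ?K" if "x \<in> ?X" for x using that unfolding XX by (elim imageE) (simp only: rg)
 have XI: "g0 o h \<in> ?X" if "h \<in> ?K" for h unfolding XX by (rule imageI) (rule that)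
 define W where "W x i = r x ` El i0 (off i0 i)" for x i
 have Wc: "vs.compl ?H ?F (off i0 i) (W x i)" if "x \<in> ?X" "i < N" "i ~= i0" for x i
  unfolding W_def using off[OF i0 that(2,3)] by (intro gen_img_compl[OF i0 i0K rK[OF that(1)]] compl_El) simp
 have El_mono: "i <= j ==> El i0 j \<subseteq> (El i0 i :: (nat => 'k) set)" for i j by (auto simp: El_def Tail_def)
 obtain c where c: "\<And>s. s \<in> vs.flags (vs.opp ?H ?F N) ==> card s + 2 <= N ==>
  (\<forall>t\<in>set (c s). t \<in> vs.flags (vs.opp ?H ?F N) & card t = Suc (card s)) &
  length (c s) <= fill_size N (cone_arg N (card s)) &
  (\<forall>d. ev (cobd d) (c s) = d s + (\<Sum>v\<in>s. ev d (c (s - {v}))))"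
  using vs.flag_cones[OF F fld] by blast
 define Phi where "Phi I x = W x ` (I - {i0})" for I x
 have Phi: "Phi I x \<in> vs.flags (vs.opp ?H ?F N)" "card (Phi I x) + 2 <= N"
  if I: "I \<subseteq> {..<N}" "i0 \<in> I" "card I < N" and x: "x \<in> ?X" for I x
 proof -
  have fI: "finite I" by (rule finite_subset[OF I(1)]) simp
  have "card (Phi I x) <= card (I - {i0})" unfolding Phi_def by (rule card_image_le) (use fI in simp)
  also have "... = card I - 1" using I(2) fI by simp
  finally show "card (Phi I x) + 2 <= N" using I(3) N3 by linarith
  have "W x i \<subseteq> W x j \<or> W x j \<subseteq> W x i" for i j
   unfolding W_def using El_mono[of "off i0 i" "off i0 j"] El_mono[of "off i0 j" "off i0 i"]
   by (cases "off i0 i <= off i0 j") (auto intro!: image_mono)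
  moreover have "W x i \<in> vs.opp ?H ?F N" if "i \<in> I - {i0}" for i
  proof -
   have i: "i < N" "i ~= i0" using that I(1) by auto
   show ?thesis unfolding vs.opp_def using off[OF i0 i] Wc[OF x i] by blast
  qed
  ultimately show "Phi I x \<in> vs.flags (vs.opp ?H ?F N)"
   unfolding vs.flags_def Phi_def using fI by (intro CollectI conjI) (simp, rule image_subsetI, simp, simp)
 qed
 have "\<exists>b. ch.cochain (m - 1) b & ch.in_star i0 g0 b &
   real (ch.wt (ch.cadd L (ch.cob b))) <= real (2 ^ N * fill_bound N) * real (ch.wt (ch.cob L))"
 proof (rule ch.star_filling[where X = ?X and W = W and c = c and K = ?K and T = "%h x. g0 o (h o r x)" and A = "%h. image h",
    OF i0 g0 refl, folded Phi_def])
  fix x y i assume x: "x \<in> ?X" and y: "y \<in> ?X" and i: "i < N" "i ~= i0"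
  have xG: "x \<in> G" "y \<in> G" using x y unfolding ch.cls_def by simp_all
  note o = off[OF i0 i]
  let ?m = "inv (r x) o r y"
  have mK: "?m \<in> ?K" by (rule gen_comp[OF rK[OF y] gen_inv[OF rK[OF x]]])
  have mm: "inv x o y = ?m"
  proof -
   have "inv x = inv (g0 o r x)" by (simp only: gr)
   also have "... = inv (r x) o inv g0" by (rule o_inv_distrib[OF gen_bij[OF g0'] gen_bij[OF rK[OF x]]])
   finally show ?thesis by (simp only: comp_assoc r_def)
  qed
  have eq: "W x i = W y i \<longleftrightarrow> ?m ` El i0 (off i0 i) = El i0 (off i0 i)"
  proof
   assume "W x i = W y i"
   then have "inv (r x) ` (r y ` El i0 (off i0 i)) = inv (r x) ` (r x ` El i0 (off i0 i))" by (simp only: W_def)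
   then show "?m ` El i0 (off i0 i) = El i0 (off i0 i)"
    by (simp only: image_comp gen_inv_simps(3)[OF rK[OF x]] image_id id_apply)
  next
   assume "?m ` El i0 (off i0 i) = El i0 (off i0 i)"
   then have "r x ` (?m ` El i0 (off i0 i)) = r x ` El i0 (off i0 i)" by (simp only:)
   then have "(r x o ?m) ` El i0 (off i0 i) = r x ` El i0 (off i0 i)" by (simp only: image_comp)
   then show "W x i = W y i" by (simp only: inv_comp(2)[OF rK[OF x]] W_def)
  qed
  show "vt i x = vt i y \<longleftrightarrow> W x i = W y i"
   unfolding vt_eq[OF xG] mm eq
  proof
   assume "?m \<in> gen ({..<N} - {i})"
   then show "?m ` El i0 (off i0 i) = El i0 (off i0 i)" by (rule gen_img_El[rotated]) (simp add: o)
  next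
   assume e: "?m ` El i0 (off i0 i) = El i0 (off i0 i)"
   have "?m \<in> gen (types_off i0 {off i0 i})" by (rule stabilises_in_gen[OF i0 mK]) (use o e in auto)
   moreover have "types_off i0 {off i0 i} \<subseteq> {..<N} - {i}" using o i0 N3 by (auto simp: types_off_def dest: mod_inj[OF i0])
   ultimately show "?m \<in> gen ({..<N} - {i})" using gen_mono by blast
  qed
 next
  fix x y i j assume x: "x \<in> ?X" "y \<in> ?X" and i: "i < N" "j < N" "i ~= i0" "j ~= i0" and e: "W x i = W y j"
  have "vs.compl ?H ?F (off i0 j) (W x i)" unfolding e by (rule Wc[OF x(2) i(2,4)])
  then have "off i0 i = off i0 j"
   by (rule vs.compl_unique[OF F Wc[OF x(1) i(1,3)]])
    (rule less_imp_le, rule off(2)[OF i0 i(1,3)], rule less_imp_le, rule off(2)[OF i0 i(2,4)])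
  then have "(i0 + off i0 i) mod N = (i0 + off i0 j) mod N" by (rule arg_cong)
  then show "i = j" by (simp only: off(3)[OF i0 i(1,3)] off(3)[OF i0 i(2,4)])
 next
  fix I x t assume I: "I \<subseteq> {..<N}" "i0 \<in> I" "card I < N" and x: "x \<in> ?X" and t: "t \<in> set (c (Phi I x))"
  have tf: "t \<in> vs.flags (vs.opp ?H ?F N)" using c[OF Phi[OF I x]] t by blast
  obtain V where V: "\<forall>j\<le>N. vs.compl ?H ?F j (V j)" "\<forall>i j. i <= j & j <= N --> V j \<subseteq> V i"
   "\<forall>U\<in>t. \<forall>j\<le>N. vs.compl ?H ?F j U --> V j = U" using vs.flag_extend[OF F tf] by (elim exE conjE)
  have "\<exists>g\<in>gen (types_off i0 {}). \<forall>j\<le>N. g ` El i0 j = V j"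
   by (rule flag_transitive[OF i0]) (use V(1,2) in auto)
  then obtain h where h: "h \<in> gen (types_off i0 {})" "\<forall>j\<le>N. h ` El i0 j = V j" by (elim bexE)
  have "types_off i0 {} \<subseteq> {..<N} - {i0}" using off_mod[OF i0] N3 by (auto simp: types_off_def)
  then have hK: "h \<in> ?K" using h(1) gen_mono by blast
  \<comment> \<open>To see that a flag \<open>t\<close> of a cone comes from a face, it is extended
    to a complete opposite flag, which is the translate of the standard one by \<open>h\<close>;
    \<open>?J\<close> collects the colours whose subspaces belong to \<open>t\<close>.\<close>
  let ?J = "{i0} Un {i. i < N & i ~= i0 & W (g0 o h) i \<in> t}"
  have "t = Phi ?J (g0 o h)"
  proof
   show "Phi ?J (g0 o h) \<subseteq> t" unfolding Phi_def by auto
   show "t \<subseteq> Phi ?J (g0 o h)"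
   proof
    fix U assume U: "U \<in> t"
    obtain j where j: "0 < j" "j < N" "vs.compl ?H ?F j U"
     by (rule vs.oppE[OF subsetD[OF vs.flagsD(2)[OF tf] U]])
    let ?i = "(i0 + j) mod N"
    have oi: "off i0 ?i = j" "?i ~= i0" "?i < N" using off_mod[OF i0 j(2,1)] N3 by auto
    have "W (g0 o h) ?i = U" unfolding W_def rg oi(1) using h(2) V(3) U j by simp
    then show "U \<in> Phi ?J (g0 o h)" unfolding Phi_def using oi U by (intro image_eqI[of _ _ ?i]) auto
   qed
  qed
  moreover have "?J \<subseteq> {..<N}" "i0 \<in> ?J" using i0 by auto
  ultimately show "\<exists>J z. J \<subseteq> {..<N} & i0 \<in> J & z \<in> ?X & t = Phi J z" using XI[OF hK] by blast
 next
  fix I x assume I: "I \<subseteq> {..<N}" "i0 \<in> I" "card I < N" and x: "x \<in> ?X"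
  note P = c[OF Phi[OF I x]]
  have "length (c (Phi I x)) <= fill_size N (cone_arg N (card (Phi I x)))" using P by blast
  also have "... <= fill_bound N" unfolding fill_bound_def using Phi(2)[OF I x]
   by (intro member_le_sum) auto
  finally show "length (c (Phi I x)) <= fill_bound N" .
  fix d show "ev (cobd d) (c (Phi I x)) = d (Phi I x) + (\<Sum>w\<in>Phi I x. ev d (c (Phi I x - {w})))" using P by blast
 next
  show "finite ?K" by (rule finite_gen)
  show "?K ~= {}" using gen.id by blast
 next
  fix h assume h: "h \<in> ?K"
  show "inj (image h)" by (rule injI) (simp only: inj_image_eq_iff[OF bij_is_inj[OF gen_bij[OF h]]])
  show "bij_betw (%x. g0 o (h o r x)) ?X ?X"
  proof (rule bij_betw_byWitness[where f' = "%x. g0 o (inv h o r x)"])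
   show "\<forall>x\<in>?X. g0 o (inv h o r (g0 o (h o r x))) = x" by (simp only: rg inv_comp(1)[OF h] gr simp_thms ball_triv)
   show "\<forall>x\<in>?X. g0 o (h o r (g0 o (inv h o r x))) = x" by (simp only: rg inv_comp(2)[OF h] gr simp_thms ball_triv)
   show "(%x. g0 o (h o r x)) ` ?X \<subseteq> ?X" by (intro image_subsetI XI gen_comp[OF rK h])
   show "(%x. g0 o (inv h o r x)) ` ?X \<subseteq> ?X" by (intro image_subsetI XI gen_comp[OF rK gen_inv[OF h]])
  qed
  fix x i assume x: "x \<in> ?X"
  show "W (g0 o (h o r x)) i = h ` W x i" by (simp only: W_def rg image_comp)
 next
  fix x assume x: "x \<in> ?X"
  note rx = rK[OF x]
  show "bij_betw (%h. g0 o (h o r x)) ?K ?X"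
  proof (rule bij_betw_byWitness[where f' = "%y. r y o inv (r x)"])
   show "\<forall>h\<in>?K. r (g0 o (h o r x)) o inv (r x) = h"
    by (simp only: rg comp_assoc gen_inv_simps(4)[OF rx] comp_id simp_thms ball_triv)
   show "\<forall>y\<in>?X. g0 o ((r y o inv (r x)) o r x) = y"
    by (simp only: comp_assoc gen_inv_simps(3)[OF rx] comp_id gr simp_thms ball_triv)
   show "(%h. g0 o (h o r x)) ` ?K \<subseteq> ?X" by (intro image_subsetI XI gen_comp[OF rx])
   show "(%y. r y o inv (r x)) ` ?X \<subseteq> ?K" by (intro image_subsetI gen_comp[OF gen_inv[OF rx] rK])
  qed
 next
  show "ch.cochain m L" "ch.in_star i0 g0 L" "1 <= m" "m < N" using A by auto
 qed
 then show "\<exists>b. ch.cochain (m - 1) b & ch.in_star i0 g0 b &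
   real (ch.wt (ch.cadd L (ch.cob b))) <= real (2 ^ N * fill_bound N) * real (ch.wt (ch.cob L))" .
qed

end

section \<open>Constants of the local-to-global step\<close>

definition vertex_group_bound :: "nat => nat => nat" where
 "vertex_group_bound N p = (2 ^ p ^ N) ^ Suc N"

text \<open>The reciprocal of the factor that has to be absorbed in
  \<open>locmin_cocycle_zero\<close>, with \<open>1\<close> added to the denominator so that the
  product stays strictly below one.\<close>

definition ratio_base :: "nat => real" where
 "ratio_base N = 1 / (4 * real N ^ 2 * (real N * (real (2 ^ N * fill_bound N + 1) * 4 ^ N) ^ N * (2 * real N * real N)) + 1)"

text \<open>The exponents double with each level down because the losses \<open>N / e j\<close> of
  all later levels multiply: \<open>2 ^ n - 1\<close> is the sum of the smaller powers of two, so
  \<open>e l\<close> times the full product of later losses is \<open>N * ratio_base N\<close> at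
  every level.\<close>

definition ratios :: "nat => nat => real" where
 "ratios N l = real N * ratio_base N ^ 2 ^ (N - 1 - l)"

text \<open>Chosen below every value of \<open>ratios N\<close>, so that mixing errors can be
  treated like the fatness thresholds.\<close>

definition mixing_bound :: "nat => real" where
 "mixing_bound N = real N * ratio_base N ^ 2 ^ N"

definition large_field :: "nat => nat => bool" where
 "large_field N p \<longleftrightarrow> (\<forall>k. k + 2 <= N --> fill_field N (cone_arg N k) < p) & real N * (1 / sqrt (real p)) < 1 &
  1 / sqrt (real p) / (1 - real N * (1 / sqrt (real p))) <= mixing_bound N"

lemma reciprocal_Suc:
 fixes A :: real
 assumes "0 <= A"
 shows "0 < 1 / (A + 1)" "1 / (A + 1) <= 1" "A * (1 / (A + 1)) < 1"
 using assms by (simp_all add: field_simps)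

lemma ratio_base: "0 < ratio_base N" "ratio_base N <= 1"
 unfolding ratio_base_def by (rule reciprocal_Suc; simp)+

lemma ratio_product:
 assumes l: "l < m" "m <= N" and N: "N > 0"
 shows "ratios N l * (\<Prod>j\<in>{Suc l..<m}. real N / ratios N j) <= real N * ratio_base N"
proof -
 let ?t = "ratio_base N"
 note t = ratio_base[of N]
 have "(\<Prod>j\<in>{Suc l..<m}. real N / ratios N j) = (\<Prod>j\<in>{Suc l..<m}. inverse ?t ^ 2 ^ (N - 1 - j))"
  using N t by (intro prod.cong) (auto simp: ratios_def field_simps)
 also have "... <= (\<Prod>j\<in>{Suc l..<N}. inverse ?t ^ 2 ^ (N - 1 - j))"
  by (rule prod_mono2) (use t l in \<open>auto intro!: one_le_power one_le_inverse\<close>)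
 also have "... = inverse ?t ^ (\<Sum>j\<in>{Suc l..<N}. 2 ^ (N - 1 - j))" by (rule power_sum[symmetric])
 also have "(\<Sum>j\<in>{Suc l..<N}. 2 ^ (N - 1 - j)) = (2::nat) ^ (N - 1 - l) - 1"
 proof -
  have "(\<Sum>j\<in>{Suc l..<N}. 2 ^ (N - 1 - j)) = (\<Sum>i<N - 1 - l. (2::nat) ^ i)"
   by (rule sum.reindex_bij_witness[of _ "%i. N - 1 - i" "%j. N - 1 - j"]) (use l in auto)
  also have "... = 2 ^ (N - 1 - l) - 1" using mask_eq_sum_exp_nat[of "N - 1 - l"] by (simp add: lessThan_def)
  finally show ?thesis .
 qed
 finally have "ratios N l * (\<Prod>j\<in>{Suc l..<m}. real N / ratios N j) <= ratios N l * inverse ?t ^ (2 ^ (N - 1 - l) - 1)"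
  using t by (intro mult_left_mono) (auto simp: ratios_def)
 also have "... = real N * (?t ^ 2 ^ (N - 1 - l) * inverse ?t ^ (2 ^ (N - 1 - l) - 1))" by (simp add: ratios_def)
 also have "?t ^ 2 ^ (N - 1 - l) = ?t * ?t ^ (2 ^ (N - 1 - l) - 1)" by (simp flip: power_Suc)
 also have "real N * (?t * ?t ^ (2 ^ (N - 1 - l) - 1) * inverse ?t ^ (2 ^ (N - 1 - l) - 1)) = real N * ?t"
  using t by (simp add: power_inverse)
 finally show ?thesis .
qed

lemma ratios_const:
 assumes m: "m <= N" "m >= 1" and lam: "lam <= mixing_bound N"
 shows "real m * (real (2 ^ N * fill_bound N + 1) * 4 ^ N) ^ m *
  (\<Sum>l<m. 2 * real N * real N * (ratios N l + lam) * (\<Prod>j\<in>{Suc l..<m}. real N / ratios N j)) < 1"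
proof -
 let ?B = "real (2 ^ N * fill_bound N + 1) * 4 ^ N" and ?t = "ratio_base N"
 have N: "real N > 0" using m by simp
 note t = ratio_base[of N]
 have B1: "1 <= ?B"
 proof -
  have "1 * 1 <= real (2 ^ N * fill_bound N + 1) * 4 ^ N" by (intro mult_mono) (auto intro: one_le_power)
  then show ?thesis by simp
 qed
 have lr: "lam <= ratios N l" for l
 proof -
  have "N - 1 - l <= N" by simp
  then have "2 ^ (N - 1 - l) <= (2::nat) ^ N" by (rule power_increasing) simp
  then have "?t ^ 2 ^ N <= ?t ^ 2 ^ (N - 1 - l)" by (rule power_decreasing) (use t in auto)
  then have "mixing_bound N <= ratios N l" unfolding mixing_bound_def ratios_def using N by (intro mult_left_mono) auto
  then show ?thesis using lam by simp
 qed
 have "(\<Sum>l<m. 2 * real N * real N * (ratios N l + lam) * (\<Prod>j\<in>{Suc l..<m}. real N / ratios N j)) <=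
  (\<Sum>l<m. 2 * real N * real N * (2 * (real N * ?t)))"
 proof (rule sum_mono)
  fix l assume l: "l \<in> {..<m}"
  let ?P = "\<Prod>j\<in>{Suc l..<m}. real N / ratios N j"
  have P: "?P >= 0" by (rule prod_nonneg) (auto simp: ratios_def t less_imp_le)
  have "(ratios N l + lam) * ?P <= (2 * ratios N l) * ?P" by (rule mult_right_mono[OF _ P]) (use lr[of l] in simp)
  also have "... <= 2 * (real N * ?t)" using ratio_product[of l m N] l m by simp
  finally show "2 * real N * real N * (ratios N l + lam) * ?P <= 2 * real N * real N * (2 * (real N * ?t))"
   unfolding mult.assoc[of "2 * real N * real N"] by (intro mult_left_mono) simp_all
 qed
 also have "... <= real N * (2 * real N * real N * (2 * (real N * ?t)))"
  using m(1) N t by (simp add: mult_right_mono)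
 finally have S: "(\<Sum>l<m. 2 * real N * real N * (ratios N l + lam) * (\<Prod>j\<in>{Suc l..<m}. real N / ratios N j)) <=
  real N * (2 * real N * real N * (2 * (real N * ?t)))" .
 let ?A = "real N * ?B ^ N * (2 * real N * real N)"
 have A: "?A >= 0" using N B1 by simp
 have mB: "real m * ?B ^ m <= real N * ?B ^ N" using m B1 by (intro mult_mono power_increasing) auto
 have "real m * ?B ^ m * (\<Sum>l<m. 2 * real N * real N * (ratios N l + lam) * (\<Prod>j\<in>{Suc l..<m}. real N / ratios N j))
  <= real m * ?B ^ m * (real N * (2 * real N * real N * (2 * (real N * ?t))))"
  by (rule mult_left_mono[OF S]) (use B1 in simp)
 also have "... <= real N * ?B ^ N * (real N * (2 * real N * real N * (2 * (real N * ?t))))"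
  by (rule mult_right_mono[OF mB]) (use N t in simp)
 also have "... = (2 * real N ^ 2 * ?A) * ?t" by (simp add: power2_eq_square mult_ac)
 also have "... <= (4 * real N ^ 2 * ?A) * ?t" using A t by (intro mult_right_mono) auto
 also have "... < 1"
 proof -
  have "0 <= 4 * real N ^ 2 * ?A" using A by simp
  then show ?thesis unfolding ratio_base_def by (rule reciprocal_Suc(3))
 qed
 finally show ?thesis .
qed

lemma card_bounded_support:
 fixes A :: "(nat => 'k::{zero,finite}) set"
 assumes fS: "finite S" and A: "\<And>v m. v \<in> A ==> m \<notin> S ==> v m = 0"
 shows "finite A & card A <= card (UNIV :: 'k set) ^ card S"
proof -
 have inj: "inj_on (%v. restrict v S) A"
 proof (rule inj_onI)
  fix u v assume uv: "u \<in> A" "v \<in> A" "restrict u S = restrict v S"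
  show "u = v"
  proof
   fix m show "u m = v m" using fun_cong[OF uv(3), of m] A[OF uv(1)] A[OF uv(2)] by (cases "m \<in> S") auto
  qed
 qed
 have fin: "finite (PiE S (%_. UNIV :: 'k set))" using fS by (intro finite_PiE) auto
 have sub: "(%v. restrict v S) ` A \<subseteq> PiE S (%_. UNIV)" by auto
 have "card A <= card (PiE S (%_. UNIV :: 'k set))" by (rule card_inj_on_le[OF inj sub fin])
 then show ?thesis using card_PiE[OF fS, of "%_. UNIV :: 'k set"] inj_on_finite[OF inj sub fin] by simp
qed

context affine_group
begin

text \<open>By \<open>flag_free\<close> an element of a vertex stabiliser is determined by the
  images of the \<open>N + 1\<close> standard spaces, each a subset of a block of at most
  \<open>p ^ N\<close> vectors. The bound is crude but does not involve \<open>L\<close>.\<close>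

lemma card_vertex_group:
 assumes i: "i < N"
 shows "card (gen ({..<N} - {i})) <= vertex_group_bound N (card (UNIV :: 'k set))"
proof -
 let ?K = "gen ({..<N} - {i})" and ?B = "Bl i :: (nat => 'k) set"
 have iK: "i \<notin> {..<N} - {i}" by simp
 have B: "finite ?B & card ?B <= card (UNIV :: 'k set) ^ card {i<..i + N}"
  by (rule card_bounded_support) (auto simp: Bl_def Tail_def Head_def)
 have El: "g ` El i j \<subseteq> ?B" if g: "g \<in> ?K" for g j
 proof -
  have "El i j \<subseteq> ?B" by (auto simp: El_def Bl_def Tail_def)
  then have "g ` El i j \<subseteq> g ` ?B" by (rule image_mono)
  then show ?thesis by (simp only: gen_img_Bl[OF i iK g])
 qed
 have inj: "inj_on (%g. \<lambda>j\<in>{..N}. g ` El i j) ?K"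
 proof (rule inj_onI)
  fix g h assume gh: "g \<in> ?K" "h \<in> ?K" "(\<lambda>j\<in>{..N}. g ` El i j) = (\<lambda>j\<in>{..N}. h ` El i j)"
  have "inv g o h = id"
  proof (rule flag_free[OF i iK gen_comp[OF gh(2) gen_inv[OF gh(1)]]])
   fix j assume "j <= N"
   then have e: "g ` El i j = h ` El i j" using fun_cong[OF gh(3), of j] by simp
   have "(inv g o h) ` El i j = inv g ` (g ` El i j)" by (simp only: e image_comp)
   then show "(inv g o h) ` El i j = El i j"
    by (simp only: image_comp gen_inv_simps(3)[OF gh(1)] image_id id_apply)
  qed
  then have "g o (inv g o h) = g o id" by (rule arg_cong)
  then show "g = h" by (simp only: inv_comp(2)[OF gh(1)] comp_id)
 qed
 have "card ?K <= card (PiE {..N} (%_. Pow ?B))"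
 proof (rule card_inj_on_le[OF inj])
  show "(%g. \<lambda>j\<in>{..N}. g ` El i j) ` ?K \<subseteq> PiE {..N} (%_. Pow ?B)"
   by (intro image_subsetI restrict_PiE_iff[THEN iffD2] ballI PowI El)
 qed (use B in \<open>auto intro!: finite_PiE\<close>)
 also have "... = (2 ^ card ?B) ^ Suc N" using B by (simp add: card_PiE card_Pow)
 also have "... <= (2 ^ card (UNIV :: 'k set) ^ N) ^ Suc N"
  using B by (intro power_mono power_increasing) auto
 finally show ?thesis by (simp only: vertex_group_bound_def)
qed

lemma card_cls_vertex:
 assumes i: "i < N" and g: "g \<in> G"
 shows "card (ch.cls {i} g) <= vertex_group_bound N (card (UNIV :: 'k set))"
proof -
 have "card (ch.cls {i} g) <= card (gen ({..<N} - {i}))"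
  unfolding cls_eq_coset[of "{i}" g, OF _ g] by (subst cls_eq_coset[OF _ g]) (use i in \<open>auto intro!: card_image_le finite_gen\<close>)
 then show ?thesis using card_vertex_group[OF i] by simp
qed

text \<open>Connectedness of the complex: multiplying by a generator preserves the vertex of any
  colour different from the type of the generator.\<close>

lemma invariant_imp_constant:
 assumes F: "\<And>i g h. i < N ==> g \<in> G ==> h \<in> G ==> vt i g = vt i h ==> F g = F h" and g: "g \<in> G"
 shows "F g = F id"
proof -
 have "g \<in> G & F g = F id" using g unfolding G_def
 proof (induction rule: gen.induct)
  case id
  show ?case by (rule conjI[OF gen.id refl])
 next
  case (step k l c)
  obtain i where i: "i < N" "i ~= l"
  proof (cases "l = 0")
   case True
   then show ?thesis using that[of 1] N3 by simp
  next
   case False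
   then show ?thesis using that[of 0] N3 by simp
  qed
  have kG: "k \<in> G" "k o Tr l c \<in> G" using step.hyps gen.step[OF step.hyps, of c] by (simp_all only: G_def)
  have "vt i k = vt i (k o Tr l c)"
   unfolding vt_eq[OF kG] inv_comp(1)[OF step.hyps(1)] using step.hyps(2) i by (intro gen_Tr) auto
  then have "F k = F (k o Tr l c)" by (rule F[OF i(1) kG])
  then show ?case using step.IH kG(2) by (simp only: G_def)
 qed
 then show ?thesis by (rule conjunct2)
qed

lemma expansion:
 fixes a :: "nat set => ((nat => 'k) => nat => 'k) => bit"
 defines "p \<equiv> card (UNIV :: 'k set)"
 assumes fld: "large_field N p" and m: "2 <= m" "m < N" and a: "ch.cochain m a" "\<And>J g. ch.cob a J g = 0"
  and small: "(\<Prod>j\<in>{1..<m}. real N / ratios N j) * real (ch.wt a) < ratios N 0 * real (card G)"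
 shows "\<exists>h. ch.cochain (m - 1) h & a = ch.cob h & ch.wt h <= (2 ^ N * vertex_group_bound N p + 1) * ch.wt a"
proof (rule ch.small_cocycle_filling[OF a _ _ m])
 let ?l = "1 / sqrt (real p)"
 let ?lam = "?l / (1 - real N * ?l)"
 have l: "?l >= 0" "real N * ?l < 1" using fld unfolding large_field_def by auto
 have "ch.star_expansion (real (2 ^ N * fill_bound N))"
  by (rule star_expansion) (use fld in \<open>simp add: large_field_def p_def\<close>)
 then show "ch.star_expansion (real (2 ^ N * fill_bound N + 1))"
  unfolding ch.star_expansion_def
  by (meson order_trans mult_right_mono of_nat_0_le_iff of_nat_mono le_add1)
 show "ch.mixing ?lam"
 proof (rule ch.mixing_from_links[OF _ _ _ l])
  show "ch.angle C i j x ?l" if "C \<subseteq> {..<N}" "card C + 2 = N" "x \<in> G" "i < N" "j < N" "i ~= j" "i \<notin> C" "j \<notin> C" for C x i j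
   unfolding p_def by (rule base_angle[OF that])
  show "(x, y) \<in> (ch.stepr C i j)\<^sup>*"
   if "C \<subseteq> {..<N}" "card C + 3 <= N" "x \<in> G" "y \<in> ch.cls C x" "i < N" "j < N" "i ~= j" "i \<notin> C" "j \<notin> C" for C x y i j
   by (rule connected_steps[OF that(1,3,4,5,6,7)])
 qed (use N3 in simp)
 show "?lam >= 0" using l by simp
 show "ratios N l > 0" for l using ratio_base N3 by (simp add: ratios_def)
 show "1 <= real (2 ^ N * fill_bound N + 1)" by simp
 show "(\<Prod>j\<in>{1..<m}. real N / ratios N j) * real (ch.wt a) < ratios N 0 * real (card G)" by (rule small)
 show "real m * (real (2 ^ N * fill_bound N + 1) * 4 ^ N) ^ m *
  (\<Sum>l<m. 2 * real N * real N * (ratios N l + ?lam) * (\<Prod>j\<in>{Suc l..<m}. real N / ratios N j)) < 1"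
  by (rule ratios_const) (use m fld in \<open>auto simp: large_field_def\<close>)
 show "2 ^ N * card (ch.cls {i} g) < 2 ^ N * vertex_group_bound N p + 1" if "i < N" "g \<in> G" for i g
  using card_cls_vertex[OF that] unfolding p_def by (simp add: less_Suc_eq_le)
qed

text \<open>Generators push the last unit vector down one coordinate at a time, and the lowest
  nonzero coordinate of its image tells the resulting \<open>L\<close> elements apart.\<close>

lemma card_G_ge: "L <= card G"
proof -
 have ex: "\<exists>g\<in>G. g (unit_vec (L - 1)) (L - 1 - n) ~= 0 & (\<forall>m < L - 1 - n. g (unit_vec (L - 1)) m = 0)" if "n < L" for n
  using that
 proof (induction n)
  case 0
  show ?case unfolding G_def by (rule bexI[of _ id]) (auto simp: unit_vec_def gen.id)
 next
  case (Suc n)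
  then obtain g where g: "g \<in> G" "g (unit_vec (L - 1)) (L - 1 - n) ~= 0" "\<forall>m < L - 1 - n. g (unit_vec (L - 1)) m = 0" by auto
  let ?i = "(L - 1 - Suc n) mod N"
  have k: "Suc (L - 1 - Suc n) = L - 1 - n" using Suc.prems by simp
  have "Tr ?i 1 o g \<in> G" unfolding G_def
   by (rule gen_comp) (use g(1) N3 in \<open>auto simp: G_def intro!: gen_Tr\<close>)
  moreover have "Tr ?i 1 (g (unit_vec (L - 1))) (L - 1 - Suc n) ~= 0"
   using g k Suc.prems by (auto simp: Tr_def)
  moreover have "\<forall>m < L - 1 - Suc n. Tr ?i 1 (g (unit_vec (L - 1))) m = 0" using g(3) by (auto simp: Tr_def)
  ultimately show ?case by (intro bexI[of _ "Tr ?i 1 o g"]) auto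
 qed
 have "\<forall>n\<in>{..<L}. \<exists>g. g \<in> G & g (unit_vec (L - 1)) (L - 1 - n) ~= 0 & (\<forall>m < L - 1 - n. g (unit_vec (L - 1)) m = 0)"
  using ex by blast
 then obtain f where f: "\<And>n. n < L ==> f n \<in> G & f n (unit_vec (L - 1)) (L - 1 - n) ~= 0 & (\<forall>m < L - 1 - n. f n (unit_vec (L - 1)) m = 0)"
  using bchoice[of "{..<L}"] by (metis lessThan_iff)
 have "inj_on f {..<L}"
 proof (rule linorder_inj_onI)
  fix x y assume xy: "x < y" "x \<in> {..<L}" "y \<in> {..<L}"
  then have "L - 1 - y < L - 1 - x" by auto
  then have "f x (unit_vec (L - 1)) (L - 1 - y) = 0" using f[of x] xy by auto
  then show "f x ~= f y" using f[of y] xy by auto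
 qed auto
 moreover have "f ` {..<L} \<subseteq> G" using f by auto
 ultimately have "card {..<L} <= card G" by (rule card_inj_on_le) (rule ch.finG)
 then show ?thesis by simp
qed

end

text \<open>On \<open>Head L\<close> an element of the larger group acts like one of the smaller.
  Together with this action, the first \<open>N\<close> coordinates of the image of
  \<open>unit_vec L\<close> determine the element, because the other coordinates follow by shifting.
  Slow growth in \<open>L\<close> is what bounds the ratios of the sizes of the complexes.\<close>

lemma card_gen_Suc:
 fixes N L :: nat and ty :: "'k::{field,finite} itself"
 assumes "affine_group N L"
 shows "card (affine_group.gen N (Suc L) J :: ((nat => 'k) => _) set) <=
  card (UNIV :: 'k set) ^ N * card (affine_group.gen N L J :: ((nat => 'k) => _) set)"
proof -
 interpret a: affine_group N L "TYPE('k)" by (rule assms)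
 interpret b: affine_group N "Suc L" "TYPE('k)" using a.N3 a.L by unfold_locales auto
 have "\<exists>g'\<in>a.gen J. \<forall>v\<in>Head L. g v = g' v" if "g \<in> b.gen J" for g
  using that
 proof (induction)
  case id
  show ?case by (rule bexI[OF _ a.gen.id]) simp
 next
  case (step g i c)
  then obtain g' where g': "g' \<in> a.gen J" "\<forall>v\<in>Head L. g v = g' v" by (elim bexE)
  have T: "b.Tr i c v = a.Tr i c v" if "v \<in> Head L" for v :: "nat => 'k"
   using that by (auto simp: Head_def a.Tr_def b.Tr_def fun_eq_iff)
  have H: "a.Tr i c v \<in> Head L" if "v \<in> Head L" for v
   using a.gen_Head[OF a.gen_Tr[of i "{i}" c] that] by simp
  show ?case
  proof (rule bexI[OF _ a.gen.step[OF g'(1) step.hyps(2)]], rule ballI)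
   fix v :: "nat => 'k" assume v: "v \<in> Head L"
   show "(g o b.Tr i c) v = (g' o a.Tr i c) v" unfolding comp_apply T[OF v] by (rule bspec[OF g'(2) H[OF v]])
  qed
 qed
 then obtain \<rho> where r: "\<And>g. g \<in> b.gen J ==> \<rho> g \<in> a.gen J & (\<forall>v\<in>Head L. g v = \<rho> g v)" by metis
 let ?e = "unit_vec L :: nat => 'k"
 let ?f = "%g. (restrict (g ?e) {..<N}, \<rho> g)"
 have inj: "inj_on ?f (b.gen J)"
 proof (rule inj_onI)
  fix g h assume g: "g \<in> b.gen J" and h: "h \<in> b.gen J" and e: "?f g = ?f h"
  have agree: "g v = h v" if v: "v \<in> Head L" for v
  proof -
   have "g v = \<rho> g v" "h v = \<rho> h v" using r[OF g] r[OF h] v by auto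
   then show ?thesis using e by simp
  qed
  have ge: "g ?e = h ?e"
  proof
   fix m
   show "g ?e m = h ?e m"
   proof (cases "m < N")
    case True
    have "restrict (g ?e) {..<N} m = restrict (h ?e) {..<N} m" using e by simp
    then show ?thesis using True by simp
   next
    case False
    have eH: "?e \<in> Head (Suc L)" by (auto simp: unit_vec_def Head_def)
    have "(%m. ?e (m + N)) \<in> Head L" using a.N3 by (auto simp: unit_vec_def Head_def)
    then have "g (%m. ?e (m + N)) = h (%m. ?e (m + N))" by (rule agree)
    then have "(%m. g ?e (m + N)) = (%m. h ?e (m + N))" by (simp only: b.gen_shift[OF g eH] b.gen_shift[OF h eH])
    then have "g ?e ((m - N) + N) = h ?e ((m - N) + N)" by (rule fun_cong)
    then show ?thesis using False by simp
   qed
  qed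
  show "g = h"
  proof
   fix v :: "nat => 'k"
   let ?a = "%m. if m < L then v m else 0" and ?b = "fscale (v L) ?e" and ?c = "%m. if m < Suc L then 0 else v m"
   have v: "v = ?a + (?b + ?c)"
   proof
    fix m show "v m = (?a + (?b + ?c)) m" by (cases m L rule: linorder_cases) (auto simp: fscale_def unit_vec_def)
   qed
   have "g ?a = h ?a" by (rule agree) (auto simp: Head_def)
   moreover have "g ?b = h ?b" by (simp only: b.gen_scale[OF g] b.gen_scale[OF h] ge)
   moreover have "g ?c = ?c" "h ?c = ?c" by (rule b.gen_fix[OF g] b.gen_fix[OF h]; simp)+
   ultimately show "g v = h v" by (subst (1 2) v) (simp only: b.gen_add[OF g] b.gen_add[OF h])
  qed
 qed
 have "card (b.gen J) <= card (PiE {..<N} (%_. UNIV :: 'k set) \<times> a.gen J)"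
 proof (rule card_inj_on_le[OF inj])
  show "?f ` b.gen J \<subseteq> PiE {..<N} (%_. UNIV) \<times> a.gen J" using r by (intro image_subsetI SigmaI) auto
 qed (auto intro!: finite_PiE a.finite_gen)
 then show ?thesis by (simp add: card_cartesian_product card_PiE)
qed

section \<open>Overlap from fillings of cocycles\<close>

definition skip :: "nat => nat => nat" where
 "skip k i = (if i < k then i else Suc i)"

definition dec :: "'q => ('q => int) => 'q => int" where
 "dec i a = a(i := a i - 1)"

text \<open>The cochain of a half space: its coboundary is dual to the hyperplane between the labels
  \<open>b\<close> and \<open>b + 1\<close>, and its sum with the one for \<open>b - 1\<close> is
  the indicator of the label \<open>b\<close>.\<close>

definition below :: "int => int => bit" where
 "below b t = (if t <= b then 1 else 0)"

text \<open>The grid cochain dual to the cell which lies in the hyperplane of label \<open>a i\<close> for \<open>i \<notin> S\<close> and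
 crosses it for \<open>i \<in> S\<close>: an iterated cup product, evaluated on the simplex with labels \<open>x 0, x 1, ...\<close>.\<close>

primrec grid :: "'q list => 'q set => ('q => int) => (nat => 'q => int) => bit" where
 "grid [] S a x = 1"
| "grid (c # cs) S a x = grid cs S a x *
  (if c \<in> S then below (a c) (x (card (S Int set cs)) c) + below (a c) (x (Suc (card (S Int set cs))) c)
  else below (a c) (x (card (S Int set cs)) c) + below (a c - 1) (x (card (S Int set cs)) c))"

lemma card_Int_Cons:
 "distinct (c # cs) ==> card (S Int set (c # cs)) = (if c \<in> S then Suc (card (S Int set cs)) else card (S Int set cs))"
 by simp

lemma grid_cong:
 "distinct cs ==> (\<And>i. i <= card (S Int set cs) ==> x i = y i) ==> (\<And>i. i \<in> set cs ==> a i = b i & (i \<in> S \<longleftrightarrow> i \<in> T)) ==>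
  grid cs S a x = grid cs T b y"
proof (induction cs)
 case (Cons c cs)
 have ST: "S Int set cs = T Int set cs" using Cons.prems(3) by auto
 note n = card_Int_Cons[OF Cons.prems(1), of S]
 have "grid cs S a x = grid cs T b y" using Cons.prems n by (intro Cons.IH) (auto split: if_splits)
 then show ?case using Cons.prems n ST by (auto split: if_splits)
qed simp

text \<open>The Leibniz rule for the cup product. Factors with coordinate in \<open>S\<close> are
  coboundaries and contribute nothing; the factor of a coordinate outside \<open>S\<close> is the
  indicator of a slab, and its coboundary is the sum of the two bounding hyperplanes, labelled by
  \<open>a\<close> and \<open>dec i a\<close>.\<close>

lemma grid_coboundary:
 assumes "distinct cs"
 shows "(\<Sum>k\<le>Suc (card (S Int set cs)). grid cs S a (x o skip k)) =
  (\<Sum>i\<in>set cs - S. grid cs (insert i S) a x + grid cs (insert i S) (dec i a) x)"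
 using assms
proof (induction cs)
 case Nil
 then show ?case by simp
next
 case (Cons c cs)
 let ?n = "card (S Int set cs)"
 have d: "distinct cs" "c \<notin> set cs" using Cons.prems by auto
 have IH: "(\<Sum>k\<le>Suc ?n. grid cs S a (x o skip k)) =
  (\<Sum>i\<in>set cs - S. grid cs (insert i S) a x + grid cs (insert i S) (dec i a) x)" by (rule Cons.IH[OF d(1)])
 \<comment> \<open>The front factor reads only the vertices up to index \<open>?n\<close>, so
   omitting a later one does not change it.\<close>
 have last: "grid cs S a (x o skip k) = grid cs S a x" if "k > ?n" for k
  by (rule grid_cong[OF d(1)]) (use that in \<open>auto simp: skip_def\<close>)
 have n1: "card (insert i S Int set cs) = Suc ?n" if "i \<in> set cs - S" for i
  using that by (simp add: Int_insert_left)
 define w where "w = (%n. if c \<in> S then below (a c) (x n c) + below (a c) (x (Suc n) c) else below (a c) (x n c) + below (a c - 1) (x n c))"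
 have step: "grid (c # cs) (insert i S) b x = grid cs (insert i S) b x * w (Suc ?n)"
  if "i \<in> set cs - S" "b = a \<or> b = dec i a" for i b
  using n1[OF that(1)] that d(2) by (auto simp: w_def dec_def)
 have old: "(\<Sum>i\<in>set cs - S. grid (c # cs) (insert i S) a x + grid (c # cs) (insert i S) (dec i a) x) =
  (\<Sum>k\<le>Suc ?n. grid cs S a (x o skip k)) * w (Suc ?n)"
  unfolding IH sum_distrib_right by (rule sum.cong) (simp_all only: step distrib_right simp_thms)
 show ?case
 proof (cases "c \<in> S")
  case True
  have "(\<Sum>k\<le>Suc (card (S Int set (c # cs))). grid (c # cs) S a (x o skip k)) =
   (\<Sum>k\<le>?n. grid (c # cs) S a (x o skip k)) + grid (c # cs) S a (x o skip (Suc ?n)) + grid (c # cs) S a (x o skip (Suc (Suc ?n)))"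
   using True d by simp
  also have "(\<Sum>k\<le>?n. grid (c # cs) S a (x o skip k)) = (\<Sum>k\<le>?n. grid cs S a (x o skip k)) * w (Suc ?n)"
   unfolding sum_distrib_right by (rule sum.cong) (use True in \<open>auto simp: skip_def w_def\<close>)
  also have "... + grid (c # cs) S a (x o skip (Suc ?n)) + grid (c # cs) S a (x o skip (Suc (Suc ?n))) =
   (\<Sum>k\<le>?n. grid cs S a (x o skip k)) * w (Suc ?n) + grid cs S a x *
   ((below (a c) (x ?n c) + below (a c) (x (Suc (Suc ?n)) c)) + (below (a c) (x ?n c) + below (a c) (x (Suc ?n) c)))"
   using True by (simp add: last distrib_left add.assoc) (simp add: skip_def)
  also have "(below (a c) (x ?n c) + below (a c) (x (Suc (Suc ?n)) c)) + (below (a c) (x ?n c) + below (a c) (x (Suc ?n) c)) =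
   (below (a c) (x ?n c) + below (a c) (x ?n c)) + w (Suc ?n)"
   using True by (simp only: w_def if_True add_ac)
  also have "(\<Sum>k\<le>?n. grid cs S a (x o skip k)) * w (Suc ?n) + grid cs S a x * (below (a c) (x ?n c) + below (a c) (x ?n c) + w (Suc ?n)) =
   (\<Sum>k\<le>Suc ?n. grid cs S a (x o skip k)) * w (Suc ?n)"
   using last[of "Suc ?n"] by (simp add: distrib_right)
  also have "... = (\<Sum>i\<in>set (c # cs) - S. grid (c # cs) (insert i S) a x + grid (c # cs) (insert i S) (dec i a) x)"
   using old True by (simp add: insert_Diff_if)
  finally show ?thesis .
 next
  case False
  have "(\<Sum>k\<le>Suc (card (S Int set (c # cs))). grid (c # cs) S a (x o skip k)) =
   (\<Sum>k\<le>?n. grid (c # cs) S a (x o skip k)) + grid (c # cs) S a (x o skip (Suc ?n))"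
   using False d by simp
  also have "(\<Sum>k\<le>?n. grid (c # cs) S a (x o skip k)) = (\<Sum>k\<le>?n. grid cs S a (x o skip k)) * w (Suc ?n)"
   unfolding sum_distrib_right by (rule sum.cong) (use False in \<open>auto simp: skip_def w_def\<close>)
  also have "grid (c # cs) S a (x o skip (Suc ?n)) = grid cs S a x * (below (a c) (x ?n c) + below (a c - 1) (x ?n c))"
   using False by (simp add: last) (simp add: skip_def)
  also have "(\<Sum>k\<le>?n. grid cs S a (x o skip k)) * w (Suc ?n) + grid cs S a x * (below (a c) (x ?n c) + below (a c - 1) (x ?n c)) =
   (\<Sum>k\<le>Suc ?n. grid cs S a (x o skip k)) * w (Suc ?n) + grid cs S a x * (below (a c) (x ?n c) + below (a c - 1) (x ?n c) + w (Suc ?n))"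
  proof -
   have *: "A * w (Suc ?n) + B * C = (A + B) * w (Suc ?n) + B * (C + w (Suc ?n))" for A B C :: bit
   proof -
    have "(A + B) * w (Suc ?n) + B * (C + w (Suc ?n)) = A * w (Suc ?n) + B * C + (B * w (Suc ?n) + B * w (Suc ?n))"
     by (simp only: distrib_left distrib_right add_ac)
    then show ?thesis by (simp only: bit_add_self add_0_right)
   qed
   have e: "(\<Sum>k\<le>Suc ?n. grid cs S a (x o skip k)) = (\<Sum>k\<le>?n. grid cs S a (x o skip k)) + grid cs S a x"
    using last[of "Suc ?n"] by simp
   show ?thesis unfolding e by (rule *)
  qed
  also have "below (a c) (x ?n c) + below (a c - 1) (x ?n c) + w (Suc ?n) =
   (below (a c) (x ?n c) + below (a c) (x (Suc ?n) c)) + (below (a c - 1) (x ?n c) + below (a c - 1) (x (Suc ?n) c))"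
   using False by (simp add: w_def add_ac)
  also have "grid cs S a x * ... = grid (c # cs) (insert c S) a x + grid (c # cs) (insert c S) (dec c a) x"
  proof -
   have "card (insert c S Int set cs) = ?n" using d(2) by simp
   moreover have "grid cs (insert c S) b x = grid cs S a x" if "b = a \<or> b = dec c a" for b
    by (rule grid_cong[OF d(1)]) (use that d(2) in \<open>auto simp: dec_def\<close>)
   ultimately show ?thesis by (simp add: dec_def distrib_left)
  qed
  also have "(\<Sum>k\<le>Suc ?n. grid cs S a (x o skip k)) * w (Suc ?n) +
   (grid (c # cs) (insert c S) a x + grid (c # cs) (insert c S) (dec c a) x) =
   (\<Sum>i\<in>set (c # cs) - S. grid (c # cs) (insert i S) a x + grid (c # cs) (insert i S) (dec i a) x)"
   using False d(2) unfolding old[symmetric] by (simp add: insert_Diff_if add_ac)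
  finally show ?thesis .
 qed
qed

lemma grid_local:
 assumes "distinct cs" "grid cs S a x ~= 0" "\<And>i j c. i <= card (S Int set cs) ==> j <= card (S Int set cs) ==> c \<in> set cs ==> \<bar>x i c - x j c\<bar> <= 1"
  and c: "c \<in> set cs"
 shows "\<bar>x 0 c - a c\<bar> <= 1"
 using assms
proof (induction cs)
 case (Cons b cs)
 have le: "card (S Int set cs) <= card (S Int set (b # cs))" by (rule card_mono) auto
 show ?case
 proof (cases "c = b")
  case False
  show ?thesis using Cons.prems False le by (intro Cons.IH) auto
 next
  case True
  let ?n = "card (S Int set cs)"
  have x: "\<bar>x 0 c - x ?n c\<bar> <= 1" using Cons.prems(3)[of 0 ?n c] le True by simp
  show ?thesis
  proof (cases "b \<in> S")
   case True
   have S: "Suc ?n <= card (S Int set (b # cs))" using True Cons.prems(1) by simp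
   have "below (a b) (x ?n b) ~= below (a b) (x (Suc ?n) b)" using Cons.prems(2) True by auto
   moreover have "\<bar>x 0 b - x (Suc ?n) b\<bar> <= 1" "\<bar>x ?n b - x (Suc ?n) b\<bar> <= 1"
    using Cons.prems(3)[of 0 "Suc ?n" b] Cons.prems(3)[of ?n "Suc ?n" b] S by auto
   ultimately show ?thesis using x \<open>c = b\<close> by (auto simp: below_def split: if_splits)
  next
   case F: False
   have "below (a b) (x ?n b) ~= below (a b - 1) (x ?n b)" using Cons.prems(2) F by auto
   then show ?thesis using x \<open>c = b\<close> by (auto simp: below_def split: if_splits)
  qed
 qed
qed simp

lemma grid_vertex: "distinct cs ==> grid cs {} a x = (if \<forall>c\<in>set cs. x 0 c = a c then 1 else 0)"
 by (induction cs) (auto simp: below_def)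

text \<open>Evaluation mod 2 of an integral chain, so that integral singular chains and their
  subdivisions can be used with coefficients in \<open>bit\<close>.\<close>

definition pair :: "('s => bit) => ('s \<Rightarrow>\<^sub>0 int) => bit" where
 "pair w c = (\<Sum>s\<in>Poly_Mapping.keys c. of_int (Poly_Mapping.lookup c s) * w s)"

lemma pair_eq: "finite A ==> Poly_Mapping.keys c \<subseteq> A ==> pair w c = (\<Sum>s\<in>A. of_int (Poly_Mapping.lookup c s) * w s)"
 unfolding pair_def by (rule sum.mono_neutral_left) (auto simp: in_keys_iff)

lemma pair_0 [simp]: "pair w 0 = 0"
 by (simp add: pair_def)

lemma pair_of [simp]: "pair w (frag_of s) = w s"
 by (simp add: pair_def)

lemma pair_add: "pair w (c + d) = pair w c + pair w d"
proof -
 let ?A = "Poly_Mapping.keys c Un Poly_Mapping.keys d"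
 have "pair w (c + d) = (\<Sum>s\<in>?A. of_int (Poly_Mapping.lookup (c + d) s) * w s)"
  by (rule pair_eq) (auto dest: subsetD[OF keys_add])
 also have "... = pair w c + pair w d"
  by (simp add: pair_eq[of ?A c] pair_eq[of ?A d] lookup_add sum.distrib distrib_right)
 finally show ?thesis .
qed

lemma pair_uminus: "pair w (- c) = pair w c"
 using pair_add[of w c "-c"] by (cases "pair w c"; cases "pair w (-c)") auto

lemma pair_diff: "pair w (c - d) = pair w c + pair w d"
 using pair_add[of w c "- d"] by (simp add: pair_uminus)

lemma pair_sign: "pair w (frag_cmul ((-1) ^ k) c) = pair w c"
 by (cases "even k") (simp_all add: pair_uminus)

lemma pair_sum: "finite A ==> pair w (sum c A) = (\<Sum>i\<in>A. pair w (c i))"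
 by (induction A rule: finite_induct) (simp_all add: pair_add)

lemma pair_cong: "(\<And>s. s \<in> Poly_Mapping.keys c ==> w s = w' s) ==> pair w c = pair w' c"
 unfolding pair_def by (rule sum.cong) auto

lemma pair_fun_sum: "pair (%s. \<Sum>i\<in>A. w i s) c = (\<Sum>i\<in>A. pair (w i) c)"
 unfolding pair_def by (simp add: sum_distrib_left) (rule sum.swap)

lemma pair_fun_add: "pair (%s. w s + w' s) c = pair w c + pair w' c"
 unfolding pair_def by (simp add: distrib_left sum.distrib)

lemma pair_nonzero: "pair w c ~= 0 ==> \<exists>s\<in>Poly_Mapping.keys c. w s ~= 0"
 unfolding pair_def by (metis (no_types, lifting) mult_zero_right sum.neutral)

lemma pair_chain_boundary:
 "pair w (chain_boundary (Suc p) c) = pair (%s. \<Sum>k\<le>Suc p. w (singular_face (Suc p) k s)) c"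
 using subset_UNIV
proof (induction c rule: frag_induction)
 case (one s)
 show ?case by (simp add: chain_boundary_of pair_sum pair_sign del: sum.atMost_Suc)
next
 case (diff a b)
 then show ?case by (simp add: chain_boundary_diff pair_diff del: sum.atMost_Suc)
qed simp

section \<open>Singular simplices of a map on a complex\<close>

definition corner :: "nat => nat => real" where
 "corner i = (%j. if j = i then 1 else 0)"

lemma corner_simplex: "i <= p ==> corner i \<in> standard_simplex p"
 unfolding corner_def by simp

lemma face_corner: "i <= p ==> singular_face (Suc p) k s (corner i) = s (corner (skip k i))"
proof -
 assume "i <= p"
 moreover have "simplical_face k (corner i) = (corner (skip k i))"
  by (auto simp: simplical_face_def corner_def skip_def fun_eq_iff)
 ultimately show ?thesis using corner_simplex[of i p] by (simp add: singular_face_def)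
qed

lemma complex_face: "simplicial_complex Z ==> U \<in> Z ==> V \<subseteq> U ==> V ~= {} ==> V \<in> Z"
 unfolding simplicial_complex_def by blast

lemma complex_simplex: "simplicial_complex Z ==> U \<in> Z ==> finite U & U ~= {}"
 unfolding simplicial_complex_def by blast

definition sv :: "nat set => nat => nat" where
 "sv \<sigma> i = sorted_list_of_set \<sigma> ! i"

lemma sv_bij: "finite \<sigma> ==> bij_betw (sv \<sigma>) {..<card \<sigma>} \<sigma>"
 unfolding sv_def using bij_betw_nth[of "sorted_list_of_set \<sigma>" "{..<card \<sigma>}" \<sigma>] by simp

lemma sv_remove:
 assumes fin: "finite \<sigma>" and k: "k < card \<sigma>" and i: "i < card \<sigma> - 1"
 shows "sv (\<sigma> - {sv \<sigma> k}) i = sv \<sigma> (skip k i)"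
proof -
 let ?xs = "sorted_list_of_set \<sigma>"
 have l: "length ?xs = card \<sigma>" by simp
 have "sorted_list_of_set (\<sigma> - {?xs ! k}) = remove1 (?xs ! k) ?xs" using fin by (rule sorted_list_of_set_remove)
 also have "... = take k ?xs @ drop (Suc k) ?xs"
 proof -
  have "?xs = take k ?xs @ ?xs ! k # drop (Suc k) ?xs" using k by (intro id_take_nth_drop) simp
  moreover have "?xs ! k \<notin> set (take k ?xs)"
  proof
   assume "?xs ! k \<in> set (take k ?xs)"
   then obtain j where j: "j < k" "?xs ! j = ?xs ! k" using k by (auto simp: in_set_conv_nth)
   then show False using nth_eq_iff_index_eq[of ?xs j k] k l by simp
  qed
  ultimately show ?thesis by (metis remove1.simps(2) remove1_append)
 qed
 finally have "sorted_list_of_set (\<sigma> - {?xs ! k}) = take k ?xs @ drop (Suc k) ?xs" .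
 then show ?thesis using k i l by (simp add: sv_def skip_def nth_append)
qed

definition bary :: "nat set => (nat => real) => nat => real" where
 "bary \<sigma> t = (%v. \<Sum>i<card \<sigma>. if sv \<sigma> i = v then t i else 0)"

lemma bary_sv:
 assumes "finite \<sigma>" "i < card \<sigma>"
 shows "bary \<sigma> t (sv \<sigma> i) = t i"
proof -
 have "bary \<sigma> t (sv \<sigma> i) = (\<Sum>j<card \<sigma>. if j = i then t j else 0)"
  unfolding bary_def using sv_bij[OF assms(1)] assms(2)
  by (intro sum.cong) (auto simp: bij_betw_def inj_on_def)
 then show ?thesis using assms(2) by simp
qed

lemma bary_outside: "finite \<sigma> ==> v \<notin> \<sigma> ==> bary \<sigma> t v = 0"
 unfolding bary_def using sv_bij[of \<sigma>] by (intro sum.neutral) (auto simp: bij_betw_def)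

lemma bary_closed_simplex:
 assumes Z: "simplicial_complex Z" and s: "\<sigma> \<in> Z" "card \<sigma> = Suc p" and t: "t \<in> standard_simplex p"
 shows "bary \<sigma> t \<in> closed_simplex Z \<sigma>"
proof -
 have fin: "finite \<sigma>" using complex_simplex[OF Z s(1)] by simp
 have nn: "0 <= bary \<sigma> t v" for v unfolding bary_def using t by (intro sum_nonneg) (auto simp: standard_simplex_def)
 have sub: "supp (bary \<sigma> t) \<subseteq> \<sigma>" unfolding supp_def using bary_outside[OF fin] by auto
 have "sum (bary \<sigma> t) (supp (bary \<sigma> t)) = sum (bary \<sigma> t) \<sigma>"
  by (rule sum.mono_neutral_left[OF fin sub]) (auto simp: supp_def)
 also have "... = (\<Sum>i<card \<sigma>. bary \<sigma> t (sv \<sigma> i))" by (rule sum.reindex_bij_betw[symmetric, OF sv_bij[OF fin]])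
 also have "... = (\<Sum>i<card \<sigma>. t i)" by (rule sum.cong) (simp_all add: bary_sv[OF fin])
 also have "... = 1" using t s(2) by (simp add: standard_simplex_def lessThan_Suc_atMost)
 finally have one: "sum (bary \<sigma> t) (supp (bary \<sigma> t)) = 1" .
 then have "supp (bary \<sigma> t) ~= {}" by auto
 then have "supp (bary \<sigma> t) \<in> Z" by (rule complex_face[OF Z s(1) sub])
 then show ?thesis using nn sub one unfolding closed_simplex_def realisation_def by blast
qed

lemma bary_face:
 assumes fin: "finite \<sigma>" and c: "card \<sigma> = Suc (Suc p)" and k: "k <= Suc p"
 shows "bary \<sigma> (simplical_face k t) = bary (\<sigma> - {sv \<sigma> k}) t"
proof
 fix v
 let ?\<rho> = "\<sigma> - {sv \<sigma> k}"
 have sk: "sv \<sigma> k \<in> \<sigma>" using sv_bij[OF fin] k c by (auto simp: bij_betw_def)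
 have cr: "card ?\<rho> = Suc p" using sk fin c by simp
 show "bary \<sigma> (simplical_face k t) v = bary ?\<rho> t v"
 proof (cases "v \<in> ?\<rho>")
  case True
  have "v \<in> sv ?\<rho> ` {..<Suc p}" using True sv_bij[of ?\<rho>] fin cr unfolding bij_betw_def by simp
  then obtain i where i: "i < Suc p" "v = sv ?\<rho> i" by auto
  have vi: "v = sv \<sigma> (skip k i)" using i sv_remove[OF fin, of k i] k c by simp
  have "bary \<sigma> (simplical_face k t) v = simplical_face k t (skip k i)"
   unfolding vi by (rule bary_sv[OF fin]) (use i c in \<open>auto simp: skip_def\<close>)
  also have "... = t i" by (auto simp: simplical_face_def skip_def)
  also have "... = bary ?\<rho> t v" unfolding i(2) by (rule bary_sv[symmetric]) (use fin i cr in auto)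
  finally show ?thesis .
 next
  case False
  then have r: "bary ?\<rho> t v = 0" using bary_outside[of ?\<rho>] fin by simp
  show ?thesis
  proof (cases "v = sv \<sigma> k")
   case True
   then show ?thesis using bary_sv[OF fin, of k] k c r by (simp add: simplical_face_def)
  next
   case False
   then show ?thesis using \<open>v \<notin> ?\<rho>\<close> bary_outside[OF fin] r by simp
  qed
 qed
qed

definition sing :: "((nat => real) => 'b) => nat set => (nat => real) => 'b" where
 "sing f \<sigma> = restrict (f o bary \<sigma>) (standard_simplex (card \<sigma> - 1))"

lemma sing_simplex:
 fixes f :: "(nat => real) => 'b::topological_space"
 assumes Z: "simplicial_complex Z" and s: "\<sigma> \<in> Z" "card \<sigma> = Suc p" and f: "continuous_on (realisation Z) f"
 shows "singular_simplex p (top_of_set (f ` closed_simplex Z \<sigma>)) (sing f \<sigma>)"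
proof -
 have "continuous_on (standard_simplex p) (%t. if sv \<sigma> i = v then t i else 0)" for i v
  by (cases "sv \<sigma> i = v") (auto intro: continuous_on_subset[OF continuous_on_product_coordinates])
 then have cb: "continuous_on (standard_simplex p) (bary \<sigma>)"
  unfolding bary_def by (intro continuous_on_coordinatewise_then_product continuous_on_sum)
 have "continuous_on (closed_simplex Z \<sigma>) f"
  by (rule continuous_on_subset[OF f]) (auto simp: closed_simplex_def)
 then have "continuous_on (standard_simplex p) (f o bary \<sigma>)"
  using bary_closed_simplex[OF Z s] by (intro continuous_on_compose cb) (auto elim: continuous_on_subset)
 then have "continuous_on (standard_simplex p) (sing f \<sigma>)"
  by (rule continuous_on_eq) (simp add: sing_def s(2))
 moreover have "sing f \<sigma> ` standard_simplex p \<subseteq> f ` closed_simplex Z \<sigma>"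
  using bary_closed_simplex[OF Z s] by (auto simp: sing_def s(2))
 ultimately show ?thesis
  unfolding singular_simplex_def euclidean_product_topology
  by (simp add: continuous_map_in_subtopology image_subset_iff sing_def s(2) Pi_iff)
qed

lemma sing_face:
 assumes "finite \<tau>" "card \<tau> = Suc (Suc p)" "k <= Suc p"
 shows "singular_face (Suc p) k (sing f \<tau>) = sing f (\<tau> - {sv \<tau> k})"
proof -
 have sk: "sv \<tau> k \<in> \<tau>" using sv_bij[OF assms(1)] assms by (auto simp: bij_betw_def)
 have "card (\<tau> - {sv \<tau> k}) = Suc p" using sk assms by simp
 then show ?thesis
  unfolding singular_face_def sing_def
  using simplical_face_in_standard_simplex[of "Suc p" k] assms
  by (auto simp: fun_eq_iff bary_face restrict_def)
qed

lemma subdivision_power_add: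
 "(singular_subdivision p ^^ n) (a + b) = (singular_subdivision p ^^ n) a + (singular_subdivision p ^^ n) b"
 by (induction n) (simp_all add: singular_subdivision_add)

lemma pair_subdivision_sign:
 "pair w ((singular_subdivision p ^^ n) (frag_cmul ((-1) ^ k) c)) = pair w ((singular_subdivision p ^^ n) c)"
proof (cases "even k")
 case False
 have "(singular_subdivision p ^^ n) (0 - c) = 0 - (singular_subdivision p ^^ n) c"
  by (simp only: singular_subdivision_power_diff singular_subdivision_power_0)
 then show ?thesis using False by (simp add: pair_uminus)
qed simp

lemma pair_subdivision_sum:
 "finite A ==> pair w ((singular_subdivision p ^^ n) (sum c A)) = (\<Sum>i\<in>A. pair w ((singular_subdivision p ^^ n) (c i)))"
 by (induction A rule: finite_induct) (simp_all add: subdivision_power_add pair_add)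

lemma subdivision_power_chain: "singular_chain p X c ==> singular_chain p X ((singular_subdivision p ^^ n) c)"
 by (induction n) (simp_all add: singular_chain_singular_subdivision)

lemma boundary_subdivision_power:
 assumes "singular_chain p X c"
 shows "chain_boundary p ((singular_subdivision p ^^ n) c) = (singular_subdivision (p - 1) ^^ n) (chain_boundary p c)"
 by (induction n) (simp_all add: chain_boundary_singular_subdivision[OF subdivision_power_chain[OF assms]])

locale grid_map =
 fixes Z :: "nat set set" and f :: "(nat => real) => 'b::topological_space" and lab :: "'b => 'q::finite => int"
  and cs :: "'q list" and n :: nat
 assumes Z: "simplicial_complex Z" and f: "continuous_on (realisation Z) f" and cs: "distinct cs" "set cs = UNIV"
begin

definition sub :: "nat set => 'b chain" where
 "sub \<sigma> = (singular_subdivision (card \<sigma> - 1) ^^ n) (frag_of (sing f \<sigma>))"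

text \<open>A stand-in for the intersection number mod 2 of the image of a simplex with a piece of
  the grid of codimension \<open>card S\<close>. Counting after subdivision gives it a meaning for
  maps that are merely continuous.\<close>

definition dual :: "'q set => ('q => int) => nat set => bit" where
 "dual S a \<sigma> = (if \<sigma> \<in> Z & card \<sigma> = Suc (card S) then pair (%s. grid cs S a (%i. lab (s (corner i)))) (sub \<sigma>) else 0)"

lemma fin: "\<sigma> \<in> Z ==> finite \<sigma>"
 using complex_simplex[OF Z] by simp

lemma sub_chain:
 assumes "\<sigma> \<in> Z" "card \<sigma> = Suc p"
 shows "singular_chain p (top_of_set (f ` closed_simplex Z \<sigma>)) (sub \<sigma>)"
 using subdivision_power_chain[of p "top_of_set (f ` closed_simplex Z \<sigma>)" "frag_of (sing f \<sigma>)" n] sing_simplex[OF Z assms f] assms(2)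
 by (simp add: sub_def singular_chain_of)

lemma sub_image:
 assumes s: "\<sigma> \<in> Z" and k: "s \<in> Poly_Mapping.keys (sub \<sigma>)" and t: "t \<in> standard_simplex (card \<sigma> - 1)"
 shows "s t \<in> f ` closed_simplex Z \<sigma>"
proof -
 have "\<sigma> ~= {}" using complex_simplex[OF Z s] by simp
 then have "card \<sigma> = Suc (card \<sigma> - 1)" using fin[OF s] by (simp add: card_gt_0_iff)
 then have "singular_simplex (card \<sigma> - 1) (top_of_set (f ` closed_simplex Z \<sigma>)) s"
  using sub_chain[OF s] k unfolding singular_chain_def by blast
 then show ?thesis using t unfolding singular_simplex_def continuous_map_def by auto
qed

text \<open>Subdivision commutes with the boundary, so the coboundary formula of the grid passes
  from the small singular simplices to \<open>Z\<close>.\<close>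

lemma dual_coboundary:
 assumes t: "\<tau> \<in> Z" "card \<tau> = Suc (Suc (card S))"
 shows "(\<Sum>v\<in>\<tau>. dual S a (\<tau> - {v})) = (\<Sum>i\<in>- S. dual (insert i S) a \<tau> + dual (insert i S) (dec i a) \<tau>)"
proof -
 let ?p = "card S"
 let ?w = "%S a s. grid cs S a (%i. lab (s (corner i)))"
 note ft = fin[OF t(1)]
 have faces: "\<tau> - {v} \<in> Z" "card (\<tau> - {v}) = Suc ?p" if "v \<in> \<tau>" for v
 proof -
  show c: "card (\<tau> - {v}) = Suc ?p" using that t ft by simp
  then have "\<tau> - {v} ~= {}" by (metis card.empty nat.distinct(1))
  then show "\<tau> - {v} \<in> Z" by (rule complex_face[OF Z t(1) Diff_subset])
 qed
 have svt: "sv \<tau> k \<in> \<tau>" if "k <= Suc ?p" for k using sv_bij[OF ft] that t(2) by (auto simp: bij_betw_def)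
 have ch: "singular_chain (Suc ?p) (top_of_set (f ` closed_simplex Z \<tau>)) (frag_of (sing f \<tau>))"
  using sing_simplex[OF Z t f] by (simp add: singular_chain_of)
 have "(\<Sum>v\<in>\<tau>. dual S a (\<tau> - {v})) = (\<Sum>v\<in>\<tau>. pair (?w S a) (sub (\<tau> - {v})))"
  by (rule sum.cong) (simp_all only: dual_def faces simp_thms if_True)
 also have "... = (\<Sum>k\<in>{..<card \<tau>}. pair (?w S a) (sub (\<tau> - {sv \<tau> k})))"
  by (rule sum.reindex_bij_betw[symmetric, OF sv_bij[OF ft]])
 also have "... = (\<Sum>k\<le>Suc ?p. pair (?w S a) ((singular_subdivision ?p ^^ n) (frag_cmul ((-1) ^ k) (frag_of (singular_face (Suc ?p) k (sing f \<tau>))))))"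
  by (rule sum.cong) (use t(2) svt faces(2) in \<open>auto simp: pair_subdivision_sign sing_face[OF ft t(2)] sub_def\<close>)
 also have "... = pair (?w S a) ((singular_subdivision ?p ^^ n) (chain_boundary (Suc ?p) (frag_of (sing f \<tau>))))"
  by (simp add: chain_boundary_of pair_subdivision_sum del: sum.atMost_Suc)
 also have "... = pair (?w S a) (chain_boundary (Suc ?p) (sub \<tau>))"
  by (simp add: boundary_subdivision_power[OF ch] sub_def t(2))
 also have "... = pair (%s. \<Sum>k\<le>Suc ?p. ?w S a (singular_face (Suc ?p) k s)) (sub \<tau>)" by (rule pair_chain_boundary)
 also have "... = pair (%s. \<Sum>i\<in>- S. ?w (insert i S) a s + ?w (insert i S) (dec i a) s) (sub \<tau>)"
 proof (rule pair_cong)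
  fix s
  have "(\<Sum>k\<le>Suc ?p. ?w S a (singular_face (Suc ?p) k s)) = (\<Sum>k\<le>Suc ?p. grid cs S a ((%i. lab (s (corner i))) o skip k))"
   by (intro sum.cong refl grid_cong[OF cs(1)]) (simp_all add: cs(2) face_corner)
  then show "(\<Sum>k\<le>Suc ?p. ?w S a (singular_face (Suc ?p) k s)) = (\<Sum>i\<in>- S. ?w (insert i S) a s + ?w (insert i S) (dec i a) s)"
   using grid_coboundary[OF cs(1), of S a "%i. lab (s (corner i))"] cs(2) by (simp add: Compl_eq_Diff_UNIV del: sum.atMost_Suc)
 qed
 also have "... = (\<Sum>i\<in>- S. pair (?w (insert i S) a) (sub \<tau>) + pair (?w (insert i S) (dec i a)) (sub \<tau>))"
  by (simp only: pair_fun_sum pair_fun_add)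
 also have "... = (\<Sum>i\<in>- S. dual (insert i S) a \<tau> + dual (insert i S) (dec i a) \<tau>)"
  by (rule sum.cong) (use t in \<open>simp_all add: dual_def\<close>)
 finally show ?thesis .
qed

lemma dual_vertex:
 assumes v: "{v} \<in> Z"
 shows "dual {} a {v} = (if lab (f (bary {v} (corner 0))) = a then 1 else 0)"
proof -
 have c: "card {v} = Suc 0" by simp
 have ch: "singular_chain 0 (top_of_set (f ` closed_simplex Z {v})) (frag_of (sing f {v}))"
  using sing_simplex[OF Z v c f] by (simp add: singular_chain_of)
 have "(singular_subdivision 0 ^^ m) (frag_of (sing f {v})) = frag_of (sing f {v})" for m
  by (induction m) (simp_all add: singular_subdivision_zero[OF ch])
 then have "sub {v} = frag_of (sing f {v})" by (simp add: sub_def)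
 then have "dual {} a {v} = grid cs {} a (%i. lab (sing f {v} (corner i)))" using v by (simp add: dual_def)
 also have "... = (if lab (sing f {v} (corner 0)) = a then 1 else 0)"
  using cs by (simp add: grid_vertex fun_eq_iff)
 also have "sing f {v} (corner 0) = f (bary {v} (corner 0))" using corner_simplex[of 0 0] by (simp add: sing_def)
 finally show ?thesis .
qed

lemma dual_local:
 assumes fine: "\<And>s x y c. s \<in> Poly_Mapping.keys (sub \<sigma>) ==> x \<in> s ` standard_simplex (card \<sigma> - 1) ==>
   y \<in> s ` standard_simplex (card \<sigma> - 1) ==> \<bar>lab x c - lab y c\<bar> <= 1"
  and d: "dual S a \<sigma> ~= 0"
 shows "\<exists>y\<in>f ` closed_simplex Z \<sigma>. \<forall>c. \<bar>lab y c - a c\<bar> <= 1"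
proof -
 have s: "\<sigma> \<in> Z" "card \<sigma> = Suc (card S)" using d by (auto simp: dual_def split: if_splits)
 then obtain s where k: "s \<in> Poly_Mapping.keys (sub \<sigma>)" and g: "grid cs S a (%i. lab (s (corner i))) ~= 0"
  using d pair_nonzero unfolding dual_def by (metis (no_types, lifting))
 have co: "corner i \<in> standard_simplex (card \<sigma> - 1)" if "i <= card S" for i using that s(2) by (simp add: corner_simplex)
 have "\<bar>lab (s (corner 0)) c - a c\<bar> <= 1" for c
 proof (rule grid_local[OF cs(1) g])
  fix i j c assume "i <= card (S Int set cs)" "j <= card (S Int set cs)"
  then show "\<bar>lab (s (corner i)) c - lab (s (corner j)) c\<bar> <= 1" using cs(2) co by (intro fine[OF k]) auto
 qed (use cs in simp)
 moreover have "s (corner 0) \<in> f ` closed_simplex Z \<sigma>" by (rule sub_image[OF s(1) k]) (rule co, simp)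
 ultimately show ?thesis by blast
qed

end

section \<open>Successive filling of the dual cochains\<close>

definition scochain :: "'v set set => nat => ('v set => bit) => bool" where
 "scochain Z p \<alpha> \<longleftrightarrow> (\<forall>\<sigma>. \<alpha> \<sigma> ~= 0 --> \<sigma> \<in> Z & card \<sigma> = Suc p)"

definition scob :: "'v set set => nat => ('v set => bit) => 'v set => bit" where
 "scob Z p \<alpha> \<tau> = (if \<tau> \<in> Z & card \<tau> = Suc p then \<Sum>v\<in>\<tau>. \<alpha> (\<tau> - {v}) else 0)"

definition swt :: "('v set => bit) => nat" where
 "swt \<alpha> = card {\<sigma>. \<alpha> \<sigma> ~= 0}"

text \<open>If \<open>Z\<close> has dimension \<open>q\<close>, every cochain of degree
  \<open>q\<close> is closed, so in that degree being a coboundary takes the place of being a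
  cocycle. The last clause expresses connectedness.\<close>

definition cocycle_filling :: "'v set set => nat => nat => real => bool" where
 "cocycle_filling Z q K \<eta> \<longleftrightarrow>
  (\<forall>p \<alpha>. 1 <= p & p <= q & scochain Z p \<alpha> & real (swt \<alpha>) <= \<eta> & (p < q --> (\<forall>\<tau>. scob Z (Suc p) \<alpha> \<tau> = 0)) &
   (p = q --> (\<exists>\<beta>. scochain Z (p - 1) \<beta> & \<alpha> = scob Z p \<beta>)) -->
   (\<exists>h. scochain Z (p - 1) h & \<alpha> = scob Z p h & swt h <= K * swt \<alpha>)) &
  (\<forall>\<alpha>. scochain Z 0 \<alpha> & (\<forall>\<tau>. scob Z 1 \<alpha> \<tau> = 0) --> (\<forall>\<sigma>. \<alpha> \<sigma> = 0) \<or> (\<forall>v\<in>vertices Z. \<alpha> {v} ~= 0))"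

text \<open>In units of the largest weight of a dual cochain, the size of the filling for a set with
  \<open>r\<close> coordinates missing: it fills one dual cochain and at most \<open>2 * q\<close>
  earlier fillings, at the cost of a factor \<open>K\<close>.\<close>

primrec descent_bound :: "nat => nat => nat => nat" where
 "descent_bound q K 0 = K"
| "descent_bound q K (Suc r) = K * (1 + 2 * q * descent_bound q K r)"

lemma scochain_add: "scochain Z p \<alpha> ==> scochain Z p \<beta> ==> scochain Z p (%\<sigma>. \<alpha> \<sigma> + \<beta> \<sigma>)"
 unfolding scochain_def by (metis add_0)

lemma scochain_sum: "(\<And>i. i \<in> A ==> scochain Z p (\<alpha> i)) ==> scochain Z p (%\<sigma>. \<Sum>i\<in>A. \<alpha> i \<sigma>)"
 unfolding scochain_def by (meson bit_sum_nonzero_ex)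

lemma finite_support: "finite Z ==> scochain Z p \<alpha> ==> finite {\<sigma>. \<alpha> \<sigma> ~= 0}"
 by (rule finite_subset[of _ Z]) (auto simp: scochain_def)

lemma swt_add:
 assumes "finite Z" "scochain Z p \<alpha>" "scochain Z p \<beta>"
 shows "swt (%\<sigma>. \<alpha> \<sigma> + \<beta> \<sigma>) <= swt \<alpha> + swt \<beta>"
proof -
 have "swt (%\<sigma>. \<alpha> \<sigma> + \<beta> \<sigma>) <= card ({\<sigma>. \<alpha> \<sigma> ~= 0} Un {\<sigma>. \<beta> \<sigma> ~= 0})"
  unfolding swt_def by (rule card_mono) (use finite_support[OF assms(1)] assms(2,3) in auto)
 then show ?thesis unfolding swt_def using card_Un_le order_trans by blast
qed

lemma swt_sum:
 assumes "finite Z" "finite A" "\<And>i. i \<in> A ==> scochain Z p (\<alpha> i)"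
 shows "swt (%\<sigma>. \<Sum>i\<in>A. \<alpha> i \<sigma>) <= (\<Sum>i\<in>A. swt (\<alpha> i))"
 using assms(2,3)
proof (induction A rule: finite_induct)
 case empty
 show ?case by (simp add: swt_def)
next
 case (insert x A)
 have "swt (%\<sigma>. \<alpha> x \<sigma> + (\<Sum>i\<in>A. \<alpha> i \<sigma>)) <= swt (\<alpha> x) + swt (%\<sigma>. \<Sum>i\<in>A. \<alpha> i \<sigma>)"
  by (rule swt_add[OF assms(1)]) (use insert.prems in \<open>auto intro!: scochain_sum\<close>)
 then show ?case using insert by simp
qed

lemma swt_zero: "finite Z ==> scochain Z p \<alpha> ==> swt \<alpha> = 0 ==> \<alpha> \<sigma> = 0"
 using finite_support[of Z p \<alpha>] unfolding swt_def by auto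

lemma dec_commute: "dec i (dec j a) = dec j (dec i a)"
 by (auto simp: dec_def fun_eq_iff)

lemma inj_dec: "inj (dec i)"
 by (rule inj_on_inverseI[where g = "%a. a(i := a i + 1)"]) (simp add: dec_def)

lemma dec_power: "(dec i ^^ k) a = a(i := a i - int k)"
 by (induction k) (auto simp: dec_def)

context grid_map
begin

text \<open>Correcting \<open>dual S a\<close> by the fillings chosen for the sets one larger makes it a cocycle; the
 corrections cancel because they are symmetric in the two added coordinates.\<close>

definition corrected :: "('q set => ('q => int) => nat set => bit) => 'q set => ('q => int) => nat set => bit" where
 "corrected h S a \<sigma> = dual S a \<sigma> + (\<Sum>i\<in>- S. h (insert i S) a \<sigma> + h (insert i S) (dec i a) \<sigma>)"

text \<open>The finiteness clause makes the final summation over all grid labels a finite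
  sum.\<close>

definition filled :: "nat => nat => ('q set => ('q => int) => nat set => bit) => 'q set => bool" where
 "filled K M h S \<longleftrightarrow> (\<forall>a. scochain Z (card S - 1) (h S a) & corrected h S a = scob Z (card S) (h S a) &
  swt (h S a) <= descent_bound CARD('q) K (CARD('q) - card S) * M) & finite {a. h S a ~= (%_. 0)}"

lemma dual_scochain: "scochain Z (card S) (dual S a)"
 by (auto simp: scochain_def dual_def split: if_splits)

lemma card_insert': "i \<in> - S ==> card (insert i S) = Suc (card S)" for S :: "'q set"
 by simp

lemma corrected_scochain:
 assumes "\<And>i. i \<in> - S ==> filled K M h (insert i S)"
 shows "scochain Z (card S) (corrected h S a)"
proof -
 have "scochain Z (card S) (h (insert i S) b)" if "i \<in> - S" for i b
  using assms[OF that] card_insert'[OF that] unfolding filled_def by simp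
 then show ?thesis unfolding corrected_def by (intro scochain_add dual_scochain scochain_sum) auto
qed

lemma corrected_cocycle:
 assumes h: "\<And>i. i \<in> - S ==> filled K M h (insert i S)"
 shows "scob Z (Suc (card S)) (corrected h S a) \<tau> = 0"
proof (cases "\<tau> \<in> Z & card \<tau> = Suc (Suc (card S))")
 case True
 then have t: "\<tau> \<in> Z" "card \<tau> = Suc (Suc (card S))" by auto
 let ?H = "%i b. (\<Sum>v\<in>\<tau>. h (insert i S) b (\<tau> - {v}))"
 have H: "?H i b = dual (insert i S) b \<tau> + (\<Sum>j\<in>- S - {i}. h (insert j (insert i S)) b \<tau> + h (insert j (insert i S)) (dec j b) \<tau>)"
  if i: "i \<in> - S" for i b
 proof -
  have "?H i b = scob Z (card (insert i S)) (h (insert i S) b) \<tau>"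
   using t card_insert'[OF i] by (simp add: scob_def)
  also have "... = corrected h (insert i S) b \<tau>" using h[OF i] unfolding filled_def by simp
  also have "- insert i S = - S - {i}" by auto
  then have "corrected h (insert i S) b \<tau> = dual (insert i S) b \<tau> +
   (\<Sum>j\<in>- S - {i}. h (insert j (insert i S)) b \<tau> + h (insert j (insert i S)) (dec j b) \<tau>)"
   unfolding corrected_def by (simp only:)
  finally show ?thesis .
 qed
 define B where "B i j = (h (insert j (insert i S)) a \<tau> + h (insert j (insert i S)) (dec j a) \<tau>) +
  (h (insert j (insert i S)) (dec i a) \<tau> + h (insert j (insert i S)) (dec j (dec i a)) \<tau>)" for i j
 have Bs: "B i j = B j i" for i j by (simp add: B_def insert_commute dec_commute add_ac)
 have "scob Z (Suc (card S)) (corrected h S a) \<tau> = (\<Sum>v\<in>\<tau>. dual S a (\<tau> - {v})) +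
   (\<Sum>v\<in>\<tau>. \<Sum>i\<in>- S. h (insert i S) a (\<tau> - {v}) + h (insert i S) (dec i a) (\<tau> - {v}))"
  using True by (simp add: scob_def corrected_def sum.distrib)
 also have "(\<Sum>v\<in>\<tau>. \<Sum>i\<in>- S. h (insert i S) a (\<tau> - {v}) + h (insert i S) (dec i a) (\<tau> - {v})) = (\<Sum>i\<in>- S. ?H i a + ?H i (dec i a))"
  by (subst sum.swap) (simp add: sum.distrib)
 also have "... = (\<Sum>i\<in>- S. (dual (insert i S) a \<tau> + dual (insert i S) (dec i a) \<tau>) + (\<Sum>j\<in>- S - {i}. B i j))"
  by (rule sum.cong) (simp_all only: H B_def sum.distrib add_ac)
 also have "... = (\<Sum>i\<in>- S. dual (insert i S) a \<tau> + dual (insert i S) (dec i a) \<tau>)"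
  using sum_symmetric_bit[of "- S" B, OF _ Bs] by (simp only: sum.distrib finite add_0_right)
 also have "(\<Sum>v\<in>\<tau>. dual S a (\<tau> - {v})) = (\<Sum>i\<in>- S. dual (insert i S) a \<tau> + dual (insert i S) (dec i a) \<tau>)"
  by (rule dual_coboundary[OF t])
 finally show ?thesis by simp
qed (auto simp: scob_def)

lemma corrected_swt:
 assumes Z: "finite Z" and M: "\<And>S a. swt (dual S a) <= M"
  and h: "\<And>i. i \<in> - S ==> filled K M h (insert i S)"
 shows "swt (corrected h S a) <= (1 + 2 * CARD('q) * descent_bound CARD('q) K (CARD('q) - Suc (card S))) * M"
proof -
 let ?D = "descent_bound CARD('q) K (CARD('q) - Suc (card S)) * M"
 have hs: "scochain Z (card S) (h (insert i S) b)" "swt (h (insert i S) b) <= ?D" if "i \<in> - S" for i b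
  using h[OF that] card_insert'[OF that] unfolding filled_def by simp_all
 have "swt (corrected h S a) <= swt (dual S a) + swt (%\<sigma>. \<Sum>i\<in>- S. h (insert i S) a \<sigma> + h (insert i S) (dec i a) \<sigma>)"
  unfolding corrected_def by (intro swt_add[OF Z dual_scochain] scochain_sum scochain_add hs)
 also have "swt (%\<sigma>. \<Sum>i\<in>- S. h (insert i S) a \<sigma> + h (insert i S) (dec i a) \<sigma>) <=
   (\<Sum>i\<in>- S. swt (%\<sigma>. h (insert i S) a \<sigma> + h (insert i S) (dec i a) \<sigma>))"
  by (rule swt_sum[OF Z finite scochain_add[OF hs(1) hs(1)]])
 also have "... <= (\<Sum>i\<in>- S. 2 * ?D)"
 proof (rule sum_mono)
  fix i assume i: "i \<in> - S"
  have "swt (%\<sigma>. h (insert i S) a \<sigma> + h (insert i S) (dec i a) \<sigma>) <= swt (h (insert i S) a) + swt (h (insert i S) (dec i a))"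
   by (rule swt_add[OF Z hs(1)[OF i] hs(1)[OF i]])
  also have "... <= 2 * ?D" using hs(2)[OF i, of a] hs(2)[OF i, of "dec i a"] by simp
  finally show "swt (%\<sigma>. h (insert i S) a \<sigma> + h (insert i S) (dec i a) \<sigma>) <= 2 * ?D" .
 qed
 also have "... = card (- S) * (2 * ?D)" by simp
 also have "... <= CARD('q) * (2 * ?D)" by (intro mult_right_mono card_mono) auto
 finally show ?thesis using M[of S a] by (simp add: algebra_simps)
qed

lemma corrected_finite:
 assumes F: "finite {a. dual S a ~= (%_. 0)}" and h: "\<And>i. i \<in> - S ==> filled K M h (insert i S)"
 shows "finite {a. corrected h S a ~= (%_. 0)}"
proof -
 let ?P = "%i. {a. h (insert i S) a ~= (%_. 0)}"
 have fP: "finite (?P i)" "finite (dec i -` ?P i)" if "i \<in> - S" for i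
 proof -
  show 1: "finite (?P i)" using h[OF that] unfolding filled_def by simp
  show "finite (dec i -` ?P i)" by (rule finite_vimageI[OF 1 inj_dec])
 qed
 have "{a. corrected h S a ~= (%_. 0)} \<subseteq> {a. dual S a ~= (%_. 0)} Un (\<Union>i\<in>- S. ?P i Un dec i -` ?P i)"
 proof (rule subsetI, rule ccontr)
  fix a assume a: "a \<in> {a. corrected h S a ~= (%_. 0)}" and n: "a \<notin> {a. dual S a ~= (%_. 0)} Un (\<Union>i\<in>- S. ?P i Un dec i -` ?P i)"
  have "dual S a = (%_. 0)" "\<And>i. i \<in> - S ==> h (insert i S) a = (%_. 0) & h (insert i S) (dec i a) = (%_. 0)" using n by auto
  then have "corrected h S a = (%_. 0)" by (simp add: corrected_def fun_eq_iff)
  then show False using a by simp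
 qed
 then show ?thesis by (rule finite_subset) (use F fP in auto)
qed

text \<open>Moving the label along one coordinate changes the top cochain by the coboundary of a
  dual cochain of one degree less, and sufficiently far away the top cochain is zero because only
  finitely many labels occur.\<close>

lemma dual_UNIV_coboundary:
 assumes F: "finite {a. dual (UNIV :: 'q set) a ~= (%_. 0)}"
 shows "\<exists>\<beta>. scochain Z (CARD('q) - 1) \<beta> & dual UNIV a = scob Z CARD('q) \<beta>"
proof -
 define i :: 'q where "i = undefined"
 let ?S = "- {i} :: 'q set"
 have q: "Suc (card ?S) = CARD('q)" using card_Suc_Diff1[of "UNIV :: 'q set" i] by (simp add: Compl_eq_Diff_UNIV)
 have one: "dual UNIV b \<tau> = scob Z CARD('q) (dual ?S b) \<tau> + dual UNIV (dec i b) \<tau>" for b \<tau>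
 proof (cases "\<tau> \<in> Z & card \<tau> = Suc CARD('q)")
  case True
  have "(\<Sum>v\<in>\<tau>. dual ?S b (\<tau> - {v})) = (\<Sum>j\<in>- ?S. dual (insert j ?S) b \<tau> + dual (insert j ?S) (dec j b) \<tau>)"
   by (rule dual_coboundary) (use True q in auto)
  moreover have "insert i ?S = UNIV" by auto
  ultimately show ?thesis using True by (simp add: scob_def add.assoc)
 next
  case False
  then show ?thesis by (auto simp: scob_def dual_def)
 qed
 have tel: "dual UNIV a \<tau> = (\<Sum>k<T. scob Z CARD('q) (dual ?S ((dec i ^^ k) a)) \<tau>) + dual UNIV ((dec i ^^ T) a) \<tau>" for T \<tau>
 proof (induction T)
  case (Suc T)
  then show ?case using one[of "(dec i ^^ T) a" \<tau>] by (simp add: add.assoc)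
 qed simp
 have "inj (%T. (dec i ^^ T) a)" 
 proof (rule injI)
  fix x y assume "(dec i ^^ x) a = (dec i ^^ y) a"
  from fun_cong[OF this, of i] show "x = y" by (simp add: dec_power)
 qed
 then have "infinite (range (%T. (dec i ^^ T) a))" by (rule range_inj_infinite)
 then have "\<not> range (%T. (dec i ^^ T) a) \<subseteq> {a. dual UNIV a ~= (%_. 0)}" using finite_subset[OF _ F] by (rule contrapos_nn)
 then obtain T where "(dec i ^^ T) a \<notin> {a. dual UNIV a ~= (%_. 0)}" unfolding image_subset_iff Ball_def not_all by (elim exE) simp
 then have T: "dual UNIV ((dec i ^^ T) a) = (%_. 0)" by simp
 let ?\<beta> = "%\<sigma>. \<Sum>k<T. dual ?S ((dec i ^^ k) a) \<sigma>"
 have "scochain Z (CARD('q) - 1) ?\<beta>" using q dual_scochain[of ?S] by (intro scochain_sum) (metis diff_Suc_1)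
 moreover have "dual UNIV a = scob Z CARD('q) ?\<beta>"
 proof
  fix \<tau>
  have "dual UNIV a \<tau> = (\<Sum>k<T. scob Z CARD('q) (dual ?S ((dec i ^^ k) a)) \<tau>)" using tel[of \<tau> T] T by simp
  also have "... = scob Z CARD('q) ?\<beta> \<tau>" unfolding scob_def by (cases "\<tau> \<in> Z & card \<tau> = Suc CARD('q)") (simp_all only: if_True if_False sum.neutral_const sum.swap[of _ _ \<tau>] simp_thms)
  finally show "dual UNIV a \<tau> = scob Z CARD('q) ?\<beta> \<tau>" .
 qed
 ultimately show ?thesis by blast
qed

lemma fill_step:
 assumes Z: "finite Z" and cf: "cocycle_filling Z CARD('q) K \<eta>"
  and M: "\<And>S a. swt (dual S a) <= M" and F: "\<And>S. finite {a. dual S a ~= (%_. 0)}"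
  and \<eta>: "\<And>r. r <= CARD('q) ==> real ((1 + 2 * CARD('q) * descent_bound CARD('q) K r) * M) <= \<eta>"
  and S: "S ~= {}" and h: "\<And>i. i \<in> - S ==> filled K M h (insert i S)"
 shows "\<exists>g. (\<forall>a. scochain Z (card S - 1) (g a) & corrected h S a = scob Z (card S) (g a) &
  swt (g a) <= descent_bound CARD('q) K (CARD('q) - card S) * M) & finite {a. g a ~= (%_. 0)}"
proof -
 let ?q = "CARD('q)" and ?p = "card S"
 have p: "1 <= ?p" "?p <= ?q" using S by (simp_all add: card_gt_0_iff Suc_le_eq card_mono)
 have pq: "?p < ?q \<longleftrightarrow> - S ~= {}" using p(2) card_subset_eq[of "UNIV :: 'q set" S] psubset_card_mono[of "UNIV :: 'q set" S] by (cases "S = UNIV") (auto simp: less_le)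
 have bound: "swt (corrected h S a) * K <= descent_bound ?q K (?q - ?p) * M & real (swt (corrected h S a)) <= \<eta>" for a
 proof (cases "- S = {}")
  case True
  then have U: "S = UNIV" by auto
  then have "corrected h S a = dual S a" by (simp add: corrected_def fun_eq_iff)
  moreover have "real M <= \<eta>"
  proof -
   have "real M <= real ((1 + 2 * ?q * descent_bound ?q K 0) * M)" by simp
   also have "... <= \<eta>" by (rule \<eta>) simp
   finally show ?thesis .
  qed
  ultimately show ?thesis using M[of S a] U by (auto simp: mult.commute)
 next
  case False
  then have l: "?p < ?q" using pq by simp
  have w: "swt (corrected h S a) <= (1 + 2 * ?q * descent_bound ?q K (?q - Suc ?p)) * M"
   by (rule corrected_swt[OF Z M h])
  have "?q - ?p = Suc (?q - Suc ?p)" using l by simp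
  then have "descent_bound ?q K (?q - ?p) = K * (1 + 2 * ?q * descent_bound ?q K (?q - Suc ?p))" by simp
  then have 1: "swt (corrected h S a) * K <= descent_bound ?q K (?q - ?p) * M"
   using mult_right_mono[OF w, of K] by (simp only: mult_ac)
  have "real (swt (corrected h S a)) <= real ((1 + 2 * ?q * descent_bound ?q K (?q - Suc ?p)) * M)" using w by (rule of_nat_mono)
  also have "... <= \<eta>" by (rule \<eta>) simp
  finally show ?thesis using 1 by simp
 qed
 have "\<exists>g. scochain Z (?p - 1) g & corrected h S a = scob Z ?p g & swt g <= K * swt (corrected h S a)" for a
 proof -
  have "scochain Z ?p (corrected h S a)" by (rule corrected_scochain[OF h])
  moreover have "?p < ?q --> (\<forall>\<tau>. scob Z (Suc ?p) (corrected h S a) \<tau> = 0)" using corrected_cocycle[OF h] by blast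
  moreover have "?p = ?q --> (\<exists>\<beta>. scochain Z (?p - 1) \<beta> & corrected h S a = scob Z ?p \<beta>)"
  proof
   assume e: "?p = ?q"
   then have U: "S = UNIV" using pq by auto
   then have "corrected h S a = dual UNIV a" by (simp add: corrected_def fun_eq_iff)
   then show "\<exists>\<beta>. scochain Z (?p - 1) \<beta> & corrected h S a = scob Z ?p \<beta>" using dual_UNIV_coboundary[OF F, of a] e by simp
  qed
  ultimately show ?thesis using cf p bound[of a] unfolding cocycle_filling_def by simp
 qed
 then obtain g where g: "\<And>a. scochain Z (?p - 1) (g a) & corrected h S a = scob Z ?p (g a) & swt (g a) <= K * swt (corrected h S a)"
  by metis
 have "{a. g a ~= (%_. 0)} \<subseteq> {a. corrected h S a ~= (%_. 0)}"
 proof (rule subsetI, rule ccontr)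
  fix a assume a: "a \<in> {a. g a ~= (%_. 0)}" "a \<notin> {a. corrected h S a ~= (%_. 0)}"
  then have "swt (corrected h S a) = 0" by (simp add: swt_def)
  then have "swt (g a) = 0" using conjunct2[OF conjunct2[OF g[of a]]] by (simp only: mult_0_right le_zero_eq)
  then have "g a = (%_. 0)" using swt_zero[OF Z, of "?p - 1" "g a"] g[of a] by (simp add: fun_eq_iff)
  then show False using a by simp
 qed
 then have "finite {a. g a ~= (%_. 0)}" using corrected_finite[OF F h] by (rule finite_subset)
 moreover have "swt (g a) <= descent_bound ?q K (?q - ?p) * M" for a
  using g[of a] bound[of a] by (metis mult.commute order_trans)
 ultimately show ?thesis using g by (intro exI[of _ g]) blast
qed

text \<open>Fillings are chosen for \<open>S\<close> of decreasing size. For the empty set the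
  corrected cochain is a cocycle of degree zero with fewer supporting vertices than \<open>Z\<close>
  has, so it vanishes. Summed over all labels at one vertex, the dual cochains give
  \<open>1\<close>, as the vertex has exactly one label, while each correction cancels against its
  shift by \<open>dec\<close>.\<close>

theorem descent:
 assumes Z: "finite Z" and cf: "cocycle_filling Z CARD('q) K \<eta>"
  and M: "\<And>S a. swt (dual S a) <= M" and F: "\<And>S. finite {a. dual S a ~= (%_. 0)}"
  and \<eta>: "\<And>r. r <= CARD('q) ==> real ((1 + 2 * CARD('q) * descent_bound CARD('q) K r) * M) <= \<eta>"
  and V: "\<eta> < real (card (vertices Z))"
 shows False
proof -
 let ?q = "CARD('q)"
 have "\<exists>h. \<forall>S. S ~= {} & ?q <= card S + k --> filled K M h S" for k
 proof (induction k)
  case 0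
  obtain g where g: "(\<forall>a. scochain Z (?q - 1) (g a) & corrected (%_ _ _. 0) UNIV a = scob Z ?q (g a) &
   swt (g a) <= descent_bound CARD('q) K (?q - ?q) * M) & finite {a. g a ~= (%_. 0)}"
   using fill_step[OF Z cf M F \<eta>, of "UNIV :: 'q set" "%_ _ _. 0"] by auto
  have "filled K M (%_. g) UNIV" using g unfolding filled_def corrected_def by simp
  moreover have "S = UNIV" if "?q <= card S + 0" for S :: "'q set"
   using that card_seteq[of "UNIV :: 'q set" S] by simp
  ultimately show ?case by metis
 next
  case (Suc k)
  then obtain h where h: "\<And>S. S ~= {} ==> ?q <= card S + k ==> filled K M h S" by blast
  let ?new = "%S :: 'q set. S ~= {} & ?q = card S + Suc k"
  let ?P = "%S g. (\<forall>a. scochain Z (card S - 1) (g a) & corrected h S a = scob Z (card S) (g a) &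
  swt (g a) <= descent_bound ?q K (?q - card S) * M) & finite {a. g a ~= (%_. 0)}"
  have ex: "\<exists>g. ?P S g" if "?new S" for S
  proof (rule fill_step[OF Z cf M F \<eta>])
   show "filled K M h (insert i S)" if "i \<in> - S" for i
    using h[of "insert i S"] that \<open>?new S\<close> by simp
  qed (use that in auto)
  define g where "g S = (SOME g. ?P S g)" for S
  have g: "?P S (g S)" if "?new S" for S unfolding g_def by (rule someI_ex[OF ex[OF that]])
  define h' where "h' S = (if ?new S then g S else h S)" for S
  have "filled K M h' S" if S: "S ~= {}" "?q <= card S + Suc k" for S
  proof -
   have "h' (insert i S) = h (insert i S)" if "i \<in> - S" for i
   proof -
    have "card (insert i S) = Suc (card S)" using card_insert'[OF that] .
    then have "\<not> ?new (insert i S)" using S(2) by linarith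
    then show ?thesis by (simp only: h'_def if_False)
   qed
   then have c: "corrected h' S = corrected h S" by (simp add: corrected_def fun_eq_iff)
   show ?thesis
   proof (cases "?new S")
    case True
    then have "h' S = g S" by (simp add: h'_def)
    then show ?thesis using g[OF True] unfolding filled_def c by simp
   next
    case False
    then have "h' S = h S" by (simp only: h'_def if_False)
    moreover have "?q <= card S + k" using False S by linarith
    ultimately show ?thesis using h[OF S(1)] unfolding filled_def c by simp
   qed
  qed
  then show ?case by blast
 qed
 from this[of ?q] obtain h where h: "\<And>S. S ~= {} ==> filled K M h S" by auto
 have hi: "filled K M h (insert i {})" for i using h by simp
 have zero: "corrected h {} a \<sigma> = 0" for a \<sigma>
 proof -
  have sc: "scochain Z (card ({} :: 'q set)) (corrected h {} a)" by (rule corrected_scochain[OF hi])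
  have "scob Z (Suc (card ({} :: 'q set))) (corrected h {} a) \<tau> = 0" for \<tau> by (rule corrected_cocycle[OF hi])
  then have "(\<forall>\<sigma>. corrected h {} a \<sigma> = 0) \<or> (\<forall>v\<in>vertices Z. corrected h {} a {v} ~= 0)"
   using cf sc unfolding cocycle_filling_def by simp
  moreover have "\<not> (\<forall>v\<in>vertices Z. corrected h {} a {v} ~= 0)"
  proof
   assume "\<forall>v\<in>vertices Z. corrected h {} a {v} ~= 0"
   then have "(%v. {v}) ` vertices Z \<subseteq> {\<sigma>. corrected h {} a \<sigma> ~= 0}" by auto
   then have "card ((%v. {v}) ` vertices Z) <= swt (corrected h {} a)"
    unfolding swt_def by (rule card_mono[OF finite_support[OF Z sc]])
   then have "real (card (vertices Z)) <= real (swt (corrected h {} a))" by (simp add: card_image)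
   also have "... <= real ((1 + 2 * ?q * descent_bound ?q K (?q - Suc (card ({} :: 'q set)))) * M)"
    by (rule of_nat_mono) (rule corrected_swt[OF Z M hi])
   also have "... <= \<eta>" by (rule \<eta>) simp
   finally show False using V by simp
  qed
  ultimately show ?thesis by blast
 qed
 have "vertices Z ~= {}"
 proof
  assume "vertices Z = {}"
  then have "\<eta> < 0" using V by simp
  then show False using \<eta>[of 0] of_nat_0_le_iff[of "(1 + 2 * ?q * descent_bound ?q K 0) * M", where ?'a = real] by linarith
 qed
 then obtain U v where U: "U \<in> Z" "v \<in> U" unfolding vertices_def by blast
 then have v: "{v} \<in> Z" by (intro complex_face[OF grid_map.Z[OF grid_map_axioms] U(1)]) auto
 let ?l = "lab (f (bary {v} (corner 0)))"
 let ?P = "%i. {a. h {i} a ~= (%_. 0)}"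
 have fP: "finite (?P i)" "finite (dec i -` ?P i)" for i
 proof -
  show 1: "finite (?P i)" using h[of "{i}"] unfolding filled_def by simp
  show "finite (dec i -` ?P i)" by (rule finite_vimageI[OF 1 inj_dec])
 qed
 \<comment> \<open>Contains every label at which a correction or its shift can be nonzero, so that
   both sums run over the full supports.\<close>
 define A where "A = insert ?l (\<Union>i. ?P i Un dec i -` ?P i)"
 have A: "finite A" unfolding A_def using fP by simp
 have shift: "(\<Sum>a\<in>A. h {i} a {v}) = (\<Sum>a\<in>A. h {i} (dec i a) {v})" for i
 proof -
  have "(\<Sum>a\<in>A. h {i} a {v}) = (\<Sum>a\<in>?P i. h {i} a {v})"
   by (rule sum.mono_neutral_right[OF A]) (auto simp: A_def)
  also have "... = (\<Sum>a\<in>dec i ` A. h {i} a {v})"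
  proof (rule sum.mono_neutral_left)
   show "?P i \<subseteq> dec i ` A"
   proof
    fix a assume a: "a \<in> ?P i"
    have "a = dec i (a(i := a i + 1))" by (simp add: dec_def)
    moreover have "a(i := a i + 1) \<in> dec i -` ?P i" using a by (simp add: dec_def)
    then have "a(i := a i + 1) \<in> A" unfolding A_def by (intro insertI2 UN_I[of i] UnI2) auto
    ultimately show "a \<in> dec i ` A" by (rule image_eqI)
   qed
  qed (use A in auto)
  also have "... = (\<Sum>a\<in>A. h {i} (dec i a) {v})" by (subst sum.reindex[OF inj_on_subset[OF inj_dec subset_UNIV]]) simp
  finally show ?thesis .
 qed
 have "0 = (\<Sum>a\<in>A. corrected h {} a {v})" by (simp add: zero)
 also have "... = (\<Sum>a\<in>A. dual {} a {v}) + (\<Sum>a\<in>A. \<Sum>i\<in>UNIV. h {i} a {v} + h {i} (dec i a) {v})"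
  by (simp add: corrected_def sum.distrib)
 also have "(\<Sum>a\<in>A. \<Sum>i\<in>UNIV. h {i} a {v} + h {i} (dec i a) {v}) = (\<Sum>i\<in>UNIV. (\<Sum>a\<in>A. h {i} a {v}) + (\<Sum>a\<in>A. h {i} (dec i a) {v}))"
  by (subst sum.swap) (simp add: sum.distrib)
 also have "... = 0" unfolding shift by simp
 also have "(\<Sum>a\<in>A. dual {} a {v}) = 1" using A by (simp add: dual_vertex[OF v] A_def)
 finally show False by simp
qed

end

section \<open>From small cochains to overlap\<close>

lemma closed_simplex_eq_bary:
 assumes Z: "simplicial_complex Z" and s: "\<sigma> \<in> Z" "card \<sigma> = Suc p"
 shows "closed_simplex Z \<sigma> = bary \<sigma> ` standard_simplex p"
proof
 show "bary \<sigma> ` standard_simplex p \<subseteq> closed_simplex Z \<sigma>" using bary_closed_simplex[OF Z s] by blast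
 show "closed_simplex Z \<sigma> \<subseteq> bary \<sigma> ` standard_simplex p"
 proof
  fix x assume x: "x \<in> closed_simplex Z \<sigma>"
  have fin: "finite \<sigma>" using complex_simplex[OF Z s(1)] by simp
  have x0: "\<And>v. 0 <= x v" "sum x (supp x) = 1" "supp x \<subseteq> \<sigma>"
   using x unfolding closed_simplex_def realisation_def by auto
  let ?t = "%i. if i <= p then x (sv \<sigma> i) else 0"
  have svs: "sv \<sigma> i \<in> \<sigma>" if "i <= p" for i using sv_bij[OF fin] that s(2) by (auto simp: bij_betw_def)
  have "(\<Sum>i\<le>p. ?t i) = (\<Sum>i\<in>{..<card \<sigma>}. x (sv \<sigma> i))" by (simp add: s(2) lessThan_Suc_atMost)
  also have "... = sum x \<sigma>" by (rule sum.reindex_bij_betw[OF sv_bij[OF fin]])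
  also have "... = sum x (supp x)" by (rule sum.mono_neutral_right[OF fin x0(3)]) (auto simp: supp_def)
  finally have one: "sum ?t {..p} = 1" using x0(2) by simp
  have "?t i <= 1" for i
  proof (cases "i <= p")
   case True
   then have "?t i <= sum ?t {..p}" using x0(1) by (intro member_le_sum) auto
   then show ?thesis using one by simp
  qed simp
  then have t: "?t \<in> standard_simplex p" using one x0(1) by (simp add: standard_simplex_def)
  have "x = bary \<sigma> ?t"
  proof
   fix v
   show "x v = bary \<sigma> ?t v"
   proof (cases "v \<in> \<sigma>")
    case True
    then have "v \<in> sv \<sigma> ` {..<card \<sigma>}" using sv_bij[OF fin] by (simp add: bij_betw_def)
    then obtain i where i: "i < card \<sigma>" "v = sv \<sigma> i" by auto
    then show ?thesis using bary_sv[OF fin i(1), of ?t] s(2) by simp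
   next
    case False
    then show ?thesis using bary_outside[OF fin False, of ?t] x0(3) by (auto simp: supp_def)
   qed
  qed
  then show "x \<in> bary \<sigma> ` standard_simplex p" using t by (rule image_eqI)
 qed
qed

lemma compact_image_closed_simplex:
 fixes f :: "(nat => real) => 'b::topological_space"
 assumes Z: "simplicial_complex Z" and s: "\<sigma> \<in> Z" and f: "continuous_on (realisation Z) f"
 shows "compact (f ` closed_simplex Z \<sigma>)"
proof -
 have "card \<sigma> > 0" using complex_simplex[OF Z s] by (simp add: card_gt_0_iff)
 then obtain p where p: "card \<sigma> = Suc p" using gr0_implies_Suc by blast
 have "sing f \<sigma> ` standard_simplex p = f ` closed_simplex Z \<sigma>"
  unfolding closed_simplex_eq_bary[OF Z s p] sing_def p image_image by simp
 moreover have "compact (sing f \<sigma> ` standard_simplex p)"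
 proof (rule compact_continuous_image)
  have "continuous_map (subtopology (powertop_real UNIV) (standard_simplex p)) (top_of_set (f ` closed_simplex Z \<sigma>)) (sing f \<sigma>)"
   using sing_simplex[OF Z s p f] unfolding singular_simplex_def by blast
  then show "continuous_on (standard_simplex p) (sing f \<sigma>)"
   unfolding euclidean_product_topology by (simp add: continuous_map_in_subtopology)
  show "compact (standard_simplex p)"
   using compactin_standard_simplex[of p] unfolding euclidean_product_topology by simp
 qed
 ultimately show ?thesis by simp
qed

lemma finite_int_box: "finite {a :: 'q::finite => int. \<forall>c. \<bar>a c\<bar> <= R}"
proof (rule finite_subset)
 show "{a :: 'q => int. \<forall>c. \<bar>a c\<bar> <= R} \<subseteq> PiE UNIV (%_. {-R..R})" 
 proof
  fix a :: "'q => int" assume "a \<in> {a. \<forall>c. \<bar>a c\<bar> <= R}"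
  then have "- R <= a c & a c <= R" for c by (simp add: abs_le_iff minus_le_iff)
  then show "a \<in> PiE UNIV (%_. {-R..R})" by (simp add: PiE_def)
 qed
 show "finite (PiE (UNIV :: 'q set) (%_. {-R..R}))" by (rule finite_PiE) auto
qed

text \<open>If every point lies in at most \<open>M\<close> images, then by compactness every set of
  small diameter meets at most \<open>M\<close> of them. A grid finer than this scale makes all dual
  cochains of weight at most \<open>M\<close>, and \<open>descent\<close> applies.\<close>

theorem topological_overlap:
 fixes f :: "(nat => real) => real ^ 'q"
 assumes Z: "simplicial_complex Z" "finite Z" and f: "continuous_on (realisation Z) f"
  and cf: "cocycle_filling Z CARD('q) K \<eta>"
  and \<eta>: "\<And>r. r <= CARD('q) ==> real ((1 + 2 * CARD('q) * descent_bound CARD('q) K r) * M) <= \<eta>"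
  and V: "\<eta> < real (card (vertices Z))"
 shows "\<exists>z. M < card {U \<in> Z. z \<in> f ` closed_simplex Z U}"
proof (rule ccontr)
 assume "\<not> ?thesis"
 then have M: "card {U \<in> Z. z \<in> f ` closed_simplex Z U} <= M" for z by (simp add: not_less)
 let ?I = "%U. f ` closed_simplex Z U"
 define Q where "Q = (\<Union>U\<in>Z. ?I U)"
 have cI: "compact (?I U)" if "U \<in> Z" for U by (rule compact_image_closed_simplex[OF Z(1) that f])
 have cQ: "compact Q" unfolding Q_def using Z(2) cI by (intro compact_UN)
 \<comment> \<open>The finitely many images that miss \<open>z\<close> are compact and hence keep a
   distance from it.\<close>
 have "\<exists>r>0. \<forall>U\<in>Z. ball z r Int ?I U ~= {} --> z \<in> ?I U" for z
 proof -
  define C where "C = (\<Union>U\<in>{U\<in>Z. z \<notin> ?I U}. ?I U)"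
  have "compact C" unfolding C_def using Z(2) cI by (intro compact_UN) auto
  then have "open (- C)" by (simp add: compact_imp_closed open_Compl)
  moreover have "z \<in> - C" unfolding C_def by simp
  ultimately obtain r where r: "r > 0" "ball z r \<subseteq> - C" by (rule openE)
  have "z \<in> ?I U" if U: "U \<in> Z" "ball z r Int ?I U ~= {}" for U
  proof (rule ccontr)
   assume "z \<notin> ?I U"
   then have "?I U \<subseteq> C" unfolding C_def using U(1) by (intro UN_upper) simp
   then show False using U(2) r(2) by auto
  qed
  then show ?thesis using r(1) by (intro exI[of _ r] conjI ballI impI)
 qed
 then have "\<exists>r. \<forall>z. r z > 0 & (\<forall>U\<in>Z. ball z (r z) Int ?I U ~= {} --> z \<in> ?I U)" by (intro choice allI)
 then obtain r where r0: "\<forall>z. r z > 0 & (\<forall>U\<in>Z. ball z (r z) Int ?I U ~= {} --> z \<in> ?I U)" by (elim exE)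
 have r: "r z > 0" "U \<in> Z ==> ball z (r z) Int ?I U ~= {} ==> z \<in> ?I U" for z U
  using r0[rule_format, of z] by simp_all
 have cov: "Q \<subseteq> \<Union> (range (%z. ball z (r z)))"
 proof
  fix x show "x \<in> \<Union> (range (%z. ball z (r z)))" by (rule UN_I[of x]) (simp_all add: r(1))
 qed
 have ne: "range (%z. ball z (r z)) ~= {}" by simp
 have op: "open B" if "B \<in> range (%z. ball z (r z))" for B using that by (elim rangeE) simp
 obtain \<delta> where \<delta>: "\<delta> > 0" "\<And>T. T \<subseteq> Q ==> diameter T < \<delta> ==> \<exists>B\<in>range (%z. ball z (r z)). T \<subseteq> B"
  by (rule Lebesgue_number_lemma[OF cQ ne cov op]) (assumption | rule that)+
 have few: "card {U \<in> Z. T Int ?I U ~= {}} <= M" if T: "bounded T" "diameter T < \<delta>" for T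
 proof -
  have "diameter (T Int Q) <= diameter T" using T(1) by (intro diameter_subset) auto
  then obtain z where z: "T Int Q \<subseteq> ball z (r z)" using \<delta>(2)[of "T Int Q"] T(2) by auto
  have "{U \<in> Z. T Int ?I U ~= {}} \<subseteq> {U \<in> Z. z \<in> ?I U}"
  proof (intro Collect_mono impI conjI)
   fix U assume U: "U \<in> Z & T Int ?I U ~= {}"
   then show "U \<in> Z" by simp
   have "?I U \<subseteq> Q" using U unfolding Q_def by blast
   then have "ball z (r z) Int ?I U ~= {}" using U z by blast
   then show "z \<in> ?I U" using r(2) U by blast
  qed
  then have "card {U \<in> Z. T Int ?I U ~= {}} <= card {U \<in> Z. z \<in> ?I U}" using Z(2) by (intro card_mono) auto
  then show ?thesis using M[of z] by simp
 qed
 \<comment> \<open>Points near one label differ by at most \<open>4 * \<epsilon>\<close> in each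
   coordinate; summed over all coordinates this is half the Lebesgue number.\<close>
 define \<epsilon> where "\<epsilon> = \<delta> / (8 * real CARD('q))"
 have e: "\<epsilon> > 0" using \<delta>(1) by (simp add: \<epsilon>_def)
 define lab where "lab y c = \<lfloor>y $ c / \<epsilon>\<rfloor>" for y :: "real ^ 'q" and c
 have lab1: "\<bar>lab x c - lab y c\<bar> <= 1" if "dist x y < \<epsilon>" for x y c
 proof -
  have "\<bar>x $ c - y $ c\<bar> < \<epsilon>" using component_le_norm_cart[of "x - y" c] that by (simp add: dist_norm)
  then have "\<bar>x $ c / \<epsilon> - y $ c / \<epsilon>\<bar> < 1" using e by (simp add: diff_divide_distrib[symmetric] divide_less_eq abs_less_iff)
  then show ?thesis unfolding lab_def by linarith
 qed
 define T where "T a = {y :: real ^ 'q. \<forall>c. \<bar>lab y c - a c\<bar> <= 1}" for a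
 have Tc: "\<bar>x $ c - y $ c\<bar> <= 4 * \<epsilon>" if "x \<in> T a" "y \<in> T a" for x y a c
 proof -
  have "\<bar>lab x c - a c\<bar> <= 1" "\<bar>lab y c - a c\<bar> <= 1" using that unfolding T_def by auto
  then have "\<bar>x $ c / \<epsilon> - y $ c / \<epsilon>\<bar> <= 4" unfolding lab_def by linarith
  then show ?thesis using e by (simp add: diff_divide_distrib[symmetric] pos_divide_le_eq)
 qed
 have Td: "norm (x - y) <= \<delta> / 2" if "x \<in> T a" "y \<in> T a" for x y a
 proof -
  have "norm (x - y) <= (\<Sum>c\<in>UNIV. \<bar>(x - y) $ c\<bar>)" by (rule norm_le_l1_cart)
  also have "... <= (\<Sum>c\<in>(UNIV::'q set). 4 * \<epsilon>)" by (rule sum_mono) (use Tc[OF that] in simp)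
  also have "... = \<delta> / 2" by (simp add: \<epsilon>_def)
  finally show ?thesis .
 qed
 have Tb: "bounded (T a)" "diameter (T a) < \<delta>" for a
 proof -
  show "bounded (T a)" unfolding bounded_any_center dist_norm bounded_def by (metis Td dist_norm)
  have "diameter (T a) <= \<delta> / 2" by (rule diameter_le) (use Td \<delta>(1) in auto)
  then show "diameter (T a) < \<delta>" using \<delta>(1) by simp
 qed
 obtain cs where cs: "set cs = (UNIV :: 'q set)" "distinct cs" using finite_distinct_list[of "UNIV :: 'q set"] by auto
 have "\<exists>n. \<forall>m\<ge>n. \<forall>s\<in>Poly_Mapping.keys ((singular_subdivision (card \<sigma> - 1) ^^ m) (frag_of (sing f \<sigma>))).
  \<exists>z. s ` standard_simplex (card \<sigma> - 1) \<subseteq> ball z (\<epsilon> / 2)" if s: "\<sigma> \<in> Z" for \<sigma>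
 proof -
  have "card \<sigma> > 0" using complex_simplex[OF Z(1) s] by (simp add: card_gt_0_iff)
  then obtain p where p: "card \<sigma> = Suc p" using gr0_implies_Suc by blast
  have "singular_chain p (top_of_set (?I \<sigma>)) (frag_of (sing f \<sigma>))"
   using sing_simplex[OF Z(1) s p f] by (simp add: singular_chain_of)
  then obtain n where n: "\<And>m g. n <= m ==> g \<in> Poly_Mapping.keys ((singular_subdivision p ^^ m) (frag_of (sing f \<sigma>))) ==>
   \<exists>V\<in>range (%z. ?I \<sigma> Int ball z (\<epsilon> / 2)). g \<in> standard_simplex p \<rightarrow> V"
  proof (rule sufficient_iterated_singular_subdivision_exists[rotated 2])
   show "openin (top_of_set (?I \<sigma>)) U" if "U \<in> range (%z. ?I \<sigma> Int ball z (\<epsilon> / 2))" for U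
    using that by (auto simp: openin_open)
   fix n assume "\<And>m g. n <= m ==> g \<in> Poly_Mapping.keys ((singular_subdivision p ^^ m) (frag_of (sing f \<sigma>))) ==>
    \<exists>V\<in>range (%z. ?I \<sigma> Int ball z (\<epsilon> / 2)). g \<in> standard_simplex p \<rightarrow> V"
   then show ?thesis by (rule that)
  next
   show "topspace (top_of_set (?I \<sigma>)) \<subseteq> \<Union> (range (%z. ?I \<sigma> Int ball z (\<epsilon> / 2)))"
   proof
    fix x assume "x \<in> topspace (top_of_set (?I \<sigma>))"
    then have "x \<in> ?I \<sigma> Int ball x (\<epsilon> / 2)" using e by simp
    then show "x \<in> \<Union> (range (%z. ?I \<sigma> Int ball z (\<epsilon> / 2)))" by blast
   qed
  qed
  show ?thesis using n p by (intro exI[of _ n]) fastforce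
 qed
 then obtain nn where nn: "\<And>\<sigma> m s. \<sigma> \<in> Z ==> nn \<sigma> <= m ==> s \<in> Poly_Mapping.keys ((singular_subdivision (card \<sigma> - 1) ^^ m) (frag_of (sing f \<sigma>)))
  ==> \<exists>z. s ` standard_simplex (card \<sigma> - 1) \<subseteq> ball z (\<epsilon> / 2)" by metis
 \<comment> \<open>The same number of subdivisions is used for all simplices, so that subdividing is
   compatible with faces.\<close>
 define n where "n = Max (nn ` Z)"
 interpret gm: grid_map Z f lab cs n by unfold_locales (use Z f cs in auto)
 have loc: "\<exists>y\<in>?I \<sigma>. y \<in> T a" if d: "gm.dual S a \<sigma> ~= 0" for S a \<sigma>
 proof -
  have s: "\<sigma> \<in> Z" using d by (auto simp: gm.dual_def split: if_splits)
  then have nle: "nn \<sigma> <= n" unfolding n_def using Z(2) by (intro Max_ge) auto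
  have "\<exists>y\<in>?I \<sigma>. \<forall>c. \<bar>lab y c - a c\<bar> <= 1"
  proof (rule gm.dual_local[OF _ d])
   fix s x y c assume k: "s \<in> Poly_Mapping.keys (gm.sub \<sigma>)" and xy: "x \<in> s ` standard_simplex (card \<sigma> - 1)" "y \<in> s ` standard_simplex (card \<sigma> - 1)"
   obtain z where "s ` standard_simplex (card \<sigma> - 1) \<subseteq> ball z (\<epsilon> / 2)" using nn[OF s nle] k unfolding gm.sub_def by blast
   then have "dist z x < \<epsilon> / 2" "dist z y < \<epsilon> / 2" using xy by auto
   then have "dist x y < \<epsilon>" by (rule dist_triangle_half_r)
   then show "\<bar>lab x c - lab y c\<bar> <= 1" by (rule lab1)
  qed
  then show ?thesis unfolding T_def by blast
 qed
 show False
 proof (rule gm.descent[OF Z(2) cf _ _ \<eta> V])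
  fix S a
  have "{\<sigma>. gm.dual S a \<sigma> ~= 0} \<subseteq> {U \<in> Z. T a Int ?I U ~= {}}"
  proof
   fix \<sigma> assume "\<sigma> \<in> {\<sigma>. gm.dual S a \<sigma> ~= 0}"
   then have d: "gm.dual S a \<sigma> ~= 0" by simp
   have "\<sigma> \<in> Z" using d by (auto simp: gm.dual_def split: if_splits)
   then show "\<sigma> \<in> {U \<in> Z. T a Int ?I U ~= {}}" using loc[OF d] by blast
  qed
  then have "swt (gm.dual S a) <= card {U \<in> Z. T a Int ?I U ~= {}}" unfolding swt_def using Z(2) by (intro card_mono) auto
  then show "swt (gm.dual S a) <= M" using few[OF Tb] by (rule order_trans)
 next
  fix S
  obtain b where b: "\<And>y. y \<in> Q ==> norm y <= b" using compact_imp_bounded[OF cQ] unfolding bounded_iff by blast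
  define R where "R = \<lceil>b / \<epsilon>\<rceil> + 2"
  have "{a. gm.dual S a ~= (%_. 0)} \<subseteq> {a. \<forall>c. \<bar>a c\<bar> <= R}"
  proof
   fix a assume "a \<in> {a. gm.dual S a ~= (%_. 0)}"
   then obtain \<sigma> where d: "gm.dual S a \<sigma> ~= 0" by (auto simp: fun_eq_iff)
   then have s: "\<sigma> \<in> Z" by (auto simp: gm.dual_def split: if_splits)
   obtain y where y: "y \<in> ?I \<sigma>" "y \<in> T a" using loc[OF d] by blast
   have yQ: "y \<in> Q" unfolding Q_def using y(1) s by blast
   have "\<bar>a c\<bar> <= R" for c
   proof -
    have "\<bar>y $ c\<bar> <= b" using b[OF yQ] component_le_norm_cart[of y c] by simp
    then have "\<bar>y $ c / \<epsilon>\<bar> <= b / \<epsilon>" using e by (simp add: divide_right_mono)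
    moreover have "\<bar>lab y c - a c\<bar> <= 1" using y(2) unfolding T_def by simp
    ultimately show ?thesis unfolding lab_def R_def by linarith
   qed
   then show "a \<in> {a. \<forall>c. \<bar>a c\<bar> <= R}" by simp
  qed
  then show "finite {a. gm.dual S a ~= (%_. 0)}" by (rule finite_subset) (rule finite_int_box)
 qed
qed

section \<open>Expanders\<close>

text \<open>The first term makes a cochain small enough for the filling theorem after lifting to
  chambers; the second keeps it at most half the number of vertices, which excludes the constant
  cocycle.\<close>

definition threshold :: "nat => nat => real" where
 "threshold N D = min (ratios N 0 / (2 * (\<Prod>j\<in>{1..<N}. real N / ratios N j) * real D)) (1 / (2 * real D))"

context affine_group
begin

text \<open>Vertices become natural numbers, as the test complexes require. The colour is part of
  the encoded name, so vertices of different colours are distinct by construction.\<close>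

definition vx :: "nat => ((nat => 'k) => nat => 'k) => nat" where
 "vx i g = (SOME e. inj_on e ((%(i, g). (i, vt i g)) ` ({..<N} \<times> G))) (i, vt i g)"

definition fc :: "nat set => ((nat => 'k) => nat => 'k) => nat set" where
 "fc I g = (%i. vx i g) ` I"

text \<open>Full chambers, with \<open>N\<close> vertices, are left out, which gives dimension at
  most \<open>N - 2\<close>; they remain present as group elements, to which cochains are
  lifted.\<close>

definition cx :: "nat set set" where
 "cx = {fc I g | I g. I \<subseteq> {..<N} & I ~= {} & card I < N & g \<in> G}"

definition lift :: "nat => (nat set => bit) => nat set => ((nat => 'k) => nat => 'k) => bit" where
 "lift m \<alpha> I g = (if I \<subseteq> {..<N} & card I = m & g \<in> G then \<alpha> (fc I g) else 0)"

lemma vx_eq: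
 assumes "i < N" "j < N" "g \<in> G" "h \<in> G"
 shows "vx i g = vx j h \<longleftrightarrow> i = j & vt i g = vt j h"
proof -
 let ?V = "(%(i, g). (i, vt i g)) ` ({..<N} \<times> G)"
 have "finite ?V" using ch.finG by simp
 then have "\<exists>e :: _ => nat. inj_on e ?V" using finite_imp_inj_to_nat_seg by blast
 then have "inj_on (SOME e :: _ => nat. inj_on e ?V) ?V" by (rule someI_ex)
 moreover have "(i, vt i g) \<in> ?V" "(j, vt j h) \<in> ?V" using assms by auto
 ultimately have "vx i g = vx j h \<longleftrightarrow> (i, vt i g) = (j, vt j h)" unfolding vx_def by (rule inj_on_eq_iff)
 then show ?thesis by simp
qed

lemma fin_type: "I \<subseteq> {..<N} ==> finite I"
 by (rule finite_subset) auto

lemma fc_inj: "I \<subseteq> {..<N} ==> g \<in> G ==> inj_on (%i. vx i g) I"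
 by (rule inj_onI) (use vx_eq in blast)

lemma card_fc: "I \<subseteq> {..<N} ==> g \<in> G ==> card (fc I g) = card I"
 unfolding fc_def by (rule card_image[OF fc_inj])

lemma fc_eq:
 assumes "I \<subseteq> {..<N}" "J \<subseteq> {..<N}" "g \<in> G" "h \<in> G"
 shows "fc I g = fc J h \<longleftrightarrow> I = J & (\<forall>i\<in>I. vt i g = vt i h)"
proof
 assume e: "fc I g = fc J h"
 have a: "i \<in> J & vt i g = vt i h" if "i \<in> I" for i
 proof -
  have "vx i g \<in> fc I g" unfolding fc_def using that by (rule imageI)
  then have "vx i g \<in> fc J h" unfolding e .
  then obtain j where j: "j \<in> J" "vx i g = vx j h" unfolding fc_def by auto
  then show ?thesis using vx_eq[of i j g h] assms that by auto
 qed
 have "j \<in> I" if "j \<in> J" for j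
 proof -
  have "vx j h \<in> fc J h" unfolding fc_def using that by (rule imageI)
  then have "vx j h \<in> fc I g" unfolding e .
  then obtain i where i: "i \<in> I" "vx j h = vx i g" unfolding fc_def by auto
  then show ?thesis using vx_eq[of j i h g] assms that by auto
 qed
 then show "I = J & (\<forall>i\<in>I. vt i g = vt i h)" using a by blast
next
 assume A: "I = J & (\<forall>i\<in>I. vt i g = vt i h)"
 have "vx i g = vx i h" if "i \<in> I" for i using vx_eq[of i i g h] assms that A by auto
 then show "fc I g = fc J h" unfolding fc_def using A by (intro image_cong) auto
qed

lemma fc_remove: "I \<subseteq> {..<N} ==> g \<in> G ==> i \<in> I ==> fc (I - {i}) g = fc I g - {vx i g}"
 unfolding fc_def using inj_on_image_set_diff[OF fc_inj[of I g], of I "{i}"] by simp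

lemma sum_fc:
 assumes "I \<subseteq> {..<N}" "g \<in> G"
 shows "(\<Sum>v\<in>fc I g. \<alpha> (fc I g - {v})) = (\<Sum>i\<in>I. \<alpha> (fc (I - {i}) g))"
proof -
 have "(\<Sum>v\<in>fc I g. \<alpha> (fc I g - {v})) = (\<Sum>i\<in>I. \<alpha> (fc I g - {vx i g}))"
  unfolding fc_def by (subst sum.reindex[OF fc_inj[OF assms]]) simp
 then show ?thesis using fc_remove[OF assms] by simp
qed

lemma cxI: "I \<subseteq> {..<N} ==> I ~= {} ==> card I < N ==> g \<in> G ==> fc I g \<in> cx"
 unfolding cx_def by blast

lemma cxE:
 assumes "\<sigma> \<in> cx"
 obtains I g where "I \<subseteq> {..<N}" "I ~= {}" "card I < N" "g \<in> G" "\<sigma> = fc I g"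
 using assms unfolding cx_def by blast

lemma cx_complex: "simplicial_complex cx"
 unfolding simplicial_complex_def
proof (intro conjI ballI allI impI)
 fix U assume "U \<in> cx"
 then show "finite U" "U ~= {}" by (auto elim!: cxE simp: fc_def fin_type)
next
 fix U V assume U: "U \<in> cx" and V: "V \<subseteq> U & V ~= {}"
 obtain I g where I: "I \<subseteq> {..<N}" "I ~= {}" "card I < N" "g \<in> G" "U = fc I g" by (rule cxE[OF U])
 obtain J where J: "J \<subseteq> I" "V = fc J g" using V I(5) unfolding fc_def by (auto simp: subset_image_iff)
 have "card J <= card I" by (rule card_mono[OF fin_type[OF I(1)] J(1)])
 then show "V \<in> cx" unfolding J(2) using J V I by (intro cxI) (auto simp: fc_def)
qed

lemma finite_cx: "finite cx"
proof -
 have "cx \<subseteq> (%(I, g). fc I g) ` (Pow {..<N} \<times> G)" unfolding cx_def by auto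
 then show ?thesis by (rule finite_subset) (simp add: ch.finG)
qed

lemma vertices_cx: "vertices cx = (\<Union>i<N. (%g. vx i g) ` G)"
proof
 show "vertices cx \<subseteq> (\<Union>i<N. (%g. vx i g) ` G)"
 proof
  fix v assume "v \<in> vertices cx"
  then obtain U where U: "U \<in> cx" "v \<in> U" unfolding vertices_def by blast
  obtain I g where "I \<subseteq> {..<N}" "g \<in> G" "U = fc I g" by (rule cxE[OF U(1)])
  then show "v \<in> (\<Union>i<N. (%g. vx i g) ` G)" using U(2) unfolding fc_def by auto
 qed
 show "(\<Union>i<N. (%g. vx i g) ` G) \<subseteq> vertices cx"
 proof
  fix v assume "v \<in> (\<Union>i<N. (%g. vx i g) ` G)"
  then obtain i g where "i < N" "g \<in> G" "v = vx i g" by auto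
  moreover from this have "fc {i} g \<in> cx" using N3 by (intro cxI) auto
  ultimately show "v \<in> vertices cx" unfolding vertices_def fc_def by auto
 qed
qed

lemma dimension_cx: "dimension_le cx (N - 2)"
 unfolding dimension_le_def by (auto elim!: cxE simp: card_fc)

lemma degree_cx: "degree_le cx (N * (vertex_group_bound N CARD('k)))"
 unfolding degree_le_def
proof
 fix s assume "s \<in> vertices cx"
 then obtain i g where i: "i < N" "g \<in> G" "s = vx i g" unfolding vertices_cx by auto
 let ?A = "(%(j, h). vx j h) ` ({..<N} \<times> ch.cls {i} g)"
 have sub: "{t. t ~= s & {s, t} \<in> cx} \<subseteq> ?A"
 proof
  fix t assume "t \<in> {t. t ~= s & {s, t} \<in> cx}"
  then have "{s, t} \<in> cx" by simp
  then obtain I h where I: "I \<subseteq> {..<N}" "h \<in> G" "{s, t} = fc I h" by (rule cxE)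
  then have "s \<in> fc I h" "t \<in> fc I h" by auto
  then obtain a b where ab: "a \<in> I" "b \<in> I" "s = vx a h" "t = vx b h" unfolding fc_def by auto
  have "vt i g = vt i h" using vx_eq[of i a g h] i ab I by auto
  then have "h \<in> ch.cls {i} g" using I(2) unfolding ch.cls_def by simp
  then show "t \<in> ?A" using ab I(1) by (intro image_eqI[of _ _ "(b, h)"]) auto
 qed
 have fin: "finite ?A" by simp
 have cd: "card ?A <= N * (vertex_group_bound N CARD('k))"
 proof -
  have "card ?A <= card ({..<N} \<times> ch.cls {i} g)" by (rule card_image_le) simp
  also have "... <= N * (vertex_group_bound N CARD('k))" using card_cls_vertex[OF i(1,2)] by (simp add: card_cartesian_product)
  finally show ?thesis .
 qed
 show "finite {t. t ~= s & {s, t} \<in> cx} & card {t. t ~= s & {s, t} \<in> cx} <= N * (vertex_group_bound N CARD('k))"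
  by (rule conjI[OF finite_subset[OF sub fin] order_trans[OF card_mono[OF fin sub] cd]])
qed

lemma card_vertices_cx: "card (vertices cx) <= N * card G" "card G <= (vertex_group_bound N CARD('k)) * card (vertices cx)"
proof -
 have "card (vertices cx) <= (\<Sum>i<N. card ((%g. vx i g) ` G))" unfolding vertices_cx by (rule card_UN_le) simp
 also have "... <= (\<Sum>i<N. card G)" by (intro sum_mono card_image_le ch.finG)
 finally show "card (vertices cx) <= N * card G" by simp
 have N0: "0 < N" using N3 by simp
 have fv: "finite (vertices cx)" unfolding vertices_cx using ch.finG by simp
 have "card G = card (\<Union>v\<in>vertices cx. {g\<in>G. vx 0 g = v})"
  by (rule arg_cong[of _ _ card]) (use N0 in \<open>auto simp: vertices_cx\<close>)
 also have "... <= (\<Sum>v\<in>vertices cx. card {g\<in>G. vx 0 g = v})" by (rule card_UN_le[OF fv])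
 also have "... <= (\<Sum>v\<in>vertices cx. (vertex_group_bound N CARD('k)))"
 proof (rule sum_mono)
  fix v
  show "card {g\<in>G. vx 0 g = v} <= (vertex_group_bound N CARD('k))"
  proof (cases "\<exists>g\<in>G. vx 0 g = v")
   case True
   then obtain g where g: "g \<in> G" "vx 0 g = v" by blast
   have "{g\<in>G. vx 0 g = v} \<subseteq> ch.cls {0} g" using g vx_eq[OF N0 N0] unfolding ch.cls_def by auto
   then have "card {g\<in>G. vx 0 g = v} <= card (ch.cls {0} g)" by (intro card_mono) auto
   then show ?thesis using card_cls_vertex[OF N0 g(1)] by simp
  next
   case False
   then have "{g\<in>G. vx 0 g = v} = {}" by blast
   then show ?thesis by (simp only: card.empty le0)
  qed
 qed
 finally show "card G <= (vertex_group_bound N CARD('k)) * card (vertices cx)" by (simp add: mult.commute)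
qed

lemma lift_cochain: "ch.cochain m (lift m \<alpha>)"
 unfolding ch.cochain_def
proof (intro conjI allI impI)
 fix I g h assume A: "g \<in> G & h \<in> G & (\<forall>i\<in>I. vt i g = vt i h)"
 show "lift m \<alpha> I g = lift m \<alpha> I h"
 proof (cases "I \<subseteq> {..<N}")
  case True
  then have "fc I g = fc I h" using fc_eq[OF True True] A by blast
  then show ?thesis using A by (simp add: lift_def)
 qed (simp add: lift_def)
qed (auto simp: lift_def split: if_splits)

text \<open>A face lies in at least one chamber, and in at most as many as one of its vertices
  does.\<close>

lemma wt_lift:
 assumes a: "scochain cx p \<alpha>"
 shows "swt \<alpha> <= ch.wt (lift (Suc p) \<alpha>)" "ch.wt (lift (Suc p) \<alpha>) <= (vertex_group_bound N CARD('k)) * swt \<alpha>"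
proof -
 let ?S = "SIGMA I:Pow {..<N}. {g\<in>G. lift (Suc p) \<alpha> I g ~= 0}"
 let ?f = "%(I, g). fc I g"
 have fS: "finite ?S" using ch.finG by (intro finite_SigmaI) auto
 have w: "ch.wt (lift (Suc p) \<alpha>) = card ?S" unfolding ch.wt_def using ch.finG by (subst card_SigmaI) auto
 have fsup: "finite {\<sigma>. \<alpha> \<sigma> ~= 0}" by (rule finite_support[OF finite_cx a])
 have img: "?f ` ?S = {\<sigma>. \<alpha> \<sigma> ~= 0}"
 proof
  show "?f ` ?S \<subseteq> {\<sigma>. \<alpha> \<sigma> ~= 0}" by (auto simp: lift_def split: if_splits)
  show "{\<sigma>. \<alpha> \<sigma> ~= 0} \<subseteq> ?f ` ?S"
  proof
   fix \<sigma> assume "\<sigma> \<in> {\<sigma>. \<alpha> \<sigma> ~= 0}"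
   then have s: "\<alpha> \<sigma> ~= 0" "\<sigma> \<in> cx" "card \<sigma> = Suc p" using a unfolding scochain_def by auto
   obtain I g where I: "I \<subseteq> {..<N}" "g \<in> G" "\<sigma> = fc I g" by (rule cxE[OF s(2)])
   then have "lift (Suc p) \<alpha> I g ~= 0" using s card_fc[OF I(1,2)] by (simp add: lift_def)
   then show "\<sigma> \<in> ?f ` ?S" using I by (intro image_eqI[of _ _ "(I, g)"]) auto
  qed
 qed
 have "swt \<alpha> = card (?f ` ?S)" unfolding swt_def by (simp only: img)
 also have "... <= card ?S" by (rule card_image_le[OF fS])
 finally show "swt \<alpha> <= ch.wt (lift (Suc p) \<alpha>)" by (simp only: w)
 have "card ?S = card (\<Union>\<sigma>\<in>{\<sigma>. \<alpha> \<sigma> ~= 0}. {x\<in>?S. ?f x = \<sigma>})"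
  by (rule arg_cong[of _ _ card]) (use img in blast)
 also have "... <= (\<Sum>\<sigma>\<in>{\<sigma>. \<alpha> \<sigma> ~= 0}. card {x\<in>?S. ?f x = \<sigma>})" by (rule card_UN_le[OF fsup])
 also have "... <= (\<Sum>\<sigma>\<in>{\<sigma>. \<alpha> \<sigma> ~= 0}. (vertex_group_bound N CARD('k)))"
 proof (rule sum_mono)
  fix \<sigma> assume "\<sigma> \<in> {\<sigma>. \<alpha> \<sigma> ~= 0}"
  then have s: "\<sigma> \<in> cx" using a unfolding scochain_def by auto
  obtain I g where I: "I \<subseteq> {..<N}" "I ~= {}" "g \<in> G" "\<sigma> = fc I g" by (rule cxE[OF s])
  obtain i where i: "i \<in> I" using I(2) by blast
  have iN: "i < N" using i I(1) by auto
  have "{x\<in>?S. ?f x = \<sigma>} \<subseteq> Pair I ` ch.cls {i} g"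
  proof
   fix x assume x: "x \<in> {x\<in>?S. ?f x = \<sigma>}"
   obtain J h where Jh: "x = (J, h)" by (cases x)
   then have J: "J \<subseteq> {..<N}" "h \<in> G" "fc I g = fc J h" using x I(4) by auto
   then have "I = J" "vt i g = vt i h" using fc_eq[OF I(1) J(1) I(3) J(2)] i by auto
   then show "x \<in> Pair I ` ch.cls {i} g" using Jh J(2) unfolding ch.cls_def by auto
  qed
  then have "card {x\<in>?S. ?f x = \<sigma>} <= card (Pair I ` ch.cls {i} g)" by (intro card_mono) auto
  also have "... <= card (ch.cls {i} g)" by (rule card_image_le) simp
  finally show "card {x\<in>?S. ?f x = \<sigma>} <= (vertex_group_bound N CARD('k))" using card_cls_vertex[OF iN I(3)] by simp
 qed
 finally show "ch.wt (lift (Suc p) \<alpha>) <= (vertex_group_bound N CARD('k)) * swt \<alpha>" by (simp add: w swt_def mult.commute)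
qed

text \<open>Below the top degree the coboundary of the lift is read off in \<open>cx\<close>. In the
  top degree the faces with \<open>N\<close> vertices are missing from \<open>cx\<close>; there the
  lift is closed because \<open>\<alpha>\<close> is itself a coboundary.\<close>

lemma lift_cocycle:
 assumes p: "p < N - 1" and coc: "p < N - 2 ==> scob cx (Suc p) \<alpha> = (%_. 0)"
  and cob: "p = N - 2 ==> \<exists>\<beta>. \<alpha> = scob cx p \<beta>"
 shows "ch.cob (lift (Suc p) \<alpha>) J g = 0"
proof (cases "J \<subseteq> {..<N} & card J = Suc (Suc p) & g \<in> G")
 case False
 have "lift (Suc p) \<alpha> (J - {j}) g = 0" if "J \<subseteq> {..<N}" "j \<in> J" for j
 proof -
  have "\<not> (card (J - {j}) = Suc p & g \<in> G)"
  proof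
   assume A: "card (J - {j}) = Suc p & g \<in> G"
   have "card J = Suc (Suc p)" unfolding card_Suc_Diff1[OF fin_type[OF that(1)] that(2), symmetric] by (simp only: A)
   then show False using False A that(1) by (simp only: simp_thms)
  qed
  then show ?thesis unfolding lift_def by (simp only: simp_thms if_False)
 qed
 then show ?thesis by (auto simp: ch.cob_def intro!: sum.neutral)
next
 case True
 then have J: "J \<subseteq> {..<N}" "card J = Suc (Suc p)" "g \<in> G" by auto
 have cJ: "card (J - {j}) = Suc p" if "j \<in> J" for j using J that fin_type[OF J(1)] by simp
 have e: "ch.cob (lift (Suc p) \<alpha>) J g = (\<Sum>j\<in>J. \<alpha> (fc (J - {j}) g))"
  unfolding ch.cob_def using J cJ by (auto simp: lift_def intro!: sum.cong)
 show ?thesis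
 proof (cases "p < N - 2")
  case True
  have "J ~= {}" using J(2) by auto
  then have "fc J g \<in> cx" using J True by (intro cxI) auto
  then have "scob cx (Suc p) \<alpha> (fc J g) = (\<Sum>v\<in>fc J g. \<alpha> (fc J g - {v}))" using J card_fc[OF J(1,3)] by (simp add: scob_def)
  then show ?thesis using e sum_fc[OF J(1,3), of \<alpha>] coc[OF True] by simp
 next
  case False
  then have "p = N - 2" using p by simp
  then obtain \<beta> where b: "\<alpha> = scob cx p \<beta>" using cob by blast
  have "\<alpha> (fc (J - {j}) g) = (\<Sum>i\<in>J - {j}. \<beta> (fc (J - {j} - {i}) g))" if j: "j \<in> J" for j
  proof -
   have s: "J - {j} \<subseteq> {..<N}" using J(1) by auto
   have "J - {j} ~= {}" using cJ[OF j] by (metis card.empty nat.distinct(1))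
   then have "fc (J - {j}) g \<in> cx" using s cJ[OF j] p J(3) by (intro cxI) auto
   then show ?thesis unfolding b scob_def using sum_fc[OF s J(3), of \<beta>] card_fc[OF s J(3)] cJ[OF j] by simp
  qed
  then have "ch.cob (lift (Suc p) \<alpha>) J g = (\<Sum>j\<in>J. \<Sum>i\<in>J - {j}. \<beta> (fc (J - {j} - {i}) g))" unfolding e by (rule sum.cong[OF refl])
  also have "... = 0" by (rule sum_symmetric_bit[OF fin_type[OF J(1)]]) (simp only: Diff_insert2[symmetric] insert_commute)
  finally show ?thesis .
 qed
qed

lemma unlift:
 assumes h: "ch.cochain (Suc p) h" and p: "Suc p < N"
 obtains \<eta> where "scochain cx p \<eta>" "lift (Suc p) \<eta> = h"
proof -
 let ?P = "%\<sigma> x. fst x \<subseteq> {..<N} & snd x \<in> G & \<sigma> = fc (fst x) (snd x)"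
 define \<eta> where "\<eta> \<sigma> = (if \<sigma> \<in> cx & card \<sigma> = Suc p then h (fst (SOME x. ?P \<sigma> x)) (snd (SOME x. ?P \<sigma> x)) else 0)" for \<sigma>
 have inv: "h I g = h I g'" if "g \<in> G" "g' \<in> G" "\<forall>i\<in>I. vt i g = vt i g'" for I g g'
  using conjunct2[OF h[unfolded ch.cochain_def]] that by blast
 have "lift (Suc p) \<eta> I g = h I g" for I g
 proof (cases "I \<subseteq> {..<N} & card I = Suc p & g \<in> G")
  case True
  then have I: "I \<subseteq> {..<N}" "card I = Suc p" "g \<in> G" by auto
  have "I ~= {}" using I(2) by auto
  then have "fc I g \<in> cx" using I p by (intro cxI) auto
  moreover
  define x where "x = (SOME x. ?P (fc I g) x)"
  have "?P (fc I g) x" unfolding x_def by (rule someI[of _ "(I, g)"]) (use I in simp)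
  then have P: "fst x \<subseteq> {..<N}" "snd x \<in> G" "fc I g = fc (fst x) (snd x)" by auto
  note e = fc_eq[OF I(1) P(1) I(3) P(2), THEN iffD1, OF P(3)]
  have "h (fst x) (snd x) = h I g"
   unfolding conjunct1[OF e, symmetric] by (rule inv[OF I(3) P(2) conjunct2[OF e], symmetric])
  ultimately show ?thesis using I card_fc[OF I(1,3)] by (simp add: lift_def \<eta>_def x_def)
 next
  case False
  then have "h I g = 0" using h unfolding ch.cochain_def by blast
  then show ?thesis using False by (auto simp: lift_def)
 qed
 then have "lift (Suc p) \<eta> = h" by (intro ext)
 moreover have "scochain cx p \<eta>" unfolding scochain_def \<eta>_def by simp
 ultimately show ?thesis by (rule that[rotated])
qed

lemma vertex_group_bound_pos: "0 < (vertex_group_bound N CARD('k))"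
 unfolding vertex_group_bound_def by simp

lemma ratio_ge_1: "1 <= real N / ratios N j" "0 < ratios N j"
proof -
 note t = ratio_base[of N]
 have N: "real N > 0" using N3 by simp
 show p: "0 < ratios N j" using t N by (simp add: ratios_def)
 have "ratio_base N ^ 2 ^ (N - 1 - j) <= 1" using t by (intro power_le_one) auto
 then have "ratios N j <= real N" unfolding ratios_def using N by simp
 then show "1 <= real N / ratios N j" using p by simp
qed

lemma threshold_pos: "0 < threshold N (vertex_group_bound N CARD('k))"
 unfolding threshold_def min_less_iff_conj
 using vertex_group_bound_pos ratio_ge_1(2) prod_pos[of "{1..<N}" "%j. real N / ratios N j"] ratio_ge_1(1)
 by (auto intro!: divide_pos_pos mult_pos_pos prod_pos simp: less_le_trans[OF zero_less_one])

text \<open>The cochain is lifted to chambers, filled there by \<open>expansion\<close>, and the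
  filling is brought back; comparing the two weights costs the factor
  \<open>vertex_group_bound\<close>. Connectedness comes from
  \<open>invariant_imp_constant\<close>.\<close>

lemma cx_filling:
 assumes fld: "large_field N (card (UNIV :: 'k set))"
 shows "cocycle_filling cx (N - 2) ((2 ^ N * (vertex_group_bound N CARD('k)) + 1) * (vertex_group_bound N CARD('k))) (threshold N (vertex_group_bound N CARD('k)) * real (card G))"
 unfolding cocycle_filling_def
proof (intro conjI allI impI)
 fix p \<alpha>
 assume A: "1 <= p & p <= N - 2 & scochain cx p \<alpha> & real (swt \<alpha>) <= threshold N (vertex_group_bound N CARD('k)) * real (card G) &
  (p < N - 2 --> (\<forall>\<tau>. scob cx (Suc p) \<alpha> \<tau> = 0)) & (p = N - 2 --> (\<exists>\<beta>. scochain cx (p - 1) \<beta> & \<alpha> = scob cx p \<beta>))"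
 then have a: "scochain cx p \<alpha>" and pN: "Suc p < N" "1 <= p" using N3 by auto
 let ?a = "lift (Suc p) \<alpha>"
 have coc: "ch.cob ?a J g = 0" for J g
  by (rule lift_cocycle) (use A pN in auto)
 have small: "(\<Prod>j\<in>{1..<Suc p}. real N / ratios N j) * real (ch.wt ?a) < ratios N 0 * real (card G)"
 proof -
  let ?P = "\<Prod>j\<in>{1..<N}. real N / ratios N j"
  have P: "0 < ?P" by (rule prod_pos) (use ratio_ge_1(1) in \<open>auto intro: less_le_trans[OF zero_less_one]\<close>)
  have G: "0 < real (card G)" using card_G_ge L by simp
  have "(\<Prod>j\<in>{1..<Suc p}. real N / ratios N j) <= ?P"
   by (rule prod_mono2) (use pN ratio_ge_1 in \<open>auto intro: order_trans[OF zero_le_one]\<close>)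
  then have "(\<Prod>j\<in>{1..<Suc p}. real N / ratios N j) * real (ch.wt ?a) <= ?P * real ((vertex_group_bound N CARD('k)) * swt \<alpha>)"
   using wt_lift(2)[OF a] P by (intro mult_mono of_nat_mono) auto
  also have "... <= ?P * (real (vertex_group_bound N CARD('k)) * (threshold N (vertex_group_bound N CARD('k)) * real (card G)))" using A P by (intro mult_left_mono) (auto intro!: mult_left_mono)
  also have "... <= ?P * (real (vertex_group_bound N CARD('k)) * (ratios N 0 / (2 * ?P * real (vertex_group_bound N CARD('k))) * real (card G)))"
   using P by (intro mult_left_mono mult_right_mono) (auto simp: threshold_def)
  also have "... = ratios N 0 * real (card G) / 2"
  proof -
   have "P * (d * (r / (2 * P * d) * g)) = r * g / 2" if "0 < P" "0 < d" for P d r g :: real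
    using that by (simp add: field_simps)
   from this[OF P, of "real (vertex_group_bound N CARD('k))"] show ?thesis using vertex_group_bound_pos by (simp only: of_nat_0_less_iff)
  qed
  also have "... < ratios N 0 * real (card G)" using G ratio_ge_1(2)[of 0] by simp
  finally show ?thesis .
 qed
 obtain h where h: "ch.cochain (Suc p - 1) h" "?a = ch.cob h" "ch.wt h <= (2 ^ N * (vertex_group_bound N CARD('k)) + 1) * ch.wt ?a"
  using expansion[OF fld _ pN(1) lift_cochain coc small] pN(2) by auto
 have sp: "Suc (p - 1) = p" using pN by simp
 have hc: "ch.cochain (Suc (p - 1)) h" using h(1) sp by simp
 obtain \<eta> where e: "scochain cx (p - 1) \<eta>" "lift (Suc (p - 1)) \<eta> = h" by (rule unlift[OF hc]) (use pN in auto)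
 have "\<alpha> \<sigma> = scob cx p \<eta> \<sigma>" for \<sigma>
 proof (cases "\<sigma> \<in> cx & card \<sigma> = Suc p")
  case False
  then have "\<alpha> \<sigma> = 0" using a unfolding scochain_def by blast
  then show ?thesis using False by (auto simp: scob_def)
 next
  case True
  obtain I g where I: "I \<subseteq> {..<N}" "g \<in> G" "\<sigma> = fc I g" by (rule cxE[OF conjunct1[OF True]])
  have cI: "card I = Suc p" using True card_fc[OF I(1,2)] I(3) by simp
  have "\<alpha> \<sigma> = ?a I g" using I cI by (simp add: lift_def)
  also have "... = (\<Sum>i\<in>I. h (I - {i}) g)" unfolding h(2) ch.cob_def using I(1) by simp
  also have "... = (\<Sum>i\<in>I. \<eta> (fc (I - {i}) g))"
  proof (rule sum.cong[OF refl])
   fix i assume "i \<in> I"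
   then have "card (I - {i}) = p" using cI fin_type[OF I(1)] by simp
   then show "h (I - {i}) g = \<eta> (fc (I - {i}) g)" unfolding e(2)[symmetric] lift_def using I sp by auto
  qed
  also have "... = (\<Sum>v\<in>fc I g. \<eta> (fc I g - {v}))" by (rule sum_fc[OF I(1,2), symmetric])
  finally show ?thesis using True I(3) by (simp add: scob_def)
 qed
 moreover have "swt \<eta> <= (2 ^ N * (vertex_group_bound N CARD('k)) + 1) * (vertex_group_bound N CARD('k)) * swt \<alpha>"
 proof -
  have "swt \<eta> <= ch.wt h" using wt_lift(1)[OF e(1)] unfolding e(2) .
  also have "... <= (2 ^ N * (vertex_group_bound N CARD('k)) + 1) * ((vertex_group_bound N CARD('k)) * swt \<alpha>)" using h(3) mult_left_mono[OF wt_lift(2)[OF a], of "2 ^ N * (vertex_group_bound N CARD('k)) + 1"] by linarith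
  finally show ?thesis by (simp only: mult.assoc)
 qed
 ultimately show "\<exists>h. scochain cx (p - 1) h & \<alpha> = scob cx p h & swt h <= (2 ^ N * (vertex_group_bound N CARD('k)) + 1) * (vertex_group_bound N CARD('k)) * swt \<alpha>"
  using e(1) by (intro exI[of _ \<eta>]) (simp only: fun_eq_iff simp_thms)
next
 fix \<alpha> assume A: "scochain cx 0 \<alpha> & (\<forall>\<tau>. scob cx 1 \<alpha> \<tau> = 0)"
 have edge: "\<alpha> {vx i g} = \<alpha> {vx j g}" if "i < N" "j < N" "g \<in> G" for i j g
 proof (cases "i = j")
  case False
  let ?I = "{i, j}"
  have I: "?I \<subseteq> {..<N}" using that by auto
  have "fc ?I g \<in> cx" using I N3 False that by (intro cxI) auto
  moreover have "card (fc ?I g) = Suc 1" using card_fc[OF I that(3)] False by simp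
  ultimately have "scob cx 1 \<alpha> (fc ?I g) = (\<Sum>k\<in>?I. \<alpha> (fc (?I - {k}) g))" using sum_fc[OF I that(3), of \<alpha>] by (simp add: scob_def)
  also have "... = \<alpha> {vx j g} + \<alpha> {vx i g}" using False by (simp add: fc_def insert_Diff_if)
  finally have "\<alpha> {vx j g} + \<alpha> {vx i g} = 0" using A by simp
  then show ?thesis by (cases "\<alpha> {vx j g}"; cases "\<alpha> {vx i g}") auto
 qed simp
 have N0: "0 < N" using N3 by simp
 have const: "\<alpha> {vx 0 g} = \<alpha> {vx 0 id}" if "g \<in> G" for g
 proof (rule invariant_imp_constant[OF _ that])
  fix i g h assume i: "i < N" "g \<in> G" "h \<in> G" "vt i g = vt i h"
  then have "vx i g = vx i h" using vx_eq[of i i g h] by simp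
  then show "\<alpha> {vx 0 g} = \<alpha> {vx 0 h}" using edge[OF N0 i(1)] i(2,3) by simp
 qed
 have all: "\<alpha> {v} = \<alpha> {vx 0 id}" if "v \<in> vertices cx" for v
 proof -
  obtain i g where i: "i < N" "g \<in> G" "v = vx i g" using \<open>v \<in> vertices cx\<close> unfolding vertices_cx by auto
  show ?thesis using edge[OF N0 i(1,2)] const[OF i(2)] i(3) by simp
 qed
 show "(\<forall>\<sigma>. \<alpha> \<sigma> = 0) \<or> (\<forall>v\<in>vertices cx. \<alpha> {v} ~= 0)"
 proof (cases "\<alpha> {vx 0 id} = 0")
  case True
  have "\<alpha> \<sigma> = 0" for \<sigma>
  proof (rule ccontr)
   assume n: "\<alpha> \<sigma> ~= 0"
   then have s: "\<sigma> \<in> cx" "card \<sigma> = Suc 0" using A unfolding scochain_def by auto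
   then obtain v where v: "\<sigma> = {v}" by (auto simp: card_Suc_eq)
   then have "v \<in> vertices cx" using s(1) unfolding vertices_def by auto
   then show False using all True n v by simp
  qed
  then show ?thesis by blast
 qed (use all in simp)
qed

end

section \<open>Coarse constructions\<close>

text \<open>The sum over \<open>r\<close> dominates every factor that the descent puts in front of
  the overlap, and the last \<open>N\<close> compares the number of vertices with that of
  chambers.\<close>

definition overlap_const :: "nat => nat => real" where
 "overlap_const N D = threshold N D /
  (real (\<Sum>r\<le>N - 2. 1 + 2 * (N - 2) * descent_bound (N - 2) ((2 ^ N * D + 1) * D) r) * real N)"

lemma (in affine_group) overlap_const_pos: "0 < overlap_const N (vertex_group_bound N CARD('k))"
proof -
 have "0 < (\<Sum>r\<le>N - 2. 1 + 2 * (N - 2) * descent_bound (N - 2) ((2 ^ N * vertex_group_bound N CARD('k) + 1) * vertex_group_bound N CARD('k)) r)"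
  by (rule sum_pos) auto
 then show ?thesis unfolding overlap_const_def using threshold_pos N3 by (intro divide_pos_pos mult_pos_pos) (simp_all only: of_nat_0_less_iff)
qed

lemma (in affine_group) cx_overlap:
 fixes f :: "(nat => real) => real ^ 'q"
 assumes N: "N = CARD('q) + 2" and fld: "large_field N CARD('k)" and f: "continuous_on (realisation cx) f"
 shows "\<exists>z. overlap_const N (vertex_group_bound N CARD('k)) * real (card (vertices cx)) <= real (card {U \<in> cx. z \<in> f ` closed_simplex cx U})"
proof -
 let ?D = "vertex_group_bound N CARD('k)"
 let ?K = "(2 ^ N * ?D + 1) * ?D" and ?t = "threshold N ?D"
 let ?w = "%r. 1 + 2 * (N - 2) * descent_bound (N - 2) ?K r"
 define W where "W = (\<Sum>r\<le>N - 2. ?w r)"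
 define M where "M = nat \<lfloor>?t * real (card G) / real W\<rfloor>"
 have q: "CARD('q) = N - 2" using N by simp
 have G: "0 < card G" using card_G_ge L by linarith
 have W: "0 < W" unfolding W_def by (rule sum_pos) auto
 have t: "0 <= ?t * real (card G)" using threshold_pos by simp
 have "real M <= ?t * real (card G) / real W" unfolding M_def using t W by (intro of_nat_floor) simp
 then have MW: "real W * real M <= ?t * real (card G)" using W by (simp add: field_simps)
 have cf: "cocycle_filling cx CARD('q) ?K (?t * real (card G))"
  unfolding q by (rule cx_filling[OF fld])
 have "\<exists>z. M < card {U \<in> cx. z \<in> f ` closed_simplex cx U}"
 proof (rule topological_overlap[OF cx_complex finite_cx f cf])
  fix r assume "r <= CARD('q)"
  then have "?w r <= W" unfolding W_def q by (intro member_le_sum) auto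
  then have "real (?w r * M) <= real W * real M" unfolding of_nat_mult by (intro mult_right_mono of_nat_mono) auto
  then show "real ((1 + 2 * CARD('q) * descent_bound CARD('q) ?K r) * M) <= ?t * real (card G)" using MW unfolding q by (rule order_trans)
 next
  have D: "0 < real ?D" using vertex_group_bound_pos by simp
  have GV: "real (card G) <= real ?D * real (card (vertices cx))"
   unfolding of_nat_mult[symmetric] by (rule of_nat_mono) (rule card_vertices_cx(2))
  have "?t * real (card G) <= 1 / (2 * real ?D) * real (card G)" by (intro mult_right_mono) (auto simp: threshold_def)
  also have "... <= 1 / (2 * real ?D) * (real ?D * real (card (vertices cx)))" using D by (intro mult_left_mono GV) simp
  also have "... = real (card (vertices cx)) / 2" using D by simp
  also have "... < real (card (vertices cx))"
  proof -
   have "0 < card (vertices cx)" using card_vertices_cx(2) G by (metis gr0I leD mult_0_right)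
   then show ?thesis by simp
  qed
  finally show "?t * real (card G) < real (card (vertices cx))" .
 qed
 then obtain z where z: "M < card {U \<in> cx. z \<in> f ` closed_simplex cx U}" by blast
 have "overlap_const N ?D * real (card (vertices cx)) = ?t / real W * (real (card (vertices cx)) / real N)"
  unfolding overlap_const_def W_def by simp
 also have "... <= ?t / real W * real (card G)"
 proof (rule mult_left_mono)
  have "real (card (vertices cx)) <= real N * real (card G)" unfolding of_nat_mult[symmetric] by (rule of_nat_mono) (rule card_vertices_cx(1))
  then show "real (card (vertices cx)) / real N <= real (card G)" using N3 by (simp add: field_simps)
 qed (use threshold_pos in simp)
 also have "... = ?t * real (card G) / real W" by simp
 also have "... <= real M + 1"
 proof -
  have "y <= real (nat \<lfloor>y\<rfloor>) + 1" for y by linarith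
  then show ?thesis unfolding M_def .
 qed
 also have "... <= real (card {U \<in> cx. z \<in> f ` closed_simplex cx U})" using z by simp
 finally show ?thesis by blast
qed

text \<open>All requirements are lower bounds for \<open>p\<close>: once \<open>sqrt p\<close> is at
  least \<open>2 * N\<close>, the denominator is at least one half, and \<open>sqrt p\<close> at
  least \<open>2 / mixing_bound N\<close> then makes the quotient small enough.\<close>

lemma ex_large_field:
 assumes N: "0 < N"
 shows "\<exists>p. prime p & large_field N p"
proof -
 let ?F = "\<Sum>k<N. fill_field N (cone_arg N k)"
 have mb: "mixing_bound N > 0" unfolding mixing_bound_def using N ratio_base by simp
 define s where "s = 2 * real N + 2 / mixing_bound N + 1"
 have s: "s > 0" "s >= 2 / mixing_bound N" "s >= 2 * real N" 
 proof -
  have "0 < 2 / mixing_bound N" using mb by simp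
  then show "s > 0" "s >= 2 / mixing_bound N" "s >= 2 * real N" unfolding s_def by linarith+
 qed
 obtain p where p: "prime p" "?F + nat \<lceil>s\<^sup>2\<rceil> < p" using bigger_prime by blast
 have sp: "s <= sqrt (real p)"
 proof (rule real_le_rsqrt)
  have "s\<^sup>2 <= real (nat \<lceil>s\<^sup>2\<rceil>)" by (rule of_nat_ceiling)
  also have "... <= real p" using p(2) by simp
  finally show "s\<^sup>2 <= real p" .
 qed
 then have rp: "sqrt (real p) > 0" using s(1) by linarith
 have half: "real N * (1 / sqrt (real p)) <= 1 / 2" using s(3) sp rp by (simp add: field_simps)
 have "1 / sqrt (real p) / (1 - real N * (1 / sqrt (real p))) <= 1 / sqrt (real p) / (1 / 2)"
 proof (rule divide_left_mono)
  show h: "1 / 2 <= 1 - real N * (1 / sqrt (real p))" using half by linarith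
  show "0 < (1 - real N * (1 / sqrt (real p))) * (1 / 2)" by (rule mult_pos_pos) (use h in linarith, simp)
 qed (use rp in simp)
 also have "... = 2 / sqrt (real p)" by simp
 also have "... <= 2 / s" using sp mult_pos_pos[OF rp s(1)] by (intro divide_left_mono) auto
 also have "... <= mixing_bound N" using s(1,2) mb by (simp add: field_simps)
 finally have mx: "1 / sqrt (real p) / (1 - real N * (1 / sqrt (real p))) <= mixing_bound N" .
 have ff: "fill_field N (cone_arg N k) < p" if "k + 2 <= N" for k
 proof -
  have "fill_field N (cone_arg N k) <= ?F" using that by (intro member_le_sum) auto
  then show ?thesis using p(2) by simp
 qed
 have "real N * (1 / sqrt (real p)) < 1" using half by linarith
 then have "large_field N p" unfolding large_field_def using ff mx by (intro conjI allI impI)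
 with p(1) have "prime p & large_field N p" by (rule conjI)
 then show ?thesis by (rule exI)
qed

definition field_prime :: "nat => nat" where
 "field_prime N = (SOME p. prime p & large_field N p)"

lemma field_prime: "0 < N ==> prime (field_prime N) & large_field N (field_prime N)"
 unfolding field_prime_def by (rule someI_ex) (rule ex_large_field)

text \<open>The order of the field has to grow with the dimension \<open>CARD('q)\<close>, so it is made part of a type.\<close>

typedef (overloaded) ('q::finite) pidx = "{0..<field_prime (CARD('q) + 2)}"
proof
 show "0 \<in> {0..<field_prime (CARD('q) + 2)}" using field_prime[of "CARD('q) + 2"] by (simp add: prime_gt_0_nat)
qed

lemma CARD_pidx: "CARD('q::finite pidx) = field_prime (CARD('q) + 2)"
 using type_definition.card[OF type_definition_pidx] by simp

instance pidx :: (finite) finite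
proof
 have "finite (Abs_pidx ` {0..<field_prime (CARD('a) + 2)} :: 'a pidx set)" by simp
 then show "finite (UNIV :: 'a pidx set)" by (simp only: type_definition.univ[OF type_definition_pidx])
qed

instance pidx :: (finite) prime_card
 by standard (use field_prime in \<open>simp add: CARD_pidx\<close>)

definition expander :: "'q::finite itself => nat => real => real => real => nat set set => bool" where
 "expander _ d c x y Z \<longleftrightarrow> simplicial_complex Z & finite (vertices Z) &
  dimension_le Z CARD('q::finite) & degree_le Z d & x <= real (card (vertices Z)) & real (card (vertices Z)) <= y &
  (\<forall>f :: (nat => real) => real ^ 'q. continuous_on (realisation Z) f -->
   (\<exists>z. c * real (card (vertices Z)) <= real (card {U \<in> Z. z \<in> f ` closed_simplex Z U})))"

text \<open>The truncation \<open>L\<close> is the largest with \<open>N * g L <= x\<close>. The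
  next one exceeds \<open>x\<close>, and one step multiplies the group by at most
  \<open>p ^ N\<close>, so the number of vertices is within the factor \<open>R\<close> of
  \<open>x\<close>.\<close>

lemma expander_family:
 "\<exists>d c R x0. c > 0 & R >= 1 & (\<forall>x::real\<ge>x0. \<exists>Z. expander TYPE('q::finite) d c (x / R) x Z)"
proof -
 let ?N = "CARD('q) + 2" and ?p = "CARD('q pidx mod_ring)"
 let ?D = "vertex_group_bound ?N ?p"
 define g where "g L = card (affine_group.gen ?N L {..<?N} :: ((nat => 'q pidx mod_ring) => _) set)" for L
 have q: "CARD('q) > 0" by simp
 have fld: "large_field ?N ?p" using field_prime[of ?N] by (simp add: CARD_pidx)
 have ag: "affine_group ?N L" if "2 * ?N < L" for L by unfold_locales (use that q in linarith)+
 let ?L0 = "2 * ?N + 1"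
 have gG: "g L = card (affine_group.G ?N L :: ((nat => 'q pidx mod_ring) => _) set)" if "2 * ?N < L" for L
  unfolding g_def affine_group.G_def[OF ag[OF that]] ..
 have gL: "L <= g L" if "2 * ?N < L" for L
  unfolding gG[OF that] by (rule affine_group.card_G_ge[OF ag[OF that]])
 have gS: "g (Suc L) <= ?p ^ ?N * g L" if "2 * ?N < L" for L
  unfolding g_def by (rule card_gen_Suc[OF ag[OF that]])
 have D: "0 < ?D" by (rule affine_group.vertex_group_bound_pos[OF ag[of ?L0]]) simp
 define R where "R = real ?N * real (?p ^ ?N) * real ?D"
 have "0 < ?N * ?p ^ ?N * ?D" using D by simp
 then have "real 1 <= real (?N * ?p ^ ?N * ?D)" by (intro of_nat_mono) (simp only: One_nat_def Suc_le_eq)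
 then have R: "R >= 1" unfolding R_def by (simp only: of_nat_mult of_nat_1)
 show ?thesis
 proof (rule exI[of _ "?N * ?D"], rule exI[of _ "overlap_const ?N ?D"], rule exI[of _ R], rule exI[of _ "real (?N * g ?L0)"],
   intro conjI allI impI)
  show "overlap_const ?N ?D > 0" by (rule affine_group.overlap_const_pos[OF ag[of ?L0]]) simp
  show "R >= 1" by (rule R)
  fix x :: real assume x: "real (?N * g ?L0) <= x"
  let ?S = "{L. 2 * ?N < L & real (?N * g L) <= x}"
  have fS: "finite ?S"
  proof (rule finite_subset)
   show "?S \<subseteq> {..nat \<lfloor>x\<rfloor>}"
   proof
    fix L assume L: "L \<in> ?S"
    then have "real L <= real (?N * g L)" using gL[of L] q by (intro of_nat_mono) (simp add: trans_le_add1)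
    also have "... <= x" using L by simp
    finally show "L \<in> {..nat \<lfloor>x\<rfloor>}" by (simp add: le_nat_floor)
   qed
  qed simp
  have "?L0 \<in> ?S" using x by simp
  then have "Max ?S \<in> ?S" using fS by (intro Max_in) auto
  define L where "L = Max ?S"
  have Lm: "2 * ?N < L" "real (?N * g L) <= x" using \<open>Max ?S \<in> ?S\<close> unfolding L_def by auto
  have "Suc L \<notin> ?S" using Max_ge[OF fS, of "Suc L"] unfolding L_def by auto
  then have up: "x < real (?N * g (Suc L))" using Lm(1) by simp
  interpret affine_group ?N L "TYPE('q pidx mod_ring)" by (rule ag[OF Lm(1)])
  have "x <= real (?N * (?p ^ ?N * g L))" using up gS[OF Lm(1)] by (smt (verit) mult_le_mono2 of_nat_mono)
  also have "... <= real (?N * (?p ^ ?N * (?D * card (vertices cx))))"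
   using card_vertices_cx(2) unfolding gG[OF Lm(1)] by (intro of_nat_mono mult_le_mono2)
  also have "... = R * real (card (vertices cx))" unfolding R_def by (simp only: of_nat_mult mult.assoc)
  finally have lo: "x / R <= real (card (vertices cx))" using R by (simp add: divide_le_eq mult.commute)
  have hi: "real (card (vertices cx)) <= x"
   using card_vertices_cx(1) Lm(2) unfolding gG[OF Lm(1)] by (meson of_nat_mono order_trans)
  have fv: "finite (vertices cx)" unfolding vertices_cx using ch.finG by simp
  show "\<exists>Z. expander TYPE('q) (?N * ?D) (overlap_const ?N ?D) (x / R) x Z"
   unfolding expander_def using dimension_cx degree_cx cx_complex fv lo hi cx_overlap[OF refl fld] by (intro exI[of _ cx]) simp
 qed
qed

text \<open>Composing with a coarse construction \<open>f\<close> and relabelling its image by \<open>\<phi>\<close>: a point of the closed simplex \<open>U\<close>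
 over \<open>z\<close> lies over the closed simplex of its support, and at most \<open>k\<close> simplices \<open>U\<close> share this support.\<close>

lemma overlap_of_coarse_image:
 fixes f :: "(nat => real) => 'v => real" and m :: real
 assumes cc: "coarse_construction Z Y k f" and Z: "finite Z"
  and Y': "subcomplex Y' Y" "finite (vertices Y')" "f ` realisation Z \<subseteq> realisation Y'"
  and ov: "\<And>f :: (nat => real) => real ^ 'q. continuous_on (realisation Z) f ==>
   \<exists>z. m <= real (card {U \<in> Z. z \<in> f ` closed_simplex Z U})"
 shows "\<exists>Z' :: nat set set. simplicial_complex Z' & finite (vertices Z') & embeds_in Z' Y &
  card (vertices Z') = card (vertices Y') & m <= real k * real (s_TO Z' TYPE('q))"
proof -
 have sY: "simplicial_complex Y'" "Y' \<subseteq> Y" using Y'(1) unfolding subcomplex_def by auto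
 obtain \<phi> :: "'v => nat" where \<phi>: "inj_on \<phi> (vertices Y')" using finite_imp_inj_to_nat_seg[OF Y'(2)] by blast
 define \<psi> where "\<psi> = inv_into (vertices Y') \<phi>"
 have \<psi>\<phi>: "\<psi> (\<phi> v) = v" if "v \<in> vertices Y'" for v unfolding \<psi>_def using \<phi> that by (rule inv_into_f_f)
 define Z' where "Z' = image \<phi> ` Y'"
 have sub: "U \<subseteq> vertices Y'" if "U \<in> Y'" for U using that unfolding vertices_def by blast
 have VZ: "vertices Z' = \<phi> ` vertices Y'" unfolding Z'_def vertices_def by blast
 have \<psi>im: "\<psi> ` \<phi> ` U = U" if "U \<subseteq> vertices Y'" for U using \<psi>\<phi> that by (force simp: image_image)
 have cZ: "simplicial_complex Z'"
  unfolding simplicial_complex_def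
 proof (intro conjI ballI allI impI)
  fix U assume U: "U \<in> Z'"
  then obtain U0 where U0: "U0 \<in> Y'" "U = \<phi> ` U0" unfolding Z'_def by auto
  show "finite U" "U ~= {}" using complex_simplex[OF sY(1) U0(1)] U0(2) by auto
  fix V assume V: "V \<subseteq> U & V ~= {}"
  then obtain V0 where V0: "V0 \<subseteq> U0" "V = \<phi> ` V0" unfolding U0(2) by (auto simp: subset_image_iff)
  then have "V0 \<in> Y'" using V by (intro complex_face[OF sY(1) U0(1)]) auto
  then show "V \<in> Z'" unfolding Z'_def V0(2) by (rule imageI)
 qed
 have emb: "embeds_in Z' Y"
  unfolding embeds_in_def
 proof (intro exI[of _ \<psi>] conjI ballI)
  show "inj_on \<psi> (vertices Z')" unfolding VZ by (rule inj_onI) (auto simp: \<psi>\<phi>)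
  fix U assume "U \<in> Z'"
  then obtain U0 where U0: "U0 \<in> Y'" "U = \<phi> ` U0" unfolding Z'_def by auto
  then show "\<psi> ` U \<in> Y" using \<psi>im[OF sub[OF U0(1)]] sY(2) by auto
 qed
 define \<Phi> where "\<Phi> x = (%n. if n \<in> \<phi> ` vertices Y' then x (\<psi> n) else 0)" for x :: "'v => real"
 have \<Phi>: "\<Phi> x \<in> realisation Z' & supp (\<Phi> x) = \<phi> ` supp x" if x: "x \<in> realisation Y'" for x
 proof -
  have x0: "\<And>v. 0 <= x v" "supp x \<in> Y'" "sum x (supp x) = 1" using x unfolding realisation_def by auto
  have sv: "supp x \<subseteq> vertices Y'" by (rule sub[OF x0(2)])
  have s: "supp (\<Phi> x) = \<phi> ` supp x"
  proof
   show "supp (\<Phi> x) \<subseteq> \<phi> ` supp x"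
   proof
    fix n assume "n \<in> supp (\<Phi> x)"
    then have n: "n \<in> \<phi> ` vertices Y'" "x (\<psi> n) ~= 0" unfolding supp_def \<Phi>_def by (auto split: if_splits)
    then obtain v where "v \<in> vertices Y'" "n = \<phi> v" by blast
    then show "n \<in> \<phi> ` supp x" using n(2) \<psi>\<phi> unfolding supp_def by simp
   qed
   show "\<phi> ` supp x \<subseteq> supp (\<Phi> x)"
   proof (rule image_subsetI)
    fix v assume v: "v \<in> supp x"
    then show "\<phi> v \<in> supp (\<Phi> x)" using subsetD[OF sv v] \<psi>\<phi> unfolding supp_def \<Phi>_def by simp
   qed
  qed
  have "sum (\<Phi> x) (\<phi> ` supp x) = sum x (supp x)"
   using sv \<psi>\<phi> by (subst sum.reindex[OF inj_on_subset[OF \<phi> sv]]) (auto simp: \<Phi>_def intro!: sum.cong)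
  then show ?thesis using x0 s unfolding realisation_def Z'_def by (auto simp: \<Phi>_def)
 qed
 have c\<Phi>: "continuous_on A \<Phi>" for A
 proof (rule continuous_on_coordinatewise_then_product)
  fix n show "continuous_on A (%x. \<Phi> x n)" unfolding \<Phi>_def
   by (cases "n \<in> \<phi> ` vertices Y'") (auto intro: continuous_on_subset[OF continuous_on_product_coordinates])
 qed
 have fin: "finite Z'" using finite_subset[of Z' "Pow (vertices Z')"] Y'(2) unfolding VZ by (auto simp: vertices_def Z'_def)
 have lower: "m <= real k * real (s_Ov Z' g)" if g: "continuous_on (realisation Z') g" for g :: "(nat => real) => real ^ 'q"
 proof -
  have cf: "continuous_on (realisation Z) f" using cc unfolding coarse_construction_def by blast
  have cgf: "continuous_on (realisation Z) (%x. g (\<Phi> (f x)))"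
  proof (rule continuous_on_compose2[OF g])
   show "continuous_on (realisation Z) (%x. \<Phi> (f x))" by (rule continuous_on_compose2[OF c\<Phi> cf]) (rule subset_refl)
   show "(%x. \<Phi> (f x)) ` realisation Z \<subseteq> realisation Z'" using \<Phi> Y'(3) by blast
  qed
  obtain z where z: "m <= real (card {U \<in> Z. z \<in> (%x. g (\<Phi> (f x))) ` closed_simplex Z U})" using ov[OF cgf] by blast
  let ?A = "{U \<in> Z. z \<in> (%x. g (\<Phi> (f x))) ` closed_simplex Z U}" and ?B = "{V \<in> Z'. z \<in> g ` closed_simplex Z' V}"
  define pt where "pt U = (SOME x. x \<in> closed_simplex Z U & z = g (\<Phi> (f x)))" for U
  have pt: "pt U \<in> closed_simplex Z U & z = g (\<Phi> (f (pt U)))" if "U \<in> ?A" for U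
  proof -
   have "\<exists>x. x \<in> closed_simplex Z U & z = g (\<Phi> (f x))" using that by auto
   from someI_ex[OF this] show ?thesis unfolding pt_def .
  qed
  have fpt: "f (pt U) \<in> realisation Y'" if "U \<in> ?A" for U
   using pt[OF that] Y'(3) unfolding closed_simplex_def by blast
  have B: "\<phi> ` supp (f (pt U)) \<in> ?B" if U: "U \<in> ?A" for U
  proof -
   have "\<Phi> (f (pt U)) \<in> closed_simplex Z' (\<phi> ` supp (f (pt U)))" using \<Phi>[OF fpt[OF U]] unfolding closed_simplex_def by auto
   moreover have "\<phi> ` supp (f (pt U)) \<in> Z'" using fpt[OF U] unfolding realisation_def Z'_def by auto
   ultimately show ?thesis using pt[OF U] by blast
  qed
  have fA: "finite ?A" and fB: "finite ?B" using Z fin by auto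
  have "?A = (\<Union>V\<in>?B. {U \<in> ?A. \<phi> ` supp (f (pt U)) = V})"
  proof
   show "?A \<subseteq> (\<Union>V\<in>?B. {U \<in> ?A. \<phi> ` supp (f (pt U)) = V})"
   proof
    fix U assume "U \<in> ?A"
    then show "U \<in> (\<Union>V\<in>?B. {U \<in> ?A. \<phi> ` supp (f (pt U)) = V})" by (intro UN_I[OF B]) simp_all
   qed
  qed (rule UN_least, rule subsetI, drule CollectD, rule conjunct1)
  then have "card ?A = card (\<Union>V\<in>?B. {U \<in> ?A. \<phi> ` supp (f (pt U)) = V})" by (rule arg_cong)
  also have "... <= (\<Sum>V\<in>?B. card {U \<in> ?A. \<phi> ` supp (f (pt U)) = V})" by (rule card_UN_le[OF fB])
  also have "... <= (\<Sum>V\<in>?B. k)"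
  proof (rule sum_mono)
   fix V assume "V \<in> ?B"
   then obtain V0 where V0: "V0 \<in> Y'" "V = \<phi> ` V0" unfolding Z'_def by auto
   have "{U \<in> ?A. \<phi> ` supp (f (pt U)) = V} \<subseteq> {U \<in> Z. closed_simplex Y V0 Int f ` closed_simplex Z U ~= {}}"
   proof
    fix U assume "U \<in> {U \<in> ?A. \<phi> ` supp (f (pt U)) = V}"
    then have U: "U \<in> ?A" "\<phi> ` supp (f (pt U)) = V" by auto
    have "supp (f (pt U)) \<in> Y'" using fpt[OF U(1)] unfolding realisation_def by simp
    then have "\<psi> ` \<phi> ` supp (f (pt U)) = supp (f (pt U))" by (intro \<psi>im sub)
    then have "supp (f (pt U)) = V0" using U(2) V0(2) \<psi>im[OF sub[OF V0(1)]] by simp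
    then have "f (pt U) \<in> closed_simplex Y V0"
     using fpt[OF U(1)] sY(2) unfolding closed_simplex_def realisation_def by auto
    then show "U \<in> {U \<in> Z. closed_simplex Y V0 Int f ` closed_simplex Z U ~= {}}" using U(1) pt[OF U(1)] by blast
   qed
   then have "card {U \<in> ?A. \<phi> ` supp (f (pt U)) = V} <= card {U \<in> Z. closed_simplex Y V0 Int f ` closed_simplex Z U ~= {}}"
    using Z by (intro card_mono) auto
   also have "... <= k" using cc V0(1) sY(2) unfolding coarse_construction_def by blast
   finally show "card {U \<in> ?A. \<phi> ` supp (f (pt U)) = V} <= k" .
  qed
  also have "... = k * card ?B" by simp
  also have "... <= k * s_Ov Z' g"
  proof (rule mult_left_mono)
   have "finite (range (%z. card {V \<in> Z'. z \<in> g ` closed_simplex Z' V}))"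
    by (rule finite_subset[of _ "{..card Z'}"]) (use fin in \<open>auto intro!: card_mono\<close>)
   then show "card ?B <= s_Ov Z' g" unfolding s_Ov_def by (rule Max_ge) blast
  qed simp
  finally have "real (card ?A) <= real (k * s_Ov Z' g)" by (rule of_nat_mono)
  then show ?thesis using z by simp
 qed
 \<comment> \<open>The zero map shows that the \<open>LEAST\<close> defining \<open>s_TO\<close> is
   taken over a nonempty set, so some continuous map attains it and \<open>lower\<close> applies to
   that map.\<close>
 have "\<exists>n. \<exists>g :: (nat => real) => real ^ 'q. continuous_on (realisation Z') g & s_Ov Z' g = n"
  by (intro exI[of _ "s_Ov Z' ((%_. 0) :: _ => real ^ 'q)"] exI[of _ "%_. 0"] conjI continuous_on_const refl)
 then have "\<exists>g :: (nat => real) => real ^ 'q. continuous_on (realisation Z') g & s_Ov Z' g = s_TO Z' TYPE('q)"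
  unfolding s_TO_def by (rule LeastI_ex)
 then have "m <= real k * real (s_TO Z' TYPE('q))" using lower by metis
 moreover have "card (vertices Z') = card (vertices Y')" unfolding VZ by (rule card_image[OF \<phi>])
 moreover have "finite (vertices Z')" unfolding VZ using Y'(2) by simp
 ultimately show ?thesis using cZ emb by blast
qed

text \<open>The set under \<open>Max\<close> is finite: the zero map bounds \<open>s_TO Z\<close> by
  the number of simplices, which is at most \<open>2\<close> to the number of vertices.\<close>

lemma s_TO_le_s_TO_Y:
 fixes Z :: "nat set set"
 assumes Z: "simplicial_complex Z" "finite (vertices Z)" "embeds_in Z Y" "real (card (vertices Z)) <= r"
 shows "s_TO Z TYPE('q::finite) <= s_TO_Y Y TYPE('q) r"
proof -
 have bound: "s_TO Z TYPE('q) <= 2 ^ nat \<lfloor>r\<rfloor>" if Z: "finite (vertices Z)" "real (card (vertices Z)) <= r" for Z :: "nat set set"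
 proof -
  have sub: "Z \<subseteq> Pow (vertices Z)" unfolding vertices_def by blast
  have fZ: "finite Z" by (rule finite_subset[OF sub]) (use Z in simp)
  have "s_TO Z TYPE('q) <= s_Ov Z ((%_. 0) :: _ => real ^ 'q)"
   unfolding s_TO_def by (rule Least_le) (intro exI[of _ "%_. 0"] conjI continuous_on_const refl)
  also have "... <= card Z"
  proof -
   let ?S = "range (%z. card {U \<in> Z. z \<in> ((%_. 0) :: _ => real ^ 'q) ` closed_simplex Z U})"
   have "?S \<subseteq> {..card Z}" using fZ by (auto intro!: card_mono)
   then have "Max ?S <= card Z" using finite_subset[of ?S "{..card Z}"] by (intro Max.boundedI) auto
   then show ?thesis unfolding s_Ov_def .
  qed
  also have "... <= card (Pow (vertices Z))" using Z(1) by (intro card_mono[OF _ sub]) simp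
  also have "... = 2 ^ card (vertices Z)" by (rule card_Pow[OF Z(1)])
  also have "... <= 2 ^ nat \<lfloor>r\<rfloor>" using Z(2) by (intro power_increasing) (auto simp: le_nat_floor)
  finally show ?thesis .
 qed
 let ?T = "{s_TO Z TYPE('q) | Z :: nat set set. simplicial_complex Z & finite (vertices Z) & embeds_in Z Y &
    real (card (vertices Z)) <= r}"
 have "finite ?T" by (rule finite_subset[of _ "{..2 ^ nat \<lfloor>r\<rfloor>}"]) (auto intro: bound)
 then show ?thesis unfolding s_TO_Y_def by (rule Max_ge) (use Z in blast)
qed

text \<open>As \<open>ln (X r)\<close> is asymptotic to \<open>ln r / a\<close>, the logarithmic
  powers cancel up to the constant \<open>(1 / a) powr b\<close>. Since the sign of \<open>b\<close>
  decides at which end of the range of \<open>n\<close> the logarithmic factor is larger, both ends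
  are compared.\<close>

lemma powr_ln_growth:
 fixes a b R :: real
 assumes a: "a > 0" and R: "R >= 1"
 defines "X \<equiv> %r. r powr (1 / a) * ln (1 + r) powr (- b / a)"
 shows "\<exists>C0>0. \<forall>\<^sub>F r in at_top. \<forall>n. X r / R <= n & n <= X r --> n powr a * ln (1 + n) powr b <= C0 * r"
proof -
 have lim: "((%r. X r powr a * ln (1 + c * X r) powr b / r) \<longlongrightarrow> (1 / a) powr b) at_top" if "c > 0" for c
  unfolding X_def using a that by real_asymp
 let ?C = "(1 / a) powr b + 1"
 have ev: "\<forall>\<^sub>F r in at_top. X r powr a * ln (1 + c * X r) powr b / r < ?C" if "c > 0" for c
  by (rule order_tendstoD(2)[OF lim[OF that]]) simp
 have R0: "0 < 1 / R" using R by simp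
 have X1: "filterlim X at_top at_top" unfolding X_def using a by real_asymp
 have "\<forall>\<^sub>F r in at_top. \<forall>n. X r / R <= n & n <= X r --> n powr a * ln (1 + n) powr b <= ?C * r"
  using ev[OF zero_less_one] ev[OF R0] eventually_gt_at_top[of 0] filterlim_at_top_dense[THEN iffD1, OF X1, rule_format, of 0]
 proof eventually_elim
  case (elim r)
  show ?case
  proof (intro allI impI)
   fix n assume n: "X r / R <= n & n <= X r"
   have XR: "0 < X r / R" using elim R by simp
   then have n0: "0 < n" using n by linarith
   have na: "n powr a <= X r powr a" using n n0 a by (intro powr_mono2) auto
   have lb: "ln (1 + n) powr b <= max (ln (1 + 1 * X r) powr b) (ln (1 + 1 / R * X r) powr b)"
   proof (cases "b >= 0")
    case True
    then have "ln (1 + n) powr b <= ln (1 + X r) powr b" using n n0 by (intro powr_mono2) auto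
    then show ?thesis by simp
   next
    case False
    then have "ln (1 + n) powr b <= ln (1 + X r / R) powr b" using n n0 XR by (intro powr_mono2') auto
    then show ?thesis by simp
   qed
   have "n powr a * ln (1 + n) powr b <= X r powr a * max (ln (1 + 1 * X r) powr b) (ln (1 + 1 / R * X r) powr b)"
    by (rule mult_mono[OF na lb]) auto
   also have "... <= ?C * r" using elim(1,2,3) by (auto simp: max_def divide_less_eq split: if_splits)
   finally show "n powr a * ln (1 + n) powr b <= ?C * r" .
  qed
 qed
 then show ?thesis by (intro exI[of _ ?C]) (simp add: add_nonneg_pos)
qed

theorem theorem1p23:
  fixes Y :: "'v set set" and a b :: real
  assumes "simplicial_complex Y" and "finite_dimensional Y" and "bounded_degree Y"
    and "a > 0"
    and "\<forall>d::nat. \<exists>k::nat. \<forall>Z :: nat set set.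
            simplicial_complex Z \<and> finite (vertices Z) \<and>
            dimension_le Z CARD('q::finite) \<and> degree_le Z d \<longrightarrow>
            (\<exists>f. coarse_construction Z Y k f \<and>
                 volume_le Z Y f (real k * real (card (vertices Z)) powr a *
                                  ln (1 + real (card (vertices Z))) powr b))"
  shows "\<exists>C::real. C > 0 \<and> (\<forall>r::nat.
            real r powr (1 / a) * ln (1 + real r) powr (- b / a)
              \<le> C * real (s_TO_Y Y TYPE('q) (C * real r)) + C)"
proof -
 define X where "X r = r powr (1 / a) * ln (1 + r) powr (- b / a)" for r :: real
 obtain d c R x0 where c: "c > 0" "R >= 1" and exp: "\<And>x::real. x >= x0 ==> \<exists>Z. expander TYPE('q) d c (x / R) x Z"
  using expander_family[where 'q = 'q] by (elim exE conjE) blast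
 obtain k where k: "\<And>Z :: nat set set. simplicial_complex Z & finite (vertices Z) & dimension_le Z CARD('q) & degree_le Z d ==>
  \<exists>f. coarse_construction Z Y k f & volume_le Z Y f (real k * real (card (vertices Z)) powr a * ln (1 + real (card (vertices Z))) powr b)"
  using assms(5) by blast
 obtain C0 where C0: "C0 > 0" "\<forall>\<^sub>F r in at_top. \<forall>n. X r / R <= n & n <= X r --> n powr a * ln (1 + n) powr b <= C0 * r"
  using powr_ln_growth[OF assms(4) c(2), of b] unfolding X_def by blast
 have "filterlim X at_top at_top" unfolding X_def using assms(4) by real_asymp
 then have "\<forall>\<^sub>F r in at_top. x0 <= X r" unfolding filterlim_at_top by blast
 then have "\<forall>\<^sub>F r in at_top. x0 <= X r & (\<forall>n. X r / R <= n & n <= X r --> n powr a * ln (1 + n) powr b <= C0 * r)"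
  using C0(2) by (rule eventually_conj)
 then have "\<forall>\<^sub>F r in sequentially. x0 <= X (real r) & (\<forall>n. X (real r) / R <= n & n <= X (real r) --> n powr a * ln (1 + n) powr b <= C0 * real r)"
  by (rule eventually_compose_filterlim[OF _ filterlim_real_sequentially])
 then obtain r0 where r0: "\<And>r. r >= r0 ==> x0 <= X (real r) &
   (\<forall>n. X (real r) / R <= n & n <= X (real r) --> n powr a * ln (1 + n) powr b <= C0 * real r)"
  unfolding eventually_sequentially by blast
 have X0: "0 <= X r" for r unfolding X_def by simp
 \<comment> \<open>The first term bounds the number of vertices of the image by
   \<open>C * r\<close>, the second is the loss in overlap, the sum covers the finitely many small
   \<open>r\<close>, and \<open>1\<close> makes \<open>C\<close> positive.\<close>
 define C where "C = real k * C0 + real k * R / c + (\<Sum>r<r0. X (real r)) + 1"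
 have nn: "0 <= real k * C0" "0 <= real k * R / c" "0 <= (\<Sum>r<r0. X (real r))"
  using C0(1) c X0 by (auto intro: sum_nonneg)
 have "X (real r) <= C * real (s_TO_Y Y TYPE('q) (C * real r)) + C" for r
 proof (cases "r < r0")
  case True
  then have "X (real r) <= (\<Sum>r<r0. X (real r))" using X0 by (intro member_le_sum) auto
  also have "... <= C" using nn by (simp add: C_def)
  finally show ?thesis using nn by (intro add_increasing) (auto simp: C_def)
 next
  case False
  then have r: "x0 <= X (real r)" "\<And>n. X (real r) / R <= n ==> n <= X (real r) ==> n powr a * ln (1 + n) powr b <= C0 * real r"
   using r0[of r] by auto
  obtain Z :: "nat set set" where Z: "simplicial_complex Z & finite (vertices Z) & dimension_le Z CARD('q) & degree_le Z d"
   "X (real r) / R <= real (card (vertices Z))" "real (card (vertices Z)) <= X (real r)"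
   and ov: "\<And>f :: (nat => real) => real ^ 'q. continuous_on (realisation Z) f ==>
   \<exists>z. c * real (card (vertices Z)) <= real (card {U \<in> Z. z \<in> f ` closed_simplex Z U})"
   using exp[OF r(1)] unfolding expander_def by blast
  let ?n = "real (card (vertices Z))"
  obtain f where f: "coarse_construction Z Y k f" "volume_le Z Y f (real k * ?n powr a * ln (1 + ?n) powr b)" using k[OF Z(1)] by blast
  obtain Y' where Y': "subcomplex Y' Y" "finite (vertices Y')" "f ` realisation Z \<subseteq> realisation Y'"
   "real (card (vertices Y')) <= real k * ?n powr a * ln (1 + ?n) powr b" using f(2) unfolding volume_le_def by blast
  have "Z \<subseteq> Pow (vertices Z)" unfolding vertices_def by blast
  then have fZ: "finite Z" using Z(1) finite_subset by blast
  obtain Z' :: "nat set set" where Z': "simplicial_complex Z'" "finite (vertices Z')" "embeds_in Z' Y"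
   "card (vertices Z') = card (vertices Y')" "c * ?n <= real k * real (s_TO Z' TYPE('q))"
   using overlap_of_coarse_image[OF f(1) fZ Y'(1,2,3) ov] by blast
  have "real (card (vertices Z')) <= real k * (?n powr a * ln (1 + ?n) powr b)" using Y'(4) Z'(4) by (simp add: mult.assoc)
  also have "... <= real k * (C0 * real r)" by (intro mult_left_mono r(2)[OF Z(2,3)]) simp
  also have "... <= C * real r" using nn by (simp add: C_def mult.assoc[symmetric] mult_right_mono)
  finally have TO: "s_TO Z' TYPE('q) <= s_TO_Y Y TYPE('q) (C * real r)" by (rule s_TO_le_s_TO_Y[OF Z'(1,2,3)])
  have "X (real r) <= R * ?n" using Z(2) c(2) by (simp add: divide_le_eq mult.commute)
  also have "... = R / c * (c * ?n)" using c(1) by simp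
  also have "... <= R / c * (real k * real (s_TO Z' TYPE('q)))" using c by (intro mult_left_mono Z'(5)) simp
  also have "... = real k * R / c * real (s_TO Z' TYPE('q))" by simp
  also have "... <= real k * R / c * real (s_TO_Y Y TYPE('q) (C * real r))" using nn(2) TO by (intro mult_left_mono of_nat_mono)
  also have "... <= C * real (s_TO_Y Y TYPE('q) (C * real r))" using nn by (intro mult_right_mono) (auto simp: C_def)
  finally show ?thesis using nn by (simp add: C_def)
 qed
 moreover have "C > 0" using nn by (simp add: C_def)
 ultimately show ?thesis unfolding X_def by blast
qed

end
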